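(* Let $\Gamma$ be a finitely generated residually finite group and let $(\Gamma_n)_{n\in\mathbb N}$ be a nested (decreasing) sequence of finite index normal subgroups of $\Gamma$ with trivial intersection. Let $\Gamma=\langle\gamma_1,\gamma_2,\cdots,\gamma_d\mid r_1,r_2,\cdots,r_k,\cdots\rangle$ be a presentation of $\Gamma$ with finitely many generators. Let $L$ be the associated ($2$-dimensional) Cayley $\Gamma$-complex and let $L_j$ be the $\Gamma$-invariant cocompact sub-complex associated with the first $j$ relations $r_1,r_2,\cdots,r_j$. Then $$\beta_1^{(2)}(\Gamma)=\lim_{j\to\infty}\ \lim_{n\to\infty}\frac{b_1(\Gamma_n\backslash L_j)}{[\Gamma:\Gamma_n]}.$$
   Context: $b_1$ is the usual first Betti number and $\beta_1^{(2)}(\Gamma)$ the first $\ell^2$-Betti number of $\Gamma$. The Cayley complex $L$ is the universal cover of the presentation complex: its $1$-skeleton is the Cayley graph of $\Gamma$ with respect to $\gamma_1,\dots,\gamma_d$, and for every $\gamma\in\Gamma$ and every relator $r_k$ there is a $2$-cell attached along the loop based at $\gamma$ labelled by $r_k$; $\Gamma$ acts freely on it by left multiplication. $L_j$ consists of the whole $1$-skeleton together with the $2$-cells corresponding to $r_1,\dots,r_j$. *)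

theory Defs
  imports
    "HOL-Analysis.Analysis"
    "HOL-Algebra.Group_Action"
    "HOL-Algebra.Generated_Groups"
    "HOL-Library.Poly_Mapping"
begin

section \<open>Residually finite groups and presentations\<close>

definition residually_finite :: "('a, 'b) monoid_scheme \<Rightarrow> bool" where
  "residually_finite G \<longleftrightarrow>
     (\<forall>g\<in>carrier G - {\<one>\<^bsub>G\<^esub>}. \<exists>N. N \<lhd> G \<and> finite (rcosets\<^bsub>G\<^esub> N) \<and> g \<notin> N)"

text \<open>The letter \<open>(i, True)\<close> stands for the \<open>i\<close>-th generator and \<open>(i, False)\<close> for its formal inverse.
  Generators and relators are numbered from \<open>0\<close>.\<close>

type_synonym letter = "nat \<times> bool"

definition inv_letter :: "letter \<Rightarrow> letter" where
  "inv_letter x = (fst x, \<not> snd x)"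

definition words :: "nat \<Rightarrow> letter list set" where
  "words d = lists ({..<d} \<times> UNIV)"

definition letter_value :: "('a, 'b) monoid_scheme \<Rightarrow> (nat \<Rightarrow> 'a) \<Rightarrow> letter \<Rightarrow> 'a" where
  "letter_value G \<gamma> x = (if snd x then \<gamma> (fst x) else inv\<^bsub>G\<^esub> (\<gamma> (fst x)))"

primrec word_value :: "('a, 'b) monoid_scheme \<Rightarrow> (nat \<Rightarrow> 'a) \<Rightarrow> letter list \<Rightarrow> 'a" where
  "word_value G \<gamma> [] = \<one>\<^bsub>G\<^esub>"
| "word_value G \<gamma> (x # w) = letter_value G \<gamma> x \<otimes>\<^bsub>G\<^esub> word_value G \<gamma> w"

text \<open>The congruence on words in \<open>d\<close> letters generated by the trivial relators \<open>x x\<^sup>-\<^sup>1\<close> and the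
  words in \<open>R\<close>. Its quotient is the group presented by \<open>d\<close> generators and relators \<open>R\<close>, that is,
  the free group modulo the normal closure of \<open>R\<close>.\<close>

inductive rel_equiv :: "nat \<Rightarrow> letter list set \<Rightarrow> letter list \<Rightarrow> letter list \<Rightarrow> bool"
  for d R where
  refl: "w \<in> words d \<Longrightarrow> rel_equiv d R w w"
| sym: "rel_equiv d R v w \<Longrightarrow> rel_equiv d R w v"
| trans: "rel_equiv d R u v \<Longrightarrow> rel_equiv d R v w \<Longrightarrow> rel_equiv d R u w"
| cancel: "u \<in> words d \<Longrightarrow> v \<in> words d \<Longrightarrow> [x] \<in> words d \<Longrightarrow>
    rel_equiv d R (u @ [x, inv_letter x] @ v) (u @ v)"
| relator: "u \<in> words d \<Longrightarrow> v \<in> words d \<Longrightarrow> r \<in> R \<Longrightarrow> rel_equiv d R (u @ r @ v) (u @ v)"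

text \<open>\<open>G = \<langle>\<gamma> 0, \<dots>, \<gamma> (d - 1) | r k, k < N\<rangle>\<close>, with \<open>N = \<infinity>\<close> for infinitely many
  relators: evaluation of words induces a bijection from the presented group onto \<open>G\<close>.\<close>

definition is_presentation ::
  "('a, 'b) monoid_scheme \<Rightarrow> nat \<Rightarrow> (nat \<Rightarrow> 'a) \<Rightarrow> enat \<Rightarrow> (nat \<Rightarrow> letter list) \<Rightarrow> bool" where
  "is_presentation G d \<gamma> N r \<longleftrightarrow>
     \<gamma> ` {..<d} \<subseteq> carrier G \<and>
     generate G (\<gamma> ` {..<d}) = carrier G \<and>
     (\<forall>k. enat k < N \<longrightarrow> r k \<in> words d) \<and>
     (\<forall>u\<in>words d. \<forall>v\<in>words d.
        word_value G \<gamma> u = word_value G \<gamma> v \<longleftrightarrow> rel_equiv d {r k | k. enat k < N} u v)"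


section \<open>Two-dimensional cell complexes and their first Betti number\<close>

text \<open>Every 2-cell is attached along a closed edge path; \<open>(e, True)\<close> means that the edge \<open>e\<close> is
  traversed from its source to its target, and \<open>(e, False)\<close> the reverse.\<close>

record ('v, 'e, 'f) complex2 =
  verts :: "'v set"
  edges :: "'e set"
  src :: "'e \<Rightarrow> 'v"
  tgt :: "'e \<Rightarrow> 'v"
  faces :: "'f set"
  attach :: "'f \<Rightarrow> ('e \<times> bool) list"

definition chain_scale :: "complex \<Rightarrow> ('c \<Rightarrow>\<^sub>0 complex) \<Rightarrow> ('c \<Rightarrow>\<^sub>0 complex)" where
  "chain_scale a c = Poly_Mapping.map (\<lambda>x. a * x) c"

lemma lookup_chain_scale [simp]:
  "Poly_Mapping.lookup (chain_scale a c) x = a * Poly_Mapping.lookup c x"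
  unfolding chain_scale_def by (simp add: Poly_Mapping.map.rep_eq when_def)

interpretation chain: vector_space chain_scale
  by unfold_locales
    (auto intro!: poly_mapping_eqI simp: lookup_add algebra_simps)

definition chains :: "'c set \<Rightarrow> ('c \<Rightarrow>\<^sub>0 complex) set" where
  "chains A = {c. Poly_Mapping.keys c \<subseteq> A}"

definition boundary1 :: "('v, 'e, 'f) complex2 \<Rightarrow> ('e \<Rightarrow>\<^sub>0 complex) \<Rightarrow> ('v \<Rightarrow>\<^sub>0 complex)" where
  "boundary1 X c = (\<Sum>e\<in>Poly_Mapping.keys c. chain_scale (Poly_Mapping.lookup c e)
     (Poly_Mapping.single (tgt X e) 1 - Poly_Mapping.single (src X e) 1))"

definition path_chain :: "('e \<times> bool) list \<Rightarrow> ('e \<Rightarrow>\<^sub>0 complex)" where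
  "path_chain p = (\<Sum>(e, b)\<leftarrow>p. Poly_Mapping.single e (if b then 1 else - 1))"

definition boundary2 :: "('v, 'e, 'f) complex2 \<Rightarrow> ('f \<Rightarrow>\<^sub>0 complex) \<Rightarrow> ('e \<Rightarrow>\<^sub>0 complex)" where
  "boundary2 X c = (\<Sum>f\<in>Poly_Mapping.keys c. chain_scale (Poly_Mapping.lookup c f)
     (path_chain (attach X f)))"

text \<open>The dimension of \<open>H\<^sub>1(X; \<complex>)\<close>, cycles modulo boundaries, for a complex with finitely many
  edges.\<close>

definition betti1 :: "('v, 'e, 'f) complex2 \<Rightarrow> nat" where
  "betti1 X = chain.dim {c \<in> chains (edges X). boundary1 X c = 0}
     - chain.dim (boundary2 X ` chains (faces X))"

text \<open>The quotient of \<open>X\<close> by a group \<open>H\<close> acting on vertices, edges and faces by \<open>av\<close>, \<open>ae\<close>, \<open>af\<close>,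
  compatibly with \<open>src\<close>, \<open>tgt\<close> and \<open>attach\<close>. The cells are the orbits of cells; the incidence maps,
  read off from representatives, do not depend on the choices.\<close>

definition quotient_complex ::
  "('a, 'b) monoid_scheme \<Rightarrow> ('a \<Rightarrow> 'v \<Rightarrow> 'v) \<Rightarrow> ('a \<Rightarrow> 'e \<Rightarrow> 'e) \<Rightarrow> ('a \<Rightarrow> 'f \<Rightarrow> 'f) \<Rightarrow>
   ('v, 'e, 'f) complex2 \<Rightarrow> ('v set, 'e set, 'f set) complex2" where
  "quotient_complex H av ae af X =
     \<lparr>verts = orbits H (verts X) av,
      edges = orbits H (edges X) ae,
      src = (\<lambda>E. orbit H av (src X (SOME e. e \<in> E))),
      tgt = (\<lambda>E. orbit H av (tgt X (SOME e. e \<in> E))),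
      faces = orbits H (faces X) af,
      attach = (\<lambda>F. map (\<lambda>(e, b). (orbit H ae e, b)) (attach X (SOME f. f \<in> F)))\<rparr>"


section \<open>The Cayley complex\<close>

text \<open>The edge \<open>(g, i)\<close> runs from \<open>g\<close> to \<open>g \<gamma>\<^sub>i\<close>; \<open>word_path G \<gamma> g w\<close> is the edge path starting at \<open>g\<close>
  with label \<open>w\<close>.\<close>

primrec word_path ::
  "('a, 'b) monoid_scheme \<Rightarrow> (nat \<Rightarrow> 'a) \<Rightarrow> 'a \<Rightarrow> letter list \<Rightarrow> (('a \<times> nat) \<times> bool) list" where
  "word_path G \<gamma> g [] = []"
| "word_path G \<gamma> g (x # w) =
     (let h = g \<otimes>\<^bsub>G\<^esub> letter_value G \<gamma> x
      in ((if snd x then g else h, fst x), snd x) # word_path G \<gamma> h w)"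

text \<open>The subcomplex of the Cayley complex consisting of the whole 1-skeleton and of the 2-cells
  \<open>(g, k)\<close>, attached along the loop at \<open>g\<close> with label \<open>r k\<close>, for \<open>g \<in> G\<close> and \<open>k \<in> I\<close>.\<close>

definition cayley_complex ::
  "('a, 'b) monoid_scheme \<Rightarrow> nat \<Rightarrow> (nat \<Rightarrow> 'a) \<Rightarrow> (nat \<Rightarrow> letter list) \<Rightarrow> nat set \<Rightarrow>
   ('a, 'a \<times> nat, 'a \<times> nat) complex2" where
  "cayley_complex G d \<gamma> r I =
     \<lparr>verts = carrier G,
      edges = carrier G \<times> {..<d},
      src = (\<lambda>(g, i). g),
      tgt = (\<lambda>(g, i). g \<otimes>\<^bsub>G\<^esub> \<gamma> i),
      faces = carrier G \<times> I,
      attach = (\<lambda>(g, k). word_path G \<gamma> g (r k))\<rparr>"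

text \<open>The subcomplex \<open>L\<^sub>j\<close> of the first \<open>j\<close> relators (all of them, if there are fewer than \<open>j\<close>).\<close>

definition cayley_sub ::
  "('a, 'b) monoid_scheme \<Rightarrow> nat \<Rightarrow> (nat \<Rightarrow> 'a) \<Rightarrow> enat \<Rightarrow> (nat \<Rightarrow> letter list) \<Rightarrow> nat \<Rightarrow>
   ('a, 'a \<times> nat, 'a \<times> nat) complex2" where
  "cayley_sub G d \<gamma> N r j = cayley_complex G d \<gamma> r {k. k < j \<and> enat k < N}"

definition cayley_quotient ::
  "('a, 'b) monoid_scheme \<Rightarrow> 'a set \<Rightarrow> ('a, 'a \<times> nat, 'a \<times> nat) complex2 \<Rightarrow>
   ('a set, ('a \<times> nat) set, ('a \<times> nat) set) complex2" where
  "cayley_quotient G H X =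
     quotient_complex (G\<lparr>carrier := H\<rparr>)
       (\<lambda>h g. h \<otimes>\<^bsub>G\<^esub> g) (\<lambda>h (g, i). (h \<otimes>\<^bsub>G\<^esub> g, i)) (\<lambda>h (g, k). (h \<otimes>\<^bsub>G\<^esub> g, k)) X"


section \<open>Square summable functions and von Neumann dimension\<close>

definition l2 :: "'x set \<Rightarrow> ('x \<Rightarrow> complex) set" where
  "l2 X = {f. (\<forall>x. x \<notin> X \<longrightarrow> f x = 0) \<and> (\<lambda>x. (cmod (f x))\<^sup>2) summable_on UNIV}"

definition l2_inner :: "('x \<Rightarrow> complex) \<Rightarrow> ('x \<Rightarrow> complex) \<Rightarrow> complex" where
  "l2_inner f g = (\<Sum>\<^sub>\<infinity>x. f x * cnj (g x))"

definition l2_norm :: "('x \<Rightarrow> complex) \<Rightarrow> real" where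
  "l2_norm f = sqrt (\<Sum>\<^sub>\<infinity>x. (cmod (f x))\<^sup>2)"

definition l2_closure :: "'x set \<Rightarrow> ('x \<Rightarrow> complex) set \<Rightarrow> ('x \<Rightarrow> complex) set" where
  "l2_closure X V = {f \<in> l2 X. \<forall>\<epsilon>>0. \<exists>v\<in>V. l2_norm (\<lambda>x. f x - v x) < \<epsilon>}"

text \<open>Orthogonal projection onto a closed subspace \<open>V\<close>.\<close>

definition l2_proj :: "('x \<Rightarrow> complex) set \<Rightarrow> ('x \<Rightarrow> complex) \<Rightarrow> ('x \<Rightarrow> complex)" where
  "l2_proj V f = (THE v. v \<in> V \<and> (\<forall>w\<in>V. l2_inner (\<lambda>x. f x - v x) w = 0))"

definition l2_delta :: "'x \<Rightarrow> 'x \<Rightarrow> complex" where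
  "l2_delta x = (\<lambda>y. if y = x then 1 else 0)"

text \<open>For \<open>G\<close> acting freely on \<open>X\<close> with finitely many orbits and \<open>V\<close> a closed \<open>G\<close>-invariant subspace of
  \<open>l2 X\<close>: the von Neumann trace of the projection onto \<open>V\<close>, the sum of its diagonal entries over
  representatives of the orbits.\<close>

definition vn_dim ::
  "('a, 'b) monoid_scheme \<Rightarrow> ('a \<Rightarrow> 'x \<Rightarrow> 'x) \<Rightarrow> 'x set \<Rightarrow> ('x \<Rightarrow> complex) set \<Rightarrow> real" where
  "vn_dim G act X V =
     (\<Sum>Q\<in>orbits G X act.
        let x = (SOME x. x \<in> Q) in Re (l2_inner (l2_proj V (l2_delta x)) (l2_delta x)))"


section \<open>\<open>\<ell>\<^sup>2\<close>-Betti numbers of a group\<close>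

text \<open>\<open>\<beta>\<^sub>p\<close> is defined, following Cheeger and Gromov, by means of the standard contractible free
  \<open>\<Delta>\<close>-complex \<open>EG\<close>: its \<open>p\<close>-simplices are all ordered \<open>(p+1)\<close>-tuples of elements of \<open>G\<close> (repetitions
  allowed), the faces are obtained by omitting an entry, and \<open>G\<close> acts by left multiplication on all
  entries.\<close>

definition tuple_act :: "('a, 'b) monoid_scheme \<Rightarrow> 'a \<Rightarrow> 'a list \<Rightarrow> 'a list" where
  "tuple_act G g \<sigma> = map (\<lambda>h. g \<otimes>\<^bsub>G\<^esub> h) \<sigma>"

definition omit :: "nat \<Rightarrow> 'a list \<Rightarrow> 'a list" where
  "omit i \<sigma> = take i \<sigma> @ drop (Suc i) \<sigma>"

definition cocompact_subcomplex :: "('a, 'b) monoid_scheme \<Rightarrow> 'a list set \<Rightarrow> bool" where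
  "cocompact_subcomplex G K \<longleftrightarrow>
     K \<subseteq> lists (carrier G) - {[]} \<and>
     (\<forall>\<sigma>\<in>K. \<forall>i<length \<sigma>. 2 \<le> length \<sigma> \<longrightarrow> omit i \<sigma> \<in> K) \<and>
     (\<forall>g\<in>carrier G. \<forall>\<sigma>\<in>K. tuple_act G g \<sigma> \<in> K) \<and>
     finite (orbits G K (tuple_act G))"

definition simplices :: "'a list set \<Rightarrow> nat \<Rightarrow> 'a list set" where
  "simplices K p = {\<sigma>\<in>K. length \<sigma> = Suc p}"

text \<open>The boundary operator in all degrees at once. Each simplex has only finitely many cofaces in
  a cocompact subcomplex, so the sum is finite; as \<open>[] \<notin> K\<close>, the boundary vanishes on
  \<open>0\<close>-chains.\<close>

definition l2_boundary :: "'a list set \<Rightarrow> ('a list \<Rightarrow> complex) \<Rightarrow> ('a list \<Rightarrow> complex)" where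
  "l2_boundary K f = (\<lambda>\<tau>. if \<tau> \<in> K
     then \<Sum>(\<sigma>, i) | \<sigma> \<in> K \<and> i < length \<sigma> \<and> omit i \<sigma> = \<tau>. (- 1) ^ i * f \<sigma>
     else 0)"

definition l2_cycles :: "'a list set \<Rightarrow> nat \<Rightarrow> ('a list \<Rightarrow> complex) set" where
  "l2_cycles K p = {f \<in> l2 (simplices K p). l2_boundary K f = (\<lambda>_. 0)}"

definition l2_boundaries :: "'a list set \<Rightarrow> nat \<Rightarrow> ('a list \<Rightarrow> complex) set" where
  "l2_boundaries K p = l2_boundary K ` l2 (simplices K (Suc p))"

text \<open>Reduced \<open>\<ell>\<^sup>2\<close>-homology, cycles modulo the closure of the boundaries, realised as a Hilbert
  space by the orthogonal complement of the boundaries in the space of cycles.\<close>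

definition l2_homology :: "'a list set \<Rightarrow> nat \<Rightarrow> ('a list \<Rightarrow> complex) set" where
  "l2_homology K p = {z \<in> l2_cycles K p. \<forall>b\<in>l2_boundaries K p. l2_inner z b = 0}"

text \<open>For \<open>K \<subseteq> K'\<close>, the closure of the image of the map from the reduced \<open>\<ell>\<^sup>2\<close>-homology of \<open>K\<close> to that of
  \<open>K'\<close> induced by inclusion: it sends a cycle to its component orthogonal to the boundaries of \<open>K'\<close>.\<close>

definition l2_homology_image :: "'a list set \<Rightarrow> 'a list set \<Rightarrow> nat \<Rightarrow> ('a list \<Rightarrow> complex) set" where
  "l2_homology_image K K' p =
     l2_closure (simplices K' p) (l2_proj (l2_homology K' p) ` l2_homology K p)"

text \<open>The dimension of the image decreases in \<open>K'\<close>, and the resulting limit increases in \<open>K\<close>.\<close>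

definition l2_betti :: "('a, 'b) monoid_scheme \<Rightarrow> nat \<Rightarrow> ereal" where
  "l2_betti G p =
     (SUP K\<in>Collect (cocompact_subcomplex G).
        INF K'\<in>{K'. cocompact_subcomplex G K' \<and> K \<subseteq> K'}.
          ereal (vn_dim G (tuple_act G) (simplices K' p) (l2_homology_image K K' p)))"

end

theory Submission
  imports Defs
    "Jordan_Normal_Form.Schur_Decomposition"
begin

text \<open>Let \<open>D\<^sub>j\<close> be the Hodge Laplacian on the 1-chains of \<open>L\<^sub>j\<close> and \<open>P\<^sub>j\<close> the projection onto its kernel, the
  space of harmonic chains. By Hodge theory, the first Betti number of the quotient of \<open>L\<^sub>j\<close> by
  \<open>\<Gamma>\<^sub>n\<close> is the limit for \<open>k \<rightarrow> \<infinity>\<close> of the traces of \<open>(1 - D/K)\<^sup>k\<close>, where \<open>D\<close> is the Laplacian of the quotient. For fixed \<open>k\<close> and large \<open>n\<close> the normalised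
  trace equals the von Neumann trace of \<open>(1 - D\<^sub>j/K)\<^sup>k\<close>, since the \<open>\<Gamma>\<^sub>n\<close> are normal and intersect
  trivially; and the limit in \<open>k\<close> is uniform in \<open>n\<close>, since \<open>D\<close> is an integer matrix, so that the product
  of its nonzero eigenvalues is at least \<open>1\<close> and few of them are small (Lueck's argument). Hence the
  inner limit is the trace of \<open>P\<^sub>j\<close>.

  To compare these traces with the \<open>\<ell>\<^sup>2\<close>-Betti number one uses equivariant chain maps between \<open>L\<^sub>j\<close> and
  \<open>EG\<close>. Given a cocompact \<open>K\<close> and \<open>j\<close>, the map from the reduced homology of \<open>K\<close> to that of a suitable
  \<open>K' \<supseteq> K\<close> factors through the harmonic chains of \<open>L\<^sub>j\<close>. Conversely, if \<open>K\<close> contains the Cayley graph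
  and \<open>K' \<supseteq> K\<close>, then for large \<open>j\<close> the boundaries of \<open>K'\<close> become boundaries in \<open>L\<^sub>j\<close>, and the identity of the
  harmonic chains of \<open>L\<^sub>j\<close> factors through the image of the homology of \<open>K\<close> in that of \<open>K'\<close>. Monotonicity
  of the von Neumann dimension gives the two inequalities.\<close>

section \<open>The real Hilbert space of square summable functions\<close>

text \<open>The boundary matrices are integral, so real Hilbert spaces suffice; complex scalars
  enter only when the given definitions are matched. Every projection arises as a strong limit of
  powers of \<open>1 - S\<close> for a positive contraction \<open>S\<close>, without a spectral
  theorem: such a power is a polynomial in sparse matrices, so at each finite stage it is
  equivariant, local and computable in the quotients, and properties of matrix entries pass to the
  limit. Two obstacles shape the rest. Images in reduced homology need not be closed, so dimensions
  cannot be compared through bounded inverses; instead, polynomials without constant term in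
  \<open>A' A\<close> and in \<open>A A'\<close>, with \<open>A'\<close> the adjoint of
  \<open>A\<close>, have the same trace. And exchanging the limits in \<open>k\<close> and
  \<open>n\<close> needs a norm bound on the Laplacian that serves upstairs and in all quotients;
  row and column sums provide it, since they do not grow when a kernel is pushed to orbits. Degree-2
  chain maps and homotopies are never built: it is enough that the relevant images of basis vectors
  are finite combinations of boundaries.\<close>

typedef 'x ell2 = "{f :: 'x \<Rightarrow> real. (\<lambda>x. (f x)\<^sup>2) summable_on UNIV}"
  morphisms coord Abs_ell2
  by (rule exI[of _ "\<lambda>_. 0"]) simp

setup_lifting type_definition_ell2

lemma sq_summable_coord: "(\<lambda>x. (coord f x)\<^sup>2) summable_on UNIV"
  using coord[of f] by simp

lemma summable_on_mult_of_squares: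
  fixes f g :: "'x \<Rightarrow> real"
  assumes "(\<lambda>x. (f x)\<^sup>2) summable_on A" "(\<lambda>x. (g x)\<^sup>2) summable_on A"
  shows "(\<lambda>x. f x * g x) summable_on A"
proof -
  have "(\<lambda>x. (f x)\<^sup>2 + (g x)\<^sup>2) summable_on A"
    by (rule summable_on_add[OF assms])
  moreover have "norm (f x * g x) \<le> (f x)\<^sup>2 + (g x)\<^sup>2" for x
  proof -
    have "\<bar>f x * g x\<bar> \<le> ((f x)\<^sup>2 + (g x)\<^sup>2) / 2"
      using sum_squares_bound[of "\<bar>f x\<bar>" "\<bar>g x\<bar>"] by (simp add: abs_mult)
    moreover have "((f x)\<^sup>2 + (g x)\<^sup>2) / 2 \<le> (f x)\<^sup>2 + (g x)\<^sup>2" by simp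
    ultimately show ?thesis unfolding real_norm_def by linarith
  qed
  ultimately have "(\<lambda>x. norm (f x * g x)) summable_on A"
    by (rule summable_on_comparison_test) auto
  then show ?thesis by (rule abs_summable_summable)
qed

lemma summable_on_square_add:
  fixes f g :: "'x \<Rightarrow> real"
  assumes "(\<lambda>x. (f x)\<^sup>2) summable_on A" "(\<lambda>x. (g x)\<^sup>2) summable_on A"
  shows "(\<lambda>x. (f x + g x)\<^sup>2) summable_on A"
proof -
  have "(\<lambda>x. ((f x)\<^sup>2 + (g x)\<^sup>2) + 2 * (f x * g x)) summable_on A"
    using assms summable_on_mult_of_squares[OF assms]
    by (intro summable_on_add summable_on_cmult_right) auto
  then show ?thesis by (simp add: power2_sum algebra_simps)
qed

lemma summable_coord_mult: "(\<lambda>x. coord f x * coord g x) summable_on A"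
  by (rule summable_on_subset[OF summable_on_mult_of_squares[OF sq_summable_coord sq_summable_coord]]) auto

instantiation ell2 :: (type) real_vector
begin

lift_definition zero_ell2 :: "'a ell2" is "\<lambda>_. 0" by simp
lift_definition plus_ell2 :: "'a ell2 \<Rightarrow> 'a ell2 \<Rightarrow> 'a ell2" is "\<lambda>f g x. f x + g x"
  by (rule summable_on_square_add)
lift_definition uminus_ell2 :: "'a ell2 \<Rightarrow> 'a ell2" is "\<lambda>f x. - f x" by simp
lift_definition minus_ell2 :: "'a ell2 \<Rightarrow> 'a ell2 \<Rightarrow> 'a ell2" is "\<lambda>f g x. f x - g x"
  subgoal for f g using summable_on_square_add[of f UNIV "\<lambda>x. - g x"] by simp
  done
lift_definition scaleR_ell2 :: "real \<Rightarrow> 'a ell2 \<Rightarrow> 'a ell2" is "\<lambda>c f x. c * f x"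
  by (simp add: power_mult_distrib summable_on_cmult_right)

instance
  by (intro_classes; transfer; auto simp: algebra_simps)

end

lemma coord_add [simp]: "coord (f + g) x = coord f x + coord g x"
  and coord_diff [simp]: "coord (f - g) x = coord f x - coord g x"
  and coord_uminus [simp]: "coord (- f) x = - coord f x"
  and coord_scaleR [simp]: "coord (c *\<^sub>R f) x = c * coord f x"
  and coord_zero [simp]: "coord 0 x = 0"
  by (transfer; simp)+

lemma ell2_eqI: "(\<And>x. coord f x = coord g x) \<Longrightarrow> f = g"
  by transfer auto

lemma coord_sum [simp]: "coord (sum f A) x = (\<Sum>a\<in>A. coord (f a) x)"
  by (induction A rule: infinite_finite_induct) auto

instantiation ell2 :: (type) real_inner
begin

definition inner_ell2 :: "'a ell2 \<Rightarrow> 'a ell2 \<Rightarrow> real"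
  where "inner_ell2 f g = (\<Sum>\<^sub>\<infinity>x. coord f x * coord g x)"
definition norm_ell2 :: "'a ell2 \<Rightarrow> real" where "norm_ell2 f = sqrt (inner f f)"
definition sgn_ell2 :: "'a ell2 \<Rightarrow> 'a ell2" where "sgn_ell2 f = f /\<^sub>R norm f"
definition dist_ell2 :: "'a ell2 \<Rightarrow> 'a ell2 \<Rightarrow> real" where "dist_ell2 f g = norm (f - g)"
definition uniformity_ell2 :: "('a ell2 \<times> 'a ell2) filter"
  where "uniformity_ell2 = (INF e\<in>{0<..}. principal {(x, y). dist x y < e})"
definition open_ell2 :: "'a ell2 set \<Rightarrow> bool"
  where "open_ell2 U = (\<forall>x\<in>U. eventually (\<lambda>(x', y). x' = x \<longrightarrow> y \<in> U) uniformity)"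

instance
proof
  fix f g h :: "'a ell2" and c :: real
  show "inner f g = inner g f" unfolding inner_ell2_def by (simp add: mult.commute)
  show "inner (f + g) h = inner f h + inner g h"
    unfolding inner_ell2_def coord_add ring_distribs
    by (rule infsum_add) (rule summable_coord_mult)+
  show "inner (c *\<^sub>R f) g = c * inner f g"
    unfolding inner_ell2_def coord_scaleR mult.assoc
    by (rule infsum_cmult_right) (rule summable_coord_mult)
  show nonneg: "0 \<le> inner f f" unfolding inner_ell2_def by (rule infsum_nonneg) simp
  show "inner f f = 0 \<longleftrightarrow> f = 0"
  proof
    assume *: "inner f f = 0"
    have "coord f x * coord f x = 0" for x
      by (rule nonneg_infsum_le_0D[where A = UNIV and f = "\<lambda>x. coord f x * coord f x"])
        (use * in \<open>auto simp: inner_ell2_def summable_coord_mult\<close>)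
    then show "f = 0" by (intro ell2_eqI) simp
  qed (simp add: inner_ell2_def)
qed (auto simp: norm_ell2_def sgn_ell2_def dist_ell2_def uniformity_ell2_def open_ell2_def)

end

lemma inner_coord: "inner f g = (\<Sum>\<^sub>\<infinity>x. coord f x * coord g x)" for f :: "'x ell2"
  by (rule inner_ell2_def)

lemma norm_sq_coord: "(norm f)\<^sup>2 = (\<Sum>\<^sub>\<infinity>x. (coord f x)\<^sup>2)" for f :: "'x ell2"
  unfolding power2_norm_eq_inner inner_coord by (simp add: power2_eq_square)

lemma sum_coord_sq_le: "finite F \<Longrightarrow> (\<Sum>x\<in>F. (coord f x)\<^sup>2) \<le> (norm f)\<^sup>2"
  unfolding norm_sq_coord by (rule finite_sum_le_infsum) (auto simp: sq_summable_coord)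

lemma abs_coord_le: "\<bar>coord f x\<bar> \<le> norm f"
  using sum_coord_sq_le[of "{x}" f] abs_le_square_iff[of "coord f x" "norm f"] by simp

text \<open>The entrance to \<open>ell2\<close> for a function given by a limit or by a kernel:
  bounds on finite partial sums are what a pointwise limit and Schur's test provide, and
  \<open>coord\<close> undoes \<open>Abs_ell2\<close> only once summability is known.\<close>

lemma ell2_of_bounded_sums:
  fixes f :: "'x \<Rightarrow> real"
  assumes bd: "\<And>F. finite F \<Longrightarrow> (\<Sum>x\<in>F. (f x)\<^sup>2) \<le> C\<^sup>2" and C: "0 \<le> C"
  shows "(\<lambda>x. (f x)\<^sup>2) summable_on UNIV" and "coord (Abs_ell2 f) = f"
    and "norm (Abs_ell2 f) \<le> C"
proof -
  show s: "(\<lambda>x. (f x)\<^sup>2) summable_on UNIV"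
    by (rule nonneg_bounded_partial_sums_imp_summable_on[where C = "C\<^sup>2"])
      (auto intro!: eventually_finite_subsets_at_top_weakI bd)
  then show c: "coord (Abs_ell2 f) = f" by (simp add: Abs_ell2_inverse)
  have "(norm (Abs_ell2 f))\<^sup>2 \<le> C\<^sup>2" unfolding norm_sq_coord c
    by (rule infsum_le_finite_sums[OF s]) (use bd in auto)
  then show "norm (Abs_ell2 f) \<le> C" using C by (rule power2_le_imp_le)
qed

instance ell2 :: (type) banach
proof
  fix X :: "nat \<Rightarrow> 'a ell2"
  assume X: "Cauchy X"
  have "Cauchy (\<lambda>n. coord (X n) x)" for x
  proof (rule CauchyI)
    fix e :: real assume "0 < e"
    then obtain M where "\<forall>m\<ge>M. \<forall>n\<ge>M. norm (X m - X n) < e" using CauchyD[OF X] by blast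
    moreover have "norm (coord (X m) x - coord (X n) x) \<le> norm (X m - X n)" for m n
      using abs_coord_le[of "X m - X n" x] by simp
    ultimately show "\<exists>M. \<forall>m\<ge>M. \<forall>n\<ge>M. norm (coord (X m) x - coord (X n) x) < e"
      by (meson le_less_trans)
  qed
  have lim: "(\<lambda>n. coord (X n) x) \<longlonglongrightarrow> lim (\<lambda>n. coord (X n) x)" for x
    by (rule convergent_LIMSEQ_iff[THEN iffD1, OF Cauchy_convergent]) fact
  define f where "f x = lim (\<lambda>n. coord (X n) x)" for x
  have lim: "(\<lambda>n. coord (X n) x) \<longlonglongrightarrow> f x" for x using lim by (simp add: f_def)
  have tail: "(\<Sum>x\<in>F. (coord (X m) x - f x)\<^sup>2) \<le> e\<^sup>2"
    if "\<forall>n\<ge>M. norm (X m - X n) < e" "finite F" for M m e F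
  proof (rule LIMSEQ_le_const2)
    show "(\<lambda>n. \<Sum>x\<in>F. (coord (X m) x - coord (X n) x)\<^sup>2)
      \<longlonglongrightarrow> (\<Sum>x\<in>F. (coord (X m) x - f x)\<^sup>2)"
      by (intro tendsto_intros lim)
    have "(\<Sum>x\<in>F. (coord (X m) x - coord (X n) x)\<^sup>2) \<le> e\<^sup>2" if "n \<ge> M" for n
    proof -
      have "(\<Sum>x\<in>F. (coord (X m - X n) x)\<^sup>2) \<le> (norm (X m - X n))\<^sup>2"
        by (rule sum_coord_sq_le) fact
      also have "\<dots> \<le> e\<^sup>2"
        using \<open>\<forall>n\<ge>M. norm (X m - X n) < e\<close> that by (intro power_mono) (auto intro: less_imp_le)
      finally show ?thesis by simp
    qed
    then show "\<exists>N. \<forall>n\<ge>N. (\<Sum>x\<in>F. (coord (X m) x - coord (X n) x)\<^sup>2) \<le> e\<^sup>2" by blast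
  qed
  obtain M0 where M0: "\<forall>m\<ge>M0. \<forall>n\<ge>M0. norm (X m - X n) < 1"
    using CauchyD[OF X, of 1] by auto
  \<comment> \<open>Only the difference of \<open>X M0\<close> and \<open>f\<close> is known to have
    bounded sums, so the limit is obtained as \<open>X M0\<close> minus that difference.\<close>
  define g where "g = X M0 - Abs_ell2 (\<lambda>x. coord (X M0) x - f x)"
  have "coord (Abs_ell2 (\<lambda>x. coord (X M0) x - f x)) = (\<lambda>x. coord (X M0) x - f x)"
  proof (rule ell2_of_bounded_sums(2)[where C = 1])
    show "(\<Sum>x\<in>F. (coord (X M0) x - f x)\<^sup>2) \<le> 1\<^sup>2" if "finite F" for F
      using tail[of M0 M0 1 F] M0 that by blast
  qed simp
  then have g: "coord g = f" by (auto simp: g_def)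
  have "X \<longlonglongrightarrow> g"
  proof (rule LIMSEQ_I)
    fix e :: real assume e: "0 < e"
    then obtain M where M: "\<forall>m\<ge>M. \<forall>n\<ge>M. norm (X m - X n) < e/2"
      using CauchyD[OF X, of "e/2"] by auto
    have "norm (X m - g) < e" if "m \<ge> M" for m
    proof -
      have "norm (Abs_ell2 (coord (X m - g))) \<le> e/2"
      proof (rule ell2_of_bounded_sums(3))
        fix F :: "'a set" assume "finite F"
        then have "(\<Sum>x\<in>F. (coord (X m) x - f x)\<^sup>2) \<le> (e/2)\<^sup>2"
          using tail[of M m "e/2" F] M that by blast
        then show "(\<Sum>x\<in>F. (coord (X m - g) x)\<^sup>2) \<le> (e/2)\<^sup>2" by (simp add: g)
      qed (use e in simp)
      then show ?thesis using e by (simp add: coord_inverse)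
    qed
    then show "\<exists>no. \<forall>n\<ge>no. norm (X n - g) < e" by blast
  qed
  then show "convergent X" by (rule convergentI)
qed

lift_definition delta :: "'x \<Rightarrow> 'x ell2" is "\<lambda>x y. if y = x then 1 else 0"
  by (rule finite_nonzero_values_imp_summable_on) auto

lemma coord_delta: "coord (delta x) y = (if y = x then 1 else 0)"
  by transfer simp

lemma inner_delta_right [simp]: "inner f (delta x) = coord f x"
proof -
  have "inner f (delta x) = (\<Sum>\<^sub>\<infinity>y\<in>{x}. coord f y * coord (delta x) y)"
    unfolding inner_coord by (rule infsum_cong_neutral) (auto simp: coord_delta)
  then show ?thesis by (simp add: coord_delta)
qed

lemma inner_delta_left [simp]: "inner (delta x) f = coord f x"
  by (metis inner_commute inner_delta_right)

lemma finite_support_eq_sum_delta: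
  assumes "finite S" "\<And>x. x \<notin> S \<Longrightarrow> coord f x = 0"
  shows "f = (\<Sum>x\<in>S. coord f x *\<^sub>R delta x)"
proof (rule ell2_eqI)
  fix y
  have "coord (\<Sum>x\<in>S. coord f x *\<^sub>R delta x) y = (\<Sum>x\<in>S. if y = x then coord f x else 0)"
    by (auto simp: coord_delta intro!: sum.cong)
  then show "coord f y = coord (\<Sum>x\<in>S. coord f x *\<^sub>R delta x) y"
    using assms by (auto simp: sum.delta)
qed

text \<open>Parseval with remainder: what is left of \<open>f\<close> outside a finite
  \<open>F\<close> has as squared norm that of \<open>f\<close> minus the partial sum of
  squares.\<close>

lemma has_sum_delta: "((\<lambda>x. coord f x *\<^sub>R delta x) has_sum f) UNIV"
proof -
  have res: "(norm (f - (\<Sum>x\<in>F. coord f x *\<^sub>R delta x)))\<^sup>2 = (norm f)\<^sup>2 - (\<Sum>x\<in>F. (coord f x)\<^sup>2)"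
    if "finite F" for F
  proof -
    let ?s = "\<Sum>x\<in>F. coord f x *\<^sub>R delta x"
    have "inner f ?s = (\<Sum>x\<in>F. (coord f x)\<^sup>2)"
      by (simp add: inner_sum_right power2_eq_square)
    moreover have c: "coord ?s x = coord f x" if "x \<in> F" for x
    proof -
      have "coord ?s x = (\<Sum>y\<in>F. if x = y then coord f y else 0)"
        by (auto simp: coord_delta intro!: sum.cong)
      then show ?thesis using that \<open>finite F\<close> by simp
    qed
    have "inner ?s ?s = (\<Sum>x\<in>F. coord f x * coord ?s x)"
      unfolding inner_sum_right by (simp only: inner_scaleR_right inner_delta_right)
    then have "inner ?s ?s = (\<Sum>x\<in>F. (coord f x)\<^sup>2)"
      by (simp only: c power2_eq_square cong: sum.cong)
    ultimately show ?thesis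
      by (simp add: power2_norm_eq_inner inner_diff_left inner_diff_right inner_commute)
  qed
  show ?thesis unfolding has_sum_def
  proof (rule tendstoI)
    fix e :: real assume e: "0 < e"
    have "((\<lambda>x. (coord f x)\<^sup>2) has_sum (norm f)\<^sup>2) UNIV"
      unfolding norm_sq_coord using sq_summable_coord by (rule has_sum_infsum)
    then have "((\<lambda>F. \<Sum>x\<in>F. (coord f x)\<^sup>2) \<longlongrightarrow> (norm f)\<^sup>2) (finite_subsets_at_top UNIV)"
      unfolding has_sum_def .
    then have "\<forall>\<^sub>F F in finite_subsets_at_top UNIV. dist (\<Sum>x\<in>F. (coord f x)\<^sup>2) ((norm f)\<^sup>2) < e\<^sup>2"
      by (rule tendstoD) (use e in simp)
    moreover have "\<forall>\<^sub>F F in finite_subsets_at_top (UNIV::'a set). finite F"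
      by (rule eventually_finite_subsets_at_top_weakI)
    ultimately show "\<forall>\<^sub>F F in finite_subsets_at_top UNIV.
        dist (\<Sum>x\<in>F. coord f x *\<^sub>R delta x) f < e"
    proof eventually_elim
      case (elim F)
      have "(norm (f - (\<Sum>x\<in>F. coord f x *\<^sub>R delta x)))\<^sup>2 < e\<^sup>2"
        using elim(1) res[OF elim(2)] by (simp add: dist_real_def)
      then have "norm (f - (\<Sum>x\<in>F. coord f x *\<^sub>R delta x)) < e"
        by (rule power2_less_imp_less) (use e in simp)
      then show ?case by (simp add: dist_norm norm_minus_commute)
    qed
  qed
qed

lemma bounded_linear_eq_on_delta:
  fixes A B :: "'x ell2 \<Rightarrow> 'b :: real_normed_vector"
  assumes "bounded_linear A" "bounded_linear B" "\<And>x. A (delta x) = B (delta x)"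
  shows "A f = B f"
proof -
  have "((\<lambda>x. A (coord f x *\<^sub>R delta x)) has_sum A f) UNIV"
    using has_sum_bounded_linear[OF assms(1) has_sum_delta[of f]] by (simp add: o_def)
  moreover have "((\<lambda>x. B (coord f x *\<^sub>R delta x)) has_sum B f) UNIV"
    using has_sum_bounded_linear[OF assms(2) has_sum_delta[of f]] by (simp add: o_def)
  moreover have "A (coord f x *\<^sub>R delta x) = B (coord f x *\<^sub>R delta x)" for x
    using assms by (simp add: bounded_linear.linear linear_cmul)
  ultimately show ?thesis by (metis (no_types, lifting) has_sum_cong infsumI)
qed

section \<open>Powers of positive contractions\<close>

lemma funpow_symmetric:
  fixes T :: "'h::real_inner \<Rightarrow> 'h"
  assumes "\<And>x y. inner (T x) y = inner x (T y)"
  shows "inner ((T ^^ k) x) y = inner x ((T ^^ k) y)"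
  by (induction k arbitrary: x y) (auto simp: assms funpow_swap1)

text \<open>The limit of the powers of \<open>1 - S\<close> is the orthogonal projection onto the kernel of \<open>S\<close>; the
  condition on \<open>S\<close> says \<open>S\<^sup>2 \<le> S\<close>, that is, \<open>0 \<le> S \<le> 1\<close>. As
  \<open>\<langle>T\<^sup>m x, x\<rangle>\<close> decreases in \<open>m\<close>, the sequence \<open>T\<^sup>k x\<close> is Cauchy.\<close>

definition kernel_proj :: "('h::{real_inner,banach} \<Rightarrow> 'h) \<Rightarrow> 'h \<Rightarrow> 'h" where
  "kernel_proj S x = lim (\<lambda>k. ((\<lambda>x. x - S x) ^^ k) x)"

locale psd_contraction =
  fixes S :: "'h::{real_inner,banach} \<Rightarrow> 'h"
  assumes lin: "linear S"
    and sym: "\<And>x y. inner (S x) y = inner x (S y)"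
    and sq_le: "\<And>x. (norm (S x))\<^sup>2 \<le> inner (S x) x"
begin

definition T where "T x = x - S x"

lemma linear_T: "linear T"
  unfolding T_def using lin by (intro linear_compose_sub linear_ident)

lemma linear_T_pow: "linear (T ^^ k)"
proof (induction k)
  case 0
  show ?case by (simp add: id_def linear_ident)
next
  case (Suc k)
  then show ?case using linear_compose[OF Suc linear_T] by (simp add: o_def)
qed

lemma sym_T: "inner (T x) y = inner x (T y)"
  by (simp add: T_def inner_diff_left inner_diff_right sym)

text \<open>The condition of the locale, \<open>S^2 \<le> S\<close> as operators, is invariant under
  exchanging \<open>S\<close> and \<open>1 - S\<close>.\<close>

lemma T_sq_le: "(norm (T x))\<^sup>2 \<le> inner (T x) x"
  using sq_le[of x] by (simp add: T_def power2_norm_eq_inner inner_diff_left inner_diff_right inner_commute)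

lemma T_inner_le: "inner (T x) x \<le> (norm x)\<^sup>2"
  using order_trans[OF zero_le_power2 sq_le[of x]]
  by (simp add: T_def power2_norm_eq_inner inner_diff_left)

lemma norm_T_le: "norm (T x) \<le> norm x"
  by (rule power2_le_imp_le[OF order_trans[OF T_sq_le T_inner_le] norm_ge_zero])

lemma norm_T_pow_le: "norm ((T ^^ k) x) \<le> norm x"
  by (induction k) (auto intro: order_trans[OF norm_T_le])

lemma inner_T_pow_add: "inner ((T ^^ (a + b)) x) y = inner ((T ^^ a) x) ((T ^^ b) y)"
  by (metis add.commute comp_apply funpow_add funpow_symmetric[OF sym_T])

lemma inner_T_pow_even: "inner ((T ^^ (k + k)) x) x = (norm ((T ^^ k) x))\<^sup>2"
  by (simp add: inner_T_pow_add power2_norm_eq_inner)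

lemma inner_T_pow_odd: "inner ((T ^^ (Suc (k + k))) x) x = inner (T ((T ^^ k) x)) ((T ^^ k) x)"
  using inner_T_pow_add[of "Suc k" k x x] by simp

lemma inner_T_pow_nonneg: "0 \<le> inner ((T ^^ m) x) x"
proof (cases "even m")
  case True
  then obtain k where "m = k + k" by (metis evenE mult_2)
  then show ?thesis by (simp only: inner_T_pow_even) simp
next
  case False
  then obtain k where "m = Suc (k + k)" by (metis oddE mult_2 Suc_eq_plus1)
  then show ?thesis
    using order_trans[OF zero_le_power2 T_sq_le] by (simp only: inner_T_pow_odd)
qed

text \<open>With \<open>y = T^k x\<close>, even exponents give the squared norm of \<open>y\<close>
  and odd ones \<open><T y, y>\<close>, so \<open>T^2 \<le> T \<le> 1\<close> suffices and no square
  root of \<open>T\<close> is needed.\<close>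

lemma inner_T_pow_decseq: "decseq (\<lambda>m. inner ((T ^^ m) x) x)"
proof (rule decseq_SucI)
  fix m
  show "inner ((T ^^ Suc m) x) x \<le> inner ((T ^^ m) x) x"
  proof (cases "even m")
    case True
    then obtain k where k: "m = k + k" by (metis evenE mult_2)
    then show ?thesis using T_inner_le[of "(T ^^ k) x"] by (simp only: inner_T_pow_even inner_T_pow_odd)
  next
    case False
    then obtain k where k: "m = Suc (k + k)" by (metis oddE mult_2 Suc_eq_plus1)
    then have "Suc m = Suc k + Suc k" by simp
    then have "inner ((T ^^ Suc m) x) x = (norm (T ((T ^^ k) x)))\<^sup>2"
      by (simp only: inner_T_pow_even funpow.simps o_apply)
    then show ?thesis using T_sq_le[of "(T ^^ k) x"] by (simp only: k inner_T_pow_odd)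
  qed
qed

lemma Cauchy_T_pow: "Cauchy (\<lambda>k. (T ^^ k) x)"
proof -
  let ?a = "\<lambda>m. inner ((T ^^ m) x) x"
  \<comment> \<open>This turns the Cauchy property in norm into convergence of the numbers
    \<open>?a m\<close>.\<close>
  have dist: "(norm ((T ^^ k) x - (T ^^ m) x))\<^sup>2 = ?a (k + k) - 2 * ?a (k + m) + ?a (m + m)" for k m
    unfolding inner_T_pow_add
    by (simp add: power2_norm_eq_inner inner_diff_left inner_diff_right inner_commute)
  obtain L where L: "?a \<longlonglongrightarrow> L" and le: "\<And>m. L \<le> ?a m"
    using decseq_convergent[OF inner_T_pow_decseq[of x], of 0] inner_T_pow_nonneg[of _ x] by blast
  show ?thesis
  proof (rule CauchyI)
    fix e :: real assume e: "0 < e"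
    \<comment> \<open>The two outer terms of \<open>dist\<close> are below
      \<open>L + e\<^sup>2 / 2\<close> and \<open>?a (k + m)\<close> is at least \<open>L\<close>,
      which leaves less than \<open>e\<^sup>2\<close>.\<close>
    then obtain M where M0: "\<And>m. m \<ge> M \<Longrightarrow> norm (?a m - L) < e\<^sup>2 / 2"
      using LIMSEQ_D[OF L, of "e\<^sup>2 / 2"] by auto
    have M: "?a m < L + e\<^sup>2 / 2" if "m \<ge> M" for m
      using M0[OF that] unfolding real_norm_def by linarith
    have "norm ((T ^^ k) x - (T ^^ m) x) < e" if "k \<ge> M" "m \<ge> M" for k m
    proof (rule power2_less_imp_less)
      show "(norm ((T ^^ k) x - (T ^^ m) x))\<^sup>2 < e\<^sup>2"
        unfolding dist using M[of "k + k"] M[of "m + m"] le[of "k + m"] that by simp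
    qed (use e in simp)
    then show "\<exists>M. \<forall>m\<ge>M. \<forall>n\<ge>M. norm ((T ^^ m) x - (T ^^ n) x) < e" by blast
  qed
qed

definition P where "P = kernel_proj S"

lemma T_pow_tendsto: "(\<lambda>k. (T ^^ k) x) \<longlonglongrightarrow> P x"
proof -
  have "(\<lambda>x. x - S x) = T" by (auto simp: T_def)
  then show ?thesis unfolding P_def kernel_proj_def
    using convergent_LIMSEQ_iff Cauchy_convergent[OF Cauchy_T_pow] by metis
qed

lemma norm_P_le: "norm (P x) \<le> norm x"
  by (rule LIMSEQ_le_const2[OF tendsto_norm[OF T_pow_tendsto]]) (use norm_T_pow_le in blast)

lemma bounded_linear_P: "bounded_linear P"
proof (rule bounded_linear_intro[where K = 1])
  show "P (x + y) = P x + P y" for x y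
    by (rule LIMSEQ_unique[OF T_pow_tendsto])
      (use tendsto_add[OF T_pow_tendsto[of x] T_pow_tendsto[of y]] in \<open>simp add: linear_add[OF linear_T_pow]\<close>)
  show "P (r *\<^sub>R x) = r *\<^sub>R P x" for r x
    by (rule LIMSEQ_unique[OF T_pow_tendsto])
      (use tendsto_scaleR[OF tendsto_const T_pow_tendsto[of x], of r] in \<open>simp add: linear_cmul[OF linear_T_pow]\<close>)
  show "norm (P x) \<le> norm x * 1" for x using norm_P_le by simp
qed

lemma bounded_linear_T: "bounded_linear T"
  by (rule bounded_linear_intro[where K = 1])
    (auto simp: linear_add[OF linear_T] linear_cmul[OF linear_T] norm_T_le)

lemma T_P: "T (P x) = P x"
proof (rule LIMSEQ_unique)
  show "(\<lambda>k. (T ^^ Suc k) x) \<longlonglongrightarrow> T (P x)"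
    using bounded_linear.tendsto[OF bounded_linear_T T_pow_tendsto[of x]] by simp
  show "(\<lambda>k. (T ^^ Suc k) x) \<longlonglongrightarrow> P x"
    by (rule LIMSEQ_Suc[OF T_pow_tendsto])
qed

lemma S_P [simp]: "S (P x) = 0"
  using T_P[of x] by (simp add: T_def)

lemma P_fix: "S x = 0 \<Longrightarrow> P x = x"
proof -
  assume "S x = 0"
  then have "(T ^^ k) x = x" for k by (induction k) (auto simp: T_def)
  then show ?thesis using T_pow_tendsto[of x] by (simp add: LIMSEQ_const_iff)
qed

lemma P_eq_iff: "P x = x \<longleftrightarrow> S x = 0"
  by (metis P_fix S_P)

lemma P_idem [simp]: "P (P x) = P x" by (simp add: P_fix)

lemma sym_P: "inner (P x) y = inner x (P y)"
proof (rule LIMSEQ_unique)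
  show "(\<lambda>k. inner ((T ^^ k) x) y) \<longlonglongrightarrow> inner (P x) y"
    by (intro tendsto_intros T_pow_tendsto)
  show "(\<lambda>k. inner ((T ^^ k) x) y) \<longlonglongrightarrow> inner x (P y)"
    unfolding funpow_symmetric[OF sym_T] by (intro tendsto_intros T_pow_tendsto)
qed

lemma inner_T_pow_tendsto: "(\<lambda>k. inner ((T ^^ k) x) x) \<longlonglongrightarrow> (norm (P x))\<^sup>2"
proof -
  have "(\<lambda>k. inner ((T ^^ k) x) x) \<longlonglongrightarrow> inner (P x) x"
    by (intro tendsto_intros T_pow_tendsto)
  then show ?thesis by (metis P_idem power2_norm_eq_inner sym_P)
qed

end

section \<open>Operators given by sparse kernels\<close>

text \<open>\<open>R\<close> and \<open>S\<close> are the data of Schur's test. Rows and columns are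
  finite so that the kernel also acts on functions that are not square summable, such as functions
  pulled back from a quotient.\<close>

definition bker :: "('x \<Rightarrow> 'y \<Rightarrow> real) \<Rightarrow> real \<Rightarrow> real \<Rightarrow> bool" where
  "bker k R S \<longleftrightarrow>
     (\<forall>x. finite {y. k x y \<noteq> 0} \<and> (\<Sum>y | k x y \<noteq> 0. \<bar>k x y\<bar>) \<le> R) \<and>
     (\<forall>y. finite {x. k x y \<noteq> 0} \<and> (\<Sum>x | k x y \<noteq> 0. \<bar>k x y\<bar>) \<le> S)"

definition ktransp :: "('x \<Rightarrow> 'y \<Rightarrow> real) \<Rightarrow> 'y \<Rightarrow> 'x \<Rightarrow> real" where
  "ktransp k y x = k x y"

lemma ktransp_ktransp [simp]: "ktransp (ktransp k) = k"
  by (auto simp: ktransp_def fun_eq_iff)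

lemma bker_transp: "bker k R S \<Longrightarrow> bker (ktransp k) S R"
  unfolding bker_def ktransp_def by blast

lemma bker_finite_row: "bker k R S \<Longrightarrow> finite {y. k x y \<noteq> 0}"
  and bker_finite_col: "bker k R S \<Longrightarrow> finite {x. k x y \<noteq> 0}"
  unfolding bker_def by blast+

lemma bker_row_sum: "bker k R S \<Longrightarrow> finite F \<Longrightarrow> (\<Sum>y\<in>F. \<bar>k x y\<bar>) \<le> R"
proof -
  assume b: "bker k R S" and F: "finite F"
  have "(\<Sum>y\<in>F. \<bar>k x y\<bar>) = (\<Sum>y\<in>F \<inter> {y. k x y \<noteq> 0}. \<bar>k x y\<bar>)"
    by (rule sum.mono_neutral_right) (use F in auto)
  also have "\<dots> \<le> (\<Sum>y | k x y \<noteq> 0. \<bar>k x y\<bar>)"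
    by (rule sum_mono2) (use bker_finite_row[OF b] in auto)
  also have "\<dots> \<le> R" using b unfolding bker_def by blast
  finally show ?thesis .
qed

lemma bker_col_sum: "bker k R S \<Longrightarrow> finite F \<Longrightarrow> (\<Sum>x\<in>F. \<bar>k x y\<bar>) \<le> S"
  using bker_row_sum[OF bker_transp, of k R S F y] by (simp add: ktransp_def)

lemma bker_nonneg: "bker k R S \<Longrightarrow> 0 \<le> R" "bker k R S \<Longrightarrow> 0 \<le> S"
  using bker_row_sum[of k R S "{}"] bker_col_sum[of k R S "{}"] by auto

text \<open>The row action on arbitrary functions, \<open>(k f)(x) = \<Sum>\<^sub>y k(x, y) f(y)\<close>. The operator \<open>kop k\<close>
  below sends \<open>delta x\<close> to the row \<open>k x\<close>, so it is the row action of the transpose.\<close>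

definition rowact :: "('x \<Rightarrow> 'y \<Rightarrow> real) \<Rightarrow> ('y \<Rightarrow> real) \<Rightarrow> 'x \<Rightarrow> real" where
  "rowact k f x = (\<Sum>y | k x y \<noteq> 0. k x y * f y)"

lemma rowact_eq_sum:
  "finite F \<Longrightarrow> {y. k x y \<noteq> 0} \<subseteq> F \<Longrightarrow> rowact k f x = (\<Sum>y\<in>F. k x y * f y)"
  unfolding rowact_def by (rule sum.mono_neutral_left) auto

definition kop :: "('x \<Rightarrow> 'y \<Rightarrow> real) \<Rightarrow> 'x ell2 \<Rightarrow> 'y ell2" where
  "kop k f = Abs_ell2 (rowact (ktransp k) (coord f))"

text \<open>Schur's test on finite sets, the form from which \<open>ell2_of_bounded_sums\<close>
  derives both membership in \<open>ell2\<close> and the norm bound.\<close>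

lemma schur_test:
  assumes b: "bker k R S" and F: "finite F"
  shows "(\<Sum>y\<in>F. (rowact (ktransp k) (coord f) y)\<^sup>2) \<le> (sqrt (R * S) * norm f)\<^sup>2"
proof -
  let ?A = "\<Union>y\<in>F. {x. k x y \<noteq> 0}"
  have A: "finite ?A" using F bker_finite_col[OF b] by auto
  have 1: "(rowact (ktransp k) (coord f) y)\<^sup>2 \<le> S * (\<Sum>x\<in>?A. \<bar>k x y\<bar> * (coord f x)\<^sup>2)" if "y \<in> F" for y
  proof -
    have "rowact (ktransp k) (coord f) y = (\<Sum>x\<in>?A. k x y * coord f x)"
      using rowact_eq_sum[of ?A "ktransp k" y "coord f"] A that by (auto simp: ktransp_def)
    \<comment> \<open>Half of the weight goes to each factor of Cauchy-Schwarz: one factor is summed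
      along the column, the other carries \<open>f\<close>.\<close>
    also have "\<dots> = (\<Sum>x\<in>?A. sqrt \<bar>k x y\<bar> * (sgn (k x y) * sqrt \<bar>k x y\<bar> * coord f x))"
    proof (rule sum.cong)
      fix x
      have "sqrt \<bar>k x y\<bar> * sqrt \<bar>k x y\<bar> * sgn (k x y) = k x y"
        by (simp add: sgn_mult_abs abs_mult_sgn)
      then show "k x y * coord f x = sqrt \<bar>k x y\<bar> * (sgn (k x y) * sqrt \<bar>k x y\<bar> * coord f x)"
        by (metis mult.assoc mult.commute)
    qed simp
    finally have "(rowact (ktransp k) (coord f) y)\<^sup>2
        \<le> (\<Sum>x\<in>?A. (sqrt \<bar>k x y\<bar>)\<^sup>2) * (\<Sum>x\<in>?A. (sgn (k x y) * sqrt \<bar>k x y\<bar> * coord f x)\<^sup>2)"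
      by (simp only: Cauchy_Schwarz_ineq_sum)
    also have "(\<Sum>x\<in>?A. (sgn (k x y) * sqrt \<bar>k x y\<bar> * coord f x)\<^sup>2) = (\<Sum>x\<in>?A. \<bar>k x y\<bar> * (coord f x)\<^sup>2)"
      by (rule sum.cong) (auto simp: power_mult_distrib sgn_if)
    also have "(\<Sum>x\<in>?A. (sqrt \<bar>k x y\<bar>)\<^sup>2) * (\<Sum>x\<in>?A. \<bar>k x y\<bar> * (coord f x)\<^sup>2)
        \<le> S * (\<Sum>x\<in>?A. \<bar>k x y\<bar> * (coord f x)\<^sup>2)"
      by (rule mult_right_mono) (use bker_col_sum[OF b A] in \<open>auto intro: sum_nonneg\<close>)
    finally show ?thesis .
  qed
  have "(\<Sum>y\<in>F. (rowact (ktransp k) (coord f) y)\<^sup>2) \<le> (\<Sum>y\<in>F. S * (\<Sum>x\<in>?A. \<bar>k x y\<bar> * (coord f x)\<^sup>2))"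
    by (rule sum_mono) (rule 1)
  also have "\<dots> = S * (\<Sum>x\<in>?A. (\<Sum>y\<in>F. \<bar>k x y\<bar>) * (coord f x)\<^sup>2)"
    by (simp only: sum_distrib_left sum_distrib_right) (rule sum.swap)
  also have "\<dots> \<le> S * (\<Sum>x\<in>?A. R * (coord f x)\<^sup>2)"
    by (intro mult_left_mono sum_mono mult_right_mono bker_row_sum[OF b F] bker_nonneg[OF b]) auto
  also have "\<dots> = R * S * (\<Sum>x\<in>?A. (coord f x)\<^sup>2)" by (simp add: sum_distrib_left mult_ac)
  also have "\<dots> \<le> R * S * (norm f)\<^sup>2"
    by (intro mult_left_mono sum_coord_sq_le A mult_nonneg_nonneg bker_nonneg[OF b])
  finally show ?thesis using bker_nonneg[OF b] by (simp add: power_mult_distrib)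
qed

lemma bker_sqrt_nonneg: "bker k R S \<Longrightarrow> 0 \<le> sqrt (R * S) * norm f"
  using bker_nonneg[of k R S] by simp

lemma coord_kop: "bker k R S \<Longrightarrow> coord (kop k f) = rowact (ktransp k) (coord f)"
  unfolding kop_def
  by (rule ell2_of_bounded_sums(2)[OF schur_test]) (assumption | erule bker_sqrt_nonneg)+

lemma norm_kop_le: "bker k R S \<Longrightarrow> norm (kop k f) \<le> sqrt (R * S) * norm f"
  unfolding kop_def
  by (rule ell2_of_bounded_sums(3)[OF schur_test]) (assumption | erule bker_sqrt_nonneg)+

lemma bounded_linear_kop: "bker k R S \<Longrightarrow> bounded_linear (kop k)"
  by (rule bounded_linear_intro[where K = "sqrt (R * S)"])
    (auto intro!: ell2_eqI simp: coord_kop rowact_def sum.distrib sum_distrib_left algebra_simps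
      dest: norm_kop_le)

lemma coord_kop_delta: "bker k R S \<Longrightarrow> coord (kop k (delta x)) y = k x y"
proof -
  assume b: "bker k R S"
  have "coord (kop k (delta x)) y = (\<Sum>x' | k x' y \<noteq> 0. if x' = x then k x' y else 0)"
    unfolding coord_kop[OF b] rowact_def ktransp_def by (rule sum.cong) (auto simp: coord_delta)
  also have "\<dots> = k x y" using bker_finite_col[OF b, of y] by (simp add: sum.delta)
  finally show ?thesis .
qed

lemma kop_adjoint:
  assumes b: "bker k R S"
  shows "inner (kop k f) g = inner f (kop (ktransp k) g)"
proof (rule bounded_linear_eq_on_delta[where A = "\<lambda>f. inner (kop k f) g"])
  show "bounded_linear (\<lambda>f. inner (kop k f) g)"
    by (rule bounded_linear_compose[OF bounded_linear_inner_left bounded_linear_kop[OF b]])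
  show "bounded_linear (\<lambda>f. inner f (kop (ktransp k) g))" by (rule bounded_linear_inner_left)
  fix x
  have "inner (kop k (delta x)) g = (\<Sum>\<^sub>\<infinity>y. k x y * coord g y)"
    unfolding inner_coord by (simp add: coord_kop_delta[OF b])
  also have "\<dots> = (\<Sum>\<^sub>\<infinity>y\<in>{y. k x y \<noteq> 0}. k x y * coord g y)"
    by (rule infsum_cong_neutral) auto
  also have "\<dots> = rowact k (coord g) x"
    using bker_finite_row[OF b, of x] by (simp add: rowact_def)
  finally show "inner (kop k (delta x)) g = inner (delta x) (kop (ktransp k) g)"
    by (simp add: coord_kop[OF bker_transp[OF b]])
qed

section \<open>Equivariant operators and the von Neumann trace\<close>

type_synonym ('a, 'x) gspace = "('a \<Rightarrow> 'x \<Rightarrow> 'x) \<times> 'x set"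

context group
begin

definition free_gspace :: "('a, 'x) gspace \<Rightarrow> bool" where
  "free_gspace \<alpha> \<longleftrightarrow>
     (\<forall>g\<in>carrier G. \<forall>x\<in>snd \<alpha>. fst \<alpha> g x \<in> snd \<alpha>) \<and>
     (\<forall>x\<in>snd \<alpha>. fst \<alpha> \<one> x = x) \<and>
     (\<forall>g\<in>carrier G. \<forall>h\<in>carrier G. \<forall>x\<in>snd \<alpha>. fst \<alpha> (g \<otimes> h) x = fst \<alpha> g (fst \<alpha> h x)) \<and>
     (\<forall>g\<in>carrier G. \<forall>x\<in>snd \<alpha>. fst \<alpha> g x = x \<longrightarrow> g = \<one>)"

lemma free_gspaceD:
  assumes "free_gspace \<alpha>" "x \<in> snd \<alpha>"
  shows "g \<in> carrier G \<Longrightarrow> fst \<alpha> g x \<in> snd \<alpha>" "fst \<alpha> \<one> x = x"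
    "g \<in> carrier G \<Longrightarrow> h \<in> carrier G \<Longrightarrow> fst \<alpha> (g \<otimes> h) x = fst \<alpha> g (fst \<alpha> h x)"
    "g \<in> carrier G \<Longrightarrow> fst \<alpha> g x = x \<Longrightarrow> g = \<one>"
  using assms unfolding free_gspace_def by blast+

lemma gspace_inv [simp]:
  assumes "free_gspace \<alpha>" "x \<in> snd \<alpha>" "g \<in> carrier G"
  shows "fst \<alpha> (inv g) (fst \<alpha> g x) = x" "fst \<alpha> g (fst \<alpha> (inv g) x) = x"
  using assms by (metis free_gspaceD(2,3) inv_closed l_inv r_inv)+

lemma gspace_bij: "free_gspace \<alpha> \<Longrightarrow> g \<in> carrier G \<Longrightarrow> bij_betw (fst \<alpha> g) (snd \<alpha>) (snd \<alpha>)"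
  by (rule bij_betw_byWitness[where f' = "fst \<alpha> (inv g)"]) (auto simp: free_gspaceD)

lemma gspace_inj:
  assumes "free_gspace \<alpha>" "x \<in> snd \<alpha>" "g \<in> carrier G" "h \<in> carrier G" "fst \<alpha> g x = fst \<alpha> h x"
  shows "g = h"
proof -
  have "fst \<alpha> (inv h \<otimes> g) x = x"
    using assms by (simp add: free_gspaceD)
  then have "inv h \<otimes> g = \<one>" by (intro free_gspaceD(4)[OF assms(1,2)]) (use assms in auto)
  then show ?thesis using assms(3,4) by (metis inv_closed inv_equality inv_inv)
qed

text \<open>A fundamental domain: the space becomes the product of the group with a finite set, and
  sums over it become finite sums of sums over the group.\<close>

definition transversal :: "('a, 'x) gspace \<Rightarrow> 'x set \<Rightarrow> bool" where
  "transversal \<alpha> R \<longleftrightarrow> finite R \<and> R \<subseteq> snd \<alpha> \<and>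
     bij_betw (\<lambda>(g, x). fst \<alpha> g x) (carrier G \<times> R) (snd \<alpha>)"

lemma transversalD:
  assumes "transversal \<alpha> R"
  shows "finite R" "R \<subseteq> snd \<alpha>" "bij_betw (\<lambda>(g, x). fst \<alpha> g x) (carrier G \<times> R) (snd \<alpha>)"
  using assms unfolding transversal_def by blast+

lemma transversal_cover:
  assumes "transversal \<alpha> R" "x \<in> snd \<alpha>"
  obtains g \<rho> where "g \<in> carrier G" "\<rho> \<in> R" "x = fst \<alpha> g \<rho>"
proof -
  have "x \<in> (\<lambda>(g, x). fst \<alpha> g x) ` (carrier G \<times> R)"
    using bij_betw_imp_surj_on[OF transversalD(3)[OF assms(1)]] assms(2) by simp
  then show thesis using that by auto
qed

lemma infsum_transversal:
  fixes f :: "'x \<Rightarrow> real"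
  assumes t: "transversal \<alpha> R" and f: "f summable_on snd \<alpha>"
  shows "infsum f (snd \<alpha>) = (\<Sum>\<rho>\<in>R. \<Sum>\<^sub>\<infinity>g\<in>carrier G. f (fst \<alpha> g \<rho>))"
proof -
  have b: "bij_betw (\<lambda>(\<rho>, g). fst \<alpha> g \<rho>) (R \<times> carrier G) (snd \<alpha>)"
  proof -
    have "bij_betw (\<lambda>(\<rho>, g). (g, \<rho>)) (R \<times> carrier G) (carrier G \<times> R)"
      by (rule bij_betw_byWitness[where f' = "\<lambda>(g, \<rho>). (\<rho>, g)"]) auto
    from bij_betw_trans[OF this transversalD(3)[OF t]] show ?thesis
      by (simp add: o_def case_prod_unfold)
  qed
  have s: "(\<lambda>(\<rho>, g). f (fst \<alpha> g \<rho>)) summable_on (R \<times> carrier G)"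
    using f summable_on_reindex_bij_betw[OF b, of f] by (simp add: case_prod_unfold)
  have "infsum f (snd \<alpha>) = infsum (\<lambda>(\<rho>, g). f (fst \<alpha> g \<rho>)) (R \<times> carrier G)"
    using infsum_reindex_bij_betw[OF b, of f] by (simp add: case_prod_unfold)
  also have "\<dots> = (\<Sum>\<^sub>\<infinity>\<rho>\<in>R. \<Sum>\<^sub>\<infinity>g\<in>carrier G. f (fst \<alpha> g \<rho>))"
    by (rule infsum_Sigma'_banach[symmetric]) (rule s)
  finally show ?thesis using transversalD(1)[OF t] by simp
qed

text \<open>An adjoint pair of equivariant operators. They act on functions on the whole type; the fourth
  condition says that they respect the decomposition into functions on the \<open>G\<close>-space and functions
  on its complement. Traces only see the former part.\<close>

definition eqop :: "('a, 'x) gspace \<Rightarrow> ('a, 'y) gspace \<Rightarrow> ('x ell2 \<Rightarrow> 'y ell2) \<Rightarrow> ('y ell2 \<Rightarrow> 'x ell2) \<Rightarrow> bool" where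
  "eqop \<alpha> \<beta> A A' \<longleftrightarrow> bounded_linear A \<and> bounded_linear A' \<and>
     (\<forall>f h. inner (A f) h = inner f (A' h)) \<and>
     (\<forall>x y. (x \<in> snd \<alpha>) \<noteq> (y \<in> snd \<beta>) \<longrightarrow> coord (A (delta x)) y = 0) \<and>
     (\<forall>g\<in>carrier G. \<forall>x\<in>snd \<alpha>. \<forall>y\<in>snd \<beta>.
        coord (A (delta (fst \<alpha> g x))) (fst \<beta> g y) = coord (A (delta x)) y)"

lemma eqopD:
  assumes "eqop \<alpha> \<beta> A A'"
  shows "bounded_linear A" "bounded_linear A'" "inner (A f) h = inner f (A' h)"
    "(x \<in> snd \<alpha>) \<noteq> (y \<in> snd \<beta>) \<Longrightarrow> coord (A (delta x)) y = 0"
    "g \<in> carrier G \<Longrightarrow> x \<in> snd \<alpha> \<Longrightarrow> y \<in> snd \<beta> \<Longrightarrow>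
      coord (A (delta (fst \<alpha> g x))) (fst \<beta> g y) = coord (A (delta x)) y"
    "coord (A' (delta y)) x = coord (A (delta x)) y"
proof -
  show "coord (A' (delta y)) x = coord (A (delta x)) y"
    using assms inner_delta_left[of x "A' (delta y)"] inner_delta_right[of "A (delta x)" y]
    unfolding eqop_def by metis
qed (use assms in \<open>unfold eqop_def, blast+\<close>)

lemma eqop_linear: "eqop \<alpha> \<beta> A A' \<Longrightarrow> linear A" "eqop \<alpha> \<beta> A A' \<Longrightarrow> linear A'"
  by (auto dest: eqopD bounded_linear.linear)

lemma eqop_adjoint: "eqop \<alpha> \<beta> A A' \<Longrightarrow> eqop \<beta> \<alpha> A' A"
  unfolding eqop_def[of \<beta> \<alpha>]
  by (intro conjI allI ballI impI) (auto simp: eqopD(1,2,6,5) eqopD(3)[symmetric] inner_commute intro: eqopD(4))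

definition supp_on :: "'x set \<Rightarrow> 'x ell2 \<Rightarrow> bool" where
  "supp_on X f \<longleftrightarrow> (\<forall>x. x \<notin> X \<longrightarrow> coord f x = 0)"

lemma eqop_supp_on: "eqop \<alpha> \<beta> A A' \<Longrightarrow> supp_on (snd \<alpha>) f \<Longrightarrow> supp_on (snd \<beta>) (A f)"
  unfolding supp_on_def
proof (intro allI impI)
  fix y assume A: "eqop \<alpha> \<beta> A A'" and f: "\<forall>x. x \<notin> snd \<alpha> \<longrightarrow> coord f x = 0" and y: "y \<notin> snd \<beta>"
  have "coord (A f) y = inner f (A' (delta y))"
    using eqopD(3)[OF A, of f "delta y"] by simp
  moreover have "coord f x * coord (A' (delta y)) x = 0" for x
    using f y eqopD(4)[OF A, of x y] by (auto simp: eqopD(6)[OF A])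
  ultimately show "coord (A f) y = 0" by (simp only: inner_coord infsum_0_simp)
qed

lemma coord_comp:
  assumes B: "eqop \<beta> \<delta> B B'"
  shows "coord (B f) z = (\<Sum>\<^sub>\<infinity>y. coord f y * coord (B (delta y)) z)"
proof -
  have "coord (B f) z = inner f (B' (delta z))"
    using eqopD(3)[OF B, of f "delta z"] by simp
  then show ?thesis by (simp add: inner_coord eqopD(6)[OF B])
qed

text \<open>Matrix entries multiply by a sum over the middle space. The support condition of
  \<open>eqop\<close> keeps that sum inside the space, and reindexing it by the action of
  \<open>g\<close> gives equivariance.\<close>

lemma eqop_comp:
  assumes A: "eqop \<alpha> \<beta> A A'" and B: "eqop \<beta> \<delta> B B'"
    and \<alpha>: "free_gspace \<alpha>" and \<beta>: "free_gspace \<beta>"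
  shows "eqop \<alpha> \<delta> (\<lambda>f. B (A f)) (\<lambda>f. A' (B' f))"
  unfolding eqop_def
proof (intro conjI allI ballI impI)
  show "bounded_linear (\<lambda>f. B (A f))" "bounded_linear (\<lambda>f. A' (B' f))"
    using A B by (auto intro: bounded_linear_compose dest: eqopD)
  show "inner (B (A f)) h = inner f (A' (B' h))" for f h
    by (simp add: eqopD(3)[OF A] eqopD(3)[OF B])
  have s: "coord (A (delta x)) y * coord (B (delta y)) z = 0" if "(x \<in> snd \<alpha>) \<noteq> (z \<in> snd \<delta>)" for x y z
    using eqopD(4)[OF A, of x y] eqopD(4)[OF B, of y z] that by auto
  show "coord (B (A (delta x))) z = 0" if "(x \<in> snd \<alpha>) \<noteq> (z \<in> snd \<delta>)" for x z
    unfolding coord_comp[OF B, of "A (delta x)"] by (simp only: s[OF that] infsum_0_simp)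
  have cY: "coord (B (A (delta x))) z = (\<Sum>\<^sub>\<infinity>y\<in>snd \<beta>. coord (A (delta x)) y * coord (B (delta y)) z)"
    if "x \<in> snd \<alpha>" for x z
    unfolding coord_comp[OF B, of "A (delta x)"]
    by (rule infsum_cong_neutral) (use that eqopD(4)[OF A] in auto)
  fix g x z assume g: "g \<in> carrier G" and x: "x \<in> snd \<alpha>" and z: "z \<in> snd \<delta>"
  have gx: "fst \<alpha> g x \<in> snd \<alpha>" using free_gspaceD(1)[OF \<alpha> x g] .
  have "coord (B (A (delta (fst \<alpha> g x)))) (fst \<delta> g z)
    = (\<Sum>\<^sub>\<infinity>y\<in>snd \<beta>. coord (A (delta (fst \<alpha> g x))) (fst \<beta> g y) * coord (B (delta (fst \<beta> g y))) (fst \<delta> g z))"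
    unfolding cY[OF gx]
    by (rule infsum_reindex_bij_betw[OF gspace_bij[OF \<beta> g], symmetric])
  also have "\<dots> = (\<Sum>\<^sub>\<infinity>y\<in>snd \<beta>. coord (A (delta x)) y * coord (B (delta y)) z)"
    by (rule infsum_cong) (simp add: eqopD(5)[OF A g x] eqopD(5)[OF B g _ z])
  finally show "coord (B (A (delta (fst \<alpha> g x)))) (fst \<delta> g z) = coord (B (A (delta x))) z"
    by (simp add: cY[OF x])
qed

lemma eqop_id:
  assumes \<alpha>: "free_gspace \<alpha>"
  shows "eqop \<alpha> \<alpha> (\<lambda>f. f) (\<lambda>f. f)"
  unfolding eqop_def
proof (intro conjI allI ballI impI)
  fix g x y assume *: "g \<in> carrier G" "x \<in> snd \<alpha>" "y \<in> snd \<alpha>"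
  then have "fst \<alpha> g y = fst \<alpha> g x \<longleftrightarrow> y = x"
    using bij_betw_inv_into_left[OF gspace_bij[OF \<alpha>]] by metis
  then show "coord (delta (fst \<alpha> g x)) (fst \<alpha> g y) = coord (delta x) y"
    by (simp add: coord_delta)
qed (auto simp: coord_delta bounded_linear_ident)

lemma eqop_add: "eqop \<alpha> \<beta> A A' \<Longrightarrow> eqop \<alpha> \<beta> B B' \<Longrightarrow> eqop \<alpha> \<beta> (\<lambda>f. A f + B f) (\<lambda>f. A' f + B' f)"
  unfolding eqop_def by (simp add: bounded_linear_add inner_add_left inner_add_right)

lemma eqop_diff: "eqop \<alpha> \<beta> A A' \<Longrightarrow> eqop \<alpha> \<beta> B B' \<Longrightarrow> eqop \<alpha> \<beta> (\<lambda>f. A f - B f) (\<lambda>f. A' f - B' f)"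
  unfolding eqop_def by (simp add: bounded_linear_sub inner_diff_left inner_diff_right)

lemma eqop_scaleR: "eqop \<alpha> \<beta> A A' \<Longrightarrow> eqop \<alpha> \<beta> (\<lambda>f. c *\<^sub>R A f) (\<lambda>f. c *\<^sub>R A' f)"
  unfolding eqop_def by (simp add: bounded_linear_const_scaleR)

lemma eqop_zero: "eqop \<alpha> \<beta> (\<lambda>f. 0) (\<lambda>f. 0)"
  unfolding eqop_def by (simp add: bounded_linear_zero)

lemma eqop_sum:
  "(\<And>i. i \<in> I \<Longrightarrow> eqop \<alpha> \<beta> (A i) (A' i)) \<Longrightarrow> eqop \<alpha> \<beta> (\<lambda>f. \<Sum>i\<in>I. A i f) (\<lambda>f. \<Sum>i\<in>I. A' i f)"
  by (induction I rule: infinite_finite_induct) (auto intro: eqop_zero eqop_add)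

lemma eqop_funpow:
  assumes "eqop \<alpha> \<alpha> T T" "free_gspace \<alpha>"
  shows "eqop \<alpha> \<alpha> (T ^^ k) (T ^^ k)"
proof (induction k)
  case 0
  show ?case using eqop_id[OF assms(2)] by (simp add: id_def)
next
  case (Suc k)
  have "T ^^ Suc k = (\<lambda>f. (T ^^ k) (T f))" by (auto simp: funpow_swap1)
  moreover have "T ^^ Suc k = (\<lambda>f. T ((T ^^ k) f))" by auto
  ultimately show ?case using eqop_comp[OF assms(1) Suc assms(2,2)] by metis
qed

text \<open>Support and equivariance are conditions on matrix entries, so they pass from the powers
  of \<open>1 - S\<close> to the limit.\<close>

lemma eqop_kernel_proj:
  assumes S: "psd_contraction S" and e: "eqop \<alpha> \<alpha> S S" and \<alpha>: "free_gspace \<alpha>"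
  shows "eqop \<alpha> \<alpha> (kernel_proj S) (kernel_proj S)"
proof -
  interpret psd_contraction S by fact
  have T: "eqop \<alpha> \<alpha> (T ^^ k) (T ^^ k)" for k
    using eqop_funpow[OF eqop_diff[OF eqop_id[OF \<alpha>] e] \<alpha>, of k] by (simp add: T_def[abs_def])
  have c: "(\<lambda>k. coord ((T ^^ k) (delta x)) y) \<longlonglongrightarrow> coord (P (delta x)) y" for x y
    using tendsto_inner[OF T_pow_tendsto[of "delta x"] tendsto_const[of "delta y"]] by simp
  show ?thesis unfolding P_def[symmetric] eqop_def
  proof (intro conjI allI ballI impI bounded_linear_P sym_P)
    show "coord (P (delta x)) y = 0" if "(x \<in> snd \<alpha>) \<noteq> (y \<in> snd \<alpha>)" for x y
      using c[of x y] eqopD(4)[OF T that] by (simp add: LIMSEQ_const_iff)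
    show "coord (P (delta (fst \<alpha> g x))) (fst \<alpha> g y) = coord (P (delta x)) y"
      if "g \<in> carrier G" "x \<in> snd \<alpha>" "y \<in> snd \<alpha>" for g x y
      using c[of "fst \<alpha> g x" "fst \<alpha> g y"] c[of x y] unfolding eqopD(5)[OF T that]
      by (rule LIMSEQ_unique)
  qed
qed

text \<open>Half of the trace property: a diagonal entry of \<open>A C\<close> is expanded into a
  sum over \<open>R\<close> and the group in which the two spaces play symmetric roles. Equivariance
  moves the translation from \<open>\<rho>\<close> to \<open>y\<close>, at the price of replacing
  \<open>g\<close> by its inverse.\<close>

lemma trace_half:
  assumes A: "eqop \<alpha> \<beta> A A'" and C: "eqop \<beta> \<alpha> C C'"
    and \<alpha>: "free_gspace \<alpha>" "transversal \<alpha> R" and \<beta>: "free_gspace \<beta>" and y: "y \<in> snd \<beta>"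
  shows "coord (A (C (delta y))) y
    = (\<Sum>\<rho>\<in>R. \<Sum>\<^sub>\<infinity>g\<in>carrier G. coord (C (delta (fst \<beta> g y))) \<rho> * coord (A (delta \<rho>)) (fst \<beta> g y))"
proof -
  have "coord (A (C (delta y))) y = (\<Sum>\<^sub>\<infinity>x. coord (C (delta y)) x * coord (A (delta x)) y)"
    by (rule coord_comp[OF A])
  also have "\<dots> = (\<Sum>\<^sub>\<infinity>x\<in>snd \<alpha>. coord (C (delta y)) x * coord (A (delta x)) y)"
    by (rule infsum_cong_neutral) (use y eqopD(4)[OF C] in auto)
  also have "\<dots> = (\<Sum>\<rho>\<in>R. \<Sum>\<^sub>\<infinity>g\<in>carrier G. coord (C (delta y)) (fst \<alpha> g \<rho>) * coord (A (delta (fst \<alpha> g \<rho>))) y)"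
    by (rule infsum_transversal[OF \<alpha>(2)])
      (use summable_coord_mult[of "C (delta y)" "A' (delta y)" "snd \<alpha>"] in \<open>simp add: eqopD(6)[OF A]\<close>)
  also have "\<dots> = (\<Sum>\<rho>\<in>R. \<Sum>\<^sub>\<infinity>g\<in>carrier G. coord (C (delta (fst \<beta> g y))) \<rho> * coord (A (delta \<rho>)) (fst \<beta> g y))"
  proof (rule sum.cong[OF HOL.refl])
    fix \<rho> assume "\<rho> \<in> R"
    then have \<rho>: "\<rho> \<in> snd \<alpha>" using transversalD(2)[OF \<alpha>(2)] by auto
    have b: "bij_betw (\<lambda>g. inv g) (carrier G) (carrier G)"
      by (rule bij_betw_byWitness[where f' = "\<lambda>g. inv g"]) auto
    have "coord (C (delta (fst \<beta> (inv g) y))) \<rho> * coord (A (delta \<rho>)) (fst \<beta> (inv g) y)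
      = coord (C (delta y)) (fst \<alpha> g \<rho>) * coord (A (delta (fst \<alpha> g \<rho>))) y" if g: "g \<in> carrier G" for g
    proof -
      have y': "fst \<beta> (inv g) y \<in> snd \<beta>" using free_gspaceD(1)[OF \<beta> y] g by simp
      show ?thesis
        using eqopD(5)[OF C g y' \<rho>] eqopD(5)[OF A g \<rho> y'] \<beta> y g by simp
    qed
    then show "(\<Sum>\<^sub>\<infinity>g\<in>carrier G. coord (C (delta y)) (fst \<alpha> g \<rho>) * coord (A (delta (fst \<alpha> g \<rho>))) y)
      = (\<Sum>\<^sub>\<infinity>g\<in>carrier G. coord (C (delta (fst \<beta> g y))) \<rho> * coord (A (delta \<rho>)) (fst \<beta> g y))"
      using infsum_reindex_bij_betw[OF b, of "\<lambda>g. coord (C (delta (fst \<beta> g y))) \<rho> * coord (A (delta \<rho>)) (fst \<beta> g y)"]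
      by (simp cong: infsum_cong)
  qed
  finally show ?thesis .
qed

lemma trace_half':
  assumes A: "eqop \<alpha> \<beta> A A'" and C: "eqop \<beta> \<alpha> C C'"
    and \<beta>: "free_gspace \<beta>" "transversal \<beta> R'" and \<rho>: "\<rho> \<in> snd \<alpha>"
  shows "coord (C (A (delta \<rho>))) \<rho>
    = (\<Sum>y\<in>R'. \<Sum>\<^sub>\<infinity>g\<in>carrier G. coord (C (delta (fst \<beta> g y))) \<rho> * coord (A (delta \<rho>)) (fst \<beta> g y))"
proof -
  have "coord (C (A (delta \<rho>))) \<rho> = (\<Sum>\<^sub>\<infinity>y\<in>snd \<beta>. coord (A (delta \<rho>)) y * coord (C (delta y)) \<rho>)"
    unfolding coord_comp[OF C, of "A (delta \<rho>)"]
    by (rule infsum_cong_neutral) (use \<rho> eqopD(4)[OF A] in auto)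
  also have "\<dots> = (\<Sum>y\<in>R'. \<Sum>\<^sub>\<infinity>g\<in>carrier G. coord (A (delta \<rho>)) (fst \<beta> g y) * coord (C (delta (fst \<beta> g y))) \<rho>)"
    by (rule infsum_transversal[OF \<beta>(2)])
      (use summable_coord_mult[of "A (delta \<rho>)" "C' (delta \<rho>)" "snd \<beta>"] in \<open>simp add: eqopD(6)[OF C]\<close>)
  finally show ?thesis by (simp add: mult.commute)
qed

text \<open>The von Neumann trace is a trace: by the two expansions above, both sides are the same
  sum over \<open>R'\<close>, \<open>R\<close> and the group.\<close>

lemma trace_commute:
  assumes A: "eqop \<alpha> \<beta> A A'" and C: "eqop \<beta> \<alpha> C C'"
    and \<alpha>: "free_gspace \<alpha>" "transversal \<alpha> R" and \<beta>: "free_gspace \<beta>" "transversal \<beta> R'"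
  shows "(\<Sum>y\<in>R'. coord (A (C (delta y))) y) = (\<Sum>x\<in>R. coord (C (A (delta x))) x)"
proof -
  have "(\<Sum>y\<in>R'. coord (A (C (delta y))) y) = (\<Sum>y\<in>R'. \<Sum>\<rho>\<in>R.
      \<Sum>\<^sub>\<infinity>g\<in>carrier G. coord (C (delta (fst \<beta> g y))) \<rho> * coord (A (delta \<rho>)) (fst \<beta> g y))"
    using transversalD(2)[OF \<beta>(2)] by (intro sum.cong HOL.refl trace_half[OF A C \<alpha> \<beta>(1)]) auto
  also have "\<dots> = (\<Sum>x\<in>R. coord (C (A (delta x))) x)"
    using transversalD(2)[OF \<alpha>(2)]
    by (subst sum.swap) (intro sum.cong HOL.refl trace_half'[OF A C \<beta>, symmetric], auto)
  finally show ?thesis .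
qed

end

section \<open>Gram operators and the comparison of von Neumann traces\<close>

context psd_contraction
begin

text \<open>The geometric sum for \<open>T = 1 - S\<close>. It exhibits \<open>1 - T^k\<close> as a
  multiple of \<open>S\<close>; if \<open>S\<close> is a Gram operator, this factors
  \<open>1 - T^k\<close> through the underlying map.\<close>

lemma telescope: "(\<Sum>i<k. (T ^^ i) (S x)) = x - (T ^^ k) x"
proof (induction k)
  case (Suc k)
  have "(T ^^ Suc k) x = (T ^^ k) x - (T ^^ k) (S x)"
    by (simp add: funpow_swap1 T_def[of x] linear_diff[OF linear_T_pow])
  with Suc show ?case by simp
qed simp

text \<open>\<open>Q\<close> is meant to be a projection onto a space containing the range of
  \<open>S\<close>. As \<open>1 - T^k\<close> is a polynomial in \<open>S\<close> without constant
  term, it equals its compression by \<open>Q\<close>, and it is at most 1 because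
  \<open>T^k\<close> is positive.\<close>

lemma inner_one_minus_le:
  assumes P: "\<And>x y. inner (Q x) y = inner x (Q y)" and S: "\<And>x. S (Q x) = S x"
  shows "inner (x - (T ^^ k) x) x \<le> (norm (Q x))\<^sup>2"
proof -
  define D where "D x = x - (T ^^ k) x" for x
  have "D (Q x) = D x" for x
    unfolding D_def telescope[symmetric] by (simp add: S)
  moreover have "inner (D x) y = inner x (D y)" for x y
    by (simp add: D_def inner_diff_left inner_diff_right funpow_symmetric[OF sym_T])
  ultimately have "inner (D x) x = inner (D (Q x)) (Q x)" by (metis inner_commute)
  also have "\<dots> \<le> inner (Q x) (Q x)"
    using inner_T_pow_nonneg[of k "Q x"] by (simp add: D_def inner_diff_left)
  finally show ?thesis by (simp add: D_def power2_norm_eq_inner)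
qed

end

text \<open>The bound on \<open>A'\<close>, applied to \<open>A x\<close>, gives
  \<open>|A' A x|^2 \<le> c |A x|^2 = c <A' A x, x>\<close>, which is the contraction condition
  after scaling by \<open>1 / c\<close>.\<close>

lemma psd_contraction_gram:
  fixes A :: "'h::{real_inner,banach} \<Rightarrow> 'k::{real_inner,banach}"
  assumes A: "linear A" "linear A'" and adj: "\<And>f h. inner (A f) h = inner f (A' h)"
    and c: "0 < c" and n: "\<And>h. (norm (A' h))\<^sup>2 \<le> c * (norm h)\<^sup>2"
  shows "psd_contraction (\<lambda>f. (1 / c) *\<^sub>R A' (A f))"
proof (rule psd_contraction.intro)
  show "linear (\<lambda>f. (1 / c) *\<^sub>R A' (A f))"
    using linear_compose_scale_right[OF linear_compose[OF A], of "1 / c"] by (simp add: o_def)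
  show "inner ((1 / c) *\<^sub>R A' (A x)) y = inner x ((1 / c) *\<^sub>R A' (A y))" for x y
    by (simp flip: adj) (metis adj inner_commute)
  show "(norm ((1 / c) *\<^sub>R A' (A x)))\<^sup>2 \<le> inner ((1 / c) *\<^sub>R A' (A x)) x" for x
  proof -
    have "(norm ((1 / c) *\<^sub>R A' (A x)))\<^sup>2 = (1 / c)\<^sup>2 * (norm (A' (A x)))\<^sup>2"
      by (simp add: power_mult_distrib power_divide)
    also have "\<dots> \<le> (1 / c)\<^sup>2 * (c * (norm (A x))\<^sup>2)" by (intro mult_left_mono n) simp
    also have "\<dots> = (1 / c) * inner (A x) (A x)"
      using c by (simp add: power2_eq_square power2_norm_eq_inner field_simps flip: power2_norm_eq_inner)
    also have "\<dots> = inner ((1 / c) *\<^sub>R A' (A x)) x" by (simp add: adj inner_commute)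
    finally show ?thesis .
  qed
qed

lemma bounded_linear_sq_bound:
  assumes "bounded_linear A" "bounded_linear A'"
  obtains c where "0 < c" "\<And>f. (norm (A f))\<^sup>2 \<le> c * (norm f)\<^sup>2" "\<And>h. (norm (A' h))\<^sup>2 \<le> c * (norm h)\<^sup>2"
proof -
  obtain K where K: "0 < K" "\<And>f. norm (A f) \<le> norm f * K"
    using bounded_linear.pos_bounded[OF assms(1)] by blast
  obtain K' where K': "0 < K'" "\<And>f. norm (A' f) \<le> norm f * K'"
    using bounded_linear.pos_bounded[OF assms(2)] by blast
  have "(norm (A f))\<^sup>2 \<le> (K\<^sup>2 + K'\<^sup>2) * (norm f)\<^sup>2" for f
  proof -
    have "(norm (A f))\<^sup>2 \<le> (norm f * K)\<^sup>2" by (intro power_mono K) simp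
    also have "\<dots> \<le> (K\<^sup>2 + K'\<^sup>2) * (norm f)\<^sup>2" by (simp add: power_mult_distrib ring_distribs mult.commute)
    finally show ?thesis .
  qed
  moreover have "(norm (A' f))\<^sup>2 \<le> (K\<^sup>2 + K'\<^sup>2) * (norm f)\<^sup>2" for f
  proof -
    have "(norm (A' f))\<^sup>2 \<le> (norm f * K')\<^sup>2" by (intro power_mono K') simp
    also have "\<dots> \<le> (K\<^sup>2 + K'\<^sup>2) * (norm f)\<^sup>2" by (simp add: power_mult_distrib ring_distribs mult.commute)
    finally show ?thesis .
  qed
  ultimately show thesis using that[of "K\<^sup>2 + K'\<^sup>2"] K K' by (simp add: add_pos_pos)
qed

lemma intertwine_funpow:
  assumes "\<And>x. A (T x) = T' (A x)"
  shows "A ((T ^^ i) x) = (T' ^^ i) (A x)"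
  by (induction i) (auto simp: assms)

context group
begin

lemma eqop_gram:
  assumes "eqop \<alpha> \<beta> A A'" "free_gspace \<alpha>" "free_gspace \<beta>"
  shows "eqop \<alpha> \<alpha> (\<lambda>f. c *\<^sub>R A' (A f)) (\<lambda>f. c *\<^sub>R A' (A f))"
  by (rule eqop_scaleR[OF eqop_comp[OF assms(1) eqop_adjoint[OF assms(1)] assms(2,3)]])

text \<open>Monotonicity of the von Neumann dimension: \<open>A\<close> maps the range of \<open>P\<close> densely to the range of
  \<open>Q\<close>. With \<open>S = A\<^sup>* A / c\<close> and \<open>S' = A A\<^sup>* / c\<close>, the operators \<open>1 - (1 - S)\<^sup>k \<le> P\<close> and
  \<open>1 - (1 - S')\<^sup>k\<close> are \<open>C A\<close> and \<open>A C\<close> for some \<open>C\<close>, so they have the same trace, and the latter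
  increases to a projection \<open>\<ge> Q\<close>.\<close>

lemma trace_proj_le:
  assumes A: "eqop \<alpha> \<beta> A A'" and P: "eqop \<alpha> \<alpha> P P" and Q: "eqop \<beta> \<beta> Q Q"
    and PP: "\<And>f. P (P f) = P f" and QQ: "\<And>f. Q (Q f) = Q f"
    and AP: "\<And>f. A (P f) = A f" and QA: "\<And>f. Q (A f) = A f"
    and inj: "\<And>y. supp_on (snd \<beta>) y \<Longrightarrow> Q y = y \<Longrightarrow> A' y = 0 \<Longrightarrow> y = 0"
    and \<alpha>: "free_gspace \<alpha>" "transversal \<alpha> R" and \<beta>: "free_gspace \<beta>" "transversal \<beta> R'"
  shows "(\<Sum>y\<in>R'. coord (Q (delta y)) y) \<le> (\<Sum>x\<in>R. coord (P (delta x)) x)"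
proof -
  note A' = eqop_adjoint[OF A]
  obtain c where c: "0 < c" "\<And>f. (norm (A f))\<^sup>2 \<le> c * (norm f)\<^sup>2" "\<And>h. (norm (A' h))\<^sup>2 \<le> c * (norm h)\<^sup>2"
    using bounded_linear_sq_bound[OF eqopD(1,2)[OF A]] by blast
  define S where "S = (\<lambda>f. (1 / c) *\<^sub>R A' (A f))"
  define S' where "S' = (\<lambda>f. (1 / c) *\<^sub>R A (A' f))"
  interpret X: psd_contraction S
    unfolding S_def by (rule psd_contraction_gram[OF eqop_linear[OF A] eqopD(3)[OF A] c(1,3)])
  interpret Y: psd_contraction S'
    unfolding S'_def by (rule psd_contraction_gram[OF eqop_linear[OF A'] eqopD(3)[OF A'] c(1,2)])
  have S: "eqop \<alpha> \<alpha> S S" unfolding S_def by (rule eqop_gram[OF A \<alpha>(1) \<beta>(1)])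
  have S': "eqop \<beta> \<beta> S' S'" unfolding S'_def by (rule eqop_gram[OF A' \<beta>(1) \<alpha>(1)])
  have T: "eqop \<alpha> \<alpha> (X.T ^^ i) (X.T ^^ i)" for i
    using eqop_funpow[OF eqop_diff[OF eqop_id[OF \<alpha>(1)] S] \<alpha>(1), of i] by (simp add: X.T_def[abs_def])
  \<comment> \<open>\<open>A'\<close> followed by the geometric sum: this choice makes both products
    with \<open>A\<close> equal to \<open>1 - T^k\<close> on the respective side.\<close>
  define C where "C k f = (\<Sum>i<k. (X.T ^^ i) ((1 / c) *\<^sub>R A' f))" for k f
  have C: "eqop \<beta> \<alpha> (C k) (\<lambda>f. \<Sum>i<k. (1 / c) *\<^sub>R A ((X.T ^^ i) f))" for k
    unfolding C_def by (rule eqop_sum, rule eqop_comp[OF eqop_scaleR[OF A'] T \<beta>(1) \<alpha>(1)])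
  have CA: "C k (A f) = f - (X.T ^^ k) f" for k f
    unfolding C_def X.telescope[symmetric] by (simp add: S_def)
  have "A (X.T x) = Y.T (A x)" for x
    unfolding X.T_def Y.T_def linear_diff[OF eqop_linear(1)[OF A]]
    by (simp add: S_def S'_def linear_cmul[OF eqop_linear(1)[OF A]])
  then have AC: "A (C k f) = f - (Y.T ^^ k) f" for k f
    unfolding C_def Y.telescope[symmetric]
    by (simp add: linear_sum[OF eqop_linear(1)[OF A]] intertwine_funpow[of A X.T Y.T]
        S'_def linear_cmul[OF eqop_linear(1)[OF A]])
  have tr: "(\<Sum>y\<in>R'. inner (delta y - (Y.T ^^ k) (delta y)) (delta y))
      = (\<Sum>x\<in>R. inner (delta x - (X.T ^^ k) (delta x)) (delta x))" for k
    using trace_commute[OF A C \<alpha> \<beta>, of k] unfolding AC CA by simp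
  have norm_sq: "coord (P (delta x)) x = (norm (P (delta x)))\<^sup>2" if "eqop \<alpha> \<alpha> P P" "\<And>f. P (P f) = P f"
    for P x and \<alpha> :: "('a, 'z) gspace"
    using eqopD(3)[OF that(1), of "P (delta x)" "delta x"] that(2) by (simp add: power2_norm_eq_inner)
  have up: "(\<Sum>y\<in>R'. inner (delta y - (Y.T ^^ k) (delta y)) (delta y)) \<le> (\<Sum>x\<in>R. coord (P (delta x)) x)" for k
    unfolding tr norm_sq[OF P PP]
    by (intro sum_mono X.inner_one_minus_le eqopD(3)[OF P]) (simp add: S_def AP)
  have lim: "(\<lambda>k. \<Sum>y\<in>R'. inner (delta y - (Y.T ^^ k) (delta y)) (delta y))
      \<longlonglongrightarrow> (\<Sum>y\<in>R'. inner (delta y) (delta y) - (norm (Y.P (delta y)))\<^sup>2)"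
    unfolding inner_diff_left by (intro tendsto_intros Y.inner_T_pow_tendsto)
  \<comment> \<open>\<open>Y.P\<close> projects onto the kernel of \<open>A'\<close>. From
    \<open>Q A = A\<close> follows \<open>A' Q = A'\<close>, so this vector lies both in the range
    of \<open>Q\<close> and in that kernel, and \<open>inj\<close> applies. Hence \<open>Q\<close>
    is at most \<open>1 - Y.P\<close>.\<close>
  have QP: "Q (Y.P (delta y)) = 0" if "y \<in> R'" for y
  proof (rule inj)
    have dy: "supp_on (snd \<beta>) (delta y)"
      using that transversalD(2)[OF \<beta>(2)] by (auto simp: supp_on_def coord_delta)
    have YP: "eqop \<beta> \<beta> Y.P Y.P"
      unfolding Y.P_def by (rule eqop_kernel_proj[OF Y.psd_contraction_axioms S' \<beta>(1)])
    show "supp_on (snd \<beta>) (Q (Y.P (delta y)))"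
      by (rule eqop_supp_on[OF Q eqop_supp_on[OF YP dy]])
    show "Q (Q (Y.P (delta y))) = Q (Y.P (delta y))" by (rule QQ)
    let ?u = "Y.P (delta y)"
    have "inner (A' ?u) (A' ?u) = c * inner (S' ?u) ?u"
      using c(1) by (simp add: S'_def eqopD(3)[OF A])
    then have "A' ?u = 0" by simp
    moreover have "A' (Q ?u) = A' ?u"
      by (rule vector_eq_rdot[THEN iffD1]) (simp add: eqopD(3)[OF A'] eqopD(3)[OF Q] QA)
    ultimately show "A' (Q ?u) = 0" by simp
  qed
  have contr: "norm (Q f) \<le> norm f" for f
  proof -
    have "(norm (Q f))\<^sup>2 = inner f (Q f)"
      using eqopD(3)[OF Q, of f "Q f"] by (simp add: QQ power2_norm_eq_inner)
    also have "\<dots> \<le> norm f * norm (Q f)" by (rule norm_cauchy_schwarz)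
    finally show ?thesis by (cases "Q f = 0") (auto simp: power2_eq_square)
  qed
  have "(\<Sum>y\<in>R'. coord (Q (delta y)) y) \<le> (\<Sum>y\<in>R'. inner (delta y) (delta y) - (norm (Y.P (delta y)))\<^sup>2)"
  proof (rule sum_mono)
    fix y assume y: "y \<in> R'"
    let ?d = "delta y"
    have "Q (?d - Y.P ?d) = Q ?d" using QP[OF y] by (simp add: linear_diff[OF eqop_linear(1)[OF Q]])
    then have "coord (Q ?d) y = (norm (Q (?d - Y.P ?d)))\<^sup>2" by (simp add: norm_sq[OF Q QQ])
    also have "\<dots> \<le> (norm (?d - Y.P ?d))\<^sup>2" by (intro power_mono contr) simp
    also have "\<dots> = inner ?d ?d - (norm (Y.P ?d))\<^sup>2"
      using Y.sym_P[of "Y.P ?d" ?d]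
      by (simp add: power2_norm_eq_inner inner_diff_left inner_diff_right)
    finally show "coord (Q ?d) y \<le> inner ?d ?d - (norm (Y.P ?d))\<^sup>2" .
  qed
  also have "\<dots> \<le> (\<Sum>x\<in>R. coord (P (delta x)) x)"
    by (rule LIMSEQ_le_const2[OF lim]) (use up in blast)
  finally show ?thesis .
qed

text \<open>The closure of the range of \<open>F\<close> is the orthogonal complement of the kernel
  of \<open>F'\<close>, that is, of the kernel of \<open>F F'\<close>; so \<open>Q\<close> is 1
  minus the projection onto the latter. The \<open>z y k\<close> come from the geometric sum and
  show explicitly how the range approximates \<open>Q y\<close>, with control of supports.\<close>

lemma range_projection:
  assumes F: "eqop \<alpha> \<beta> F F'" and \<alpha>: "free_gspace \<alpha>" and \<beta>: "free_gspace \<beta>"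
  obtains Q z where "eqop \<beta> \<beta> Q Q" "\<And>f. Q (Q f) = Q f" "\<And>f. Q (F f) = F f"
    "\<And>y. (\<lambda>k. F (z y k)) \<longlonglongrightarrow> Q y" "\<And>y k. supp_on (snd \<beta>) y \<Longrightarrow> supp_on (snd \<alpha>) (z y k)"
proof -
  note F' = eqop_adjoint[OF F]
  obtain c where c: "0 < c" "\<And>f. (norm (F f))\<^sup>2 \<le> c * (norm f)\<^sup>2" "\<And>h. (norm (F' h))\<^sup>2 \<le> c * (norm h)\<^sup>2"
    using bounded_linear_sq_bound[OF eqopD(1,2)[OF F]] by blast
  define S where "S = (\<lambda>f. (1 / c) *\<^sub>R F (F' f))"
  interpret psd_contraction S
    unfolding S_def by (rule psd_contraction_gram[OF eqop_linear[OF F'] eqopD(3)[OF F'] c(1,2)])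
  have S: "eqop \<beta> \<beta> S S" unfolding S_def by (rule eqop_gram[OF F' \<beta> \<alpha>])
  have T: "eqop \<beta> \<beta> (T ^^ i) (T ^^ i)" for i
    using eqop_funpow[OF eqop_diff[OF eqop_id[OF \<beta>] S] \<beta>, of i] by (simp add: T_def[abs_def])
  have P: "eqop \<beta> \<beta> P P"
    unfolding P_def by (rule eqop_kernel_proj[OF psd_contraction_axioms S \<beta>])
  have F'P: "F' (P y) = 0" for y
  proof -
    have "inner (F' (P y)) (F' (P y)) = c * inner (S (P y)) (P y)"
      using c(1) by (simp add: S_def eqopD(3)[OF F])
    then show ?thesis by simp
  qed
  have PF: "P (F f) = 0" for f
  proof -
    have "inner (P (F f)) (P (F f)) = inner f (F' (P (P (F f))))"
      by (metis sym_P eqopD(3)[OF F])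
    then show ?thesis by (simp add: F'P)
  qed
  define Q where "Q y = y - P y" for y
  define z where "z y k = (\<Sum>i<k. (1 / c) *\<^sub>R F' ((T ^^ i) y))" for y k
  have "S (T x) = T (S x)" for x by (simp add: T_def linear_diff[OF lin])
  then have ST: "(T ^^ i) (S x) = S ((T ^^ i) x)" for i x
    by (induction i) auto
  have Fz: "F (z y k) = y - (T ^^ k) y" for y k
    unfolding telescope[symmetric] ST
    by (simp add: z_def S_def linear_sum[OF eqop_linear(1)[OF F]] linear_cmul[OF eqop_linear(1)[OF F]])
  show thesis
  proof (rule that[of Q z])
    show "eqop \<beta> \<beta> Q Q" unfolding Q_def[abs_def] by (rule eqop_diff[OF eqop_id[OF \<beta>] P])
    show "Q (Q f) = Q f" for f
      by (simp add: Q_def linear_diff[OF bounded_linear.linear[OF bounded_linear_P]])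
    show "Q (F f) = F f" for f by (simp add: Q_def PF)
    show "(\<lambda>k. F (z y k)) \<longlonglongrightarrow> Q y" for y
      unfolding Fz Q_def by (intro tendsto_intros T_pow_tendsto)
    show "supp_on (snd \<alpha>) (z y k)" if "supp_on (snd \<beta>) y" for y k
    proof -
      have "eqop \<beta> \<alpha> (\<lambda>f. \<Sum>i<k. (1 / c) *\<^sub>R F' ((T ^^ i) f)) (\<lambda>f. \<Sum>i<k. (T ^^ i) ((1 / c) *\<^sub>R F f))"
        using eqop_sum[of "{..<k}", OF eqop_comp[OF T eqop_scaleR[OF F', of "1 / c"] \<beta> \<beta>]] by simp
      from eqop_supp_on[OF this that] show ?thesis by (simp add: z_def)
    qed
  qed
qed

end

lemma sq_sum_mult_le: "(a * u + b * w)\<^sup>2 \<le> (a\<^sup>2 + b\<^sup>2) * (u\<^sup>2 + w\<^sup>2)" for a b u w :: real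
proof -
  have "(a * u + b * w)\<^sup>2 = (a\<^sup>2 + b\<^sup>2) * (u\<^sup>2 + w\<^sup>2) - (a * w - b * u)\<^sup>2"
    by (simp add: power2_eq_square algebra_simps)
  then show ?thesis by simp
qed

text \<open>The quadratic form is \<open>(|B1 f|^2 + |B2' f|^2) / K\<close>, whence the kernel. For
  the contraction condition the two summands of the Laplacian are combined by Cauchy-Schwarz in the
  plane, so \<open>c1 + c2 \<le> K\<close> is enough.\<close>

lemma psd_contraction_laplacian:
  fixes B1 :: "'h::{real_inner,banach} \<Rightarrow> 'k::real_inner" and B2 :: "'l::real_inner \<Rightarrow> 'h"
  assumes B1: "linear B1" "linear B1'" "\<And>f h. inner (B1 f) h = inner f (B1' h)"
    and B2: "linear B2" "linear B2'" "\<And>f h. inner (B2 f) h = inner f (B2' h)"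
    and n1: "\<And>h. norm (B1' h) \<le> sqrt c1 * norm h" and n2: "\<And>h. norm (B2 h) \<le> sqrt c2 * norm h"
    and c: "0 \<le> c1" "0 \<le> c2" "c1 + c2 \<le> K" "0 < K"
  shows "psd_contraction (\<lambda>f. (1 / K) *\<^sub>R (B1' (B1 f) + B2 (B2' f)))"
    and "(1 / K) *\<^sub>R (B1' (B1 f) + B2 (B2' f)) = 0 \<longleftrightarrow> B1 f = 0 \<and> B2' f = 0"
proof -
  have form: "inner ((1 / K) *\<^sub>R (B1' (B1 f) + B2 (B2' f))) h
    = (1 / K) * (inner (B1 f) (B1 h) + inner (B2' f) (B2' h))" for f h
  proof -
    have "inner (B1' (B1 f)) h = inner (B1 f) (B1 h)" by (metis B1(3) inner_commute)
    then show ?thesis by (simp add: inner_add_left B2(3))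
  qed
  show "psd_contraction (\<lambda>f. (1 / K) *\<^sub>R (B1' (B1 f) + B2 (B2' f)))"
  proof (rule psd_contraction.intro)
    show "linear (\<lambda>f. (1 / K) *\<^sub>R (B1' (B1 f) + B2 (B2' f)))"
      using linear_compose_scale_right[OF linear_compose_add[OF linear_compose[OF B1(1,2)] linear_compose[OF B2(2,1)]], of "1 / K"]
      by (simp add: o_def)
    show "inner ((1 / K) *\<^sub>R (B1' (B1 f) + B2 (B2' f))) h = inner f ((1 / K) *\<^sub>R (B1' (B1 h) + B2 (B2' h)))" for f h
      unfolding inner_commute[of f] form by (simp add: inner_commute)
    fix f
    let ?u = "norm (B1 f)" and ?w = "norm (B2' f)"
    have "norm (B1' (B1 f) + B2 (B2' f)) \<le> sqrt c1 * ?u + sqrt c2 * ?w"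
      by (rule order_trans[OF norm_triangle_ineq add_mono[OF n1 n2]])
    then have "(norm (B1' (B1 f) + B2 (B2' f)))\<^sup>2 \<le> (sqrt c1 * ?u + sqrt c2 * ?w)\<^sup>2"
      by (intro power_mono) auto
    also have "\<dots> \<le> ((sqrt c1)\<^sup>2 + (sqrt c2)\<^sup>2) * (?u\<^sup>2 + ?w\<^sup>2)"
      by (rule sq_sum_mult_le)
    also have "\<dots> \<le> K * (?u\<^sup>2 + ?w\<^sup>2)" using c by (intro mult_right_mono) auto
    finally have *: "(norm (B1' (B1 f) + B2 (B2' f)))\<^sup>2 \<le> K * (?u\<^sup>2 + ?w\<^sup>2)" .
    have "(norm ((1 / K) *\<^sub>R (B1' (B1 f) + B2 (B2' f))))\<^sup>2 = (1 / K)\<^sup>2 * (norm (B1' (B1 f) + B2 (B2' f)))\<^sup>2"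
      by (simp add: power_mult_distrib power_divide)
    also have "\<dots> \<le> (1 / K)\<^sup>2 * (K * (?u\<^sup>2 + ?w\<^sup>2))" by (intro mult_left_mono *) simp
    also have "\<dots> = (1 / K) * (?u\<^sup>2 + ?w\<^sup>2)" using c(4) by (simp add: power2_eq_square)
    finally show "(norm ((1 / K) *\<^sub>R (B1' (B1 f) + B2 (B2' f))))\<^sup>2 \<le> inner ((1 / K) *\<^sub>R (B1' (B1 f) + B2 (B2' f))) f"
      unfolding form power2_norm_eq_inner[of "B1 f", symmetric] power2_norm_eq_inner[of "B2' f", symmetric] .
  qed
  show "(1 / K) *\<^sub>R (B1' (B1 f) + B2 (B2' f)) = 0 \<longleftrightarrow> B1 f = 0 \<and> B2' f = 0"
  proof
    assume "(1 / K) *\<^sub>R (B1' (B1 f) + B2 (B2' f)) = 0"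
    with form[of f f] have "(1 / K) * (inner (B1 f) (B1 f) + inner (B2' f) (B2' f)) = 0"
      by (metis inner_zero_left)
    then have "inner (B1 f) (B1 f) + inner (B2' f) (B2' f) = 0" using c(4) by simp
    then show "B1 f = 0 \<and> B2' f = 0"
      by (metis add_nonneg_eq_0_iff inner_eq_zero_iff inner_ge_zero)
  next
    assume "B1 f = 0 \<and> B2' f = 0"
    then show "(1 / K) *\<^sub>R (B1' (B1 f) + B2 (B2' f)) = 0"
      by (simp add: linear_0[OF B1(2)] linear_0[OF B2(1)])
  qed
qed

section \<open>Equivariant kernels and orbit representatives\<close>

context group
begin

text \<open>Finiteness is asked of rows only; for columns it follows from equivariance when there
  are finitely many orbits.\<close>

definition eqker :: "('a, 'x) gspace \<Rightarrow> ('a, 'y) gspace \<Rightarrow> ('x \<Rightarrow> 'y \<Rightarrow> real) \<Rightarrow> bool" where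
  "eqker \<alpha> \<beta> k \<longleftrightarrow> (\<forall>x y. k x y \<noteq> 0 \<longrightarrow> x \<in> snd \<alpha> \<and> y \<in> snd \<beta>) \<and> (\<forall>x. finite {y. k x y \<noteq> 0}) \<and>
     (\<forall>g\<in>carrier G. \<forall>x\<in>snd \<alpha>. \<forall>y\<in>snd \<beta>. k (fst \<alpha> g x) (fst \<beta> g y) = k x y)"

lemma eqkerD:
  assumes "eqker \<alpha> \<beta> k"
  shows "k x y \<noteq> 0 \<Longrightarrow> x \<in> snd \<alpha>" "k x y \<noteq> 0 \<Longrightarrow> y \<in> snd \<beta>" "finite {y. k x y \<noteq> 0}"
    "g \<in> carrier G \<Longrightarrow> x \<in> snd \<alpha> \<Longrightarrow> y \<in> snd \<beta> \<Longrightarrow> k (fst \<alpha> g x) (fst \<beta> g y) = k x y"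
  using assms unfolding eqker_def by blast+

lemma eqker_shift:
  assumes "eqker \<alpha> \<beta> k" "free_gspace \<alpha>" "free_gspace \<beta>" "g \<in> carrier G" "x \<in> snd \<alpha>" "y \<in> snd \<beta>"
  shows "k (fst \<alpha> g x) y = k x (fst \<beta> (inv g) y)"
  using eqkerD(4)[OF assms(1,4,5), of "fst \<beta> (inv g) y"] assms by (simp add: free_gspaceD)

text \<open>The points \<open>inv g\<close> applied to \<open>y\<close> lie in the finite row of
  \<open>x\<close>, and freeness recovers \<open>g\<close> from them.\<close>

lemma eqker_finite_stab:
  assumes k: "eqker \<alpha> \<beta> k" and f: "free_gspace \<alpha>" "free_gspace \<beta>" and x: "x \<in> snd \<alpha>" and y: "y \<in> snd \<beta>"
  shows "finite {g \<in> carrier G. k (fst \<alpha> g x) y \<noteq> 0}"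
proof (rule finite_imageD)
  show "finite ((\<lambda>g. fst \<beta> (inv g) y) ` {g \<in> carrier G. k (fst \<alpha> g x) y \<noteq> 0})"
    by (rule finite_subset[OF _ eqkerD(3)[OF k, of x]]) (use eqker_shift[OF k f _ x y] in auto)
  show "inj_on (\<lambda>g. fst \<beta> (inv g) y) {g \<in> carrier G. k (fst \<alpha> g x) y \<noteq> 0}"
    by (rule inj_onI) (use gspace_inj[OF f(2) y] in \<open>metis (no_types, lifting) inv_closed inv_inv mem_Collect_eq\<close>)
qed

lemma eqker_finite_col:
  assumes k: "eqker \<alpha> \<beta> k" and f: "free_gspace \<alpha>" "free_gspace \<beta>" and t: "transversal \<alpha> R"
  shows "finite {x. k x y \<noteq> 0}"
proof (cases "y \<in> snd \<beta>")
  case True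
  have "{x. k x y \<noteq> 0} \<subseteq> (\<Union>\<rho>\<in>R. (\<lambda>g. fst \<alpha> g \<rho>) ` {g \<in> carrier G. k (fst \<alpha> g \<rho>) y \<noteq> 0})"
  proof
    fix x assume x: "x \<in> {x. k x y \<noteq> 0}"
    then have "x \<in> snd \<alpha>" using eqkerD(1)[OF k] by blast
    then obtain g \<rho> where "g \<in> carrier G" "\<rho> \<in> R" "x = fst \<alpha> g \<rho>" by (rule transversal_cover[OF t])
    then show "x \<in> (\<Union>\<rho>\<in>R. (\<lambda>g. fst \<alpha> g \<rho>) ` {g \<in> carrier G. k (fst \<alpha> g \<rho>) y \<noteq> 0})" using x by auto
  qed
  moreover have "finite (\<Union>\<rho>\<in>R. (\<lambda>g. fst \<alpha> g \<rho>) ` {g \<in> carrier G. k (fst \<alpha> g \<rho>) y \<noteq> 0})"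
    using transversalD(1,2)[OF t] eqker_finite_stab[OF k f _ True] by auto
  ultimately show ?thesis by (rule finite_subset)
next
  case False
  then have "{x. k x y \<noteq> 0} = {}" using eqkerD(2)[OF k] by blast
  then show ?thesis by simp
qed

lemma eqker_transp:
  assumes k: "eqker \<alpha> \<beta> k" and f: "free_gspace \<alpha>" "free_gspace \<beta>" and t: "transversal \<alpha> R"
  shows "eqker \<beta> \<alpha> (ktransp k)"
  unfolding eqker_def ktransp_def using eqker_finite_col[OF k f t] eqkerD[OF k] by blast

text \<open>Row sums are constant along orbits, so finitely many representatives bound them
  all.\<close>

lemma eqker_row_sum:
  assumes k: "eqker \<alpha> \<beta> k" and f: "free_gspace \<alpha>" "free_gspace \<beta>" and t: "transversal \<alpha> R"
  shows "(\<Sum>y | k x y \<noteq> 0. \<bar>k x y\<bar>) \<le> (\<Sum>\<rho>\<in>R. \<Sum>y | k \<rho> y \<noteq> 0. \<bar>k \<rho> y\<bar>)"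
proof (cases "x \<in> snd \<alpha>")
  case True
  then obtain g \<rho> where g: "g \<in> carrier G" "\<rho> \<in> R" "x = fst \<alpha> g \<rho>" by (rule transversal_cover[OF t])
  then have \<rho>: "\<rho> \<in> snd \<alpha>" using transversalD(2)[OF t] by auto
  have "(\<Sum>y | k x y \<noteq> 0. \<bar>k x y\<bar>) = (\<Sum>y | k \<rho> y \<noteq> 0. \<bar>k \<rho> y\<bar>)"
  proof (rule sum.reindex_bij_witness[where i = "fst \<beta> g" and j = "fst \<beta> (inv g)"])
    fix y assume "y \<in> {y. k x y \<noteq> 0}"
    then have y: "y \<in> snd \<beta>" "k x y \<noteq> 0" using eqkerD(2)[OF k] by auto
    then show "fst \<beta> g (fst \<beta> (inv g) y) = y" "fst \<beta> (inv g) y \<in> {y. k \<rho> y \<noteq> 0}"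
      "\<bar>k \<rho> (fst \<beta> (inv g) y)\<bar> = \<bar>k x y\<bar>"
      using eqker_shift[OF k f g(1) \<rho> y(1)] f g by auto
  next
    fix y assume "y \<in> {y. k \<rho> y \<noteq> 0}"
    then have y: "y \<in> snd \<beta>" "k \<rho> y \<noteq> 0" using eqkerD(2)[OF k] by auto
    then show "fst \<beta> (inv g) (fst \<beta> g y) = y" "fst \<beta> g y \<in> {y. k x y \<noteq> 0}"
      using eqkerD(4)[OF k g(1) \<rho> y(1)] f g by auto
  qed
  also have "\<dots> \<le> (\<Sum>\<rho>\<in>R. \<Sum>y | k \<rho> y \<noteq> 0. \<bar>k \<rho> y\<bar>)"
    by (rule member_le_sum[OF g(2)]) (use transversalD(1)[OF t] in \<open>auto intro: sum_nonneg\<close>)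
  finally show ?thesis .
next
  case False
  then have "{y. k x y \<noteq> 0} = {}" using eqkerD(1)[OF k] by blast
  then show ?thesis by (auto intro!: sum_nonneg)
qed

text \<open>Cocompactness makes sparse equivariant kernels satisfy Schur's test; the boundary and
  comparison operators upstairs are bounded for this reason.\<close>

lemma eqker_bker:
  assumes k: "eqker \<alpha> \<beta> k" and f: "free_gspace \<alpha>" "free_gspace \<beta>" and t: "transversal \<alpha> R" "transversal \<beta> R'"
  obtains C C' where "bker k C C'"
proof -
  have "bker k (\<Sum>\<rho>\<in>R. \<Sum>y | k \<rho> y \<noteq> 0. \<bar>k \<rho> y\<bar>) (\<Sum>\<rho>\<in>R'. \<Sum>y | ktransp k \<rho> y \<noteq> 0. \<bar>ktransp k \<rho> y\<bar>)"
    unfolding bker_def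
    using eqker_row_sum[OF k f t(1)] eqkerD(3)[OF k] eqker_finite_col[OF k f t(1)]
      eqker_row_sum[OF eqker_transp[OF k f t(1)] f(2,1) t(2)]
    by (auto simp: ktransp_def)
  then show thesis by (rule that)
qed

lemma eqop_kop:
  assumes k: "eqker \<alpha> \<beta> k" and b: "bker k C C'"
  shows "eqop \<alpha> \<beta> (kop k) (kop (ktransp k))"
  unfolding eqop_def
  using eqkerD(1,2,4)[OF k]
  by (auto simp: bounded_linear_kop[OF b] bounded_linear_kop[OF bker_transp[OF b]]
      kop_adjoint[OF b] coord_kop_delta[OF b])

text \<open>The representatives picked by \<open>vn_dim\<close>, so that its sum is literally a sum
  over this set.\<close>

definition orbit_reps :: "('a, 'x) gspace \<Rightarrow> 'x set" where
  "orbit_reps \<alpha> = (\<lambda>Q. SOME x. x \<in> Q) ` orbits G (snd \<alpha>) (fst \<alpha>)"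

lemma orbit_eq_iff:
  assumes f: "free_gspace \<alpha>" and x: "x \<in> snd \<alpha>" and y: "y \<in> snd \<alpha>"
  shows "orbit G (fst \<alpha>) x = orbit G (fst \<alpha>) y \<longleftrightarrow> (\<exists>g\<in>carrier G. y = fst \<alpha> g x)"
proof
  assume "orbit G (fst \<alpha>) x = orbit G (fst \<alpha>) y"
  moreover have "y \<in> orbit G (fst \<alpha>) y"
    unfolding orbit_def using free_gspaceD(2)[OF f y] one_closed by (metis (mono_tags, lifting) mem_Collect_eq)
  ultimately show "\<exists>g\<in>carrier G. y = fst \<alpha> g x" unfolding orbit_def by auto
next
  assume "\<exists>g\<in>carrier G. y = fst \<alpha> g x"
  then obtain g where g: "g \<in> carrier G" "y = fst \<alpha> g x" by blast
  have "fst \<alpha> h y = fst \<alpha> (h \<otimes> g) x" "fst \<alpha> h x = fst \<alpha> (h \<otimes> inv g) y" if "h \<in> carrier G" for h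
    using that g f x by (auto simp: free_gspaceD)
  then show "orbit G (fst \<alpha>) x = orbit G (fst \<alpha>) y"
    unfolding orbit_def using g(1) by (smt (verit) Collect_cong inv_closed m_closed)
qed

lemma some_in_orbit:
  assumes f: "free_gspace \<alpha>" and Q: "Q \<in> orbits G (snd \<alpha>) (fst \<alpha>)"
  shows "(SOME x. x \<in> Q) \<in> Q" "(SOME x. x \<in> Q) \<in> snd \<alpha>" "orbit G (fst \<alpha>) (SOME x. x \<in> Q) = Q"
proof -
  obtain x where x: "x \<in> snd \<alpha>" "Q = orbit G (fst \<alpha>) x" using Q unfolding orbits_def by blast
  have "x \<in> Q" unfolding x(2) orbit_def using free_gspaceD(2)[OF f x(1)] one_closed by (metis (mono_tags, lifting) mem_Collect_eq)
  then show *: "(SOME x. x \<in> Q) \<in> Q" by (rule someI)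
  then obtain g where g: "g \<in> carrier G" "(SOME x. x \<in> Q) = fst \<alpha> g x" unfolding x(2) orbit_def by blast
  show s: "(SOME x. x \<in> Q) \<in> snd \<alpha>" unfolding g(2) by (rule free_gspaceD(1)[OF f x(1) g(1)])
  show "orbit G (fst \<alpha>) (SOME x. x \<in> Q) = Q"
    unfolding x(2) using orbit_eq_iff[OF f x(1) s] g x(2) by metis
qed

lemma transversal_orbit_reps:
  assumes f: "free_gspace \<alpha>" and fin: "finite (orbits G (snd \<alpha>) (fst \<alpha>))"
  shows "transversal \<alpha> (orbit_reps \<alpha>)"
  unfolding transversal_def
proof (intro conjI)
  show "finite (orbit_reps \<alpha>)" unfolding orbit_reps_def using fin by simp
  show sub: "orbit_reps \<alpha> \<subseteq> snd \<alpha>" unfolding orbit_reps_def using some_in_orbit[OF f] by auto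
  show "bij_betw (\<lambda>(g, x). fst \<alpha> g x) (carrier G \<times> orbit_reps \<alpha>) (snd \<alpha>)"
    unfolding bij_betw_def
  proof
    show "inj_on (\<lambda>(g, x). fst \<alpha> g x) (carrier G \<times> orbit_reps \<alpha>)"
    proof (rule inj_onI, clarsimp)
      fix g x h y assume *: "g \<in> carrier G" "h \<in> carrier G" "x \<in> orbit_reps \<alpha>" "y \<in> orbit_reps \<alpha>"
        "fst \<alpha> g x = fst \<alpha> h y"
      then have xy: "x \<in> snd \<alpha>" "y \<in> snd \<alpha>" using sub by auto
      have "orbit G (fst \<alpha>) x = orbit G (fst \<alpha>) (fst \<alpha> g x)" "orbit G (fst \<alpha>) y = orbit G (fst \<alpha>) (fst \<alpha> h y)"
        using orbit_eq_iff[OF f] free_gspaceD(1)[OF f] xy * by metis+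
      then have "orbit G (fst \<alpha>) x = orbit G (fst \<alpha>) y" using * by simp
      then have "x = y" using *(3,4) some_in_orbit(3)[OF f] unfolding orbit_reps_def by auto
      then show "g = h \<and> x = y" using gspace_inj[OF f xy(1) *(1,2)] * by simp
    qed
    show "(\<lambda>(g, x). fst \<alpha> g x) ` (carrier G \<times> orbit_reps \<alpha>) = snd \<alpha>"
    proof
      show "(\<lambda>(g, x). fst \<alpha> g x) ` (carrier G \<times> orbit_reps \<alpha>) \<subseteq> snd \<alpha>"
        using sub free_gspaceD(1)[OF f] by auto
      show "snd \<alpha> \<subseteq> (\<lambda>(g, x). fst \<alpha> g x) ` (carrier G \<times> orbit_reps \<alpha>)"
      proof
        fix x assume x: "x \<in> snd \<alpha>"
        then have Q: "orbit G (fst \<alpha>) x \<in> orbits G (snd \<alpha>) (fst \<alpha>)" unfolding orbits_def by blast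
        let ?r = "SOME y. y \<in> orbit G (fst \<alpha>) x"
        have "?r \<in> orbit_reps \<alpha>" using Q unfolding orbit_reps_def by blast
        moreover obtain g where "g \<in> carrier G" "x = fst \<alpha> g ?r"
          using orbit_eq_iff[OF f some_in_orbit(2)[OF f Q] x] some_in_orbit(3)[OF f Q] by auto
        ultimately show "x \<in> (\<lambda>(g, x). fst \<alpha> g x) ` (carrier G \<times> orbit_reps \<alpha>)" by force
      qed
    qed
  qed
qed

lemma sum_orbits_eq_sum_reps:
  assumes f: "free_gspace \<alpha>"
  shows "(\<Sum>Q\<in>orbits G (snd \<alpha>) (fst \<alpha>). h (SOME x. x \<in> Q)) = sum h (orbit_reps \<alpha>)"
proof -
  have "inj_on (\<lambda>Q. SOME x. x \<in> Q) (orbits G (snd \<alpha>) (fst \<alpha>))"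
    by (rule inj_onI) (metis some_in_orbit(3)[OF f])
  then show ?thesis by (simp add: orbit_reps_def sum.reindex)
qed

end

section \<open>Complex square summable functions\<close>

definition cplx :: "'x ell2 \<Rightarrow> 'x ell2 \<Rightarrow> 'x \<Rightarrow> complex" where
  "cplx u v = (\<lambda>x. Complex (coord u x) (coord v x))"

lemma cplx_eq_iff: "cplx u v = cplx u' v' \<longleftrightarrow> u = u' \<and> v = v'"
  by (auto simp: cplx_def fun_eq_iff intro: ell2_eqI)

lemma cplx_diff: "(\<lambda>x. cplx u v x - cplx u' v' x) = cplx (u - u') (v - v')"
  by (auto simp: cplx_def complex_eq_iff)

lemma cplx_delta: "l2_delta x = cplx (delta x) 0"
  by (auto simp: cplx_def l2_delta_def coord_delta complex_eq_iff)

context group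
begin

lemma cplx_in_l2:
  assumes "supp_on X u" "supp_on X v"
  shows "cplx u v \<in> l2 X"
proof -
  have "(\<lambda>x. (coord u x)\<^sup>2 + (coord v x)\<^sup>2) summable_on UNIV"
    by (intro summable_on_add sq_summable_coord)
  then show ?thesis using assms
    by (simp add: l2_def cplx_def cmod_power2 supp_on_def complex_eq_iff)
qed

lemma l2_cplxE:
  assumes "f \<in> l2 X"
  obtains u v where "supp_on X u" "supp_on X v" "f = cplx u v"
proof -
  have s: "(\<lambda>x. (Re (f x))\<^sup>2 + (Im (f x))\<^sup>2) summable_on UNIV" and z: "\<And>x. x \<notin> X \<Longrightarrow> f x = 0"
    using assms by (auto simp: l2_def cmod_power2)
  have r: "(\<lambda>x. (Re (f x))\<^sup>2) summable_on UNIV" and i: "(\<lambda>x. (Im (f x))\<^sup>2) summable_on UNIV"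
    by (rule summable_on_comparison_test[OF s]; simp)+
  show thesis
    by (rule that[of "Abs_ell2 (\<lambda>x. Re (f x))" "Abs_ell2 (\<lambda>x. Im (f x))"])
      (use r i z in \<open>auto simp: supp_on_def cplx_def Abs_ell2_inverse\<close>)
qed

lemma l2_inner_cplx:
  "l2_inner (cplx u v) (cplx u' v') = Complex (inner u u' + inner v v') (inner v u' - inner u v')"
proof -
  have h: "((\<lambda>x. coord a x * coord b x) has_sum inner a b) UNIV" for a b :: "'x ell2"
    unfolding inner_coord by (rule has_sum_infsum[OF summable_coord_mult])
  have "((\<lambda>x. of_real (coord u x * coord u' x + coord v x * coord v' x)
      + \<i> * of_real (coord v x * coord u' x + - (coord u x * coord v' x)))
    has_sum (of_real (inner u u' + inner v v') + \<i> * of_real (inner v u' + - inner u v'))) UNIV"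
    by (intro has_sum_add has_sum_cmult_right has_sum_of_real has_sum_uminusI h)
  moreover have "(\<lambda>x. of_real (coord u x * coord u' x + coord v x * coord v' x)
      + \<i> * of_real (coord v x * coord u' x + - (coord u x * coord v' x)))
    = (\<lambda>x. cplx u v x * cnj (cplx u' v' x))"
    by (auto simp: cplx_def complex_eq_iff)
  ultimately show ?thesis unfolding l2_inner_def
    by (simp add: infsumI complex_eq_iff)
qed

lemma l2_norm_cplx: "l2_norm (cplx u v) = sqrt ((norm u)\<^sup>2 + (norm v)\<^sup>2)"
  unfolding l2_norm_def norm_sq_coord
  by (simp add: cplx_def cmod_power2 infsum_add[OF sq_summable_coord sq_summable_coord])

text \<open>All operators below are real, so the closed subspaces of \<open>l2 X\<close> that occur are complexifications
  of ranges of real projections.\<close>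

definition cspace :: "'x set \<Rightarrow> ('x ell2 \<Rightarrow> 'x ell2) \<Rightarrow> ('x \<Rightarrow> complex) set" where
  "cspace X P = {cplx u v | u v. supp_on X u \<and> supp_on X v \<and> P u = u \<and> P v = v}"

lemma supp_on_diff: "supp_on X u \<Longrightarrow> supp_on X v \<Longrightarrow> supp_on X (u - v)"
  and supp_on_zero: "supp_on X 0"
  and supp_on_mono: "supp_on X u \<Longrightarrow> X \<subseteq> Y \<Longrightarrow> supp_on Y u"
  by (auto simp: supp_on_def)

lemma supp_on_delta: "x \<in> X \<Longrightarrow> supp_on X (delta x)"
  by (auto simp: supp_on_def coord_delta)

text \<open>Here the definite description in \<open>l2_proj\<close> is resolved. Existence holds as
  \<open>P\<close> is symmetric and idempotent; a second candidate differs from the first by an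
  element of the subspace that is orthogonal to itself.\<close>

lemma l2_proj_cspace:
  assumes P: "eqop \<alpha> \<alpha> P P" and PP: "\<And>f. P (P f) = P f"
    and u: "supp_on (snd \<alpha>) u" and v: "supp_on (snd \<alpha>) v"
  shows "l2_proj (cspace (snd \<alpha>) P) (cplx u v) = cplx (P u) (P v)"
  unfolding l2_proj_def
proof (rule the_equality)
  have orth: "inner (f - P f) w = 0" if "P w = w" for f w
    using eqopD(3)[OF P, of f w] that by (simp add: inner_diff_left)
  show "cplx (P u) (P v) \<in> cspace (snd \<alpha>) P \<and>
      (\<forall>w\<in>cspace (snd \<alpha>) P. l2_inner (\<lambda>x. cplx u v x - cplx (P u) (P v) x) w = 0)"
  proof
    show "cplx (P u) (P v) \<in> cspace (snd \<alpha>) P"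
      unfolding cspace_def using eqop_supp_on[OF P] u v PP by blast
    show "\<forall>w\<in>cspace (snd \<alpha>) P. l2_inner (\<lambda>x. cplx u v x - cplx (P u) (P v) x) w = 0"
      unfolding cplx_diff cspace_def by (auto simp: l2_inner_cplx orth complex_eq_iff)
  qed
  fix z assume z: "z \<in> cspace (snd \<alpha>) P \<and> (\<forall>w\<in>cspace (snd \<alpha>) P. l2_inner (\<lambda>x. cplx u v x - z x) w = 0)"
  then obtain a b where ab: "supp_on (snd \<alpha>) a" "supp_on (snd \<alpha>) b" "P a = a" "P b = b" "z = cplx a b"
    unfolding cspace_def by blast
  have PL: "P (x - y) = P x - P y" for x y by (rule linear_diff[OF eqop_linear(1)[OF P]])
  have "cplx (a - P u) (b - P v) \<in> cspace (snd \<alpha>) P"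
  proof -
    have "supp_on (snd \<alpha>) (a - P u)" "supp_on (snd \<alpha>) (b - P v)"
      by (rule supp_on_diff[OF ab(1) eqop_supp_on[OF P u]], rule supp_on_diff[OF ab(2) eqop_supp_on[OF P v]])
    moreover have "P (a - P u) = a - P u" "P (b - P v) = b - P v" by (simp_all add: PL PP ab)
    ultimately show ?thesis unfolding cspace_def by blast
  qed
  then have "l2_inner (cplx (u - a) (v - b)) (cplx (a - P u) (b - P v)) = 0"
    using z unfolding ab(5) cplx_diff by blast
  then have "inner (u - a) (a - P u) + inner (v - b) (b - P v) = 0"
    by (simp add: l2_inner_cplx complex_eq_iff)
  moreover have "inner (u - P u) (a - P u) = 0" "inner (v - P v) (b - P v) = 0"
    by (rule orth, simp add: PL PP ab)+
  ultimately have "inner (a - P u) (a - P u) + inner (b - P v) (b - P v) = 0"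
    by (simp add: inner_diff_left inner_diff_right)
  then have "inner (a - P u) (a - P u) = 0 \<and> inner (b - P v) (b - P v) = 0"
    by (metis add_nonneg_eq_0_iff inner_ge_zero)
  then show "z = cplx (P u) (P v)" by (simp add: ab(5))
qed

lemma vn_dim_cspace:
  assumes P: "eqop \<alpha> \<alpha> P P" and PP: "\<And>f. P (P f) = P f" and f: "free_gspace \<alpha>"
  shows "vn_dim G (fst \<alpha>) (snd \<alpha>) (cspace (snd \<alpha>) P) = (\<Sum>x\<in>orbit_reps \<alpha>. coord (P (delta x)) x)"
proof -
  have "vn_dim G (fst \<alpha>) (snd \<alpha>) (cspace (snd \<alpha>) P)
    = (\<Sum>x\<in>orbit_reps \<alpha>. Re (l2_inner (l2_proj (cspace (snd \<alpha>) P) (l2_delta x)) (l2_delta x)))"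
    unfolding vn_dim_def Let_def by (rule sum_orbits_eq_sum_reps[OF f])
  also have "\<dots> = (\<Sum>x\<in>orbit_reps \<alpha>. coord (P (delta x)) x)"
  proof (rule sum.cong)
    fix x assume "x \<in> orbit_reps \<alpha>"
    then have "x \<in> snd \<alpha>" using some_in_orbit(2)[OF f] unfolding orbit_reps_def by auto
    then show "Re (l2_inner (l2_proj (cspace (snd \<alpha>) P) (l2_delta x)) (l2_delta x)) = coord (P (delta x)) x"
      by (simp add: cplx_delta l2_proj_cspace[OF P PP] supp_on_delta supp_on_zero l2_inner_cplx
          linear_0[OF eqop_linear(1)[OF P]])
  qed simp
  finally show ?thesis .
qed

text \<open>Pythagoras, as \<open>u - P u\<close> is orthogonal to the range of
  \<open>P\<close>.\<close>

lemma proj_residual_le: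
  assumes P: "eqop \<alpha> \<alpha> P P" and PP: "\<And>f. P (P f) = P f" and w: "P w = w"
  shows "norm (u - P u) \<le> norm (u - w)"
proof (rule power2_le_imp_le)
  have "inner (u - P u) (P u - w) = 0"
    using eqopD(3)[OF P, of u "P u - w"] w linear_diff[OF eqop_linear(1)[OF P], of "P u" w]
    by (simp add: inner_diff_left PP)
  then have "(norm (u - w))\<^sup>2 = (norm (u - P u))\<^sup>2 + (norm (P u - w))\<^sup>2"
    by (simp add: power2_norm_eq_inner inner_diff_left inner_diff_right inner_commute)
  then show "(norm (u - P u))\<^sup>2 \<le> (norm (u - w))\<^sup>2" by simp
qed simp

text \<open>A limit of points of the range of \<open>F\<close> is fixed by \<open>Q\<close>, since
  \<open>Q u\<close> is at least as near to \<open>u\<close> as any of them; conversely the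
  approximants \<open>z\<close> present each vector fixed by \<open>Q\<close> as such a
  limit.\<close>

lemma l2_closure_range:
  assumes Q: "eqop \<beta> \<beta> Q Q" and QQ: "\<And>f. Q (Q f) = Q f" and QF: "\<And>f. Q (F f) = F f"
    and lim: "\<And>y. (\<lambda>k. F (z y k)) \<longlonglongrightarrow> Q y" and zX: "\<And>y k. supp_on (snd \<beta>) y \<Longrightarrow> supp_on X (z y k)"
  shows "l2_closure (snd \<beta>) {cplx (F a) (F b) | a b. supp_on X a \<and> supp_on X b} = cspace (snd \<beta>) Q"
proof
  show "l2_closure (snd \<beta>) {cplx (F a) (F b) | a b. supp_on X a \<and> supp_on X b} \<subseteq> cspace (snd \<beta>) Q"
  proof
    fix f assume f: "f \<in> l2_closure (snd \<beta>) {cplx (F a) (F b) | a b. supp_on X a \<and> supp_on X b}"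
    then obtain u v where uv: "supp_on (snd \<beta>) u" "supp_on (snd \<beta>) v" "f = cplx u v"
      unfolding l2_closure_def by (auto elim: l2_cplxE)
    have small: "norm (u - Q u) < e \<and> norm (v - Q v) < e" if e: "0 < e" for e
    proof -
      obtain a b where "l2_norm (\<lambda>x. f x - cplx (F a) (F b) x) < e"
        using f e unfolding l2_closure_def by blast
      then have lt: "sqrt ((norm (u - F a))\<^sup>2 + (norm (v - F b))\<^sup>2) < e"
        unfolding uv(3) cplx_diff l2_norm_cplx .
      have "norm (u - F a) \<le> sqrt ((norm (u - F a))\<^sup>2 + (norm (v - F b))\<^sup>2)"
        "norm (v - F b) \<le> sqrt ((norm (u - F a))\<^sup>2 + (norm (v - F b))\<^sup>2)"
        by (rule real_le_rsqrt; simp)+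
      then show ?thesis
        using lt proj_residual_le[OF Q QQ QF, of u a] proj_residual_le[OF Q QQ QF, of v b] by linarith
    qed
    have "norm (u - Q u) \<le> 0" "norm (v - Q v) \<le> 0"
      using small by (meson field_le_epsilon less_imp_le add.left_neutral le_less_linear less_irrefl)+
    then show "f \<in> cspace (snd \<beta>) Q" unfolding cspace_def using uv by force
  qed
  show "cspace (snd \<beta>) Q \<subseteq> l2_closure (snd \<beta>) {cplx (F a) (F b) | a b. supp_on X a \<and> supp_on X b}"
  proof
    fix f assume "f \<in> cspace (snd \<beta>) Q"
    then obtain u v where uv: "supp_on (snd \<beta>) u" "supp_on (snd \<beta>) v" "Q u = u" "Q v = v" "f = cplx u v"
      unfolding cspace_def by blast
    have "\<exists>w\<in>{cplx (F a) (F b) | a b. supp_on X a \<and> supp_on X b}. l2_norm (\<lambda>x. f x - w x) < e"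
      if e: "0 < e" for e
    proof -
      have "(\<lambda>k. sqrt ((norm (u - F (z u k)))\<^sup>2 + (norm (v - F (z v k)))\<^sup>2)) \<longlonglongrightarrow> sqrt ((norm (u - Q u))\<^sup>2 + (norm (v - Q v))\<^sup>2)"
        by (intro tendsto_intros lim)
      then have "(\<lambda>k. sqrt ((norm (u - F (z u k)))\<^sup>2 + (norm (v - F (z v k)))\<^sup>2)) \<longlonglongrightarrow> 0"
        using uv by simp
      from LIMSEQ_D[OF this e] obtain k where "sqrt ((norm (u - F (z u k)))\<^sup>2 + (norm (v - F (z v k)))\<^sup>2) < e"
        by fastforce
      then have "l2_norm (\<lambda>x. f x - cplx (F (z u k)) (F (z v k)) x) < e"
        unfolding uv(5) cplx_diff l2_norm_cplx .
      moreover have "supp_on X (z u k)" "supp_on X (z v k)" using zX uv by blast+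
      ultimately show ?thesis by blast
    qed
    then show "f \<in> l2_closure (snd \<beta>) {cplx (F a) (F b) | a b. supp_on X a \<and> supp_on X b}"
      unfolding l2_closure_def using cplx_in_l2[OF uv(1,2)] uv(5) by blast
  qed
qed

end

section \<open>Reduced homology of subcomplexes of \<open>EG\<close>\<close>

lemma norm_le_of_sq_bound:
  fixes a b :: real
  assumes "a\<^sup>2 \<le> c * b\<^sup>2" "0 \<le> a" "0 \<le> b"
  shows "a \<le> sqrt c * b"
proof -
  have "a \<le> sqrt (c * b\<^sup>2)" by (rule real_le_rsqrt) (rule assms)
  then show ?thesis using assms(3) by (simp add: real_sqrt_mult)
qed

context group
begin

text \<open>The projection is \<open>kernel_proj\<close> of the Laplacian
  \<open>B1' B1 + B2 B2'\<close>, scaled by the sum of two squared norm bounds.\<close>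

lemma harmonic_projection:
  assumes B1: "eqop \<alpha> \<beta> B1 B1'" and B2: "eqop \<delta> \<alpha> B2 B2'"
    and f: "free_gspace \<alpha>" "free_gspace \<beta>" "free_gspace \<delta>"
  obtains P where "eqop \<alpha> \<alpha> P P" "\<And>u. P (P u) = P u" "\<And>u. P u = u \<longleftrightarrow> B1 u = 0 \<and> B2' u = 0"
proof -
  obtain c1 where c1: "0 < c1" "\<And>f. (norm (B1 f))\<^sup>2 \<le> c1 * (norm f)\<^sup>2" "\<And>h. (norm (B1' h))\<^sup>2 \<le> c1 * (norm h)\<^sup>2"
    using bounded_linear_sq_bound[OF eqopD(1,2)[OF B1]] by blast
  obtain c2 where c2: "0 < c2" "\<And>f. (norm (B2 f))\<^sup>2 \<le> c2 * (norm f)\<^sup>2" "\<And>h. (norm (B2' h))\<^sup>2 \<le> c2 * (norm h)\<^sup>2"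
    using bounded_linear_sq_bound[OF eqopD(1,2)[OF B2]] by blast
  define S where "S = (\<lambda>f. (1 / (c1 + c2)) *\<^sub>R (B1' (B1 f) + B2 (B2' f)))"
  have n: "norm (B1' h) \<le> sqrt c1 * norm h" "norm (B2 w) \<le> sqrt c2 * norm w" for h w
    using norm_le_of_sq_bound[OF c1(3)] norm_le_of_sq_bound[OF c2(2)] by auto
  note lap = psd_contraction_laplacian[OF eqop_linear[OF B1] eqopD(3)[OF B1] eqop_linear[OF B2] eqopD(3)[OF B2] n, of "c1 + c2"]
  interpret psd_contraction S
    unfolding S_def by (rule lap(1)) (use c1(1) c2(1) in auto)
  have S: "S u = 0 \<longleftrightarrow> B1 u = 0 \<and> B2' u = 0" for u
    unfolding S_def by (rule lap(2)) (use c1(1) c2(1) in auto)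
  have "eqop \<alpha> \<alpha> S S"
    unfolding S_def
    by (intro eqop_scaleR eqop_add eqop_comp[OF B1 eqop_adjoint[OF B1] f(1,2)]
        eqop_comp[OF eqop_adjoint[OF B2] B2 f(1,3)])
  then have "eqop \<alpha> \<alpha> P P" unfolding P_def by (rule eqop_kernel_proj[OF psd_contraction_axioms _ f(1)])
  then show thesis by (rule that) (simp_all add: P_eq_iff S)
qed

definition ksp :: "'a list set \<Rightarrow> nat \<Rightarrow> ('a, 'a list) gspace" where
  "ksp K p = (tuple_act G, simplices K p)"

lemma fst_ksp [simp]: "fst (ksp K p) = tuple_act G" and snd_ksp [simp]: "snd (ksp K p) = simplices K p"
  by (simp_all add: ksp_def)

lemma cocompactD:
  assumes "cocompact_subcomplex G K"
  shows "\<sigma> \<in> K \<Longrightarrow> \<sigma> \<noteq> [] \<and> set \<sigma> \<subseteq> carrier G"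
    "\<sigma> \<in> K \<Longrightarrow> i < length \<sigma> \<Longrightarrow> 2 \<le> length \<sigma> \<Longrightarrow> omit i \<sigma> \<in> K"
    "g \<in> carrier G \<Longrightarrow> \<sigma> \<in> K \<Longrightarrow> tuple_act G g \<sigma> \<in> K" "finite (orbits G K (tuple_act G))"
  using assms unfolding cocompact_subcomplex_def by (blast+)

lemma length_tuple_act [simp]: "length (tuple_act G g \<sigma>) = length \<sigma>"
  by (simp add: tuple_act_def)

lemma left_cancel:
  "x \<in> carrier G \<Longrightarrow> a \<in> carrier G \<Longrightarrow> b \<in> carrier G \<Longrightarrow> x \<otimes> a = x \<otimes> b \<longleftrightarrow> a = b"
  using Units_l_cancel Units_eq by simp

lemma tuple_act_inj:
  assumes "tuple_act G g \<sigma> = tuple_act G g \<tau>" "g \<in> carrier G" "set \<sigma> \<subseteq> carrier G" "set \<tau> \<subseteq> carrier G"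
  shows "\<sigma> = \<tau>"
proof (rule map_inj_on[OF assms(1)[unfolded tuple_act_def]])
  show "inj_on (\<lambda>h. g \<otimes> h) (set \<sigma> \<union> set \<tau>)"
    using assms left_cancel[of g] by (intro inj_onI) blast
qed

lemma free_ksp:
  assumes K: "cocompact_subcomplex G K"
  shows "free_gspace (ksp K p)"
  unfolding free_gspace_def
proof (intro conjI ballI impI)
  fix \<sigma> assume "\<sigma> \<in> snd (ksp K p)"
  then have \<sigma>: "\<sigma> \<in> K" "length \<sigma> = Suc p" "set \<sigma> \<subseteq> carrier G" "\<sigma> \<noteq> []"
    using cocompactD(1)[OF K] by (auto simp: simplices_def)
  show "fst (ksp K p) \<one> \<sigma> = \<sigma>"
    using \<sigma>(3) by (auto simp: tuple_act_def intro!: map_idI)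
  fix g assume g: "g \<in> carrier G"
  show "fst (ksp K p) g \<sigma> \<in> snd (ksp K p)"
    using cocompactD(3)[OF K g \<sigma>(1)] \<sigma>(2) by (simp add: simplices_def)
  show "fst (ksp K p) (g \<otimes> h) \<sigma> = fst (ksp K p) g (fst (ksp K p) h \<sigma>)" if "h \<in> carrier G" for h
    using g that \<sigma>(3) by (auto simp: tuple_act_def intro!: m_assoc)
  assume "fst (ksp K p) g \<sigma> = \<sigma>"
  then have "hd (map (\<lambda>h. g \<otimes> h) \<sigma>) = hd \<sigma>" by (simp add: tuple_act_def)
  then have "g \<otimes> hd \<sigma> = hd \<sigma>" using \<sigma>(4) by (simp add: hd_map)
  moreover have "hd \<sigma> \<in> carrier G" using \<sigma>(3,4) by auto
  ultimately show "g = \<one>" using g r_cancel_one by blast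
qed

lemma transversal_ksp:
  assumes K: "cocompact_subcomplex G K"
  shows "transversal (ksp K p) (orbit_reps (ksp K p))"
proof (rule transversal_orbit_reps[OF free_ksp[OF K]])
  have "orbits G (snd (ksp K p)) (fst (ksp K p)) \<subseteq> orbits G K (tuple_act G)"
    unfolding orbits_def by (auto simp: simplices_def)
  then show "finite (orbits G (snd (ksp K p)) (fst (ksp K p)))"
    using cocompactD(4)[OF K] by (rule finite_subset)
qed

text \<open>The sum over \<open>i\<close> matters: entries may repeat, so one tuple can be a face of
  another in several ways, with signs that may cancel.\<close>

definition bdker :: "'a list set \<Rightarrow> nat \<Rightarrow> 'a list \<Rightarrow> 'a list \<Rightarrow> real" where
  "bdker K p \<sigma> \<tau> = (if \<sigma> \<in> simplices K (Suc p) \<and> \<tau> \<in> simplices K p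
     then \<Sum>i | i < length \<sigma> \<and> omit i \<sigma> = \<tau>. (- 1) ^ i else 0)"

text \<open>The bare incidence relation. Because of cancellation it can be larger than the support
  of \<open>bdker\<close>, and it is what indexes the sum in \<open>l2_boundary\<close>, so
  finiteness has to be proved for it.\<close>

definition coface :: "'a list set \<Rightarrow> nat \<Rightarrow> 'a list \<Rightarrow> 'a list \<Rightarrow> real" where
  "coface K p \<sigma> \<tau> = (if \<sigma> \<in> simplices K (Suc p) \<and> \<tau> \<in> simplices K p \<and> (\<exists>i<length \<sigma>. omit i \<sigma> = \<tau>)
     then 1 else 0)"

lemma omit_tuple_act: "omit i (tuple_act G g \<sigma>) = tuple_act G g (omit i \<sigma>)"
  by (simp add: omit_def tuple_act_def take_map drop_map)

lemma set_omit: "set (omit i \<sigma>) \<subseteq> set \<sigma>"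
  unfolding omit_def using set_take_subset set_drop_subset by fastforce

lemma length_omit: "i < length \<sigma> \<Longrightarrow> length (omit i \<sigma>) = length \<sigma> - 1"
  by (simp add: omit_def)

lemma omit_act_iff:
  assumes K: "cocompact_subcomplex G K" and "g \<in> carrier G" "\<sigma> \<in> K" "\<tau> \<in> K"
  shows "omit i (tuple_act G g \<sigma>) = tuple_act G g \<tau> \<longleftrightarrow> omit i \<sigma> = \<tau>"
  using tuple_act_inj[OF _ assms(2), of "omit i \<sigma>" \<tau>] cocompactD(1)[OF K] assms(3,4) set_omit[of i \<sigma>]
  unfolding omit_tuple_act by blast

lemma eqker_coface:
  assumes K: "cocompact_subcomplex G K"
  shows "eqker (ksp K (Suc p)) (ksp K p) (coface K p)"
  unfolding eqker_def
proof (intro conjI allI ballI impI)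
  show "finite {\<tau>. coface K p \<sigma> \<tau> \<noteq> 0}" for \<sigma>
    by (rule finite_subset[of _ "(\<lambda>i. omit i \<sigma>) ` {..<length \<sigma>}"]) (auto simp: coface_def split: if_splits)
  fix g \<sigma> \<tau> assume *: "g \<in> carrier G" "\<sigma> \<in> snd (ksp K (Suc p))" "\<tau> \<in> snd (ksp K p)"
  then have "\<sigma> \<in> K" "\<tau> \<in> K" by (auto simp: simplices_def)
  with * show "coface K p (fst (ksp K (Suc p)) g \<sigma>) (fst (ksp K p) g \<tau>) = coface K p \<sigma> \<tau>"
    using free_gspaceD(1)[OF free_ksp[OF K] *(2,1)] free_gspaceD(1)[OF free_ksp[OF K] *(3,1)]
    by (simp add: coface_def omit_act_iff[OF K *(1)])
qed (auto simp: coface_def split: if_splits)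

lemma eqker_bdker:
  assumes K: "cocompact_subcomplex G K"
  shows "eqker (ksp K (Suc p)) (ksp K p) (bdker K p)"
  unfolding eqker_def
proof (intro conjI allI ballI impI)
  have sub: "{\<tau>. bdker K p \<sigma> \<tau> \<noteq> 0} \<subseteq> {\<tau>. coface K p \<sigma> \<tau> \<noteq> 0}" for \<sigma>
  proof
    fix \<tau> assume "\<tau> \<in> {\<tau>. bdker K p \<sigma> \<tau> \<noteq> 0}"
    then have nz: "bdker K p \<sigma> \<tau> \<noteq> 0" by simp
    then have "{i. i < length \<sigma> \<and> omit i \<sigma> = \<tau>} \<noteq> {}" unfolding bdker_def by (metis sum.empty)
    then show "\<tau> \<in> {\<tau>. coface K p \<sigma> \<tau> \<noteq> 0}"
      using nz by (auto simp: coface_def bdker_def split: if_splits)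
  qed
  show "finite {\<tau>. bdker K p \<sigma> \<tau> \<noteq> 0}" for \<sigma>
    by (rule finite_subset[OF sub eqkerD(3)[OF eqker_coface[OF K]]])
  fix g \<sigma> \<tau> assume *: "g \<in> carrier G" "\<sigma> \<in> snd (ksp K (Suc p))" "\<tau> \<in> snd (ksp K p)"
  then have "\<sigma> \<in> K" "\<tau> \<in> K" by (auto simp: simplices_def)
  with * show "bdker K p (fst (ksp K (Suc p)) g \<sigma>) (fst (ksp K p) g \<tau>) = bdker K p \<sigma> \<tau>"
    using free_gspaceD(1)[OF free_ksp[OF K] *(2,1)] free_gspaceD(1)[OF free_ksp[OF K] *(3,1)]
    by (simp add: bdker_def omit_act_iff[OF K *(1)])
qed (auto simp: bdker_def split: if_splits)

definition bd :: "'a list set \<Rightarrow> nat \<Rightarrow> 'a list ell2 \<Rightarrow> 'a list ell2" where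
  "bd K p = kop (bdker K p)"

definition cobd :: "'a list set \<Rightarrow> nat \<Rightarrow> 'a list ell2 \<Rightarrow> 'a list ell2" where
  "cobd K p = kop (ktransp (bdker K p))"

lemma eqop_bd:
  assumes K: "cocompact_subcomplex G K"
  shows "eqop (ksp K (Suc p)) (ksp K p) (bd K p) (cobd K p)"
proof -
  obtain C C' where "bker (bdker K p) C C'"
    using eqker_bker[OF eqker_bdker[OF K] free_ksp[OF K] free_ksp[OF K] transversal_ksp[OF K] transversal_ksp[OF K]] .
  from eqop_kop[OF eqker_bdker[OF K] this] show ?thesis by (simp add: bd_def cobd_def)
qed

lemma coord_bd:
  assumes K: "cocompact_subcomplex G K"
  shows "coord (bd K p u) = rowact (ktransp (bdker K p)) (coord u)"
    and "coord (bd K p (delta \<sigma>)) \<tau> = bdker K p \<sigma> \<tau>"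
proof -
  obtain C C' where b: "bker (bdker K p) C C'"
    using eqker_bker[OF eqker_bdker[OF K] free_ksp[OF K] free_ksp[OF K] transversal_ksp[OF K] transversal_ksp[OF K]] .
  show "coord (bd K p u) = rowact (ktransp (bdker K p)) (coord u)"
    unfolding bd_def by (rule coord_kop[OF b])
  show "coord (bd K p (delta \<sigma>)) \<tau> = bdker K p \<sigma> \<tau>"
    unfolding bd_def by (rule coord_kop_delta[OF b])
qed

text \<open>A sum over an infinite set is 0 by convention, so the formula rests on the finiteness of
  the set of cofaces, which comes from cocompactness.\<close>

lemma boundary_sum:
  assumes K: "cocompact_subcomplex G K" and \<tau>: "\<tau> \<in> simplices K p"
  shows "(\<Sum>(\<sigma>, i) | \<sigma> \<in> K \<and> i < length \<sigma> \<and> omit i \<sigma> = \<tau>. (- 1) ^ i * h \<sigma>)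
    = rowact (ktransp (bdker K p)) h \<tau>"
proof -
  let ?C = "{\<sigma>. coface K p \<sigma> \<tau> \<noteq> 0}" and ?I = "\<lambda>\<sigma>. {i. i < length \<sigma> \<and> omit i \<sigma> = \<tau>}"
  have C: "finite ?C"
    by (rule eqker_finite_col[OF eqker_coface[OF K] free_ksp[OF K] free_ksp[OF K] transversal_ksp[OF K]])
  have len: "length \<sigma> = Suc (Suc p)" if "i < length \<sigma>" "omit i \<sigma> = \<tau>" for \<sigma> i
    using length_omit[OF that(1)] that \<tau> by (auto simp: simplices_def)
  have inC: "\<sigma> \<in> ?C \<longleftrightarrow> \<sigma> \<in> K \<and> ?I \<sigma> \<noteq> {}" for \<sigma>
  proof
    assume "\<sigma> \<in> ?C"
    then have "\<sigma> \<in> simplices K (Suc p)" "\<exists>i<length \<sigma>. omit i \<sigma> = \<tau>"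
      by (auto simp: coface_def split: if_splits)
    then show "\<sigma> \<in> K \<and> ?I \<sigma> \<noteq> {}" by (simp add: simplices_def)
  next
    assume *: "\<sigma> \<in> K \<and> ?I \<sigma> \<noteq> {}"
    then obtain i where i: "i < length \<sigma>" "omit i \<sigma> = \<tau>" by blast
    then have "\<sigma> \<in> simplices K (Suc p)" using * len[OF i] by (simp add: simplices_def)
    moreover have "\<exists>i<length \<sigma>. omit i \<sigma> = \<tau>" using i by blast
    ultimately show "\<sigma> \<in> ?C" using \<tau> by (simp add: coface_def)
  qed
  have "{(\<sigma>, i). \<sigma> \<in> K \<and> i < length \<sigma> \<and> omit i \<sigma> = \<tau>} = Sigma ?C ?I"
    unfolding set_eq_iff split_paired_All mem_Sigma_iff inC by blast
  then have "(\<Sum>(\<sigma>, i) | \<sigma> \<in> K \<and> i < length \<sigma> \<and> omit i \<sigma> = \<tau>. (- 1) ^ i * h \<sigma>)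
    = (\<Sum>\<sigma>\<in>?C. \<Sum>i\<in>?I \<sigma>. (- 1) ^ i * h \<sigma>)"
    by (simp add: sum.Sigma[OF C])
  also have "\<dots> = (\<Sum>\<sigma>\<in>?C. ktransp (bdker K p) \<tau> \<sigma> * h \<sigma>)"
  proof (rule sum.cong)
    fix \<sigma> assume "\<sigma> \<in> ?C"
    then have "bdker K p \<sigma> \<tau> = (\<Sum>i\<in>?I \<sigma>. (- 1) ^ i)"
      by (auto simp: coface_def bdker_def split: if_splits)
    then show "(\<Sum>i\<in>?I \<sigma>. (- 1) ^ i * h \<sigma>) = ktransp (bdker K p) \<tau> \<sigma> * h \<sigma>"
      by (simp add: ktransp_def sum_distrib_right)
  qed simp
  also have "\<dots> = rowact (ktransp (bdker K p)) h \<tau>"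
  proof (rule rowact_eq_sum[OF C, symmetric], rule subsetI)
    fix \<sigma> assume "\<sigma> \<in> {\<sigma>. ktransp (bdker K p) \<tau> \<sigma> \<noteq> 0}"
    then have nz: "bdker K p \<sigma> \<tau> \<noteq> 0" by (simp add: ktransp_def)
    then have "?I \<sigma> \<noteq> {}" unfolding bdker_def by (metis sum.empty)
    moreover have "\<sigma> \<in> K" using nz by (auto simp: bdker_def simplices_def split: if_splits)
    ultimately show "\<sigma> \<in> ?C" using inC by blast
  qed
  finally show ?thesis .
qed

lemma l2_boundary_cplx:
  assumes K: "cocompact_subcomplex G K"
    and u: "supp_on (simplices K (Suc p)) u" and v: "supp_on (simplices K (Suc p)) v"
  shows "l2_boundary K (cplx u v) = cplx (bd K p u) (bd K p v)"
proof
  fix \<tau>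
  have z: "coord (bd K p w) \<tau> = 0" if "supp_on (simplices K (Suc p)) w" "\<tau> \<notin> simplices K p" for w
    using eqop_supp_on[OF eqop_bd[OF K], of p w] that by (auto simp: supp_on_def)
  show "l2_boundary K (cplx u v) \<tau> = cplx (bd K p u) (bd K p v) \<tau>"
  proof (cases "\<tau> \<in> simplices K p")
    case True
    have pow: "Re ((- 1) ^ i * w) = (- 1) ^ i * Re w" "Im ((- 1) ^ i * w) = (- 1) ^ i * Im w" for i w
      by (cases "even i"; simp)+
    have "Re (l2_boundary K (cplx u v) \<tau>) = coord (bd K p u) \<tau>"
      using boundary_sum[OF K True, of "coord u"] True
      by (simp add: l2_boundary_def simplices_def case_prod_unfold pow coord_bd(1)[OF K] cplx_def)
    moreover have "Im (l2_boundary K (cplx u v) \<tau>) = coord (bd K p v) \<tau>"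
      using boundary_sum[OF K True, of "coord v"] True
      by (simp add: l2_boundary_def simplices_def case_prod_unfold pow coord_bd(1)[OF K] cplx_def)
    ultimately show ?thesis by (simp add: cplx_def complex_eq_iff)
  next
    case False
    have "cplx u v \<sigma> = 0" if "\<tau> \<in> K" "i < length \<sigma>" "omit i \<sigma> = \<tau>" for \<sigma> i
    proof -
      have "length \<sigma> \<noteq> Suc (Suc p)"
        using length_omit[OF that(2)] that False by (auto simp: simplices_def)
      then have "\<sigma> \<notin> simplices K (Suc p)" by (simp add: simplices_def)
      then show ?thesis using u v by (simp add: cplx_def supp_on_def complex_eq_iff)
    qed
    then have "l2_boundary K (cplx u v) \<tau> = 0"
      unfolding l2_boundary_def by (auto intro!: sum.neutral)
    then show ?thesis using z[OF u False] z[OF v False] by (simp add: cplx_def complex_eq_iff)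
  qed
qed

text \<open>Testing a chain against the boundary of its own coboundary shows that it is orthogonal
  to all boundaries exactly if its coboundary vanishes. Real and imaginary part go together: the
  real part of that inner product is a sum of two squares.\<close>

lemma l2_homology_eq_cspace:
  assumes K: "cocompact_subcomplex G K"
    and P: "\<And>u. P u = u \<longleftrightarrow> bd K 0 u = 0 \<and> cobd K 1 u = 0"
  shows "l2_homology K 1 = cspace (simplices K 1) P"
proof -
  have B2: "eqop (ksp K 2) (ksp K 1) (bd K 1) (cobd K 1)"
    using eqop_bd[OF K, of 1] by (simp add: numeral_2_eq_2)
  have cyc: "cplx u v \<in> l2_cycles K 1 \<longleftrightarrow> bd K 0 u = 0 \<and> bd K 0 v = 0"
    if "supp_on (simplices K 1) u" "supp_on (simplices K 1) v" for u v
  proof -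
    have "(\<lambda>_. 0) = cplx (0 :: 'a list ell2) 0" by (auto simp: cplx_def complex_eq_iff)
    then show ?thesis
      using that cplx_in_l2[OF that] l2_boundary_cplx[OF K, of 0 u v]
      by (simp add: l2_cycles_def cplx_eq_iff)
  qed
  have bnd: "(\<forall>b\<in>l2_boundaries K 1. l2_inner (cplx u v) b = 0) \<longleftrightarrow> cobd K 1 u = 0 \<and> cobd K 1 v = 0"
    if u: "supp_on (simplices K 1) u" and v: "supp_on (simplices K 1) v" for u v
  proof
    assume *: "\<forall>b\<in>l2_boundaries K 1. l2_inner (cplx u v) b = 0"
    have s: "supp_on (simplices K 2) (cobd K 1 w)" if "supp_on (simplices K 1) w" for w
      using eqop_supp_on[OF eqop_adjoint[OF B2], of w] that by simp
    have "l2_boundary K (cplx (cobd K 1 u) (cobd K 1 v)) \<in> l2_boundaries K 1"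
      unfolding l2_boundaries_def
      by (rule imageI) (use cplx_in_l2[OF s[OF u] s[OF v]] in \<open>simp add: numeral_2_eq_2\<close>)
    moreover have "l2_boundary K (cplx (cobd K 1 u) (cobd K 1 v))
      = cplx (bd K 1 (cobd K 1 u)) (bd K 1 (cobd K 1 v))"
      by (rule l2_boundary_cplx[OF K]) (use s u v in \<open>auto simp: numeral_2_eq_2\<close>)
    ultimately have "l2_inner (cplx u v) (cplx (bd K 1 (cobd K 1 u)) (bd K 1 (cobd K 1 v))) = 0"
      using * by metis
    then have "inner u (bd K 1 (cobd K 1 u)) + inner v (bd K 1 (cobd K 1 v)) = 0"
      unfolding l2_inner_cplx by (simp add: complex_eq_iff)
    then have "inner (cobd K 1 u) (cobd K 1 u) + inner (cobd K 1 v) (cobd K 1 v) = 0"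
      using eqopD(3)[OF eqop_adjoint[OF B2]] by metis
    then show "cobd K 1 u = 0 \<and> cobd K 1 v = 0"
      by (metis add_nonneg_eq_0_iff inner_eq_zero_iff inner_ge_zero)
  next
    assume *: "cobd K 1 u = 0 \<and> cobd K 1 v = 0"
    show "\<forall>b\<in>l2_boundaries K 1. l2_inner (cplx u v) b = 0"
    proof
      fix b assume "b \<in> l2_boundaries K 1"
      then obtain c where c: "c \<in> l2 (simplices K (Suc 1))" "b = l2_boundary K c"
        unfolding l2_boundaries_def by blast
      obtain x y where xy: "supp_on (simplices K (Suc 1)) x" "supp_on (simplices K (Suc 1)) y" "c = cplx x y"
        using l2_cplxE[OF c(1)] .
      have "inner w (bd K 1 z) = inner (cobd K 1 w) z" for w z
        using eqopD(3)[OF eqop_adjoint[OF B2], of w z] by simp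
      then show "l2_inner (cplx u v) b = 0"
        using * unfolding c(2) xy(3) l2_boundary_cplx[OF K xy(1,2)] l2_inner_cplx
        by (simp add: complex_eq_iff)
    qed
  qed
  have "z \<in> l2_homology K 1 \<longleftrightarrow> z \<in> cspace (simplices K 1) P" for z
  proof
    assume z: "z \<in> l2_homology K 1"
    then have "z \<in> l2 (simplices K 1)" by (auto simp: l2_homology_def l2_cycles_def)
    then obtain u v where uv: "supp_on (simplices K 1) u" "supp_on (simplices K 1) v" "z = cplx u v"
      by (rule l2_cplxE)
    then show "z \<in> cspace (simplices K 1) P"
      using z cyc[OF uv(1,2)] bnd[OF uv(1,2)] unfolding cspace_def l2_homology_def P by blast
  next
    assume "z \<in> cspace (simplices K 1) P"
    then obtain u v where uv: "supp_on (simplices K 1) u" "supp_on (simplices K 1) v" "z = cplx u v"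
      and "P u = u" "P v = v"
      unfolding cspace_def by blast
    then show "z \<in> l2_homology K 1"
      using cyc[OF uv(1,2)] bnd[OF uv(1,2)] unfolding l2_homology_def P by blast
  qed
  then show ?thesis by blast
qed

text \<open>Functions live on the whole type, so inclusion of chains is the identity on them. It is
  cut off to \<open>X\<close> because \<open>eqop\<close> forbids entries from a point outside the
  first space to a point inside the second, and the identity has such entries at the simplices that
  are new in the larger complex.\<close>

definition incl :: "'a list set \<Rightarrow> 'a list \<Rightarrow> 'a list \<Rightarrow> real" where
  "incl X \<sigma> \<tau> = (if \<sigma> \<in> X \<and> \<tau> = \<sigma> then 1 else 0)"

text \<open>Collects what the comparison uses about the image. The harmonic chains of
  \<open>K\<close> are the range of \<open>P\<close>, so the image is the range of
  \<open>P' J P\<close>, and \<open>range_projection\<close> supplies the projection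
  \<open>Q\<close> onto its closure together with approximants. The von Neumann dimension is then
  the trace of \<open>Q\<close>.\<close>

lemma l2_homology_image_projection:
  assumes K: "cocompact_subcomplex G K" and K': "cocompact_subcomplex G K'" and sub: "K \<subseteq> K'"
  obtains P P' J J' Q z where
    "eqop (ksp K 1) (ksp K 1) P P" "\<And>u. P u = u \<longleftrightarrow> bd K 0 u = 0 \<and> cobd K 1 u = 0" "\<And>u. P (P u) = P u"
    "eqop (ksp K' 1) (ksp K' 1) P' P'" "\<And>u. P' u = u \<longleftrightarrow> bd K' 0 u = 0 \<and> cobd K' 1 u = 0" "\<And>u. P' (P' u) = P' u"
    "eqop (ksp K 1) (ksp K' 1) J J'" "\<And>u. supp_on (simplices K 1) u \<Longrightarrow> J u = u"
    "eqop (ksp K' 1) (ksp K' 1) Q Q" "\<And>u. Q (Q u) = Q u" "\<And>u. Q (P' (J (P u))) = P' (J (P u))"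
    "\<And>y. (\<lambda>k. P' (J (P (z y k)))) \<longlonglongrightarrow> Q y"
    "\<And>y k. supp_on (simplices K' 1) y \<Longrightarrow> supp_on (simplices K 1) (z y k)"
    "vn_dim G (tuple_act G) (simplices K' 1) (l2_homology_image K K' 1)
      = (\<Sum>x\<in>orbit_reps (ksp K' 1). coord (Q (delta x)) x)"
proof -
  note f = free_ksp[OF K] and f' = free_ksp[OF K']
  obtain P where P: "eqop (ksp K 1) (ksp K 1) P P" "\<And>u. P (P u) = P u"
    "\<And>u. P u = u \<longleftrightarrow> bd K 0 u = 0 \<and> cobd K 1 u = 0"
    using harmonic_projection[OF eqop_bd[OF K, of 0] eqop_bd[OF K, of "Suc 0"] f f f] by (metis One_nat_def)
  obtain P' where P': "eqop (ksp K' 1) (ksp K' 1) P' P'" "\<And>u. P' (P' u) = P' u"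
    "\<And>u. P' u = u \<longleftrightarrow> bd K' 0 u = 0 \<and> cobd K' 1 u = 0"
    using harmonic_projection[OF eqop_bd[OF K', of 0] eqop_bd[OF K', of "Suc 0"] f' f' f'] by (metis One_nat_def)
  have sub1: "simplices K 1 \<subseteq> simplices K' 1" using sub by (auto simp: simplices_def)
  have i: "eqker (ksp K 1) (ksp K' 1) (incl (simplices K 1))"
    unfolding eqker_def
  proof (intro conjI allI ballI impI)
    fix g \<sigma> \<tau> assume *: "g \<in> carrier G" "\<sigma> \<in> snd (ksp K 1)" "\<tau> \<in> snd (ksp K' 1)"
    have "tuple_act G g \<tau> = tuple_act G g \<sigma> \<longleftrightarrow> \<tau> = \<sigma>"
      using tuple_act_inj[OF _ *(1), of \<tau> \<sigma>] cocompactD(1)[OF K] cocompactD(1)[OF K'] *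
      by (auto simp: simplices_def)
    then show "incl (simplices K 1) (fst (ksp K 1) g \<sigma>) (fst (ksp K' 1) g \<tau>) = incl (simplices K 1) \<sigma> \<tau>"
      using free_gspaceD(1)[OF f *(2,1)] * by (simp add: incl_def)
  qed (use sub1 in \<open>auto simp: incl_def split: if_splits\<close>)
  obtain C C' where b: "bker (incl (simplices K 1)) C C'"
    using eqker_bker[OF i f f' transversal_ksp[OF K] transversal_ksp[OF K']] .
  define J where "J = kop (incl (simplices K 1))"
  define J' where "J' = kop (ktransp (incl (simplices K 1)))"
  have J: "eqop (ksp K 1) (ksp K' 1) J J'" unfolding J_def J'_def by (rule eqop_kop[OF i b])
  have Ju: "J u = u" if "supp_on (simplices K 1) u" for u
  proof (rule ell2_eqI)
    fix \<tau>
    have "coord (J u) \<tau> = (\<Sum>\<sigma>\<in>{\<tau>}. ktransp (incl (simplices K 1)) \<tau> \<sigma> * coord u \<sigma>)"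
      unfolding J_def coord_kop[OF b]
      by (rule rowact_eq_sum) (auto simp: ktransp_def incl_def split: if_splits)
    then show "coord (J u) \<tau> = coord u \<tau>" using that by (auto simp: ktransp_def incl_def supp_on_def)
  qed
  have F: "eqop (ksp K 1) (ksp K' 1) (\<lambda>u. P' (J (P u))) (\<lambda>u. P (J' (P' u)))"
    by (rule eqop_comp[OF eqop_comp[OF P(1) J f f] P'(1) f f'])
  obtain Q z where Q: "eqop (ksp K' 1) (ksp K' 1) Q Q" "\<And>u. Q (Q u) = Q u" "\<And>u. Q (P' (J (P u))) = P' (J (P u))"
    "\<And>y. (\<lambda>k. P' (J (P (z y k)))) \<longlonglongrightarrow> Q y"
    "\<And>y k. supp_on (snd (ksp K' 1)) y \<Longrightarrow> supp_on (snd (ksp K 1)) (z y k)"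
    using range_projection[OF F f f'] by blast
  have "l2_proj (l2_homology K' 1) ` l2_homology K 1
    = {cplx (P' (J (P a))) (P' (J (P b))) | a b. supp_on (simplices K 1) a \<and> supp_on (simplices K 1) b}"
  proof -
    have pr: "l2_proj (l2_homology K' 1) (cplx u v) = cplx (P' u) (P' v)"
      if "supp_on (simplices K 1) u" "supp_on (simplices K 1) v" for u v
      unfolding l2_homology_eq_cspace[OF K' P'(3)]
      using l2_proj_cspace[OF P'(1,2), of u v] that supp_on_mono[OF _ sub1] by simp
    have Ps: "supp_on (simplices K 1) (P u)" if "supp_on (simplices K 1) u" for u
      using eqop_supp_on[OF P(1), of u] that by simp
    show ?thesis
      unfolding l2_homology_eq_cspace[OF K P(3)]
    proof (intro equalityI subsetI)
      fix w assume "w \<in> l2_proj (l2_homology K' 1) ` cspace (simplices K 1) P"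
      then obtain u v where "supp_on (simplices K 1) u" "supp_on (simplices K 1) v" "P u = u" "P v = v"
        "w = l2_proj (l2_homology K' 1) (cplx u v)"
        unfolding cspace_def by blast
      then have "w = cplx (P' (J (P u))) (P' (J (P v)))" "supp_on (simplices K 1) u" "supp_on (simplices K 1) v"
        by (simp_all add: pr Ju del: One_nat_def)
      then show "w \<in> {cplx (P' (J (P a))) (P' (J (P b))) | a b. supp_on (simplices K 1) a \<and> supp_on (simplices K 1) b}"
        by blast
    next
      fix w assume "w \<in> {cplx (P' (J (P a))) (P' (J (P b))) | a b. supp_on (simplices K 1) a \<and> supp_on (simplices K 1) b}"
      then obtain a b where ab: "supp_on (simplices K 1) a" "supp_on (simplices K 1) b"
        "w = cplx (P' (J (P a))) (P' (J (P b)))" by blast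
      then have "w = l2_proj (l2_homology K' 1) (cplx (P a) (P b))" by (simp add: pr Ps Ju del: One_nat_def)
      moreover have "cplx (P a) (P b) \<in> cspace (simplices K 1) P"
        unfolding cspace_def using Ps ab P(2) by blast
      ultimately show "w \<in> l2_proj (l2_homology K' 1) ` cspace (simplices K 1) P" by blast
    qed
  qed
  then have "l2_homology_image K K' 1 = cspace (simplices K' 1) Q"
    unfolding l2_homology_image_def
    using l2_closure_range[OF Q(1,2), of "\<lambda>u. P' (J (P u))" z, OF Q(3,4,5)] by (simp del: One_nat_def)
  then have "vn_dim G (tuple_act G) (simplices K' 1) (l2_homology_image K K' 1)
      = (\<Sum>x\<in>orbit_reps (ksp K' 1). coord (Q (delta x)) x)"
    using vn_dim_cspace[OF Q(1,2) f'] by (simp del: One_nat_def)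
  then show thesis
    using that[of P P' J J' Q z] P P' J Ju Q by (simp del: One_nat_def)
qed

end

section \<open>Hodge decomposition and induced maps on reduced homology\<close>

context group
begin

text \<open>A cycle with vanishing harmonic part is a limit of boundaries, and a chain killed by
  \<open>B2'\<close> is orthogonal to all of these. Limits are taken because the range of
  \<open>B2\<close> need not be closed.\<close>

lemma hodge_orthogonal:
  assumes B1: "eqop \<alpha> \<beta> B1 B1'" and B2: "eqop \<delta> \<alpha> B2 B2'" and BB: "\<And>u. B1 (B2 u) = 0"
    and f: "free_gspace \<alpha>" "free_gspace \<delta>"
    and P: "eqop \<alpha> \<alpha> P P" "\<And>u. P u = u \<longleftrightarrow> B1 u = 0 \<and> B2' u = 0"
    and z: "B1 z = 0" "P z = 0" and x: "B2' x = 0"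
  shows "inner z x = 0"
proof -
  obtain Q w where Q: "eqop \<alpha> \<alpha> Q Q" "\<And>f. Q (Q f) = Q f" "\<And>f. Q (B2 f) = B2 f"
    "\<And>y. (\<lambda>k. B2 (w y k)) \<longlonglongrightarrow> Q y"
    "\<And>y k. supp_on (snd \<alpha>) y \<Longrightarrow> supp_on (snd \<delta>) (w y k)"
    using range_projection[OF B2 f(2,1)] by blast
  let ?q = "Q z"
  have B2z: "B2' (z - ?q) = 0"
  proof -
    have "inner (B2' (z - ?q)) v = inner (z - ?q) (B2 v)" for v
      using eqopD(3)[OF eqop_adjoint[OF B2]] .
    also have "inner (z - ?q) (B2 v) = 0" for v
      using eqopD(3)[OF Q(1), of z "B2 v"] by (simp add: inner_diff_left Q(3))
    finally have "inner (B2' (z - ?q)) (B2' (z - ?q)) = 0" .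
    then show ?thesis by simp
  qed
  have "(\<lambda>k. B1 (B2 (w z k))) \<longlonglongrightarrow> B1 ?q"
    by (rule bounded_linear.tendsto[OF eqopD(1)[OF B1] Q(4)])
  then have "B1 ?q = 0" by (simp add: BB LIMSEQ_const_iff)
  \<comment> \<open>The difference \<open>z - ?q\<close> is harmonic, hence orthogonal to
    \<open>z\<close>, and it is orthogonal to \<open>?q\<close>; so it is 0.\<close>
  then have "P (z - ?q) = z - ?q"
    using B2z z(1) by (simp add: P(2) linear_diff[OF eqop_linear(1)[OF B1]])
  then have "inner (z - ?q) z = 0"
    using eqopD(3)[OF P(1), of "z - ?q" z] z(2) by simp
  moreover have "inner (z - ?q) ?q = 0"
    using eqopD(3)[OF Q(1), of z ?q] by (simp add: inner_diff_left Q(2))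
  ultimately have "inner (z - ?q) (z - ?q) = 0" by (simp add: inner_diff_right)
  then have "z = ?q" by simp
  then have "(\<lambda>k. inner (B2 (w z k)) x) \<longlonglongrightarrow> inner z x"
    using Q(4)[of z] by (intro tendsto_intros) auto
  moreover have "inner (B2 (w z k)) x = 0" for k
    using eqopD(3)[OF B2, of "w z k" x] x by simp
  ultimately show ?thesis by (simp add: LIMSEQ_const_iff)
qed

text \<open>A chain map \<open>\<theta>\<close> induces a map on reduced homology: a cycle and its harmonic part have images
  with the same harmonic part.\<close>

lemma harmonic_part_chain_map:
  assumes B1: "eqop \<alpha> \<beta> B1 B1'" and B2: "eqop \<delta> \<alpha> B2 B2'" and BB: "\<And>u. B1 (B2 u) = 0"
    and f: "free_gspace \<alpha>" "free_gspace \<delta>"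
    and P: "eqop \<alpha> \<alpha> P P" "\<And>u. P (P u) = P u" "\<And>u. P u = u \<longleftrightarrow> B1 u = 0 \<and> B2' u = 0"
    and \<theta>: "eqop \<alpha> \<alpha>' \<theta> \<theta>'" and P': "eqop \<alpha>' \<alpha>' P' P'"
    and bnd: "\<And>x. B2' (\<theta>' (P' x)) = 0" and v: "B1 v = 0"
  shows "P' (\<theta> v) = P' (\<theta> (P v))"
proof -
  have "inner (P' (\<theta> (v - P v))) y = 0" for y
  proof -
    have "inner (P' (\<theta> (v - P v))) y = inner (v - P v) (\<theta>' (P' y))"
      by (simp add: eqopD(3)[OF P'] eqopD(3)[OF \<theta>])
    also have "\<dots> = 0"
    proof (rule hodge_orthogonal[OF B1 B2 BB f P(1,3) _ _ bnd])
      have "B1 (P v) = 0" using P(2,3) by metis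
      then show "B1 (v - P v) = 0" using v by (simp add: linear_diff[OF eqop_linear(1)[OF B1]])
      show "P (v - P v) = 0" using P(2) by (simp add: linear_diff[OF eqop_linear(1)[OF P(1)]])
    qed
    finally show ?thesis .
  qed
  from this[of "P' (\<theta> (v - P v))"] have "P' (\<theta> (v - P v)) = 0" by simp
  then show ?thesis
    by (simp add: linear_diff[OF eqop_linear(1)[OF P']] linear_diff[OF eqop_linear(1)[OF \<theta>]])
qed

text \<open>The substitute for chain homotopies: to see that \<open>A u\<close> is orthogonal to a
  chain killed by \<open>B'\<close>, it suffices to write each \<open>A (delta x)\<close> as a
  finite combination of boundaries. The number of terms may vary with \<open>x\<close>, since only
  orthogonality is carried to the limit.\<close>

lemma span_range_orthogonal:
  assumes A: "bounded_linear A" and B: "eqop \<alpha> \<beta> B B'" and y: "B' y = 0"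
    and s: "\<And>x. x \<in> X \<Longrightarrow> A (delta x) \<in> span (range (\<lambda>s. B (delta s)))" and u: "supp_on X u"
  shows "inner (A u) y = 0"
proof -
  have z: "inner w y = 0" if "w \<in> span (range (\<lambda>s. B (delta s)))" for w
    using that
  proof (induction rule: span_induct)
    case base
    show ?case by (rule real_vector.subspaceI) (auto simp: inner_add_left)
  next
    case (step z)
    then show ?case using eqopD(3)[OF B] y by auto
  qed
  have "inner (A (coord u x *\<^sub>R delta x)) y = 0" for x
    using z[OF s, of x] u by (cases "x \<in> X")
      (auto simp: supp_on_def linear_cmul[OF bounded_linear.linear[OF A]] linear_0[OF bounded_linear.linear[OF A]])
  moreover have "((\<lambda>x. inner (A (coord u x *\<^sub>R delta x)) y) has_sum inner (A u) y) UNIV"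
    using has_sum_bounded_linear[OF bounded_linear_compose[OF bounded_linear_inner_left A] has_sum_delta[of u], of y]
    by (simp add: o_def)
  ultimately show ?thesis using infsumI by fastforce
qed

end

section \<open>Words and edge paths\<close>

definition lcoef :: "('e \<times> bool) list \<Rightarrow> 'e \<Rightarrow> real" where
  "lcoef p y = (\<Sum>(e, b)\<leftarrow>p. if e = y then (if b then 1 else - 1) else 0)"

text \<open>The same signed count of edges as \<open>lcoef\<close>, now as a vector: kernels and
  quotients use the function, operator identities the vector.\<close>

definition pathv :: "('e \<times> bool) list \<Rightarrow> 'e ell2" where
  "pathv p = (\<Sum>(e, b)\<leftarrow>p. if b then delta e else - delta e)"

lemma pathv_simps [simp]:
  "pathv [] = 0" "pathv ((e, b) # p) = (if b then delta e else - delta e) + pathv p"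
  "pathv (p @ q) = pathv p + pathv q"
  by (simp_all add: pathv_def)

lemma coord_pathv: "coord (pathv p) y = lcoef p y"
  by (induction p) (auto simp: pathv_def lcoef_def coord_delta)

lemma lcoef_nonzero: "lcoef p y \<noteq> 0 \<Longrightarrow> y \<in> fst ` set p"
  by (induction p) (auto simp: lcoef_def split: if_splits)

lemma finite_lcoef: "finite {y. lcoef p y \<noteq> 0}"
  by (rule finite_subset[of _ "fst ` set p"]) (auto dest: lcoef_nonzero)

lemma lcoef_map:
  assumes "inj_on f (insert y (fst ` set p))"
  shows "lcoef (map (\<lambda>(e, b). (f e, b)) p) (f y) = lcoef p y"
  using assms
proof (induction p)
  case (Cons a p)
  obtain e b where a: "a = (e, b)" by fastforce
  have "f e = f y \<longleftrightarrow> e = y" using Cons.prems a by (auto simp: inj_on_def)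
  moreover have "inj_on f (insert y (fst ` set p))" using Cons.prems by (rule inj_on_subset) auto
  ultimately show ?case using Cons.IH a by (simp add: lcoef_def)
qed (simp add: lcoef_def)

locale cayley = group G for G (structure) +
  fixes d :: nat and \<gamma> :: "nat \<Rightarrow> 'a" and N :: enat and r :: "nat \<Rightarrow> letter list"
  assumes pres: "is_presentation G d \<gamma> N r"
begin

lemma gen_closed: "i < d \<Longrightarrow> \<gamma> i \<in> carrier G"
  and gen_generate: "generate G (\<gamma> ` {..<d}) = carrier G"
  and rel_words: "enat k < N \<Longrightarrow> r k \<in> words d"
  and word_problem: "u \<in> words d \<Longrightarrow> v \<in> words d \<Longrightarrow>
    word_value G \<gamma> u = word_value G \<gamma> v \<longleftrightarrow> rel_equiv d {r k | k. enat k < N} u v"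
  using pres unfolding is_presentation_def by blast+

abbreviation val where "val \<equiv> word_value G \<gamma>"
abbreviation wpath where "wpath \<equiv> word_path G \<gamma>"

lemma words_simps [simp]:
  "[] \<in> words d" "x # w \<in> words d \<longleftrightarrow> fst x < d \<and> w \<in> words d"
  "u @ v \<in> words d \<longleftrightarrow> u \<in> words d \<and> v \<in> words d"
  by (cases x; auto simp: words_def)+

lemma letter_closed [simp]: "fst x < d \<Longrightarrow> letter_value G \<gamma> x \<in> carrier G"
  by (simp add: letter_value_def gen_closed)

lemma val_closed [simp]: "w \<in> words d \<Longrightarrow> val w \<in> carrier G"
  by (induction w) auto

lemma val_append: "u \<in> words d \<Longrightarrow> v \<in> words d \<Longrightarrow> val (u @ v) = val u \<otimes> val v"
  by (induction u) (auto simp: m_assoc)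

lemma ex_word: "g \<in> carrier G \<Longrightarrow> \<exists>w\<in>words d. val w = g"
  unfolding gen_generate[symmetric]
proof (induction rule: generate.induct)
  case one
  show ?case by (rule bexI[of _ "[]"]) auto
next
  case (incl h)
  then obtain i where "i < d" "h = \<gamma> i" by auto
  then show ?case by (intro bexI[of _ "[(i, True)]"]) (auto simp: letter_value_def gen_closed)
next
  case (inv h)
  then obtain i where "i < d" "h = \<gamma> i" by auto
  then show ?case by (intro bexI[of _ "[(i, False)]"]) (auto simp: letter_value_def gen_closed)
next
  case (eng h1 h2)
  then show ?case using val_append by (metis words_simps(3))
qed

definition wd :: "'a \<Rightarrow> letter list" where
  "wd g = (SOME w. w \<in> words d \<and> val w = g)"

lemma wd: "g \<in> carrier G \<Longrightarrow> wd g \<in> words d" "g \<in> carrier G \<Longrightarrow> val (wd g) = g"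
  using someI_ex[of "\<lambda>w. w \<in> words d \<and> val w = g"] ex_word unfolding wd_def by blast+

lemma wpath_append: "u \<in> words d \<Longrightarrow> v \<in> words d \<Longrightarrow> g \<in> carrier G \<Longrightarrow>
    wpath g (u @ v) = wpath g u @ wpath (g \<otimes> val u) v"
  by (induction u arbitrary: g) (auto simp: Let_def m_assoc)

lemma wpath_translate: "w \<in> words d \<Longrightarrow> g \<in> carrier G \<Longrightarrow> h \<in> carrier G \<Longrightarrow>
    wpath (h \<otimes> g) w = map (\<lambda>(e, b). ((\<lambda>(g, i). (h \<otimes> g, i)) e, b)) (wpath g w)"
  by (induction w arbitrary: g) (auto simp: Let_def m_assoc)

lemma wpath_edges: "w \<in> words d \<Longrightarrow> g \<in> carrier G \<Longrightarrow> fst ` set (wpath g w) \<subseteq> carrier G \<times> {..<d}"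
proof (induction w arbitrary: g)
  case (Cons x w)
  then show ?case using Cons.IH[of "g \<otimes> letter_value G \<gamma> x"] by (cases x) (auto simp: Let_def)
qed simp

text \<open>One family of free spaces for both kinds of cells: \<open>I\<close> is the set of
  generators for edges and a set of relators for 2-cells.\<close>

definition psp :: "nat set \<Rightarrow> ('a, 'a \<times> nat) gspace" where
  "psp I = ((\<lambda>h (g, i). (h \<otimes> g, i)), carrier G \<times> I)"

definition vsp :: "('a, 'a) gspace" where
  "vsp = ((\<lambda>h g. h \<otimes> g), carrier G)"

lemma psp_simps [simp]: "fst (psp I) h (g, i) = (h \<otimes> g, i)" "snd (psp I) = carrier G \<times> I"
  "fst vsp h g = h \<otimes> g" "snd vsp = carrier G"
  by (simp_all add: psp_def vsp_def)

lemma free_psp: "free_gspace (psp I)" and free_vsp: "free_gspace vsp"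
  by (auto simp: free_gspace_def m_assoc)

lemma transversal_psp: "finite I \<Longrightarrow> transversal (psp I) ({\<one>} \<times> I)"
  unfolding transversal_def
  by (auto simp: bij_betw_def inj_on_def image_def)

lemma transversal_vsp: "transversal vsp {\<one>}"
  unfolding transversal_def
  by (auto simp: bij_betw_def inj_on_def image_def)

definition d1ker :: "'a \<times> nat \<Rightarrow> 'a \<Rightarrow> real" where
  "d1ker e v = (if e \<in> carrier G \<times> {..<d} \<and> v \<in> carrier G
     then (if v = fst e \<otimes> \<gamma> (snd e) then 1 else 0) - (if v = fst e then 1 else 0) else 0)"

definition pathker :: "nat set \<Rightarrow> 'a \<times> nat \<Rightarrow> 'a \<times> nat \<Rightarrow> real" where
  "pathker I f e = (if f \<in> carrier G \<times> I then lcoef (wpath (fst f) (r (snd f))) e else 0)"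

lemma eqker_d1: "eqker (psp {..<d}) vsp d1ker"
  unfolding eqker_def
proof (intro conjI allI ballI impI)
  show "finite {v. d1ker e v \<noteq> 0}" for e
    by (rule finite_subset[of _ "{fst e \<otimes> \<gamma> (snd e), fst e}"]) (auto simp: d1ker_def split: if_splits)
  fix g e v assume "g \<in> carrier G" "e \<in> snd (psp {..<d})" "v \<in> snd vsp"
  then show "d1ker (fst (psp {..<d}) g e) (fst vsp g v) = d1ker e v"
    by (cases e) (auto simp: d1ker_def m_assoc left_cancel gen_closed)
qed (auto simp: d1ker_def split: if_splits)

lemma lcoef_translate:
  assumes "w \<in> words d" "g \<in> carrier G" "h \<in> carrier G" "fst e \<in> carrier G"
  shows "lcoef (wpath (h \<otimes> g) w) (fst (psp I) h e) = lcoef (wpath g w) e"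
proof -
  have "inj_on (\<lambda>(g, i). (h \<otimes> g, i)) (insert e (fst ` set (wpath g w)))"
  proof (rule inj_on_subset)
    show "inj_on (\<lambda>(g, i). (h \<otimes> g, i)) (carrier G \<times> UNIV)"
      using assms(3) by (auto simp: inj_on_def left_cancel)
    show "insert e (fst ` set (wpath g w)) \<subseteq> carrier G \<times> UNIV"
      using wpath_edges[OF assms(1,2)] assms(4) by (cases e) auto
  qed
  from lcoef_map[OF this] show ?thesis
    unfolding wpath_translate[OF assms(1,2,3)] by (simp add: psp_def)
qed

lemma eqker_pathker:
  assumes I: "\<And>k. k \<in> I \<Longrightarrow> enat k < N"
  shows "eqker (psp I) (psp {..<d}) (pathker I)"
  unfolding eqker_def
proof (intro conjI allI ballI impI)
  show "f \<in> snd (psp I)" if "pathker I f e \<noteq> 0" for f e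
    using that by (auto simp: pathker_def split: if_splits)
  show "e \<in> snd (psp {..<d})" if nz: "pathker I f e \<noteq> 0" for f e
  proof -
    have f: "f \<in> carrier G \<times> I" "lcoef (wpath (fst f) (r (snd f))) e \<noteq> 0"
      using nz by (auto simp: pathker_def split: if_splits)
    then have "r (snd f) \<in> words d" using I rel_words by auto
    then show ?thesis
      using subsetD[OF wpath_edges[of _ "fst f"] lcoef_nonzero[OF f(2)]] f(1) by (simp add: mem_Times_iff)
  qed
  show "finite {e. pathker I f e \<noteq> 0}" for f
    by (rule finite_subset[OF _ finite_lcoef[of "wpath (fst f) (r (snd f))"]])
      (auto simp: pathker_def split: if_splits)
  fix g f e assume *: "g \<in> carrier G" "f \<in> snd (psp I)" "e \<in> snd (psp {..<d})"
  then have "r (snd f) \<in> words d" using I rel_words by auto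
  then show "pathker I (fst (psp I) g f) (fst (psp {..<d}) g e) = pathker I f e"
    using * lcoef_translate[of "r (snd f)" "fst f" g e "{..<d}"]
    by (cases f) (auto simp: pathker_def)
qed

definition d1 where "d1 = kop d1ker"
definition d1t where "d1t = kop (ktransp d1ker)"
definition d2 where "d2 I = kop (pathker I)"
definition d2t where "d2t I = kop (ktransp (pathker I))"

lemma eqop_d1: "eqop (psp {..<d}) vsp d1 d1t"
  and d1_delta: "g \<in> carrier G \<Longrightarrow> i < d \<Longrightarrow> d1 (delta (g, i)) = delta (g \<otimes> \<gamma> i) - delta g"
proof -
  obtain C C' where b: "bker d1ker C C'"
    using eqker_bker[OF eqker_d1 free_psp free_vsp transversal_psp transversal_vsp] by auto
  show "eqop (psp {..<d}) vsp d1 d1t" unfolding d1_def d1t_def by (rule eqop_kop[OF eqker_d1 b])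
  show "g \<in> carrier G \<Longrightarrow> i < d \<Longrightarrow> d1 (delta (g, i)) = delta (g \<otimes> \<gamma> i) - delta g"
    unfolding d1_def
    by (rule ell2_eqI) (auto simp: coord_kop_delta[OF b] d1ker_def coord_delta gen_closed)
qed

lemma eqop_d2:
  assumes "finite I" and "\<And>k. k \<in> I \<Longrightarrow> enat k < N"
  shows "eqop (psp I) (psp {..<d}) (d2 I) (d2t I)"
    and "g \<in> carrier G \<Longrightarrow> k \<in> I \<Longrightarrow> d2 I (delta (g, k)) = pathv (wpath g (r k))"
    and "f \<notin> carrier G \<times> I \<Longrightarrow> d2 I (delta f) = 0"
proof -
  obtain C C' where b: "bker (pathker I) C C'"
    using eqker_bker[OF eqker_pathker[OF assms(2)] free_psp free_psp transversal_psp[OF assms(1)] transversal_psp] by auto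
  show "eqop (psp I) (psp {..<d}) (d2 I) (d2t I)"
    unfolding d2_def d2t_def by (rule eqop_kop[OF eqker_pathker[OF assms(2)] b])
  show "g \<in> carrier G \<Longrightarrow> k \<in> I \<Longrightarrow> d2 I (delta (g, k)) = pathv (wpath g (r k))"
    "f \<notin> carrier G \<times> I \<Longrightarrow> d2 I (delta f) = 0"
    unfolding d2_def
    by (auto intro!: ell2_eqI simp: coord_kop_delta[OF b] pathker_def coord_pathv)
qed

lemma d1_wpath:
  "w \<in> words d \<Longrightarrow> g \<in> carrier G \<Longrightarrow> d1 (pathv (wpath g w)) = delta (g \<otimes> val w) - delta g"
proof (induction w arbitrary: g)
  case Nil
  then show ?case by (simp add: linear_0[OF eqop_linear(1)[OF eqop_d1]])
next
  case (Cons x w)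
  obtain i b where x: "x = (i, b)" by fastforce
  have i: "i < d" using Cons.prems x by simp
  let ?h = "g \<otimes> letter_value G \<gamma> x"
  have h: "?h \<in> carrier G" using Cons.prems by simp
  have "d1 (pathv (wpath ?h w)) = delta (?h \<otimes> val w) - delta ?h"
    using Cons.IH[OF _ h] Cons.prems by simp
  moreover have "?h \<otimes> val w = g \<otimes> val (x # w)" using Cons.prems by (simp add: m_assoc)
  moreover have "d1 (if b then delta (g, i) else - delta (?h, i)) = delta ?h - delta g"
    using d1_delta[OF Cons.prems(2) i] d1_delta[OF h i] Cons.prems i x
    by (auto simp: letter_value_def linear_neg[OF eqop_linear(1)[OF eqop_d1]] m_assoc gen_closed)
  ultimately show ?case
    by (auto simp: Let_def x linear_add[OF eqop_linear(1)[OF eqop_d1]])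
qed

lemma rel_val: "enat k < N \<Longrightarrow> val (r k) = \<one>"
proof -
  assume k: "enat k < N"
  have "rel_equiv d {r k | k. enat k < N} ([] @ r k @ []) ([] @ [])"
    by (rule rel_equiv.relator) (use k in auto)
  then show ?thesis using word_problem[of "r k" "[]"] rel_words[OF k] by simp
qed

text \<open>A derivation uses finitely many relators. Here equality in the group is traded for a
  finite stage; the form with all larger \<open>j\<close> lets derivations of different stages be
  joined.\<close>

lemma rel_equiv_finite:
  "rel_equiv d {r k | k. enat k < N} u v \<Longrightarrow> \<exists>j0. \<forall>j\<ge>j0. rel_equiv d {r k | k. k < j \<and> enat k < N} u v"
proof (induction rule: rel_equiv.induct)
  case (trans u v w)
  then obtain j1 j2 where j1: "\<forall>j\<ge>j1. rel_equiv d {r k | k. k < j \<and> enat k < N} u v"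
    and j2: "\<forall>j\<ge>j2. rel_equiv d {r k | k. k < j \<and> enat k < N} v w" by blast
  have "\<forall>j\<ge>max j1 j2. rel_equiv d {r k | k. k < j \<and> enat k < N} u w"
  proof (intro allI impI)
    fix j assume "max j1 j2 \<le> j"
    then show "rel_equiv d {r k | k. k < j \<and> enat k < N} u w"
      using j1 j2 by (intro rel_equiv.trans[of d _ u v w]) auto
  qed
  then show ?case by blast
next
  case (relator u v w)
  then obtain k where "w = r k" "enat k < N" by blast
  then show ?case using relator by (intro exI[of _ "Suc k"]) (auto intro!: rel_equiv.relator)
next
  case (refl w)
  then show ?case by (blast intro: rel_equiv.refl)
next
  case (sym v w)
  then show ?case by (blast intro: rel_equiv.sym)
next
  case (cancel u v x)
  then show ?case by (blast intro: rel_equiv.cancel)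
qed

definition rels :: "nat \<Rightarrow> nat set" where "rels j = {k. k < j \<and> enat k < N}"

lemma finite_rels [simp]: "finite (rels j)" by (simp add: rels_def)
lemma relsD: "k \<in> rels j \<Longrightarrow> enat k < N" by (simp add: rels_def)

text \<open>Van Kampen's lemma for chains, by induction on the derivation: inserting a letter
  followed by its inverse leaves the chain of the path unchanged, and inserting a relator adds the
  boundary of one translated 2-cell.\<close>

lemma path_difference_in_span:
  assumes "rel_equiv d {r k | k. k < j \<and> enat k < N} u v"
  shows "g \<in> carrier G \<Longrightarrow>
    pathv (wpath g u) - pathv (wpath g v) \<in> span (range (\<lambda>f. d2 (rels j) (delta f)))"
  using assms
proof (induction arbitrary: g rule: rel_equiv.induct)
  case (refl w)
  then show ?case by (simp add: span_zero)
next
  case (sym v w)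
  then show ?case using span_neg[OF sym.IH[OF sym.prems]] by simp
next
  case (trans u v w)
  then show ?case using span_add[OF trans.IH(1)[OF trans.prems] trans.IH(2)[OF trans.prems]] by simp
next
  case (cancel u v x)
  have x: "fst x < d" using cancel by simp
  have h: "g \<otimes> val u \<in> carrier G" using cancel by simp
  have "pathv (wpath (g \<otimes> val u) [x, inv_letter x]) = 0"
    using x h by (cases "snd x") (auto simp: Let_def inv_letter_def letter_value_def m_assoc gen_closed)
  moreover have "val [x, inv_letter x] = \<one>"
    using x by (cases "snd x") (auto simp: inv_letter_def letter_value_def gen_closed)
  moreover have "[x, inv_letter x] \<in> words d" using x by (simp add: inv_letter_def)
  ultimately have "pathv (wpath (g \<otimes> val u) ([x, inv_letter x] @ v)) = pathv (wpath (g \<otimes> val u) v)"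
    using wpath_append[of "[x, inv_letter x]" v "g \<otimes> val u"] cancel h by simp
  moreover have "pathv (wpath g (u @ ([x, inv_letter x] @ v)))
    = pathv (wpath g u) + pathv (wpath (g \<otimes> val u) ([x, inv_letter x] @ v))"
    using wpath_append[of u "[x, inv_letter x] @ v" g] cancel \<open>[x, inv_letter x] \<in> words d\<close> by simp
  ultimately show ?case
    using wpath_append[of u v g] cancel by (simp add: span_zero)
next
  case (relator u v w)
  then obtain k where k: "w = r k" "k \<in> rels j" by (auto simp: rels_def)
  then have w: "w \<in> words d" "val w = \<one>" using rel_words rel_val relsD by auto
  have h: "g \<otimes> val u \<in> carrier G" using relator by simp
  have "pathv (wpath g (u @ w @ v)) - pathv (wpath g (u @ v)) = pathv (wpath (g \<otimes> val u) w)"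
    using wpath_append[of u "w @ v" g] wpath_append[of u v g] wpath_append[of w v "g \<otimes> val u"] w h relator
    by simp
  also have "\<dots> = d2 (rels j) (delta (g \<otimes> val u, k))"
    using eqop_d2(2)[OF finite_rels relsD h k(2)] k(1) by simp
  finally show ?case by (simp add: span_base)
qed

text \<open>Attaching paths are closed because relators have value 1.\<close>

lemma d1_d2: "d1 (d2 (rels j) u) = 0"
proof (rule bounded_linear_eq_on_delta[of "\<lambda>u. d1 (d2 (rels j) u)" "\<lambda>u. 0"])
  note D2 = eqop_d2[OF finite_rels[of j] relsD]
  show "bounded_linear (\<lambda>u. d1 (d2 (rels j) u))"
    by (rule bounded_linear_compose[OF eqopD(1)[OF eqop_d1] eqopD(1)[OF D2(1)]])
  fix f show "d1 (d2 (rels j) (delta f)) = 0"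
  proof (cases "f \<in> carrier G \<times> rels j")
    case True
    then obtain g k where f: "f = (g, k)" "g \<in> carrier G" "k \<in> rels j" by auto
    then show ?thesis using d1_wpath[OF rel_words[OF relsD[OF f(3)]] f(2)] rel_val[OF relsD[OF f(3)]]
      by (simp add: D2(2))
  next
    case False
    then show ?thesis using D2(3)[where f = f] by (simp add: linear_0[OF eqop_linear(1)[OF eqop_d1]])
  qed
qed simp

end

section \<open>Comparison of the Cayley complex with \<open>EG\<close>\<close>

context group
begin

lemma bd_delta:
  assumes K: "cocompact_subcomplex G K" and \<sigma>: "\<sigma> \<in> simplices K (Suc p)"
  shows "bd K p (delta \<sigma>) = (\<Sum>i<length \<sigma>. (- 1) ^ i *\<^sub>R delta (omit i \<sigma>))"
proof (rule ell2_eqI)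
  fix \<tau>
  have om: "omit i \<sigma> \<in> simplices K p" if "i < length \<sigma>" for i
    using cocompactD(2)[OF K, of \<sigma> i] length_omit[OF that] \<sigma> that by (auto simp: simplices_def)
  have "coord (\<Sum>i<length \<sigma>. (- 1) ^ i *\<^sub>R delta (omit i \<sigma>)) \<tau>
    = (\<Sum>i<length \<sigma>. if omit i \<sigma> = \<tau> then (- 1) ^ i else 0)"
    by (auto simp: coord_delta intro!: sum.cong)
  also have "\<dots> = (\<Sum>i\<in>{i \<in> {..<length \<sigma>}. omit i \<sigma> = \<tau>}. (- 1) ^ i)"
    by (rule sum.inter_filter[symmetric]) simp
  also have "\<dots> = bdker K p \<sigma> \<tau>"
  proof (cases "\<tau> \<in> simplices K p")
    case True
    then show ?thesis using \<sigma> by (simp add: bdker_def)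
  next
    case False
    then have "{i \<in> {..<length \<sigma>}. omit i \<sigma> = \<tau>} = {}" using om by auto
    then show ?thesis using False by (simp only: bdker_def sum.empty) simp
  qed
  finally show "coord (bd K p (delta \<sigma>)) \<tau> = coord (\<Sum>i<length \<sigma>. (- 1) ^ i *\<^sub>R delta (omit i \<sigma>)) \<tau>"
    by (simp add: coord_bd(2)[OF K])
qed

lemma bd_delta_other:
  assumes K: "cocompact_subcomplex G K" and \<sigma>: "\<sigma> \<notin> simplices K (Suc p)"
  shows "bd K p (delta \<sigma>) = 0"
  by (rule ell2_eqI) (use \<sigma> in \<open>simp add: coord_bd(2)[OF K] bdker_def\<close>)

lemma bd_edge: "cocompact_subcomplex G K \<Longrightarrow> [a, b] \<in> K \<Longrightarrow> bd K 0 (delta [a, b]) = delta [b] - delta [a]"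
  by (subst bd_delta) (auto simp: simplices_def omit_def lessThan_Suc)

lemma bd_triangle: "cocompact_subcomplex G K \<Longrightarrow> [a, b, c] \<in> K \<Longrightarrow>
    bd K 1 (delta [a, b, c]) = delta [b, c] - delta [a, c] + delta [a, b]"
  by (subst bd_delta) (auto simp: simplices_def omit_def lessThan_Suc numeral_3_eq_3)

lemma simplices_1E:
  assumes "\<sigma> \<in> simplices K 1" obtains a b where "\<sigma> = [a, b]" "[a, b] \<in> K"
  using assms by (auto simp: simplices_def length_Suc_conv)

lemma simplices_2E:
  assumes "\<sigma> \<in> simplices K (Suc 1)" obtains a b c where "\<sigma> = [a, b, c]" "[a, b, c] \<in> K"
  using assms by (auto simp: simplices_def length_Suc_conv)

lemma triangle_edges:
  assumes K: "cocompact_subcomplex G K" and t: "[a, b, c] \<in> K"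
  shows "[b, c] \<in> K" "[a, c] \<in> K" "[a, b] \<in> K"
  using cocompactD(2)[OF K t, of 0] cocompactD(2)[OF K t, of 1] cocompactD(2)[OF K t, of 2]
  by (auto simp: omit_def)

lemma bd_bd:
  assumes K: "cocompact_subcomplex G K"
  shows "bd K 0 (bd K 1 u) = 0"
proof (rule bounded_linear_eq_on_delta[of "\<lambda>u. bd K 0 (bd K 1 u)" "\<lambda>u. 0"])
  note l = eqop_linear(1)[OF eqop_bd[OF K, of 0]]
  show "bounded_linear (\<lambda>u. bd K 0 (bd K 1 u))"
    by (rule bounded_linear_compose[OF eqopD(1)[OF eqop_bd[OF K]] eqopD(1)[OF eqop_bd[OF K]]])
  fix \<sigma> show "bd K 0 (bd K 1 (delta \<sigma>)) = 0"
  proof (cases "\<sigma> \<in> simplices K (Suc 1)")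
    case True
    then obtain a b c where s: "\<sigma> = [a, b, c]" "[a, b, c] \<in> K" by (rule simplices_2E)
    show ?thesis
      unfolding s(1) bd_triangle[OF K s(2)] linear_add[OF l] linear_diff[OF l]
      by (simp add: bd_edge[OF K] triangle_edges[OF K s(2)])
  next
    case False
    then show ?thesis using bd_delta_other[OF K False] by (simp add: linear_0[OF l])
  qed
qed simp

text \<open>A Rips-type complex, cut off at \<open>m\<close> entries. Nearness is measured by the
  left-invariant ratios \<open>inv a \<otimes> b\<close>, which makes the set invariant under the
  group.\<close>

definition near :: "nat \<Rightarrow> 'a set \<Rightarrow> 'a list set" where
  "near m B = {\<tau>. \<tau> \<noteq> [] \<and> length \<tau> \<le> m \<and> set \<tau> \<subseteq> carrier G \<and> (\<forall>a\<in>set \<tau>. \<forall>b\<in>set \<tau>. inv a \<otimes> b \<in> B)}"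

lemma ratio_translate:
  "g \<in> carrier G \<Longrightarrow> a \<in> carrier G \<Longrightarrow> b \<in> carrier G \<Longrightarrow> inv (g \<otimes> a) \<otimes> (g \<otimes> b) = inv a \<otimes> b"
  by (simp add: inv_mult_group m_assoc) (simp flip: m_assoc)

lemma orbit_tuple_act:
  assumes g: "g \<in> carrier G" and \<rho>: "set \<rho> \<subseteq> carrier G"
  shows "orbit G (tuple_act G) (tuple_act G g \<rho>) = orbit G (tuple_act G) \<rho>"
proof -
  have c: "tuple_act G h (tuple_act G k \<rho>) = tuple_act G (h \<otimes> k) \<rho>" if "h \<in> carrier G" "k \<in> carrier G" for h k
    using \<rho> that by (auto simp: tuple_act_def m_assoc)
  show ?thesis
  proof
    show "orbit G (tuple_act G) (tuple_act G g \<rho>) \<subseteq> orbit G (tuple_act G) \<rho>"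
      unfolding orbit_def using c g by auto
    show "orbit G (tuple_act G) \<rho> \<subseteq> orbit G (tuple_act G) (tuple_act G g \<rho>)"
    proof
      fix x assume "x \<in> orbit G (tuple_act G) \<rho>"
      then obtain h where h: "h \<in> carrier G" "x = tuple_act G h \<rho>" unfolding orbit_def by blast
      then have "x = tuple_act G (h \<otimes> inv g) (tuple_act G g \<rho>)" using c g by (simp add: m_assoc)
      then show "x \<in> orbit G (tuple_act G) (tuple_act G g \<rho>)" unfolding orbit_def using h g by blast
    qed
  qed
qed

text \<open>Translating its first entry to the identity moves a tuple into the lists over
  \<open>B\<close> of length at most \<open>m\<close>, and these are finitely many.\<close>

lemma cocompact_near:
  assumes B: "finite B"
  shows "cocompact_subcomplex G (near m B)"
  unfolding cocompact_subcomplex_def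
proof (intro conjI ballI allI impI)
  show "near m B \<subseteq> lists (carrier G) - {[]}" unfolding near_def by auto
  show "omit i \<sigma> \<in> near m B" if "\<sigma> \<in> near m B" "i < length \<sigma>" "2 \<le> length \<sigma>" for \<sigma> i
  proof -
    have "omit i \<sigma> \<noteq> []" using length_omit[OF that(2)] that(3) by auto
    moreover have "length (omit i \<sigma>) \<le> m" using length_omit[OF that(2)] that(1) by (auto simp: near_def)
    ultimately show ?thesis using that(1) set_omit[of i \<sigma>] unfolding near_def by blast
  qed
  show "tuple_act G g \<sigma> \<in> near m B" if "g \<in> carrier G" "\<sigma> \<in> near m B" for g \<sigma>
    using that by (auto simp: near_def tuple_act_def ratio_translate subset_iff)
  have "orbits G (near m B) (tuple_act G)
    \<subseteq> (\<lambda>\<rho>. orbit G (tuple_act G) \<rho>) ` {\<rho>. set \<rho> \<subseteq> B \<and> length \<rho> \<le> m}"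
  proof
    fix Q assume "Q \<in> orbits G (near m B) (tuple_act G)"
    then obtain \<tau> where \<tau>: "\<tau> \<in> near m B" "Q = orbit G (tuple_act G) \<tau>" unfolding orbits_def by blast
    have hd: "hd \<tau> \<in> set \<tau>" "hd \<tau> \<in> carrier G" and c: "set \<tau> \<subseteq> carrier G"
      using \<tau>(1) by (auto simp: near_def)
    let ?\<rho> = "tuple_act G (inv (hd \<tau>)) \<tau>"
    have "set ?\<rho> \<subseteq> B" "length ?\<rho> \<le> m" using \<tau>(1) hd by (auto simp: near_def tuple_act_def)
    moreover have "Q = orbit G (tuple_act G) ?\<rho>"
      unfolding \<tau>(2) by (rule orbit_tuple_act[symmetric]) (use hd c in auto)
    ultimately show "Q \<in> (\<lambda>\<rho>. orbit G (tuple_act G) \<rho>) ` {\<rho>. set \<rho> \<subseteq> B \<and> length \<rho> \<le> m}" by blast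
  qed
  then show "finite (orbits G (near m B) (tuple_act G))"
    using finite_lists_length_le[OF B, of m] by (rule finite_subset[OF _ finite_imageI])
qed

lemma cocompact_Un:
  assumes "cocompact_subcomplex G K" "cocompact_subcomplex G K'"
  shows "cocompact_subcomplex G (K \<union> K')"
proof -
  have "orbits G (K \<union> K') (tuple_act G) = orbits G K (tuple_act G) \<union> orbits G K' (tuple_act G)"
    unfolding orbits_def by auto
  then show ?thesis using assms unfolding cocompact_subcomplex_def by (auto simp: ball_Un)
qed

definition ratios :: "'a list set \<Rightarrow> 'a set" where
  "ratios K = {inv a \<otimes> b | a b \<sigma>. \<sigma> \<in> K \<and> a \<in> set \<sigma> \<and> b \<in> set \<sigma>}"

text \<open>Ratios do not change under translation, so one representative per orbit already yields
  all of them.\<close>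

lemma finite_ratios:
  assumes K: "cocompact_subcomplex G K"
  shows "finite (ratios K)"
proof (rule finite_subset)
  let ?S = "\<lambda>Q. set (SOME \<sigma>. \<sigma> \<in> Q)"
  show "finite (\<Union>Q\<in>orbits G K (tuple_act G). (\<lambda>(a, b). inv a \<otimes> b) ` (?S Q \<times> ?S Q))"
    using cocompactD(4)[OF K] by auto
  show "ratios K \<subseteq> (\<Union>Q\<in>orbits G K (tuple_act G). (\<lambda>(a, b). inv a \<otimes> b) ` (?S Q \<times> ?S Q))"
  proof
    fix x assume "x \<in> ratios K"
    then obtain a b \<sigma> where x: "x = inv a \<otimes> b" "\<sigma> \<in> K" "a \<in> set \<sigma>" "b \<in> set \<sigma>" unfolding ratios_def by blast
    have c: "set \<sigma> \<subseteq> carrier G" using cocompactD(1)[OF K x(2)] by blast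
    let ?Q = "orbit G (tuple_act G) \<sigma>"
    have "tuple_act G \<one> \<sigma> = \<sigma>" using c by (auto simp: tuple_act_def intro!: map_idI)
    then have "\<sigma> \<in> ?Q" unfolding orbit_def using one_closed by (metis (mono_tags, lifting) mem_Collect_eq)
    then have "(SOME \<sigma>. \<sigma> \<in> ?Q) \<in> ?Q" by (rule someI)
    then obtain g where g: "g \<in> carrier G" "(SOME \<sigma>. \<sigma> \<in> ?Q) = tuple_act G g \<sigma>" unfolding orbit_def by blast
    have "x = inv (g \<otimes> a) \<otimes> (g \<otimes> b)" using x c g by (simp add: ratio_translate subset_iff)
    moreover have "g \<otimes> a \<in> ?S ?Q" "g \<otimes> b \<in> ?S ?Q" unfolding g(2) tuple_act_def using x by auto
    ultimately have "x \<in> (\<lambda>(a, b). inv a \<otimes> b) ` (?S ?Q \<times> ?S ?Q)"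
      by (intro image_eqI[of _ _ "(g \<otimes> a, g \<otimes> b)"]) auto
    moreover have "?Q \<in> orbits G K (tuple_act G)" unfolding orbits_def using x(2) by blast
    ultimately show "x \<in> (\<Union>Q\<in>orbits G K (tuple_act G). (\<lambda>(a, b). inv a \<otimes> b) ` (?S Q \<times> ?S Q))" by blast
  qed
qed

lemma ratios_closed: "cocompact_subcomplex G K \<Longrightarrow> x \<in> ratios K \<Longrightarrow> x \<in> carrier G"
  unfolding ratios_def using cocompactD(1) by (blast intro: m_closed inv_closed)

end

section \<open>Vertices of paths, the comparison maps and the filling of paths\<close>

context cayley
begin

primrec pverts :: "'a \<Rightarrow> letter list \<Rightarrow> 'a set" where
  "pverts g [] = {g}"
| "pverts g (x # w) = insert g (pverts (g \<otimes> letter_value G \<gamma> x) w)"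

lemma finite_pverts: "finite (pverts g w)"
  by (induction w arbitrary: g) auto

lemma start_pverts: "g \<in> pverts g w"
  by (cases w) auto

lemma end_pverts: "w \<in> words d \<Longrightarrow> g \<in> carrier G \<Longrightarrow> g \<otimes> val w \<in> pverts g w"
proof (induction w arbitrary: g)
  case (Cons x w)
  then show ?case using Cons.IH[of "g \<otimes> letter_value G \<gamma> x"] by (auto simp: m_assoc)
qed simp

lemma pverts_translate: "w \<in> words d \<Longrightarrow> g \<in> carrier G \<Longrightarrow> h \<in> carrier G \<Longrightarrow>
    pverts (h \<otimes> g) w = (\<lambda>x. h \<otimes> x) ` pverts g w"
proof (induction w arbitrary: g)
  case (Cons x w)
  then show ?case using Cons.IH[of "g \<otimes> letter_value G \<gamma> x"] by (simp add: m_assoc)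
qed simp

lemma pverts_closed: "w \<in> words d \<Longrightarrow> g \<in> carrier G \<Longrightarrow> pverts g w \<subseteq> carrier G"
  by (induction w arbitrary: g) auto

definition wratios :: "letter list set \<Rightarrow> 'a set" where
  "wratios W = (\<Union>w\<in>W. (\<lambda>(a, b). inv a \<otimes> b) ` (pverts \<one> w \<times> pverts \<one> w))"

lemma finite_wratios: "finite W \<Longrightarrow> finite (wratios W)"
  unfolding wratios_def by (auto simp: finite_pverts)

text \<open>The purpose of \<open>wratios\<close>: short tuples of vertices on a path labelled by a
  word of \<open>W\<close> are simplices, wherever the path starts. The triangles that fill such a
  path are of this kind.\<close>

lemma near_wratios:
  assumes "w \<in> W" "w \<in> words d" "g \<in> carrier G" "set \<tau> \<subseteq> pverts g w" "\<tau> \<noteq> []" "length \<tau> \<le> m"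
  shows "\<tau> \<in> near m (wratios W)"
proof -
  have p: "pverts g w = (\<lambda>x. g \<otimes> x) ` pverts \<one> w"
    using pverts_translate[OF assms(2) one_closed assms(3)] assms(3) by simp
  have "inv a \<otimes> b \<in> wratios W" if ab: "a \<in> set \<tau>" "b \<in> set \<tau>" for a b
  proof -
    obtain a' b' where *: "a' \<in> pverts \<one> w" "b' \<in> pverts \<one> w" "a = g \<otimes> a'" "b = g \<otimes> b'"
      using ab assms(4) unfolding p by blast
    then have "inv a \<otimes> b = inv a' \<otimes> b'"
      using ratio_translate[OF assms(3), of a' b'] pverts_closed[OF assms(2) one_closed] by blast
    moreover have "inv a' \<otimes> b' \<in> (\<lambda>(a, b). inv a \<otimes> b) ` (pverts \<one> w \<times> pverts \<one> w)"
      by (intro image_eqI[of _ _ "(a', b')"]) (use * in auto)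
    ultimately show ?thesis unfolding wratios_def using UN_I[OF assms(1)] by simp
  qed
  moreover have "set \<tau> \<subseteq> carrier G" using assms(4) pverts_closed[OF assms(2,3)] by blast
  ultimately show ?thesis using assms(5,6) unfolding near_def by blast
qed

text \<open>The maps \<open>ps\<close> and \<open>ph\<close> below are mutually inverse up to homotopy: \<open>ps\<close> regards an edge as a
  1-simplex, \<open>ph\<close> replaces a 1-simplex \<open>[a, b]\<close> by the edge path from \<open>a\<close> labelled by a chosen word
  for \<open>a\<^sup>-\<^sup>1 b\<close>.\<close>

definition edgeker :: "'a \<times> nat \<Rightarrow> 'a list \<Rightarrow> real" where
  "edgeker e \<tau> = (if e \<in> carrier G \<times> {..<d} \<and> \<tau> = [fst e, fst e \<otimes> \<gamma> (snd e)] then 1 else 0)"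

definition skel :: "'a list set \<Rightarrow> bool" where
  "skel K \<longleftrightarrow> (\<forall>g\<in>carrier G. \<forall>i<d. [g, g \<otimes> \<gamma> i] \<in> K)"

lemma eqker_edgeker:
  assumes K: "cocompact_subcomplex G K" and s: "skel K"
  shows "eqker (psp {..<d}) (ksp K 1) edgeker"
  unfolding eqker_def
proof (intro conjI allI ballI impI)
  show "finite {\<tau>. edgeker e \<tau> \<noteq> 0}" for e
    by (rule finite_subset[of _ "{[fst e, fst e \<otimes> \<gamma> (snd e)]}"]) (auto simp: edgeker_def split: if_splits)
  fix g e \<tau> assume *: "g \<in> carrier G" "e \<in> snd (psp {..<d})" "\<tau> \<in> snd (ksp K 1)"
  then obtain h i where e: "e = (h, i)" "h \<in> carrier G" "i < d" by auto
  have "\<tau> \<in> simplices K 1" using * by simp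
  then obtain a b where t: "\<tau> = [a, b]" "[a, b] \<in> K" by (rule simplices_1E)
  then have "a \<in> carrier G" "b \<in> carrier G" using cocompactD(1)[OF K] by force+
  then show "edgeker (fst (psp {..<d}) g e) (fst (ksp K 1) g \<tau>) = edgeker e \<tau>"
    using e * by (simp add: edgeker_def t tuple_act_def left_cancel gen_closed m_assoc)
qed (use s in \<open>auto simp: edgeker_def skel_def simplices_def split: if_splits\<close>)

definition ps where "ps = kop edgeker"
definition pst where "pst = kop (ktransp edgeker)"

lemma eqop_ps:
  assumes K: "cocompact_subcomplex G K" and s: "skel K"
  shows "eqop (psp {..<d}) (ksp K 1) ps pst"
    and "g \<in> carrier G \<Longrightarrow> i < d \<Longrightarrow> ps (delta (g, i)) = delta [g, g \<otimes> \<gamma> i]"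
    and "e \<notin> carrier G \<times> {..<d} \<Longrightarrow> ps (delta e) = 0"
proof -
  obtain C C' where b: "bker edgeker C C'"
    using eqker_bker[OF eqker_edgeker[OF K s] free_psp free_ksp[OF K] transversal_psp transversal_ksp[OF K]] by auto
  show "eqop (psp {..<d}) (ksp K 1) ps pst" unfolding ps_def pst_def by (rule eqop_kop[OF eqker_edgeker[OF K s] b])
  show "g \<in> carrier G \<Longrightarrow> i < d \<Longrightarrow> ps (delta (g, i)) = delta [g, g \<otimes> \<gamma> i]"
    "e \<notin> carrier G \<times> {..<d} \<Longrightarrow> ps (delta e) = 0"
    unfolding ps_def by (auto intro!: ell2_eqI simp: coord_kop_delta[OF b] edgeker_def coord_delta)
qed

text \<open>The label depends on the two end points only through their ratio, which makes the kernel
  equivariant although the words are chosen arbitrarily.\<close>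

definition wordker :: "'a list set \<Rightarrow> 'a list \<Rightarrow> 'a \<times> nat \<Rightarrow> real" where
  "wordker K \<sigma> e = (if \<sigma> \<in> simplices K 1 then lcoef (wpath (\<sigma> ! 0) (wd (inv (\<sigma> ! 0) \<otimes> \<sigma> ! 1))) e else 0)"

lemma eqker_wordker:
  assumes K: "cocompact_subcomplex G K"
  shows "eqker (ksp K 1) (psp {..<d}) (wordker K)"
  unfolding eqker_def
proof (intro conjI allI ballI impI)
  have pt: "\<exists>a b. \<sigma> = [a, b] \<and> a \<in> carrier G \<and> b \<in> carrier G \<and> wd (inv a \<otimes> b) \<in> words d"
    if "\<sigma> \<in> simplices K 1" for \<sigma>
  proof -
    obtain a b where s: "\<sigma> = [a, b]" "[a, b] \<in> K" using \<open>\<sigma> \<in> simplices K 1\<close> by (rule simplices_1E)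
    then have "a \<in> carrier G" "b \<in> carrier G" using cocompactD(1)[OF K] by force+
    then show ?thesis using s wd by simp
  qed
  show "\<sigma> \<in> snd (ksp K 1)" if "wordker K \<sigma> e \<noteq> 0" for \<sigma> e
    using that by (auto simp: wordker_def split: if_splits)
  show "e \<in> snd (psp {..<d})" if nz: "wordker K \<sigma> e \<noteq> 0" for \<sigma> e
  proof -
    have s: "\<sigma> \<in> simplices K 1" "lcoef (wpath (\<sigma> ! 0) (wd (inv (\<sigma> ! 0) \<otimes> \<sigma> ! 1))) e \<noteq> 0"
      using nz by (auto simp: wordker_def split: if_splits)
    obtain a b where ab: "\<sigma> = [a, b]" "a \<in> carrier G" "wd (inv a \<otimes> b) \<in> words d" using pt[OF s(1)] by blast
    show ?thesis
      using subsetD[OF wpath_edges[OF ab(3,2)], of e] lcoef_nonzero[of "wpath a (wd (inv a \<otimes> b))" e] s(2) ab(1) by simp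
  qed
  show "finite {e. wordker K \<sigma> e \<noteq> 0}" for \<sigma>
    by (rule finite_subset[OF _ finite_lcoef[of "wpath (\<sigma> ! 0) (wd (inv (\<sigma> ! 0) \<otimes> \<sigma> ! 1))"]])
      (auto simp: wordker_def split: if_splits)
  fix g \<sigma> e assume *: "g \<in> carrier G" "\<sigma> \<in> snd (ksp K 1)" "e \<in> snd (psp {..<d})"
  then obtain a b where ab: "\<sigma> = [a, b]" "a \<in> carrier G" "b \<in> carrier G" "wd (inv a \<otimes> b) \<in> words d"
    using pt[of \<sigma>] by auto
  have "fst (ksp K 1) g \<sigma> \<in> simplices K 1" using free_gspaceD(1)[OF free_ksp[OF K] *(2,1)] by simp
  then show "wordker K (fst (ksp K 1) g \<sigma>) (fst (psp {..<d}) g e) = wordker K \<sigma> e"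
    using lcoef_translate[OF ab(4,2) *(1), of e "{..<d}"] * ab
    by (auto simp: wordker_def tuple_act_def ratio_translate)
qed

definition ph where "ph K = kop (wordker K)"
definition pht where "pht K = kop (ktransp (wordker K))"

lemma eqop_ph:
  assumes K: "cocompact_subcomplex G K"
  shows "eqop (ksp K 1) (psp {..<d}) (ph K) (pht K)"
    and "[a, b] \<in> K \<Longrightarrow> ph K (delta [a, b]) = pathv (wpath a (wd (inv a \<otimes> b)))"
    and "\<sigma> \<notin> simplices K 1 \<Longrightarrow> ph K (delta \<sigma>) = 0"
proof -
  obtain C C' where b: "bker (wordker K) C C'"
    using eqker_bker[OF eqker_wordker[OF K] free_ksp[OF K] free_psp transversal_ksp[OF K] transversal_psp] by auto
  show "eqop (ksp K 1) (psp {..<d}) (ph K) (pht K)"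
    unfolding ph_def pht_def by (rule eqop_kop[OF eqker_wordker[OF K] b])
  show "[a, b] \<in> K \<Longrightarrow> ph K (delta [a, b]) = pathv (wpath a (wd (inv a \<otimes> b)))"
    unfolding ph_def by (rule ell2_eqI) (simp add: coord_kop_delta[OF b] wordker_def coord_pathv simplices_def)
  show "\<sigma> \<notin> simplices K 1 \<Longrightarrow> ph K (delta \<sigma>) = 0"
    unfolding ph_def by (rule ell2_eqI) (simp add: coord_kop_delta[OF b] wordker_def)
qed

definition vertker :: "'a list set \<Rightarrow> 'a \<Rightarrow> 'a list \<Rightarrow> real" where
  "vertker K g \<tau> = (if g \<in> carrier G \<and> \<tau> = [g] \<and> \<tau> \<in> K then 1 else 0)"

lemma eqker_vertker:
  assumes K: "cocompact_subcomplex G K"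
  shows "eqker vsp (ksp K 0) (vertker K)"
  unfolding eqker_def
proof (intro conjI allI ballI impI)
  show "finite {\<tau>. vertker K g \<tau> \<noteq> 0}" for g
    by (rule finite_subset[of _ "{[g]}"]) (auto simp: vertker_def split: if_splits)
  fix g h \<tau> assume *: "g \<in> carrier G" "h \<in> snd vsp" "\<tau> \<in> snd (ksp K 0)"
  then obtain a where t: "\<tau> = [a]" "[a] \<in> K" by (auto simp: simplices_def length_Suc_conv)
  then have "a \<in> carrier G" using cocompactD(1)[OF K] by force
  then show "vertker K (fst vsp g h) (fst (ksp K 0) g \<tau>) = vertker K h \<tau>"
    using * t cocompactD(3)[OF K *(1) t(2)] by (simp add: vertker_def tuple_act_def left_cancel)
qed (auto simp: vertker_def simplices_def split: if_splits)

definition vi where "vi K = kop (vertker K)"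
definition vit where "vit K = kop (ktransp (vertker K))"

lemma eqop_vi:
  assumes K: "cocompact_subcomplex G K"
  shows "eqop vsp (ksp K 0) (vi K) (vit K)"
    and "[g] \<in> K \<Longrightarrow> vi K (delta g) = delta [g]" and "[g] \<in> K \<Longrightarrow> vit K (delta [g]) = delta g"
proof -
  obtain C C' where b: "bker (vertker K) C C'"
    using eqker_bker[OF eqker_vertker[OF K] free_vsp free_ksp[OF K] transversal_vsp transversal_ksp[OF K]] by auto
  show "eqop vsp (ksp K 0) (vi K) (vit K)"
    unfolding vi_def vit_def by (rule eqop_kop[OF eqker_vertker[OF K] b])
  have "g \<in> carrier G" if "[g] \<in> K" using cocompactD(1)[OF K that] by simp
  then show "[g] \<in> K \<Longrightarrow> vi K (delta g) = delta [g]" "[g] \<in> K \<Longrightarrow> vit K (delta [g]) = delta g"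
    unfolding vi_def vit_def
    by (auto intro!: ell2_eqI simp: coord_kop_delta[OF b] coord_kop_delta[OF bker_transp[OF b]] vertker_def ktransp_def coord_delta)
qed

lemma edge_verts:
  assumes K: "cocompact_subcomplex G K" and e: "[a, b] \<in> K"
  shows "[a] \<in> K" "[b] \<in> K" "a \<in> carrier G" "b \<in> carrier G"
  using cocompactD(1)[OF K e] cocompactD(2)[OF K e, of 0] cocompactD(2)[OF K e, of 1] by (auto simp: omit_def)

text \<open>The chain map property of \<open>ph\<close> in degree 1: the path chosen for
  \<open>[a, b]\<close> does end in \<open>b\<close>.\<close>

lemma d1_ph:
  assumes K: "cocompact_subcomplex G K"
  shows "d1 (ph K u) = vit K (bd K 0 u)"
proof (rule bounded_linear_eq_on_delta[of "\<lambda>u. d1 (ph K u)" "\<lambda>u. vit K (bd K 0 u)"])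
  show "bounded_linear (\<lambda>u. d1 (ph K u))"
    by (rule bounded_linear_compose[OF eqopD(1)[OF eqop_d1] eqopD(1)[OF eqop_ph(1)[OF K]]])
  show "bounded_linear (\<lambda>u. vit K (bd K 0 u))"
    by (rule bounded_linear_compose[OF eqopD(2)[OF eqop_vi(1)[OF K]] eqopD(1)[OF eqop_bd[OF K]]])
  fix \<sigma> show "d1 (ph K (delta \<sigma>)) = vit K (bd K 0 (delta \<sigma>))"
  proof (cases "\<sigma> \<in> simplices K 1")
    case True
    then obtain a b where s: "\<sigma> = [a, b]" "[a, b] \<in> K" by (rule simplices_1E)
    note v = edge_verts[OF K s(2)]
    have "a \<otimes> (inv a \<otimes> b) = b" using v by (simp flip: m_assoc)
    then show ?thesis
      using d1_wpath[OF wd(1) v(3), of "inv a \<otimes> b"] wd(2)[of "inv a \<otimes> b"] v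
      by (simp add: s(1) eqop_ph(2)[OF K s(2)] bd_edge[OF K s(2)] eqop_vi(3)[OF K]
          linear_diff[OF eqop_linear(2)[OF eqop_vi(1)[OF K]]])
  next
    case False
    then show ?thesis
      using bd_delta_other[OF K, of \<sigma> 0] eqop_ph(3)[OF K False]
      by (simp add: linear_0[OF eqop_linear(1)[OF eqop_d1]] linear_0[OF eqop_linear(2)[OF eqop_vi(1)[OF K]]])
  qed
qed

lemma bd_ps:
  assumes K: "cocompact_subcomplex G K" and s: "skel K" and that: "supp_on (carrier G \<times> {..<d}) u"
  shows "bd K 0 (ps u) = vi K (d1 u)"
proof -
  let ?A = "\<lambda>u. bd K 0 (ps u) - vi K (d1 u)"
  have A: "bounded_linear ?A"
    by (intro bounded_linear_sub bounded_linear_compose[OF eqopD(1)[OF eqop_bd[OF K]] eqopD(1)[OF eqop_ps(1)[OF K s]]]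
        bounded_linear_compose[OF eqopD(1)[OF eqop_vi(1)[OF K]] eqopD(1)[OF eqop_d1]])
  have z: "?A (delta e) = 0" if e: "e \<in> carrier G \<times> {..<d}" for e
  proof -
    obtain g i where gi: "e = (g, i)" "g \<in> carrier G" "i < d" using e by auto
    have ed: "[g, g \<otimes> \<gamma> i] \<in> K" using s gi unfolding skel_def by blast
    show ?thesis
      using edge_verts[OF K ed] gi
      by (simp add: eqop_ps(2)[OF K s] bd_edge[OF K ed] d1_delta linear_diff[OF eqop_linear(1)[OF eqop_vi(1)[OF K]]] eqop_vi(2)[OF K])
  qed
  \<comment> \<open>Used with the zero operator as \<open>B\<close>: basis vectors in the support
    are sent to 0, so \<open>?A u\<close> is orthogonal to every vector, itself included.\<close>
  have "inner (?A u) (?A u) = 0"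
    by (rule span_range_orthogonal[OF A eqop_zero[of vsp "ksp K 0"] _ _ that])
      (simp_all add: z real_vector.span_zero)
  then show ?thesis by simp
qed

text \<open>The path is coned off to its end point, one triangle per letter, with the end point as
  last vertex. \<open>V\<close> stays fixed in the induction because the remaining paths keep their
  vertices in it.\<close>

lemma path_filling:
  assumes K: "cocompact_subcomplex G K" and s: "skel K"
  shows "w \<in> words d \<Longrightarrow> g \<in> carrier G \<Longrightarrow> pverts g w \<subseteq> V \<Longrightarrow> \<forall>a\<in>V. \<forall>b\<in>V. \<forall>c\<in>V. [a, b, c] \<in> K \<Longrightarrow>
    ps (pathv (wpath g w)) - delta [g, g \<otimes> val w] \<in> span (range (\<lambda>\<sigma>. bd K 1 (delta \<sigma>)))"
proof (induction w arbitrary: g)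
  case Nil
  \<comment> \<open>The degenerate triangle bounds the degenerate edge, as two of its three faces
    cancel.\<close>
  then have "[g, g, g] \<in> K" by simp
  then have "delta [g, g] = bd K 1 (delta [g, g, g])" using bd_triangle[OF K] by simp
  then have "delta [g, g] \<in> span (range (\<lambda>\<sigma>. bd K 1 (delta \<sigma>)))" by (metis rangeI span_base)
  then show ?case using Nil span_neg by (simp add: linear_0[OF eqop_linear(1)[OF eqop_ps(1)[OF K s]]])
next
  case (Cons x w)
  obtain i b where x: "x = (i, b)" by fastforce
  have i: "i < d" using Cons.prems x by simp
  let ?h = "g \<otimes> letter_value G \<gamma> x"
  let ?t = "?h \<otimes> val w"
  note l = eqop_linear(1)[OF eqop_ps(1)[OF K s]]
  have h: "?h \<in> carrier G" using Cons.prems by simp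
  have t: "?t = g \<otimes> val (x # w)" using Cons.prems by (simp add: m_assoc)
  have V: "g \<in> V" "?h \<in> V" "?t \<in> V"
    using Cons.prems start_pverts[of ?h w] end_pverts[OF _ h, of w] by auto
  let ?S = "span (range (\<lambda>\<sigma>. bd K 1 (delta \<sigma>)))"
  have IH: "ps (pathv (wpath ?h w)) - delta [?h, ?t] \<in> ?S"
    by (rule Cons.IH) (use Cons.prems h in auto)
  show ?case
  proof (cases b)
    case True
    have "[g, ?h, ?t] \<in> K" using Cons.prems(4) V by blast
    then have m1: "delta [?h, ?t] - delta [g, ?t] + delta [g, ?h] \<in> ?S"
      using bd_triangle[OF K] by (metis rangeI span_base)
    have "?h = g \<otimes> \<gamma> i" using x True by (simp add: letter_value_def)
    then have m2: "ps (pathv (wpath g (x # w))) = delta [g, ?h] + ps (pathv (wpath ?h w))"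
      using eqop_ps(2)[OF K s Cons.prems(2) i] True x by (simp add: Let_def linear_add[OF l])
    have m3: "ps (pathv (wpath g (x # w))) - delta [g, ?t]
      = (ps (pathv (wpath ?h w)) - delta [?h, ?t]) + (delta [?h, ?t] - delta [g, ?t] + delta [g, ?h])"
      unfolding m2 by simp
    show ?thesis unfolding t[symmetric] m3 by (rule span_add[OF IH m1])
  next
    case False
    \<comment> \<open>For an inverse letter the edge runs from \<open>?h\<close> to
      \<open>g\<close>, so the triangle starts in \<open>?h\<close> and enters with the opposite
      sign.\<close>
    have "[?h, g, ?t] \<in> K" using Cons.prems(4) V by blast
    then have m1: "delta [g, ?t] - delta [?h, ?t] + delta [?h, g] \<in> ?S"
      using bd_triangle[OF K] by (metis rangeI span_base)
    have "?h \<otimes> \<gamma> i = g"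
      using x False i Cons.prems by (simp add: letter_value_def m_assoc gen_closed)
    then have m2: "ps (pathv (wpath g (x # w))) = - delta [?h, g] + ps (pathv (wpath ?h w))"
      using eqop_ps(2)[OF K s h i] False x by (simp add: Let_def linear_diff[OF l])
    have m3: "ps (pathv (wpath g (x # w))) - delta [g, ?t]
      = (ps (pathv (wpath ?h w)) - delta [?h, ?t]) - (delta [g, ?t] - delta [?h, ?t] + delta [?h, g])"
      unfolding m2 by simp
    show ?thesis unfolding t[symmetric] m3 by (rule span_diff[OF IH m1])
  qed
qed

end

section \<open>The two trace inequalities and the limit over the relators\<close>

context cayley
begin

lemma ratiosI: "\<sigma> \<in> K \<Longrightarrow> a \<in> set \<sigma> \<Longrightarrow> b \<in> set \<sigma> \<Longrightarrow> inv a \<otimes> b \<in> ratios K"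
  unfolding ratios_def by blast

text \<open>The harmonic projection of the \<open>j\<close>-th subcomplex is fixed by its
  properties, so that the comparison with EG does not depend on how it is constructed.\<close>

definition harm :: "nat \<Rightarrow> (('a \<times> nat) ell2 \<Rightarrow> ('a \<times> nat) ell2) \<Rightarrow> bool" where
  "harm j P \<longleftrightarrow> eqop (psp {..<d}) (psp {..<d}) P P \<and> (\<forall>u. P (P u) = P u) \<and>
     (\<forall>u. P u = u \<longleftrightarrow> d1 u = 0 \<and> d2t (rels j) u = 0)"

lemma harmD:
  assumes "harm j P"
  shows "eqop (psp {..<d}) (psp {..<d}) P P" "P (P u) = P u" "P u = u \<longleftrightarrow> d1 u = 0 \<and> d2t (rels j) u = 0"
  using assms unfolding harm_def by blast+

definition edgewords :: "letter list set" where
  "edgewords = (\<lambda>i. [(i, True)]) ` {..<d}"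

lemma skel_near:
  assumes "edgewords \<subseteq> W" "2 \<le> m"
  shows "skel (near m (wratios W))"
  unfolding skel_def
proof (intro ballI allI impI)
  fix g i assume *: "g \<in> carrier G" "i < d"
  show "[g, g \<otimes> \<gamma> i] \<in> near m (wratios W)"
    by (rule near_wratios[of "[(i, True)]" _ g]) (use * assms in \<open>auto simp: edgewords_def letter_value_def\<close>)
qed

text \<open>\<open>K'\<close> is \<open>K\<close> with enough triangles to fill three kinds of
  paths: edges of the Cayley graph, so that \<open>ps\<close> maps into \<open>K'\<close>; the
  relators of stage \<open>j\<close>, so that \<open>ps\<close> sends boundaries to boundaries; and
  the words chosen for the edges of \<open>K\<close>, so that the inclusion of \<open>K\<close> is
  homotopic to \<open>ps\<close> after \<open>ph\<close>.\<close>

lemma trace_image_le_harmonic: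
  assumes K: "cocompact_subcomplex G K" and P: "harm j Pj"
  obtains K' where "cocompact_subcomplex G K'" "K \<subseteq> K'"
    "vn_dim G (tuple_act G) (simplices K' 1) (l2_homology_image K K' 1)
      \<le> (\<Sum>x\<in>{\<one>} \<times> {..<d}. coord (Pj (delta x)) x)"
proof -
  define W where "W = edgewords \<union> r ` rels j \<union> wd ` ratios K"
  define K' where "K' = K \<union> near 3 (wratios W)"
  have W: "finite W" "W \<subseteq> words d"
    using finite_ratios[OF K] ratios_closed[OF K] wd(1) relsD rel_words
    by (auto simp: W_def edgewords_def)
  have cn: "cocompact_subcomplex G (near 3 (wratios W))" by (rule cocompact_near[OF finite_wratios[OF W(1)]])
  have K': "cocompact_subcomplex G K'" unfolding K'_def by (rule cocompact_Un[OF K cn])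
  have KK': "K \<subseteq> K'" unfolding K'_def by simp
  have sk: "skel K'" using skel_near[of W 3] unfolding W_def K'_def skel_def by auto
  have fill: "ps (pathv (wpath g w)) - delta [g, g \<otimes> val w] \<in> span (range (\<lambda>\<sigma>. bd K' 1 (delta \<sigma>)))"
    if "w \<in> W" "g \<in> carrier G" for w g
  proof (rule path_filling[OF K' sk _ that(2) subset_refl])
    show w: "w \<in> words d" using that W by blast
    show "\<forall>a\<in>pverts g w. \<forall>b\<in>pverts g w. \<forall>c\<in>pverts g w. [a, b, c] \<in> K'"
      unfolding K'_def using near_wratios[OF that(1) w that(2), of "[_, _, _]" 3] by auto
  qed
  note f1 = free_ksp[OF K', of 1] and fp = free_psp[of "{..<d}"] and D2 = eqop_d2[OF finite_rels[of j] relsD]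
  have B2: "eqop (ksp K' 2) (ksp K' 1) (bd K' 1) (cobd K' 1)"
    using eqop_bd[OF K', of 1] by (simp add: numeral_2_eq_2)
  obtain P P' J J' Q z where
    PK: "eqop (ksp K 1) (ksp K 1) P P" "\<And>u. P u = u \<longleftrightarrow> bd K 0 u = 0 \<and> cobd K 1 u = 0" "\<And>u. P (P u) = P u"
    and P': "eqop (ksp K' 1) (ksp K' 1) P' P'" "\<And>u. P' u = u \<longleftrightarrow> bd K' 0 u = 0 \<and> cobd K' 1 u = 0" "\<And>u. P' (P' u) = P' u"
    and J: "eqop (ksp K 1) (ksp K' 1) J J'" "\<And>u. supp_on (simplices K 1) u \<Longrightarrow> J u = u"
    and Q: "eqop (ksp K' 1) (ksp K' 1) Q Q" "\<And>u. Q (Q u) = Q u" "\<And>u. Q (P' (J (P u))) = P' (J (P u))"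
      "\<And>y. (\<lambda>k. P' (J (P (z y k)))) \<longlonglongrightarrow> Q y"
      "\<And>y k. supp_on (simplices K' 1) y \<Longrightarrow> supp_on (simplices K 1) (z y k)"
    and dim: "vn_dim G (tuple_act G) (simplices K' 1) (l2_homology_image K K' 1)
      = (\<Sum>x\<in>orbit_reps (ksp K' 1). coord (Q (delta x)) x)"
    apply (rule l2_homology_image_projection[OF K K' KK'])
    subgoal premises prems for P P' J J' Q z by (rule that[of P P' J J' Q z]; fact prems)
    done
  note eps = eqop_ps(1)[OF K' sk] and eph = eqop_ph(1)[OF K]
  have cobP': "cobd K' 1 (P' y) = 0" for y using P'(2,3) by metis
  have psd2: "ps (d2 (rels j) (delta f)) \<in> span (range (\<lambda>\<sigma>. bd K' 1 (delta \<sigma>)))" for f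
  proof (cases "f \<in> carrier G \<times> rels j")
    case True
    then obtain g k where f: "f = (g, k)" "g \<in> carrier G" "k \<in> rels j" by auto
    have w: "r k \<in> W" using f by (auto simp: W_def)
    \<comment> \<open>A relator is a loop, so its filling leaves the degenerate edge
      \<open>[g, g]\<close>, which bounds a degenerate triangle.\<close>
    have "[g, g, g] \<in> K'"
      unfolding K'_def using near_wratios[OF w _ f(2), of "[g, g, g]" 3] start_pverts W(2) w by auto
    then have "delta [g, g] = bd K' 1 (delta [g, g, g])" using bd_triangle[OF K'] by simp
    then have "delta [g, g] \<in> span (range (\<lambda>\<sigma>. bd K' 1 (delta \<sigma>)))" by (metis rangeI span_base)
    from span_add[OF fill[OF w f(2)] this] show ?thesis
      using f rel_val[OF relsD[OF f(3)]] by (simp add: D2(2))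
  next
    case False
    then show ?thesis
      using D2(3)[where f = f] by (simp add: linear_0[OF eqop_linear(1)[OF eps]] real_vector.span_zero)
  qed
  \<comment> \<open>The dual form of \<open>psd2\<close>, as required by
    \<open>harmonic_part_chain_map\<close>.\<close>
  have d2pst: "d2t (rels j) (pst (P' x)) = 0" for x
  proof -
    have "inner (ps (d2 (rels j) u)) (P' x) = 0" for u
      by (rule span_range_orthogonal[where X = UNIV, OF bounded_linear_compose[OF eqopD(1)[OF eps] eqopD(1)[OF D2(1)]] B2 cobP'])
        (use psd2 in \<open>auto simp: supp_on_def\<close>)
    from this[of "d2t (rels j) (pst (P' x))"]
    have "inner (d2t (rels j) (pst (P' x))) (d2t (rels j) (pst (P' x))) = 0"
      by (simp add: eqopD(3)[OF eps] eqopD(3)[OF D2(1)])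
    then show ?thesis by simp
  qed
  \<comment> \<open>On each edge of \<open>K\<close> the difference is a combination of boundaries
    of \<open>K'\<close>, and \<open>P'\<close> annihilates boundaries.\<close>
  have homotopy: "P' (J u) = P' (ps (ph K u))" if u: "supp_on (simplices K 1) u" for u
  proof -
    let ?A = "\<lambda>u. u - ps (ph K u)"
    have "inner (?A u) (P' y) = 0" for y
    proof (rule span_range_orthogonal[OF _ B2 cobP' _ u])
      show "bounded_linear ?A"
        by (rule bounded_linear_sub[OF bounded_linear_ident bounded_linear_compose[OF eqopD(1)[OF eps] eqopD(1)[OF eph]]])
      fix \<sigma> assume "\<sigma> \<in> simplices K 1"
      then obtain a b where s: "\<sigma> = [a, b]" "[a, b] \<in> K" by (rule simplices_1E)
      note v = edge_verts[OF K s(2)]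
      have rt: "inv a \<otimes> b \<in> ratios K"
        using ratiosI[OF s(2), of a b] by simp
      have ab: "a \<otimes> (inv a \<otimes> b) = b" using v by (simp flip: m_assoc)
      have "ps (pathv (wpath a (wd (inv a \<otimes> b)))) - delta [a, b] \<in> span (range (\<lambda>\<sigma>. bd K' 1 (delta \<sigma>)))"
        using fill[of "wd (inv a \<otimes> b)" a] rt v wd(2)[of "inv a \<otimes> b"] ab by (simp add: W_def)
      from span_neg[OF this] show "?A (delta \<sigma>) \<in> span (range (\<lambda>\<sigma>. bd K' 1 (delta \<sigma>)))"
        by (simp add: s(1) eqop_ph(2)[OF K s(2)])
    qed
    from this[of "?A u"] have "inner (P' (?A u)) (P' (?A u)) = 0"
      using eqopD(3)[OF P'(1), of "?A u" "P' (?A u)"] by (simp add: P'(3))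
    then have "P' (?A u) = 0" by simp
    then show ?thesis by (simp add: J(2)[OF u] linear_diff[OF eqop_linear(1)[OF P'(1)]])
  qed
  define A where "A u = Q (P' (ps (Pj u)))" for u
  define A' where "A' u = Pj (pst (P' (Q u)))" for u
  have A: "eqop (psp {..<d}) (ksp K' 1) A A'"
    unfolding A_def[abs_def] A'_def[abs_def]
    by (rule eqop_comp[OF eqop_comp[OF eqop_comp[OF harmD(1)[OF P] eps fp fp] P'(1) fp f1] Q(1) fp f1])
  \<comment> \<open>Such a \<open>y\<close> is orthogonal to the range of \<open>P' J P\<close>: the
    homotopy routes this map through \<open>ph\<close> and \<open>ps\<close>, a cycle may be
    replaced by its harmonic part in between, and what remains is a pairing with
    \<open>A' y\<close>. As \<open>Q y = y\<close> is a limit of that range, \<open>y\<close> is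
    0.\<close>
  have main: "y = 0" if y: "supp_on (snd (ksp K' 1)) y" "Q y = y" "A' y = 0" for y
  proof -
    have "inner y (P' (J (P u))) = 0" if u: "supp_on (simplices K 1) u" for u
    proof -
      have Pu: "supp_on (simplices K 1) (P u)" using eqop_supp_on[OF PK(1), of u] u by simp
      have c: "bd K 0 (P u) = 0" using PK(2,3) by metis
      have "d1 (ph K (P u)) = 0"
        by (simp add: d1_ph[OF K] c linear_0[OF eqop_linear(2)[OF eqop_vi(1)[OF K]]])
      then have "P' (ps (ph K (P u))) = P' (ps (Pj (ph K (P u))))"
        by (intro harmonic_part_chain_map[OF eqop_d1 D2(1) d1_d2 fp free_psp harmD[OF P] eps P'(1) d2pst])
      then have "inner y (P' (J (P u))) = inner (P' (ps (Pj (ph K (P u))))) y"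
        by (simp add: homotopy[OF Pu] inner_commute)
      also have "\<dots> = inner (ph K (P u)) (A' y)"
        by (simp add: eqopD(3)[OF P'(1)] eqopD(3)[OF eps] eqopD(3)[OF harmD(1)[OF P]] A'_def y(2))
      finally show ?thesis by (simp add: y(3))
    qed
    then have "inner y (P' (J (P (z y k)))) = 0" for k using Q(5)[of y k] y(1) by simp
    moreover have "(\<lambda>k. inner y (P' (J (P (z y k))))) \<longlonglongrightarrow> inner y (Q y)"
      by (intro tendsto_intros Q(4))
    ultimately have "inner y y = 0" by (simp add: LIMSEQ_const_iff y(2))
    then show ?thesis by simp
  qed
  have "(\<Sum>x\<in>orbit_reps (ksp K' 1). coord (Q (delta x)) x) \<le> (\<Sum>x\<in>{\<one>} \<times> {..<d}. coord (Pj (delta x)) x)"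
    by (rule trace_proj_le[OF A harmD(1)[OF P] Q(1) harmD(2)[OF P] Q(2) _ _ main fp transversal_psp f1 transversal_ksp[OF K']])
      (simp_all add: A_def harmD(2)[OF P] Q(2))
  then show thesis using that[OF K'] dim by (simp add: K'_def)
qed

text \<open>One \<open>K\<close>, the Cayley graph with reversed and degenerate edges added, serves
  for all \<open>K'\<close>. Given \<open>K'\<close>, the stage \<open>j\<close> has to be so large
  that \<open>ph\<close> sends boundaries of triangles to boundaries and that \<open>ph\<close>
  after \<open>ps\<close> is homotopic to the identity.\<close>

lemma harmonic_le_trace_image:
  obtains K where "cocompact_subcomplex G K"
    "\<And>K'. cocompact_subcomplex G K' \<Longrightarrow> K \<subseteq> K' \<Longrightarrow> \<exists>j0. \<forall>j\<ge>j0. \<forall>Pj. harm j Pj \<longrightarrow>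
      (\<Sum>x\<in>{\<one>} \<times> {..<d}. coord (Pj (delta x)) x)
        \<le> vn_dim G (tuple_act G) (simplices K' 1) (l2_homology_image K K' 1)"
proof -
  \<comment> \<open>With at most two entries per tuple, \<open>K\<close> has no triangles, so all
    its 1-cycles are harmonic.\<close>
  define K where "K = near 2 (wratios edgewords)"
  have K: "cocompact_subcomplex G K"
    unfolding K_def by (rule cocompact_near[OF finite_wratios]) (simp add: edgewords_def)
  have skK: "skel K" unfolding K_def by (rule skel_near) auto
  have main: "\<exists>j0. \<forall>j\<ge>j0. \<forall>Pj. harm j Pj \<longrightarrow>
      (\<Sum>x\<in>{\<one>} \<times> {..<d}. coord (Pj (delta x)) x)
        \<le> vn_dim G (tuple_act G) (simplices K' 1) (l2_homology_image K K' 1)"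
    if K': "cocompact_subcomplex G K'" and sub: "K \<subseteq> K'" for K'
  proof -
    have sk: "skel K'" using skK sub unfolding skel_def by blast
    \<comment> \<open>The identities between words that must follow from the first \<open>j\<close>
      relators: the product rule along the triangles of \<open>K'\<close>, and agreement of the word
      chosen for a generator with that generator.\<close>
    define E where "E = (\<lambda>(a, b). (wd a @ wd b, wd (a \<otimes> b))) ` (ratios K' \<times> ratios K') \<union>
      (\<lambda>i. (wd (\<gamma> i), [(i, True)])) ` {..<d}"
    have fE: "finite E" unfolding E_def using finite_ratios[OF K'] by auto
    have "\<exists>j0. \<forall>j\<ge>j0. rel_equiv d {r k | k. k < j \<and> enat k < N} (fst p) (snd p)" if "p \<in> E" for p
    proof (rule rel_equiv_finite)
      have "fst p \<in> words d" "snd p \<in> words d" "val (fst p) = val (snd p)"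
        using that ratios_closed[OF K']
        by (auto simp: E_def wd val_append gen_closed letter_value_def)
      then show "rel_equiv d {r k | k. enat k < N} (fst p) (snd p)" using word_problem by blast
    qed
    then have "\<forall>p\<in>E. \<exists>j0. \<forall>j\<ge>j0. rel_equiv d {r k | k. k < j \<and> enat k < N} (fst p) (snd p)" by simp
    from bchoice[OF this] obtain J0
      where J0: "\<forall>p\<in>E. \<forall>j\<ge>J0 p. rel_equiv d {r k | k. k < j \<and> enat k < N} (fst p) (snd p)" ..
    \<comment> \<open>The element \<open>0\<close> keeps the maximum meaningful when
      \<open>E\<close> is empty.\<close>
    define j0 where "j0 = Max (insert 0 (J0 ` E))"
    have rel: "rel_equiv d {r k | k. k < j \<and> enat k < N} u v" if "(u, v) \<in> E" "j \<ge> j0" for u v j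
    proof -
      have "J0 (u, v) \<le> j0" unfolding j0_def using fE that by (intro Max_ge) auto
      then show ?thesis using bspec[OF J0 that(1)] that(2) by simp
    qed
    show ?thesis
    proof (intro exI[of _ j0] allI impI)
      fix j Pj assume j: "j0 \<le> j" and P: "harm j Pj"
      note f1 = free_ksp[OF K', of 1] and fp = free_psp[of "{..<d}"] and D2 = eqop_d2[OF finite_rels[of j] relsD]
      obtain P P' J J' Q z where
        PK: "eqop (ksp K 1) (ksp K 1) P P" "\<And>u. P u = u \<longleftrightarrow> bd K 0 u = 0 \<and> cobd K 1 u = 0" "\<And>u. P (P u) = P u"
        and P': "eqop (ksp K' 1) (ksp K' 1) P' P'" "\<And>u. P' u = u \<longleftrightarrow> bd K' 0 u = 0 \<and> cobd K' 1 u = 0" "\<And>u. P' (P' u) = P' u"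
        and J: "eqop (ksp K 1) (ksp K' 1) J J'" "\<And>u. supp_on (simplices K 1) u \<Longrightarrow> J u = u"
        and Q: "eqop (ksp K' 1) (ksp K' 1) Q Q" "\<And>u. Q (Q u) = Q u" "\<And>u. Q (P' (J (P u))) = P' (J (P u))"
          "\<And>y. (\<lambda>k. P' (J (P (z y k)))) \<longlonglongrightarrow> Q y"
          "\<And>y k. supp_on (simplices K' 1) y \<Longrightarrow> supp_on (simplices K 1) (z y k)"
        and dim: "vn_dim G (tuple_act G) (simplices K' 1) (l2_homology_image K K' 1)
          = (\<Sum>x\<in>orbit_reps (ksp K' 1). coord (Q (delta x)) x)"
        apply (rule l2_homology_image_projection[OF K K' sub])
        subgoal premises prems for P P' J J' Q z by (rule that[of P P' J J' Q z]; fact prems)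
        done
      note eps = eqop_ps(1)[OF K' sk] and eph = eqop_ph(1)[OF K']
      have lph: "linear (ph K')" by (rule eqop_linear(1)[OF eph])
      have d2P: "d2t (rels j) (Pj y) = 0" for y using harmD(2,3)[OF P] by metis
      let ?S = "span (range (\<lambda>f. d2 (rels j) (delta f)))"
      \<comment> \<open>The boundary of a triangle goes to the path of a concatenation of two words
        minus the path of the word for the product, and \<open>E\<close> contains this pair.\<close>
      have phbd: "ph K' (bd K' 1 (delta \<sigma>)) \<in> ?S" for \<sigma>
      proof (cases "\<sigma> \<in> simplices K' (Suc 1)")
        case True
        then obtain a b c where s: "\<sigma> = [a, b, c]" "[a, b, c] \<in> K'" by (rule simplices_2E)
        note t = triangle_edges[OF K' s(2)]
        have v: "a \<in> carrier G" "b \<in> carrier G" "c \<in> carrier G"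
          using edge_verts[OF K' t(3)] edge_verts[OF K' t(1)] by auto
        have rt: "inv a \<otimes> b \<in> ratios K'" "inv b \<otimes> c \<in> ratios K'"
          using ratiosI[OF s(2), of a b] ratiosI[OF s(2), of b c] by simp_all
        have m: "(inv a \<otimes> b) \<otimes> (inv b \<otimes> c) = inv a \<otimes> c"
          using v by (simp add: m_assoc) (simp flip: m_assoc)
        have "(wd (inv a \<otimes> b) @ wd (inv b \<otimes> c), wd (inv a \<otimes> c)) \<in> E"
          unfolding E_def using rt m by (intro UnI1 image_eqI[of _ _ "(inv a \<otimes> b, inv b \<otimes> c)"]) auto
        from path_difference_in_span[OF rel[OF this j] v(1)]
        have "pathv (wpath a (wd (inv a \<otimes> b) @ wd (inv b \<otimes> c))) - pathv (wpath a (wd (inv a \<otimes> c))) \<in> ?S" .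
        moreover have "a \<otimes> (inv a \<otimes> b) = b" using v by (simp flip: m_assoc)
        ultimately show ?thesis
          using v wpath_append[OF wd(1) wd(1), of "inv a \<otimes> b" "inv b \<otimes> c" a]
          unfolding s(1) bd_triangle[OF K' s(2)] linear_add[OF lph] linear_diff[OF lph]
          by (simp add: eqop_ph(2)[OF K'] t wd algebra_simps)
      next
        case False
        then show ?thesis using bd_delta_other[OF K' False] by (simp add: linear_0[OF lph] real_vector.span_zero)
      qed
      have cobph: "cobd K' 1 (pht K' (Pj x)) = 0" for x
      proof -
        have "inner (ph K' (bd K' 1 u)) (Pj x) = 0" for u
          by (rule span_range_orthogonal[where X = UNIV, OF bounded_linear_compose[OF eqopD(1)[OF eph] eqopD(1)[OF eqop_bd[OF K']]] D2(1) d2P])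
            (use phbd in \<open>auto simp: supp_on_def\<close>)
        from this[of "cobd K' 1 (pht K' (Pj x))"]
        have "inner (cobd K' 1 (pht K' (Pj x))) (cobd K' 1 (pht K' (Pj x))) = 0"
          by (simp add: eqopD(3)[OF eph] eqopD(3)[OF eqop_bd[OF K']])
        then show ?thesis by simp
      qed
      have homotopy: "Pj (ph K' (ps y)) = Pj y" if y: "supp_on (carrier G \<times> {..<d}) y" for y
      proof -
        let ?A = "\<lambda>y. ph K' (ps y) - y"
        have "inner (?A y) (Pj x) = 0" for x
        proof (rule span_range_orthogonal[OF _ D2(1) d2P _ y])
          show "bounded_linear ?A"
            by (rule bounded_linear_sub[OF bounded_linear_compose[OF eqopD(1)[OF eph] eqopD(1)[OF eps]] bounded_linear_ident])
          fix e assume "e \<in> carrier G \<times> {..<d}"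
          then obtain g i where e: "e = (g, i)" "g \<in> carrier G" "i < d" by auto
          have ed: "[g, g \<otimes> \<gamma> i] \<in> K'" using sk e unfolding skel_def by blast
          have "inv g \<otimes> (g \<otimes> \<gamma> i) = \<gamma> i" using e gen_closed by (simp flip: m_assoc)
          moreover have "(wd (\<gamma> i), [(i, True)]) \<in> E" unfolding E_def using e by blast
          from path_difference_in_span[OF rel[OF this j] e(2)]
          have "pathv (wpath g (wd (\<gamma> i))) - delta (g, i) \<in> ?S" by (simp add: Let_def)
          ultimately show "?A (delta e) \<in> ?S"
            using e by (simp add: eqop_ps(2)[OF K' sk] eqop_ph(2)[OF K' ed])
        qed
        from this[of "?A y"] have "inner (Pj (?A y)) (Pj (?A y)) = 0"
          using eqopD(3)[OF harmD(1)[OF P], of "?A y" "Pj (?A y)"] by (simp add: harmD(2)[OF P])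
        then have "Pj (?A y) = 0" by simp
        then show ?thesis by (simp add: linear_diff[OF eqop_linear(1)[OF harmD(1)[OF P]]])
      qed
      define A where "A u = Pj (ph K' (Q u))" for u
      define A' where "A' u = Q (pht K' (Pj u))" for u
      have A: "eqop (ksp K' 1) (psp {..<d}) A A'"
        unfolding A_def[abs_def] A'_def[abs_def]
        by (rule eqop_comp[OF eqop_comp[OF Q(1) eph f1 f1] harmD(1)[OF P] f1 fp])
      \<comment> \<open>For harmonic \<open>y\<close>, \<open>ps y\<close> is a cycle, hence
        harmonic in \<open>K\<close>, so its harmonic part in \<open>K'\<close> lies in the range of
        \<open>Q\<close>. Passing to that part does not change the image under \<open>Pj\<close>
        after \<open>ph\<close>, which is \<open>y\<close> by the homotopy. So
        \<open>inner y y\<close> becomes a pairing with \<open>A' y\<close>.\<close>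
      have inj: "y = 0" if y: "supp_on (snd (psp {..<d})) y" "Pj y = y" "A' y = 0" for y
      proof -
        have ys: "supp_on (carrier G \<times> {..<d}) y" using y(1) by simp
        have d1y: "d1 y = 0" using y(2) harmD(3)[OF P] by blast
        have bK: "bd K 0 (ps y) = 0" and bK': "bd K' 0 (ps y) = 0"
          using bd_ps[OF K skK ys] bd_ps[OF K' sk ys] d1y
          by (simp_all add: linear_0[OF eqop_linear(1)[OF eqop_vi(1)]] K K')
        have "cobd K 1 u = 0" for u
        proof (rule ell2_eqI)
          fix \<sigma>
          have "\<sigma> \<notin> simplices K (Suc 1)" by (auto simp: K_def near_def simplices_def)
          from bd_delta_other[OF K this] have "inner u (bd K 1 (delta \<sigma>)) = 0" by simp
          then show "coord (cobd K 1 u) \<sigma> = coord 0 \<sigma>"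
            using eqopD(3)[OF eqop_adjoint[OF eqop_bd[OF K, of 1]], of u "delta \<sigma>"] by simp
        qed
        then have Pps: "P (ps y) = ps y" using PK(2) bK by blast
        have sps: "supp_on (simplices K 1) (ps y)"
          using eqop_supp_on[OF eqop_ps(1)[OF K skK], of y] ys by simp
        have Qm: "Q (P' (ps y)) = P' (ps y)" using Q(3)[of "ps y"] by (simp add: Pps J(2)[OF sps])
        have "Pj (ph K' (ps y)) = Pj (ph K' (P' (ps y)))"
          by (rule harmonic_part_chain_map[OF eqop_bd[OF K', of 0, folded One_nat_def] eqop_bd[OF K', of 1] bd_bd[OF K'] f1
                free_ksp[OF K'] P'(1,3,2) eph harmD(1)[OF P] cobph bK'])
        then have "inner y y = inner (Pj (ph K' (P' (ps y)))) y"
          using homotopy[OF ys] y(2) by simp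
        also have "\<dots> = inner (Q (P' (ps y))) (pht K' (Pj y))"
          by (simp add: eqopD(3)[OF eph] eqopD(3)[OF harmD(1)[OF P]] Qm)
        also have "\<dots> = inner (P' (ps y)) (A' y)" by (simp add: eqopD(3)[OF Q(1)] A'_def)
        finally show ?thesis using y(3) by simp
      qed
      have "(\<Sum>x\<in>{\<one>} \<times> {..<d}. coord (Pj (delta x)) x) \<le> (\<Sum>x\<in>orbit_reps (ksp K' 1). coord (Q (delta x)) x)"
        by (rule trace_proj_le[OF A Q(1) harmD(1)[OF P] Q(2) harmD(2)[OF P] _ _ inj f1 transversal_ksp[OF K'] fp transversal_psp])
          (simp_all add: A_def harmD(2)[OF P] Q(2))
      then show "(\<Sum>x\<in>{\<one>} \<times> {..<d}. coord (Pj (delta x)) x)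
        \<le> vn_dim G (tuple_act G) (simplices K' 1) (l2_homology_image K K' 1)" by (simp only: dim)
    qed
  qed
  show thesis by (rule that[OF K main])
qed

text \<open>The Betti number is at most every \<open>l j\<close>. Conversely, for the
  \<open>K\<close> of the preceding lemma and any \<open>K'\<close>, eventually \<open>l j\<close>
  is at most the term of \<open>K'\<close>; so a number above the infimum over \<open>K'\<close> is
  eventually above \<open>l j\<close>.\<close>

lemma harmonic_traces_tendsto_l2_betti:
  assumes P: "\<And>j. harm j (P j)"
  shows "(\<lambda>j. ereal (\<Sum>x\<in>{\<one>} \<times> {..<d}. coord (P j (delta x)) x)) \<longlonglongrightarrow> l2_betti G 1"
proof -
  define l where "l j = (\<Sum>x\<in>{\<one>} \<times> {..<d}. coord (P j (delta x)) x)" for j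
  define D where "D K K' = vn_dim G (tuple_act G) (simplices K' 1) (l2_homology_image K K' 1)" for K K'
  define L where "L K = (INF K'\<in>{K'. cocompact_subcomplex G K' \<and> K \<subseteq> K'}. ereal (D K K'))" for K
  have betti: "l2_betti G 1 = (SUP K\<in>Collect (cocompact_subcomplex G). L K)"
    unfolding l2_betti_def L_def D_def ..
  have upper: "l2_betti G 1 \<le> ereal (l j)" for j
    unfolding betti
  proof (rule SUP_least)
    fix K assume "K \<in> Collect (cocompact_subcomplex G)"
    then have K: "cocompact_subcomplex G K" by simp
    obtain K' where "cocompact_subcomplex G K'" "K \<subseteq> K'" "D K K' \<le> l j"
      using trace_image_le_harmonic[OF K P[of j]] unfolding D_def l_def by blast
    then show "L K \<le> ereal (l j)" unfolding L_def by (intro INF_lower2[of K']) auto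
  qed
  obtain K where K: "cocompact_subcomplex G K"
    and low: "\<And>K'. cocompact_subcomplex G K' \<Longrightarrow> K \<subseteq> K' \<Longrightarrow> \<exists>j0. \<forall>j\<ge>j0. \<forall>Pj. harm j Pj \<longrightarrow>
      (\<Sum>x\<in>{\<one>} \<times> {..<d}. coord (Pj (delta x)) x)
        \<le> vn_dim G (tuple_act G) (simplices K' 1) (l2_homology_image K K' 1)"
    apply (rule harmonic_le_trace_image)
    subgoal premises prems for K by (rule that[of K]; fact prems)
    done
  have lower: "\<exists>j0. \<forall>j\<ge>j0. l j \<le> D K K'" if "cocompact_subcomplex G K'" "K \<subseteq> K'" for K'
    using low[OF that] P unfolding D_def l_def by blast
  have "(\<lambda>j. ereal (l j)) \<longlonglongrightarrow> l2_betti G 1"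
  proof (rule order_tendstoI)
    fix c assume "c < l2_betti G 1"
    then show "\<forall>\<^sub>F j in sequentially. c < ereal (l j)"
      using upper by (intro always_eventually allI) (rule less_le_trans)
  next
    fix c assume c: "l2_betti G 1 < c"
    have "L K \<le> l2_betti G 1" unfolding betti by (rule SUP_upper) (use K in simp)
    then have "L K < c" using c by (rule le_less_trans)
    then obtain K' where K': "cocompact_subcomplex G K'" "K \<subseteq> K'" "ereal (D K K') < c"
      unfolding L_def INF_less_iff by blast
    obtain j0 where j0: "\<forall>j\<ge>j0. l j \<le> D K K'" using lower[OF K'(1,2)] by blast
    then show "\<forall>\<^sub>F j in sequentially. ereal (l j) < c"
      unfolding eventually_sequentially
    proof (intro exI allI impI)
      fix j assume "j0 \<le> j"
      then have "ereal (l j) \<le> ereal (D K K')" using j0 by simp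
      then show "ereal (l j) < c" using K'(3) by (rule le_less_trans)
    qed
  qed
  then show ?thesis unfolding l_def .
qed

end

section \<open>The first Betti number of a finite complex as a trace\<close>

definition hip :: "'c set \<Rightarrow> ('c \<Rightarrow>\<^sub>0 complex) \<Rightarrow> ('c \<Rightarrow>\<^sub>0 complex) \<Rightarrow> complex" where
  "hip E c s = (\<Sum>x\<in>E. Poly_Mapping.lookup c x * cnj (Poly_Mapping.lookup s x))"

lemma hip_simps:
  "hip E (c + c') s = hip E c s + hip E c' s" "hip E (c - c') s = hip E c s - hip E c' s"
  "hip E (chain_scale a c) s = a * hip E c s"
  "hip E c (s + s') = hip E c s + hip E c s'" "hip E c (chain_scale a s) = cnj a * hip E c s" "hip E c 0 = 0"
  by (simp_all add: hip_def lookup_add lookup_minus ring_distribs sum.distrib sum_subtractf sum_distrib_left mult_ac)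

lemma hip_commute: "hip E c s = cnj (hip E s c)"
  by (simp add: hip_def mult.commute)

lemma in_chains_iff: "c \<in> chains E \<longleftrightarrow> (\<forall>x. x \<notin> E \<longrightarrow> Poly_Mapping.lookup c x = 0)"
  by (auto simp: chains_def in_keys_iff)

lemma chains_subspace: "chain.subspace (chains E)"
  by (rule chain.subspaceI)
    (auto simp: in_chains_iff lookup_add)

lemma lookup_chains: "c \<in> chains E \<Longrightarrow> x \<notin> E \<Longrightarrow> Poly_Mapping.lookup c x = 0"
  by (auto simp: chains_def in_keys_iff)

lemma hip_definite:
  assumes E: "finite E" and c: "c \<in> chains E" and z: "hip E c c = 0"
  shows "c = 0"
proof (rule poly_mapping_eqI)
  fix x
  have "of_real (\<Sum>x\<in>E. (cmod (Poly_Mapping.lookup c x))\<^sup>2) = hip E c c"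
    by (simp only: hip_def of_real_sum complex_norm_square)
  then have "(\<Sum>x\<in>E. (cmod (Poly_Mapping.lookup c x))\<^sup>2) = 0" using z by (metis of_real_eq_0_iff)
  then have "x \<in> E \<Longrightarrow> Poly_Mapping.lookup c x = 0"
    using sum_nonneg_eq_0_iff[OF E, of "\<lambda>x. (cmod (Poly_Mapping.lookup c x))\<^sup>2"] by auto
  then show "Poly_Mapping.lookup c x = Poly_Mapping.lookup 0 x"
    using lookup_chains[OF c, of x] by (cases "x \<in> E") auto
qed

definition lin :: "(('c \<Rightarrow>\<^sub>0 complex) \<Rightarrow> ('c \<Rightarrow>\<^sub>0 complex)) \<Rightarrow> bool" where
  "lin P \<longleftrightarrow> (\<forall>c c'. P (c + c') = P c + P c') \<and> (\<forall>a c. P (chain_scale a c) = chain_scale a (P c))"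

lemma lin_sum:
  assumes "lin P" "finite A"
  shows "P (\<Sum>x\<in>A. chain_scale (g x) (h x)) = (\<Sum>x\<in>A. chain_scale (g x) (P (h x)))"
  using assms(2)
proof (induction A rule: finite_induct)
  case empty
  have "P (chain_scale 0 0) = chain_scale 0 (P 0)" using assms(1) unfolding lin_def by blast
  then show ?case by simp
qed (use assms(1) in \<open>simp add: lin_def\<close>)

text \<open>Gram-Schmidt, adding one vector at a time.\<close>

lemma orthogonal_projection_span:
  assumes E: "finite E" and S: "finite S" "S \<subseteq> chains E"
  shows "\<exists>P. lin P \<and> (\<forall>c. P c \<in> chain.span S) \<and> (\<forall>c. \<forall>s\<in>chain.span S. hip E (c - P c) s = 0)"
  using S
proof (induction S rule: finite_induct)
  case empty
  show ?case by (rule exI[of _ "\<lambda>c. 0"]) (auto simp: lin_def chain.span_empty hip_simps)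
next
  case (insert b S)
  then obtain P where P: "lin P" "\<And>c. P c \<in> chain.span S"
    "\<And>c s. s \<in> chain.span S \<Longrightarrow> hip E (c - P c) s = 0" by auto
  have Pin: "P c \<in> chain.span (insert b S)" for c
    using P(2)[of c] chain.span_mono[OF subset_insertI] by blast
  define u where "u = b - P b"
  have u: "u \<in> chain.span (insert b S)"
    unfolding u_def by (rule chain.span_diff[OF chain.span_base Pin]) simp
  have uE: "u \<in> chains E"
    using chain.span_minimal[OF insert.prems chains_subspace] u by blast
  have us: "hip E u s = 0" "hip E s u = 0" if "s \<in> chain.span S" for s
    using P(3)[OF that, of b] hip_commute[of E s u] by (simp_all add: u_def)
  \<comment> \<open>If \<open>b\<close> already lies in the span, then \<open>u\<close> is 0, the
    quotient is 0 by the convention for division by 0, and \<open>P'\<close> agrees with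
    \<open>P\<close>.\<close>
  define P' where "P' c = P c + chain_scale (hip E c u / hip E u u) u" for c
  show ?case
  proof (intro exI[of _ P'] conjI allI ballI)
    show "lin P'" using P(1) by (simp add: lin_def P'_def hip_simps add_divide_distrib chain.scale_left_distrib
          chain.scale_right_distrib algebra_simps)
    show "P' c \<in> chain.span (insert b S)" for c
      unfolding P'_def by (intro chain.span_add chain.span_scale u Pin)
    fix c s assume "s \<in> chain.span (insert b S)"
    then obtain k where k: "s - chain_scale k b \<in> chain.span S" by (auto simp: chain.span_breakdown_eq)
    define t where "t = s - chain_scale k b + chain_scale k (P b)"
    have t: "t \<in> chain.span S" unfolding t_def by (intro chain.span_add chain.span_scale k P(2))
    have s: "s = t + chain_scale k u" by (simp add: t_def u_def chain.scale_right_diff_distrib)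
    have "hip E (c - P' c) t = 0"
      unfolding P'_def using P(3)[OF t, of c] us(1)[OF t] by (simp add: hip_simps)
    moreover have "hip E (c - P' c) u = 0"
    proof (cases "u = 0")
      case False
      then have "hip E u u \<noteq> 0" using hip_definite[OF E uE] by blast
      then show ?thesis using us(2)[OF P(2)[of c]] by (simp add: P'_def hip_simps)
    qed (simp add: hip_simps)
    ultimately show "hip E (c - P' c) s = 0" unfolding s by (simp add: hip_simps)
  qed
qed

lemma chain_eq_sum_single:
  assumes "finite E" "c \<in> chains E"
  shows "c = (\<Sum>x\<in>E. chain_scale (Poly_Mapping.lookup c x) (Poly_Mapping.single x 1))"
proof (rule poly_mapping_eqI)
  fix y
  have "(\<Sum>x\<in>E. Poly_Mapping.lookup c x * Poly_Mapping.lookup (Poly_Mapping.single x 1) y)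
    = (\<Sum>x\<in>E. if x = y then Poly_Mapping.lookup c x else 0)"
    by (rule sum.cong) (auto simp: lookup_single when_def)
  then show "Poly_Mapping.lookup c y = Poly_Mapping.lookup (\<Sum>x\<in>E. chain_scale (Poly_Mapping.lookup c x) (Poly_Mapping.single x 1)) y"
    using assms lookup_chains[OF assms(2), of y] by (auto simp: lookup_sum)
qed

lemma chain_basis:
  assumes E: "finite E" and W: "chain.subspace W" "W \<subseteq> chains E"
  obtains B where "finite B" "B \<subseteq> W" "chain.independent B" "chain.span B = W" "card B = chain.dim W"
proof -
  obtain B where B: "B \<subseteq> W" "chain.independent B" "W \<subseteq> chain.span B" "card B = chain.dim W"
    using chain.basis_exists by blast
  let ?T = "(\<lambda>x. Poly_Mapping.single x (1::complex)) ` E"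
  have "B \<subseteq> chain.span ?T"
  proof
    fix b assume "b \<in> B"
    then have "b \<in> chains E" using B W by blast
    then show "b \<in> chain.span ?T"
      by (subst chain_eq_sum_single[OF E \<open>b \<in> chains E\<close>])
        (rule chain.span_sum, rule chain.span_scale, rule chain.span_base, rule imageI)
  qed
  then have "finite B" using chain.independent_span_bound[OF _ B(2)] E by blast
  moreover have "chain.span B = W" using B(3) chain.span_minimal[OF B(1) W(1)] by blast
  ultimately show thesis using that B by blast
qed

text \<open>Trace equals rank. Expanding the elements \<open>b\<close> of a basis of
  \<open>W\<close> in single cells turns the trace into the sum over \<open>b\<close> of the
  coefficient of \<open>b\<close> in \<open>P b\<close>; as \<open>P b = b\<close>, each of these is
  1.\<close>

lemma trace_idempotent_eq_dim:
  assumes E: "finite E" and W: "chain.subspace W" "W \<subseteq> chains E"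
    and P: "lin P" "\<And>c. c \<in> chains E \<Longrightarrow> P c \<in> W" "\<And>w. w \<in> W \<Longrightarrow> P w = w"
  shows "(\<Sum>x\<in>E. Poly_Mapping.lookup (P (Poly_Mapping.single x 1)) x) = of_nat (chain.dim W)"
proof -
  obtain B where B: "finite B" "B \<subseteq> W" "chain.independent B" "chain.span B = W" "card B = chain.dim W"
    using chain_basis[OF E W] .
  define \<rho> where "\<rho> = chain.representation B"
  have sW: "Poly_Mapping.single x 1 \<in> chains E" if "x \<in> E" for x using that by (simp add: chains_def)
  have rep: "(\<Sum>b\<in>B. chain_scale (\<rho> v b) b) = v" if "v \<in> W" for v
    unfolding \<rho>_def by (rule chain.sum_representation_eq) (use B that in auto)
  have uniq: "\<rho> v b = g b" if "v = (\<Sum>b\<in>B. chain_scale (g b) b)" "b \<in> B" for v g b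
  proof -
    have v: "v \<in> chain.span B" unfolding that(1) by (intro chain.span_sum chain.span_scale chain.span_base)
    have "(\<Sum>b\<in>B. chain_scale (\<rho> v b - g b) b) = 0"
      using rep[of v] v B(4) that(1) by (simp add: chain.scale_left_diff_distrib sum_subtractf)
    then have "\<rho> v b - g b = 0"
      using chain.independentD[OF B(3) B(1) subset_refl, of "\<lambda>b. \<rho> v b - g b" b] that(2) by simp
    then show ?thesis by simp
  qed
  have "(\<Sum>x\<in>E. Poly_Mapping.lookup (P (Poly_Mapping.single x 1)) x)
    = (\<Sum>x\<in>E. \<Sum>b\<in>B. \<rho> (P (Poly_Mapping.single x 1)) b * Poly_Mapping.lookup b x)"
  proof (rule sum.cong)
    fix x assume "x \<in> E"
    then have "P (Poly_Mapping.single x 1) = (\<Sum>b\<in>B. chain_scale (\<rho> (P (Poly_Mapping.single x 1)) b) b)"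
      using rep P(2) sW by simp
    then have "Poly_Mapping.lookup (P (Poly_Mapping.single x 1)) x
      = Poly_Mapping.lookup (\<Sum>b\<in>B. chain_scale (\<rho> (P (Poly_Mapping.single x 1)) b) b) x" by (rule arg_cong)
    then show "Poly_Mapping.lookup (P (Poly_Mapping.single x 1)) x
      = (\<Sum>b\<in>B. \<rho> (P (Poly_Mapping.single x 1)) b * Poly_Mapping.lookup b x)"
      by (simp add: lookup_sum)
  qed simp
  also have "\<dots> = (\<Sum>b\<in>B. \<Sum>x\<in>E. Poly_Mapping.lookup b x * \<rho> (P (Poly_Mapping.single x 1)) b)"
    by (subst sum.swap) (simp add: mult.commute)
  also have "\<dots> = (\<Sum>b\<in>B. 1)"
  proof (rule sum.cong)
    fix b assume b: "b \<in> B"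
    then have bW: "b \<in> W" using B by blast
    have "b = P (\<Sum>x\<in>E. chain_scale (Poly_Mapping.lookup b x) (Poly_Mapping.single x 1))"
      using P(3)[OF bW] chain_eq_sum_single[OF E, of b] bW W by auto
    also have "\<dots> = (\<Sum>x\<in>E. chain_scale (Poly_Mapping.lookup b x) (P (Poly_Mapping.single x 1)))"
      by (rule lin_sum[OF P(1) E])
    also have "\<dots> = (\<Sum>x\<in>E. chain_scale (Poly_Mapping.lookup b x) (\<Sum>b'\<in>B. chain_scale (\<rho> (P (Poly_Mapping.single x 1)) b') b'))"
      by (rule sum.cong) (auto simp: rep P(2) sW)
    also have "\<dots> = (\<Sum>b'\<in>B. chain_scale (\<Sum>x\<in>E. Poly_Mapping.lookup b x * \<rho> (P (Poly_Mapping.single x 1)) b') b')"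
      by (simp add: chain.scale_sum_right chain.scale_sum_left) (rule sum.swap)
    finally have "\<rho> b b = (\<Sum>x\<in>E. Poly_Mapping.lookup b x * \<rho> (P (Poly_Mapping.single x 1)) b)"
      by (rule uniq) (rule b)
    moreover have "\<rho> b b = 1" unfolding \<rho>_def using chain.representation_basis[OF B(3) b] by simp
    ultimately show "(\<Sum>x\<in>E. Poly_Mapping.lookup b x * \<rho> (P (Poly_Mapping.single x 1)) b) = 1" by simp
  qed simp
  finally show ?thesis using B(5) by simp
qed

lemma orthogonal_projection_subspace:
  assumes E: "finite E" and W: "chain.subspace W" "W \<subseteq> chains E"
  shows "\<exists>P. lin P \<and> (\<forall>c. P c \<in> W) \<and> (\<forall>c. \<forall>s\<in>W. hip E (c - P c) s = 0) \<and> (\<forall>w\<in>W. P w = w)"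
proof -
  obtain B where B: "finite B" "B \<subseteq> W" "chain.independent B" "chain.span B = W" "card B = chain.dim W"
    using chain_basis[OF E W] .
  have "B \<subseteq> chains E" using B(2) W(2) by (rule subset_trans)
  from orthogonal_projection_span[OF E B(1) this]
  obtain P where P: "lin P \<and> (\<forall>c. P c \<in> W) \<and> (\<forall>c. \<forall>s\<in>W. hip E (c - P c) s = 0)"
    unfolding B(4) ..
  have "P w = w" if "w \<in> W" for w
  proof -
    have d: "w - P w \<in> W" using P by (intro chain.subspace_diff[OF W(1) that]) simp
    moreover have "w - P w \<in> chains E" using d W(2) by (rule subsetD[rotated])
    moreover have "hip E (w - P w) (w - P w) = 0" using P d by simp
    ultimately have "w - P w = 0" using hip_definite[OF E, of "w - P w"] by blast
    then show ?thesis by simp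
  qed
  then show ?thesis using P by (intro exI[of _ P]) simp
qed

text \<open>The difference of the orthogonal projections onto \<open>Z\<close> and \<open>B\<close>
  is the projection onto the complement, so dimensions are subtracted as traces.\<close>

lemma dim_orthogonal_decomposition:
  assumes E: "finite E" and Z: "chain.subspace Z" "Z \<subseteq> chains E" and B: "chain.subspace B" "B \<subseteq> Z"
  shows "chain.dim Z = chain.dim B + chain.dim {z \<in> Z. \<forall>b\<in>B. hip E z b = 0}"
proof -
  have BE: "B \<subseteq> chains E" using B Z by blast
  let ?H = "{z \<in> Z. \<forall>b\<in>B. hip E z b = 0}"
  obtain P where P0: "lin P \<and> (\<forall>c. P c \<in> Z) \<and> (\<forall>c. \<forall>s\<in>Z. hip E (c - P c) s = 0) \<and> (\<forall>w\<in>Z. P w = w)"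
    using orthogonal_projection_subspace[OF E Z] ..
  have P: "lin P" "P c \<in> Z" "s \<in> Z \<Longrightarrow> hip E (c - P c) s = 0" "w \<in> Z \<Longrightarrow> P w = w" for c s w
    using P0 by simp_all
  obtain Q where Q0: "lin Q \<and> (\<forall>c. Q c \<in> B) \<and> (\<forall>c. \<forall>s\<in>B. hip E (c - Q c) s = 0) \<and> (\<forall>w\<in>B. Q w = w)"
    using orthogonal_projection_subspace[OF E B(1) BE] ..
  have Q: "lin Q" "Q c \<in> B" "s \<in> B \<Longrightarrow> hip E (c - Q c) s = 0" "w \<in> B \<Longrightarrow> Q w = w" for c s w
    using Q0 by simp_all
  have H: "chain.subspace ?H"
    using Z(1) by (auto simp: chain.subspace_def hip_simps hip_def[of E 0])
  have HE: "?H \<subseteq> chains E" using Z by blast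
  have hH: "P c - Q c \<in> ?H" for c
  proof (intro CollectI conjI ballI)
    show "P c - Q c \<in> Z" using P(2) Q(2) B by (intro chain.subspace_diff[OF Z(1)]) auto
    fix b assume b: "b \<in> B"
    then have "hip E (c - P c) b = 0" "hip E (c - Q c) b = 0" using P(3) Q(3) B by auto
    then show "hip E (P c - Q c) b = 0" by (simp add: hip_simps)
  qed
  have fix_H: "P h - Q h = h" if h: "h \<in> ?H" for h
  proof -
    have "hip E (h - Q h) (Q h) = 0" using Q(2,3) by blast
    moreover have "hip E h (Q h) = 0" using h Q(2) by blast
    ultimately have "hip E (Q h) (Q h) = 0" by (simp add: hip_simps)
    then have "Q h = 0" using hip_definite[OF E] Q(2) BE by blast
    then show ?thesis using P(4) h by simp
  qed
  have "lin (\<lambda>c. P c - Q c)" using P(1) Q(1) by (simp add: lin_def chain.scale_right_diff_distrib)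
  then have "(\<Sum>x\<in>E. Poly_Mapping.lookup (P (Poly_Mapping.single x 1) - Q (Poly_Mapping.single x 1)) x) = of_nat (chain.dim ?H)"
    by (rule trace_idempotent_eq_dim[OF E H HE _ hH fix_H])
  moreover have "(\<Sum>x\<in>E. Poly_Mapping.lookup (P (Poly_Mapping.single x 1)) x) = of_nat (chain.dim Z)"
    by (rule trace_idempotent_eq_dim[OF E Z P(1,2,4)])
  moreover have "(\<Sum>x\<in>E. Poly_Mapping.lookup (Q (Poly_Mapping.single x 1)) x) = of_nat (chain.dim B)"
    by (rule trace_idempotent_eq_dim[OF E B(1) BE Q(1,2,4)])
  ultimately have "of_nat (chain.dim Z) - of_nat (chain.dim B) = (of_nat (chain.dim ?H) :: complex)"
    by (simp add: lookup_minus sum_subtractf)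
  then have "(of_nat (chain.dim Z) :: complex) = of_nat (chain.dim B + chain.dim ?H)"
    by (simp add: algebra_simps)
  then show ?thesis by (simp only: of_nat_eq_iff)
qed

lemma lookup_path_chain: "Poly_Mapping.lookup (path_chain p) e = of_real (lcoef p e)"
  by (induction p) (auto simp: path_chain_def lcoef_def lookup_add lookup_single when_def)

lemma boundary2_eq: "finite F \<Longrightarrow> c \<in> chains F \<Longrightarrow>
    boundary2 X c = (\<Sum>f\<in>F. chain_scale (Poly_Mapping.lookup c f) (path_chain (attach X f)))"
  unfolding boundary2_def by (rule sum.mono_neutral_left) (auto simp: chains_def in_keys_iff)

lemma boundary1_eq: "finite E \<Longrightarrow> c \<in> chains E \<Longrightarrow>
    boundary1 X c = (\<Sum>e\<in>E. chain_scale (Poly_Mapping.lookup c e)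
      (Poly_Mapping.single (tgt X e) 1 - Poly_Mapping.single (src X e) 1))"
  unfolding boundary1_def by (rule sum.mono_neutral_left) (auto simp: chains_def in_keys_iff)

definition inc1 :: "('v, 'e, 'f) complex2 \<Rightarrow> 'e \<Rightarrow> 'v \<Rightarrow> real" where
  "inc1 X e v = (if v = tgt X e then 1 else 0) - (if v = src X e then 1 else 0)"

lemma lookup_boundary1: "finite E \<Longrightarrow> c \<in> chains E \<Longrightarrow>
    Poly_Mapping.lookup (boundary1 X c) v = (\<Sum>e\<in>E. Poly_Mapping.lookup c e * of_real (inc1 X e v))"
  by (auto simp: boundary1_eq lookup_sum lookup_minus lookup_single when_def inc1_def intro!: sum.cong)

text \<open>Finite Hodge theory: the cycles orthogonal to all boundaries have dimension
  \<open>betti1\<close>, where truncated subtraction does no harm because boundaries are cycles by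
  \<open>closed\<close>. \<open>P\<close> is real and acts on functions on the whole edge type,
  whereas the trace runs over the edges of \<open>X\<close>.\<close>

lemma betti1_eq_trace:
  fixes X :: "('v, 'e, 'f) complex2"
  assumes E: "finite (edges X)" and F: "finite (faces X)"
    and att: "\<And>f. f \<in> faces X \<Longrightarrow> fst ` set (attach X f) \<subseteq> edges X"
    and closed: "\<And>f v. f \<in> faces X \<Longrightarrow> (\<Sum>e\<in>edges X. lcoef (attach X f) e * inc1 X e v) = 0"
    and P: "linear P" "\<And>u. P (P u) = P u"
    and fix_P: "\<And>u. P u = u \<longleftrightarrow> (\<forall>v. (\<Sum>e\<in>edges X. coord u e * inc1 X e v) = 0) \<and>
      (\<forall>f\<in>faces X. (\<Sum>e\<in>edges X. coord u e * lcoef (attach X f) e) = 0)"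
  shows "real (betti1 X) = (\<Sum>e\<in>edges X. coord (P (delta e)) e)"
proof -
  let ?E = "edges X" and ?F = "faces X"
  let ?Z = "{c \<in> chains ?E. boundary1 X c = 0}" and ?B = "boundary2 X ` chains ?F"
  have Zi: "c \<in> ?Z \<longleftrightarrow> c \<in> chains ?E \<and> (\<forall>v. (\<Sum>e\<in>?E. Poly_Mapping.lookup c e * of_real (inc1 X e v)) = 0)" for c
    using lookup_boundary1[OF E, of c X] by (auto simp: poly_mapping_eq_iff fun_eq_iff)
  have Z: "chain.subspace ?Z"
  proof (rule chain.subspaceI)
    show "0 \<in> ?Z" unfolding Zi by (simp add: chain.subspace_0[OF chains_subspace])
    show "x + y \<in> ?Z" if "x \<in> ?Z" "y \<in> ?Z" for x y
      using that unfolding Zi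
      by (simp add: chain.subspace_add[OF chains_subspace] lookup_add ring_distribs sum.distrib)
    show "chain_scale a x \<in> ?Z" if "x \<in> ?Z" for a x
      using that unfolding Zi
      by (simp add: chain.subspace_scale[OF chains_subspace] mult.assoc flip: sum_distrib_left)
  qed
  have Bsub: "chain.subspace ?B"
  proof (rule chain.subspaceI)
    have "boundary2 X 0 = 0" by (simp add: boundary2_def)
    then show "0 \<in> ?B" using chain.subspace_0[OF chains_subspace] by (metis imageI)
    fix x y assume "x \<in> ?B" "y \<in> ?B"
    then obtain c c' where c: "c \<in> chains ?F" "x = boundary2 X c" "c' \<in> chains ?F" "y = boundary2 X c'" by blast
    have s: "c + c' \<in> chains ?F" by (rule chain.subspace_add[OF chains_subspace c(1,3)])
    have "x + y = boundary2 X (c + c')"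
      using c s by (simp add: boundary2_eq[OF F] lookup_add chain.scale_left_distrib sum.distrib)
    then show "x + y \<in> ?B" using s by blast
  next
    fix a x assume "x \<in> ?B"
    then obtain c where c: "c \<in> chains ?F" "x = boundary2 X c" by blast
    have s: "chain_scale a c \<in> chains ?F" by (rule chain.subspace_scale[OF chains_subspace c(1)])
    have "chain_scale a x = boundary2 X (chain_scale a c)"
      using c s by (simp add: boundary2_eq[OF F] chain.scale_sum_right)
    then show "chain_scale a x \<in> ?B" using s by blast
  qed
  have pc: "path_chain (attach X f) \<in> ?Z" if f: "f \<in> ?F" for f
  proof -
    have "path_chain (attach X f) \<in> chains ?E"
      using att[OF f] lcoef_nonzero[of "attach X f"] by (auto simp: chains_def in_keys_iff lookup_path_chain)
    moreover have "(\<Sum>e\<in>?E. Poly_Mapping.lookup (path_chain (attach X f)) e * of_real (inc1 X e v)) = 0" for v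
    proof -
      have "(\<Sum>e\<in>?E. Poly_Mapping.lookup (path_chain (attach X f)) e * of_real (inc1 X e v))
        = complex_of_real (\<Sum>e\<in>?E. lcoef (attach X f) e * inc1 X e v)" by (simp add: lookup_path_chain)
      then show ?thesis by (simp only: closed[OF f] of_real_0)
    qed
    ultimately show ?thesis unfolding Zi by blast
  qed
  have BZ: "?B \<subseteq> ?Z"
  proof
    fix x assume "x \<in> ?B"
    then obtain c where c: "c \<in> chains ?F" "x = boundary2 X c" by blast
    show "x \<in> ?Z"
      unfolding c(2) boundary2_eq[OF F c(1)]
      by (rule chain.subspace_sum[OF Z chain.subspace_scale[OF Z pc]])
  qed
  have pcB: "path_chain (attach X f) \<in> ?B" if f: "f \<in> ?F" for f
  proof -
    have s: "Poly_Mapping.single f 1 \<in> chains ?F" using f by (simp add: chains_def)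
    have "boundary2 X (Poly_Mapping.single f 1) = path_chain (attach X f)"
      by (simp add: boundary2_def)
    then show ?thesis using s by (metis imageI)
  qed
  let ?H = "{z \<in> ?Z. \<forall>b\<in>?B. hip ?E z b = 0}"
  have Hi: "z \<in> ?H \<longleftrightarrow> z \<in> chains ?E \<and> (\<forall>v. (\<Sum>e\<in>?E. Poly_Mapping.lookup z e * of_real (inc1 X e v)) = 0) \<and>
      (\<forall>f\<in>?F. (\<Sum>e\<in>?E. Poly_Mapping.lookup z e * of_real (lcoef (attach X f) e)) = 0)" for z
  proof -
    have h: "hip ?E z (path_chain (attach X f)) = (\<Sum>e\<in>?E. Poly_Mapping.lookup z e * of_real (lcoef (attach X f) e))" for f
      by (simp add: hip_def lookup_path_chain)
    have hs: "hip ?E z (\<Sum>f\<in>A. chain_scale (g f) (path_chain (attach X f)))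
      = (\<Sum>f\<in>A. cnj (g f) * hip ?E z (path_chain (attach X f)))" if "finite A" for A g
      using that by (induction A rule: finite_induct) (auto simp: hip_simps)
    have "(\<forall>b\<in>?B. hip ?E z b = 0) \<longleftrightarrow> (\<forall>f\<in>?F. hip ?E z (path_chain (attach X f)) = 0)"
    proof
      assume *: "\<forall>f\<in>?F. hip ?E z (path_chain (attach X f)) = 0"
      show "\<forall>b\<in>?B. hip ?E z b = 0"
      proof
        fix b assume "b \<in> ?B"
        then obtain c where c: "c \<in> chains ?F" "b = boundary2 X c" by blast
        show "hip ?E z b = 0" unfolding c(2) boundary2_eq[OF F c(1)] hs[OF F] using * by simp
      qed
    qed (use pcB in blast)
    then show ?thesis using Zi[of z] h by auto
  qed
  have "betti1 X = chain.dim ?H"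
    using dim_orthogonal_decomposition[OF E Z _ Bsub BZ] unfolding betti1_def by auto
  moreover have H: "chain.subspace ?H"
    using Z by (auto simp: chain.subspace_def hip_simps hip_def[of ?E 0])
  define p where "p x y = coord (P (delta x)) y" for x y
  \<comment> \<open>The complex-linear map with the matrix of \<open>P\<close>, cut off to the edges
    of \<open>X\<close>.\<close>
  define Pc :: "('e \<Rightarrow>\<^sub>0 complex) \<Rightarrow> ('e \<Rightarrow>\<^sub>0 complex)" where "Pc c = (\<Sum>y\<in>?E. Poly_Mapping.single y (\<Sum>x\<in>?E. Poly_Mapping.lookup c x * of_real (p x y)))" for c
  have lookup_Pc: "Poly_Mapping.lookup (Pc c) y = (if y \<in> ?E then \<Sum>x\<in>?E. Poly_Mapping.lookup c x * of_real (p x y) else 0)" for c y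
    unfolding Pc_def lookup_sum lookup_single when_def using E by (simp add: sum.delta)
  have "(\<Sum>x\<in>?E. Poly_Mapping.lookup (Pc (Poly_Mapping.single x 1)) x) = of_nat (chain.dim ?H)"
  proof (rule trace_idempotent_eq_dim[where P = Pc, OF E H])
    show "lin Pc" unfolding lin_def
      by (auto intro!: poly_mapping_eqI simp: lookup_Pc lookup_add ring_distribs sum.distrib sum_distrib_left mult.assoc)
    have sw: "(\<Sum>y\<in>?E. Poly_Mapping.lookup (Pc c) y * of_real (g y))
      = (\<Sum>x\<in>?E. Poly_Mapping.lookup c x * of_real (\<Sum>y\<in>?E. p x y * g y))" for c g
    proof -
      have "(\<Sum>y\<in>?E. Poly_Mapping.lookup (Pc c) y * of_real (g y))
        = (\<Sum>y\<in>?E. \<Sum>x\<in>?E. Poly_Mapping.lookup c x * (of_real (p x y) * of_real (g y)))"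
        by (simp add: lookup_Pc sum_distrib_right mult.assoc)
      also have "\<dots> = (\<Sum>x\<in>?E. \<Sum>y\<in>?E. Poly_Mapping.lookup c x * (of_real (p x y) * of_real (g y)))" by (rule sum.swap)
      finally show ?thesis by (simp add: sum_distrib_left)
    qed
    show "Pc c \<in> ?H" for c
    proof -
      have "(\<Sum>y\<in>?E. p x y * inc1 X y v) = 0" "f \<in> ?F \<Longrightarrow> (\<Sum>y\<in>?E. p x y * lcoef (attach X f) y) = 0" for x v f
        using fix_P[of "P (delta x)"] P(2) by (auto simp: p_def)
      then show ?thesis unfolding Hi sw by (auto simp: chains_def in_keys_iff lookup_Pc split: if_splits)
    qed
    show "Pc w = w" if w: "w \<in> ?H" for w
    proof (rule poly_mapping_eqI)
      fix y
      \<comment> \<open>Real harmonic functions are fixed by \<open>P\<close>; this is applied to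
        the real and to the imaginary part of \<open>w\<close>.\<close>
      have part: "(\<Sum>x\<in>?E. g x * p x y) = g y"
        if g: "\<And>v. (\<Sum>e\<in>?E. g e * inc1 X e v) = 0" "\<And>f. f \<in> ?F \<Longrightarrow> (\<Sum>e\<in>?E. g e * lcoef (attach X f) e) = 0"
          and y: "y \<in> ?E" for g :: "'e \<Rightarrow> real"
      proof -
        define u where "u = (\<Sum>x\<in>?E. g x *\<^sub>R delta x)"
        have cu: "coord u e = g e" if "e \<in> ?E" for e
        proof -
          have "coord u e = (\<Sum>x\<in>?E. if e = x then g x else 0)"
            by (auto simp: u_def coord_delta intro!: sum.cong)
          then show ?thesis using E that by simp
        qed
        have "P u = u" unfolding fix_P using g by (simp add: cu)
        then have "coord (P u) y = g y" using cu[OF y] by simp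
        moreover have "P u = (\<Sum>x\<in>?E. g x *\<^sub>R P (delta x))"
          unfolding u_def by (simp add: linear_sum[OF P(1)] linear_cmul[OF P(1)])
        ultimately show ?thesis by (simp add: p_def)
      qed
      show "Poly_Mapping.lookup (Pc w) y = Poly_Mapping.lookup w y"
      proof (cases "y \<in> ?E")
        case True
        have z1: "(\<Sum>e\<in>?E. Re (Poly_Mapping.lookup w e) * inc1 X e v) = 0" "(\<Sum>e\<in>?E. Im (Poly_Mapping.lookup w e) * inc1 X e v) = 0" for v
        proof -
          have "(\<Sum>e\<in>?E. Poly_Mapping.lookup w e * of_real (inc1 X e v)) = 0" using w unfolding Hi by blast
          from arg_cong[OF this, of Re] arg_cong[OF this, of Im]
          show "(\<Sum>e\<in>?E. Re (Poly_Mapping.lookup w e) * inc1 X e v) = 0" "(\<Sum>e\<in>?E. Im (Poly_Mapping.lookup w e) * inc1 X e v) = 0"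
            by simp_all
        qed
        have z2: "(\<Sum>e\<in>?E. Re (Poly_Mapping.lookup w e) * lcoef (attach X f) e) = 0" "(\<Sum>e\<in>?E. Im (Poly_Mapping.lookup w e) * lcoef (attach X f) e) = 0"
          if "f \<in> ?F" for f
        proof -
          have "(\<Sum>e\<in>?E. Poly_Mapping.lookup w e * of_real (lcoef (attach X f) e)) = 0" using w that unfolding Hi by blast
          from arg_cong[OF this, of Re] arg_cong[OF this, of Im]
          show "(\<Sum>e\<in>?E. Re (Poly_Mapping.lookup w e) * lcoef (attach X f) e) = 0" "(\<Sum>e\<in>?E. Im (Poly_Mapping.lookup w e) * lcoef (attach X f) e) = 0"
            by simp_all
        qed
        have "Re (Poly_Mapping.lookup (Pc w) y) = Re (Poly_Mapping.lookup w y)"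
          using part[OF z1(1) z2(1) True] True by (simp add: lookup_Pc)
        moreover have "Im (Poly_Mapping.lookup (Pc w) y) = Im (Poly_Mapping.lookup w y)"
          using part[OF z1(2) z2(2) True] True by (simp add: lookup_Pc)
        ultimately show ?thesis by (rule complex_eqI)
      next
        case False
        then show ?thesis using w lookup_chains[of w ?E y] by (simp add: lookup_Pc)
      qed
    qed
  qed blast
  moreover have "Poly_Mapping.lookup (Pc (Poly_Mapping.single x 1)) x = of_real (p x x)" if "x \<in> ?E" for x
  proof -
    have "Poly_Mapping.lookup (Pc (Poly_Mapping.single x 1)) x = (\<Sum>x'\<in>?E. if x = x' then of_real (p x' x) else 0)"
      using that unfolding lookup_Pc by (auto simp: lookup_single when_def intro!: sum.cong)
    then show ?thesis using that E by simp
  qed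
  ultimately have "of_real (\<Sum>x\<in>?E. p x x) = complex_of_real (real (betti1 X))" by simp
  then show ?thesis unfolding of_real_eq_iff by (simp add: p_def)
qed

section \<open>Small eigenvalues of integer matrices\<close>

definition mtrace :: "complex mat \<Rightarrow> complex" where
  "mtrace A = (\<Sum>i<dim_row A. A $$ (i, i))"

lemma mtrace_commute:
  assumes "A \<in> carrier_mat m m" "B \<in> carrier_mat m m"
  shows "mtrace (A * B) = mtrace (B * A)"
proof -
  have "mtrace (A * B) = (\<Sum>i<m. \<Sum>k<m. A $$ (i, k) * B $$ (k, i))"
    using assms by (auto simp: mtrace_def scalar_prod_def atLeast0LessThan intro!: sum.cong)
  also have "\<dots> = (\<Sum>k<m. \<Sum>i<m. B $$ (k, i) * A $$ (i, k))"
    by (subst sum.swap) (simp add: mult.commute)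
  also have "\<dots> = mtrace (B * A)"
    using assms by (auto simp: mtrace_def scalar_prod_def atLeast0LessThan intro!: sum.cong)
  finally show ?thesis .
qed

lemma mtrace_similar:
  assumes "P * Q = 1\<^sub>m m" "Q * P = 1\<^sub>m m" "X \<in> carrier_mat m m" "P \<in> carrier_mat m m" "Q \<in> carrier_mat m m"
  shows "mtrace (P * X * Q) = mtrace X"
proof -
  have "mtrace (P * X * Q) = mtrace (Q * (P * X))" by (rule mtrace_commute) (use assms in auto)
  also have "Q * (P * X) = X" using assms by (simp flip: assoc_mult_mat)
  finally show ?thesis .
qed

lemma upper_triangular_pow:
  assumes C: "(C :: complex mat) \<in> carrier_mat m m" and ut: "upper_triangular C"
  shows "upper_triangular (C ^\<^sub>m k) \<and> (\<forall>i<m. (C ^\<^sub>m k) $$ (i, i) = (C $$ (i, i)) ^ k)"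
proof (induction k)
  case 0
  show ?case using C by auto
next
  case (Suc k)
  have Ck: "C ^\<^sub>m k \<in> carrier_mat m m" using C by simp
  have z: "C $$ (l, j) = 0" if "j < l" "l < m" for l j using ut C that by auto
  have zk: "(C ^\<^sub>m k) $$ (l, j) = 0" if "j < l" "l < m" for l j using Suc Ck that by auto
  have e: "(C ^\<^sub>m Suc k) $$ (i, j) = (\<Sum>l<m. (C ^\<^sub>m k) $$ (i, l) * C $$ (l, j))" if "i < m" "j < m" for i j
    using that C Ck by (simp add: scalar_prod_def atLeast0LessThan)
  show ?case
  proof (intro conjI allI impI upper_triangularI)
    fix i j assume *: "j < i" "i < dim_row (C ^\<^sub>m Suc k)"
    then have "i < m" "j < m" using C by auto
    then show "(C ^\<^sub>m Suc k) $$ (i, j) = 0"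
      unfolding e[OF \<open>i < m\<close> \<open>j < m\<close>]
      by (intro sum.neutral ballI) (use *(1) z zk in \<open>metis lessThan_iff linorder_not_less mult_eq_0_iff order_less_le_trans\<close>)
  next
    fix i assume i: "i < m"
    have "(C ^\<^sub>m k) $$ (i, l) * C $$ (l, i) = (if l = i then (C $$ (i, i)) ^ Suc k else 0)" if "l < m" for l
      using that i z[of i l] zk[of l i] Suc by (cases l i rule: linorder_cases) auto
    then have "(\<Sum>l<m. (C ^\<^sub>m k) $$ (i, l) * C $$ (l, i)) = (\<Sum>l<m. if l = i then (C $$ (i, i)) ^ Suc k else 0)"
      by (intro sum.cong HOL.refl) simp
    then show "(C ^\<^sub>m Suc k) $$ (i, i) = (C $$ (i, i)) ^ Suc k"
      unfolding e[OF i i] using i by simp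
  qed
qed

text \<open>Pairing an eigenvector with itself gives \<open>e\<close> times its squared length. By
  symmetry this is real and equal to the quadratic form at the real part plus that at the imaginary
  part, to which \<open>psd\<close> and \<open>bd\<close> apply.\<close>

lemma symmetric_eigenvalue_real:
  fixes D :: "nat \<Rightarrow> nat \<Rightarrow> int"
  assumes sym: "\<And>i j. D i j = D j i"
    and psd: "\<And>u. 0 \<le> (\<Sum>i<m. \<Sum>j<m. real_of_int (D i j) * u i * u j)"
    and bd: "\<And>u. (\<Sum>i<m. \<Sum>j<m. real_of_int (D i j) * u i * u j) \<le> K * (\<Sum>i<m. (u i)\<^sup>2)"
    and e: "eigenvalue (mat m m (\<lambda>(i, j). complex_of_int (D i j))) e"
  shows "\<exists>\<mu>. e = complex_of_real \<mu> \<and> 0 \<le> \<mu> \<and> \<mu> \<le> K"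
proof -
  let ?A = "mat m m (\<lambda>(i, j). complex_of_int (D i j))"
  obtain v where v: "v \<in> carrier_vec m" "v \<noteq> 0\<^sub>v m" "?A *\<^sub>v v = e \<cdot>\<^sub>v v"
    using e unfolding eigenvalue_def eigenvector_def by auto
  define w where "w i = vec_index v i" for i
  have ev: "(\<Sum>j<m. complex_of_int (D i j) * w j) = e * w i" if "i < m" for i
  proof -
    have "vec_index (?A *\<^sub>v v) i = (\<Sum>j<m. complex_of_int (D i j) * w j)"
      using v(1) that by (simp add: scalar_prod_def atLeast0LessThan w_def)
    then show ?thesis unfolding v(3) using v(1) that by (simp add: w_def)
  qed
  let ?Q = "\<lambda>u. \<Sum>i<m. \<Sum>j<m. real_of_int (D i j) * u i * u j"
  let ?q = "?Q (\<lambda>i. Re (w i)) + ?Q (\<lambda>i. Im (w i))" and ?n = "\<Sum>i<m. (cmod (w i))\<^sup>2"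
  have n: "?n = (\<Sum>i<m. (Re (w i))\<^sup>2) + (\<Sum>i<m. (Im (w i))\<^sup>2)"
    by (simp add: cmod_power2 sum.distrib)
  have "e * of_real ?n = (\<Sum>i<m. cnj (w i) * (e * w i))"
    by (simp add: sum_distrib_left complex_norm_square mult_ac del: of_real_power)
  also have "\<dots> = (\<Sum>i<m. \<Sum>j<m. complex_of_int (D i j) * (cnj (w i) * w j))"
    by (auto simp: ev[symmetric] sum_distrib_left mult_ac intro!: sum.cong)
  finally have eq: "e * of_real ?n = (\<Sum>i<m. \<Sum>j<m. complex_of_int (D i j) * (cnj (w i) * w j))" .
  have tm: "Re (complex_of_int (D i j) * (cnj (w i) * w j))
      = real_of_int (D i j) * Re (w i) * Re (w j) + real_of_int (D i j) * Im (w i) * Im (w j)"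
    "Im (complex_of_int (D i j) * (cnj (w i) * w j))
      = real_of_int (D i j) * (Re (w i) * Im (w j)) - real_of_int (D i j) * (Im (w i) * Re (w j))" for i j
    by (simp_all add: algebra_simps)
  have "Re (e * of_real ?n) = ?q"
    by (simp only: eq Re_sum tm sum.distrib)
  have sw: "(\<Sum>i<m. \<Sum>j<m. real_of_int (D i j) * (Im (w i) * Re (w j)))
    = (\<Sum>i<m. \<Sum>j<m. real_of_int (D i j) * (Re (w i) * Im (w j)))"
    by (subst sum.swap) (simp add: sym mult_ac)
  have "Im (e * of_real ?n) = 0"
    by (simp only: eq Im_sum tm sum_subtractf sw)
  have "e * of_real ?n = of_real ?q"
    by (rule complex_eqI) (use \<open>Re (e * of_real ?n) = ?q\<close> \<open>Im (e * of_real ?n) = 0\<close> in simp_all)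
  moreover have npos: "0 < ?n"
  proof -
    obtain i where i: "i < m" "w i \<noteq> 0"
      using v(1,2) by (auto simp: w_def vec_eq_iff)
    have "(cmod (w i))\<^sup>2 \<le> ?n" by (rule member_le_sum) (use i in auto)
    moreover have "0 < (cmod (w i))\<^sup>2" using i by simp
    ultimately show ?thesis by linarith
  qed
  moreover have "e * of_real n = of_real q \<Longrightarrow> 0 < n \<Longrightarrow> e = complex_of_real (q / n)" for n q :: real
    by (simp add: field_simps)
  ultimately have "e = of_real (?q / ?n)" by blast
  moreover have "0 \<le> ?q / ?n" using psd[of "\<lambda>i. Re (w i)"] psd[of "\<lambda>i. Im (w i)"] npos by simp
  moreover have "?q \<le> K * ?n"
    using bd[of "\<lambda>i. Re (w i)"] bd[of "\<lambda>i. Im (w i)"] unfolding n by (simp add: ring_distribs)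
  then have "?q / ?n \<le> K" using npos by (simp add: divide_le_eq)
  ultimately show ?thesis by blast
qed

text \<open>After the zero roots are split off, the constant coefficient of the remaining factor is,
  up to sign, the product of the nonzero roots; being a coefficient of \<open>p\<close>, it is a
  nonzero integer.\<close>

lemma nonzero_root_product:
  fixes a :: "nat \<Rightarrow> complex"
  assumes "(\<Prod>i<m. [:- a i, 1:]) = map_poly of_int p"
  shows "1 \<le> cmod (\<Prod>i | i < m \<and> a i \<noteq> 0. a i)"
proof -
  let ?Z = "{i. i < m \<and> a i = 0}" and ?N = "{i. i < m \<and> a i \<noteq> 0}"
  let ?q = "\<Prod>i\<in>?N. [:- a i, 1:]"
  have "(\<Prod>i<m. [:- a i, 1:]) = (\<Prod>i\<in>?Z. [:- a i, 1:]) * ?q"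
    by (subst prod.union_disjoint[symmetric]) (auto intro!: prod.cong)
  also have "(\<Prod>i\<in>?Z. [:- a i, 1:]) = (\<Prod>i\<in>?Z. monom 1 1)"
    by (rule prod.cong) (auto simp: monom_altdef)
  also have "\<dots> = monom 1 (card ?Z)" by (simp add: monom_power)
  finally have "map_poly of_int p = monom 1 (card ?Z) * ?q" using assms by simp
  then have "coeff (map_poly of_int p) (card ?Z) = coeff ?q 0"
    by (simp add: coeff_monom_mult)
  then have "of_int (coeff p (card ?Z)) = poly ?q 0" by (simp add: coeff_map_poly poly_0_coeff_0)
  also have "\<dots> = (\<Prod>i\<in>?N. - a i)" by (simp add: poly_prod)
  finally have "cmod (of_int (coeff p (card ?Z))) = cmod (\<Prod>i\<in>?N. - a i)" by (rule arg_cong)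
  also have "\<dots> = cmod (\<Prod>i\<in>?N. a i)" by (simp flip: prod_norm)
  finally have c: "cmod (\<Prod>i\<in>?N. a i) = \<bar>real_of_int (coeff p (card ?Z))\<bar>" by simp
  have "(\<Prod>i\<in>?N. a i) \<noteq> 0" by (simp add: prod_zero_iff)
  then have "coeff p (card ?Z) \<noteq> 0" using c by auto
  then have "1 \<le> \<bar>coeff p (card ?Z)\<bar>" by linarith
  then show ?thesis unfolding c by linarith
qed

text \<open>The \<open>\<mu> i\<close> are the diagonal of a Schur triangular form, from which
  traces of powers are read off. The powers of \<open>1 - D / K\<close> enter through their
  recursion \<open>t0\<close>, \<open>tS\<close>, so that entries of operators on
  \<open>ell2\<close> can be inserted directly.\<close>

lemma integer_matrix_spectrum:
  fixes D :: "nat \<Rightarrow> nat \<Rightarrow> int"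
  assumes sym: "\<And>i j. D i j = D j i"
    and psd: "\<And>u. 0 \<le> (\<Sum>i<m. \<Sum>j<m. real_of_int (D i j) * u i * u j)"
    and bd: "\<And>u. (\<Sum>i<m. \<Sum>j<m. real_of_int (D i j) * u i * u j) \<le> K * (\<Sum>i<m. (u i)\<^sup>2)"
    and t0: "\<And>i j. i < m \<Longrightarrow> j < m \<Longrightarrow> t 0 i j = (if i = j then 1 else 0)"
    and tS: "\<And>k i j. i < m \<Longrightarrow> j < m \<Longrightarrow>
      t (Suc k) i j = (\<Sum>l<m. t k i l * ((if l = j then 1 else 0) - real_of_int (D l j) / K))"
  obtains \<mu> :: "nat \<Rightarrow> real" where "\<And>i. i < m \<Longrightarrow> 0 \<le> \<mu> i" "\<And>i. i < m \<Longrightarrow> \<mu> i \<le> K"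
    "\<And>k. (\<Sum>i<m. t k i i) = (\<Sum>i<m. (1 - \<mu> i / K) ^ k)" "1 \<le> (\<Prod>i | i < m \<and> \<mu> i \<noteq> 0. \<mu> i)"
proof -
  define Ai where "Ai = mat m m (\<lambda>(i, j). D i j)"
  define A where "A = mat m m (\<lambda>(i, j). complex_of_int (D i j))"
  have A: "A \<in> carrier_mat m m" and Ai: "Ai \<in> carrier_mat m m" by (auto simp: A_def Ai_def)
  have "A = map_mat of_int Ai" by (rule eq_matI) (auto simp: A_def Ai_def)
  then have cpi: "char_poly A = map_poly of_int (char_poly Ai)"
    by (simp add: of_int_hom.char_poly_hom[OF Ai])
  obtain es where "char_poly A = (\<Prod>a\<leftarrow>es. [:- a, 1:])" using char_poly_factorized[OF A] by blast
  then obtain B where B: "B \<in> carrier_mat m m" "upper_triangular B" "similar_mat A B"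
    using schur_decomposition_exists[OF A] by blast
  obtain P Q where wit: "similar_mat_wit A B P Q" using B(3) unfolding similar_mat_def by blast
  note w = similar_mat_witD2[OF A wit]
  define a where "a i = B $$ (i, i)" for i
  have "char_poly A = (\<Prod>x\<leftarrow>diag_mat B. [:- x, 1:])"
    using char_poly_similar[OF B(3)] char_poly_upper_triangular[OF B(1,2)] by simp
  also have "\<dots> = (\<Prod>i<m. [:- a i, 1:])"
    using B(1) by (simp add: diag_mat_def a_def o_def prod.distinct_set_conv_list[symmetric] atLeast0LessThan)
  finally have cp: "char_poly A = (\<Prod>i<m. [:- a i, 1:])" .
  have "\<exists>\<mu>. a i = complex_of_real \<mu> \<and> 0 \<le> \<mu> \<and> \<mu> \<le> K" if i: "i < m" for i
  proof -
    have "poly (char_poly A) (a i) = 0"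
      unfolding cp poly_prod using i by (intro prod_zero) auto
    then have "eigenvalue A (a i)" using eigenvalue_root_char_poly[OF A] by simp
    then show ?thesis unfolding A_def by (intro symmetric_eigenvalue_real[OF sym psd bd])
  qed
  then have "\<forall>i\<in>{..<m}. \<exists>\<mu>. a i = complex_of_real \<mu> \<and> 0 \<le> \<mu> \<and> \<mu> \<le> K" by simp
  from bchoice[OF this] obtain \<mu> where \<mu>: "\<forall>i\<in>{..<m}. a i = complex_of_real (\<mu> i) \<and> 0 \<le> \<mu> i \<and> \<mu> i \<le> K" ..
  define c where "c = complex_of_real (1 / K)"
  define T where "T = 1\<^sub>m m - c \<cdot>\<^sub>m A"
  define C where "C = 1\<^sub>m m - c \<cdot>\<^sub>m B"
  have T: "T \<in> carrier_mat m m" and C: "C \<in> carrier_mat m m" using A B(1) by (auto simp: T_def C_def)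
  have TC: "T = P * C * Q"
  proof -
    have "P * C = P - c \<cdot>\<^sub>m (P * B)"
      unfolding C_def using w B(1) by (subst mult_minus_distrib_mat[of _ m m]) auto
    then have "P * C * Q = P * Q - (c \<cdot>\<^sub>m (P * B)) * Q"
      using w B(1) by (simp add: minus_mult_distrib_mat[of _ m m])
    also have "(c \<cdot>\<^sub>m (P * B)) * Q = c \<cdot>\<^sub>m (P * B * Q)"
      by (rule mult_smult_assoc_mat[of _ m m _ m]) (use w B(1) in auto)
    finally have "P * C * Q = P * Q - c \<cdot>\<^sub>m (P * B * Q)" .
    then show ?thesis unfolding T_def w(1) using w(3) by simp
  qed
  have "similar_mat_wit T C P Q"
    by (rule similar_mat_witI[OF w(1,2) TC T C w(6,7)])
  then have Tk: "T ^\<^sub>m k = P * C ^\<^sub>m k * Q" for k by (rule similar_mat_wit_pow_id)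
  have ut: "upper_triangular C"
  proof (rule upper_triangularI)
    fix i j assume ij: "j < i" "i < dim_row C"
    then have "i < m" "j < m" "B $$ (i, j) = 0"
      using B(1) C upper_triangularD[OF B(2) ij(1)] by auto
    then show "C $$ (i, j) = 0" using ij(1) B(1) by (simp add: C_def)
  qed
  have tr: "mtrace (T ^\<^sub>m k) = (\<Sum>i<m. (1 - c * a i) ^ k)" for k
  proof -
    have "mtrace (T ^\<^sub>m k) = mtrace (C ^\<^sub>m k)"
      unfolding Tk by (rule mtrace_similar[OF w(1,2)]) (use w C in auto)
    also have "\<dots> = (\<Sum>i<m. (C $$ (i, i)) ^ k)"
      using upper_triangular_pow[OF C ut, of k] C by (simp add: mtrace_def)
    also have "\<dots> = (\<Sum>i<m. (1 - c * a i) ^ k)"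
      using B(1) by (auto simp: C_def a_def intro!: sum.cong)
    finally show ?thesis .
  qed
  have tT: "complex_of_real (t k i j) = (T ^\<^sub>m k) $$ (i, j)" if "i < m" "j < m" for k i j
    using that
  proof (induction k arbitrary: j)
    case 0
    then show ?case using T by (simp add: t0)
  next
    case (Suc k)
    have Tl: "T $$ (l, j) = complex_of_real ((if l = j then 1 else 0) - real_of_int (D l j) / K)" if "l < m" for l
      using that Suc.prems by (auto simp: T_def A_def c_def)
    have "(T ^\<^sub>m Suc k) $$ (i, j) = (\<Sum>l<m. (T ^\<^sub>m k) $$ (i, l) * T $$ (l, j))"
      using Suc.prems T by (simp add: scalar_prod_def atLeast0LessThan)
    also have "\<dots> = (\<Sum>l<m. complex_of_real (t k i l * ((if l = j then 1 else 0) - real_of_int (D l j) / K)))"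
      by (rule sum.cong) (use Suc in \<open>simp_all only: lessThan_iff Tl of_real_mult\<close>)
    also have "\<dots> = complex_of_real (t (Suc k) i j)" by (simp only: tS[OF Suc.prems] of_real_sum)
    finally show ?case by simp
  qed
  show thesis
  proof (rule that[of \<mu>])
    show "0 \<le> \<mu> i" "\<mu> i \<le> K" if "i < m" for i using \<mu> that by auto
    show "(\<Sum>i<m. t k i i) = (\<Sum>i<m. (1 - \<mu> i / K) ^ k)" for k
    proof -
      have "complex_of_real (\<Sum>i<m. t k i i) = mtrace (T ^\<^sub>m k)"
        using T by (simp add: mtrace_def tT)
      also have "\<dots> = complex_of_real (\<Sum>i<m. (1 - \<mu> i / K) ^ k)"
        unfolding tr using \<mu> by (auto simp: c_def intro!: sum.cong)
      finally show ?thesis by (simp only: of_real_eq_iff)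
    qed
    have "{i. i < m \<and> a i \<noteq> 0} = {i. i < m \<and> \<mu> i \<noteq> 0}" using \<mu> by auto
    then have "(\<Prod>i | i < m \<and> a i \<noteq> 0. a i) = complex_of_real (\<Prod>i | i < m \<and> \<mu> i \<noteq> 0. \<mu> i)"
      using \<mu> by (auto intro!: prod.cong)
    moreover have "0 \<le> (\<Prod>i | i < m \<and> \<mu> i \<noteq> 0. \<mu> i)" using \<mu> by (intro prod_nonneg) auto
    ultimately show "1 \<le> (\<Prod>i | i < m \<and> \<mu> i \<noteq> 0. \<mu> i)"
      using nonzero_root_product[of a m "char_poly Ai"] cp cpi by (simp del: of_real_prod)
  qed
qed

text \<open>Lueck's estimate: since the product of the nonzero eigenvalues is at least \<open>1\<close>, few of them
  lie below \<open>\<epsilon>\<close>.\<close>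

lemma power_trace_estimate:
  fixes \<mu> :: "nat \<Rightarrow> real"
  assumes \<mu>: "\<And>i. i < m \<Longrightarrow> 0 \<le> \<mu> i" "\<And>i. i < m \<Longrightarrow> \<mu> i \<le> K"
    and pr: "1 \<le> (\<Prod>i | i < m \<and> \<mu> i \<noteq> 0. \<mu> i)"
    and K: "1 \<le> K" and \<epsilon>: "0 < \<epsilon>" "\<epsilon> < 1"
    and lim: "(\<lambda>k. \<Sum>i<m. (1 - \<mu> i / K) ^ k) \<longlonglongrightarrow> L"
  shows "(\<Sum>i<m. (1 - \<mu> i / K) ^ k) \<le> L + real m * (ln K / ln (1 / \<epsilon>) + (1 - \<epsilon> / K) ^ k)"
proof -
  let ?Z = "{i. i < m \<and> \<mu> i = 0}" and ?N = "{i. i < m \<and> \<mu> i \<noteq> 0}"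
  let ?S = "{i. i < m \<and> \<mu> i \<noteq> 0 \<and> \<mu> i < \<epsilon>}" and ?B = "{i. i < m \<and> \<epsilon> \<le> \<mu> i}"
  have range: "0 \<le> 1 - \<mu> i / K" "1 - \<mu> i / K \<le> 1" if "i < m" for i
    using \<mu>[OF that] K by (simp_all add: divide_le_eq)
  have "(\<lambda>k. \<Sum>i<m. (1 - \<mu> i / K) ^ k) \<longlonglongrightarrow> (\<Sum>i<m. if \<mu> i = 0 then 1 else 0)"
  proof (rule tendsto_sum)
    fix i assume "i \<in> {..<m}"
    then have i: "i < m" by simp
    show "(\<lambda>k. (1 - \<mu> i / K) ^ k) \<longlonglongrightarrow> (if \<mu> i = 0 then 1 else 0)"
    proof (cases "\<mu> i = 0")
      case False
      then have "1 - \<mu> i / K < 1" using \<mu>(1)[OF i] K by simp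
      then show ?thesis using False range(1)[OF i] by (simp add: LIMSEQ_realpow_zero)
    qed simp
  qed
  then have "L = (\<Sum>i<m. if \<mu> i = 0 then 1 else 0)" by (rule LIMSEQ_unique[OF lim])
  also have "\<dots> = (\<Sum>i\<in>?Z. 1)" by (rule sum.mono_neutral_cong_right) auto
  \<comment> \<open>\<open>L\<close> counts the zero eigenvalues. In the trace, each element of
    \<open>?S\<close> contributes at most 1 and each element of \<open>?B\<close> at most
    \<open>(1 - \<epsilon> / K) ^ k\<close>.\<close>
  finally have L: "L = real (card ?Z)" by simp
  have split: "{..<m} = ?Z \<union> (?S \<union> ?B)" using \<epsilon> by auto
  have "(\<Sum>i<m. (1 - \<mu> i / K) ^ k) = (\<Sum>i\<in>?Z. (1 - \<mu> i / K) ^ k) + ((\<Sum>i\<in>?S. (1 - \<mu> i / K) ^ k) + (\<Sum>i\<in>?B. (1 - \<mu> i / K) ^ k))"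
    unfolding split using \<epsilon> by (subst sum.union_disjoint, auto)+
  moreover have "(\<Sum>i\<in>?Z. (1 - \<mu> i / K) ^ k) = L" unfolding L by simp
  moreover have "(\<Sum>i\<in>?S. (1 - \<mu> i / K) ^ k) \<le> (\<Sum>i\<in>?S. 1)"
    by (rule sum_mono) (use range in \<open>auto intro!: power_le_one\<close>)
  moreover have "(\<Sum>i\<in>?B. (1 - \<mu> i / K) ^ k) \<le> (\<Sum>i\<in>?B. (1 - \<epsilon> / K) ^ k)"
    by (rule sum_mono) (use range K in \<open>auto intro!: power_mono divide_right_mono\<close>)
  moreover have "(\<Sum>i\<in>?B. (1 - \<epsilon> / K) ^ k) \<le> real m * (1 - \<epsilon> / K) ^ k"
  proof -
    have "card ?B \<le> card {..<m}" by (rule card_mono) auto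
    then show ?thesis using \<epsilon> K by (auto intro!: mult_right_mono simp: divide_le_eq)
  qed
  moreover have "real (card ?S) \<le> real m * (ln K / ln (1 / \<epsilon>))"
  proof -
    \<comment> \<open>The product of the nonzero eigenvalues is at most
      \<open>\<epsilon> ^ card ?S * K ^ m\<close>; as it is at least 1, logarithms bound
      \<open>card ?S\<close>.\<close>
    have N: "?N = ?S \<union> {i. i < m \<and> \<mu> i \<noteq> 0 \<and> \<epsilon> \<le> \<mu> i}" by auto
    have "(\<Prod>i\<in>?N. \<mu> i) = (\<Prod>i\<in>?S. \<mu> i) * (\<Prod>i\<in>{i. i < m \<and> \<mu> i \<noteq> 0 \<and> \<epsilon> \<le> \<mu> i}. \<mu> i)"
      by (subst N, rule prod.union_disjoint) auto
    also have "\<dots> \<le> (\<Prod>i\<in>?S. \<epsilon>) * (\<Prod>i\<in>{i. i < m \<and> \<mu> i \<noteq> 0 \<and> \<epsilon> \<le> \<mu> i}. K)"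
      by (intro mult_mono prod_mono prod_nonneg) (use \<mu> \<epsilon> K in auto)
    also have "\<dots> \<le> \<epsilon> ^ card ?S * K ^ m"
    proof -
      have "card {i. i < m \<and> \<mu> i \<noteq> 0 \<and> \<epsilon> \<le> \<mu> i} \<le> card {..<m}" by (rule card_mono) auto
      then show ?thesis using \<epsilon> K by (auto intro!: mult_left_mono power_increasing)
    qed
    finally have "1 \<le> \<epsilon> ^ card ?S * K ^ m" using pr by linarith
    then have "ln 1 \<le> ln (\<epsilon> ^ card ?S * K ^ m)" using \<epsilon> K by (subst ln_le_cancel_iff) auto
    then have "0 \<le> real (card ?S) * ln \<epsilon> + real m * ln K"
      using \<epsilon> K by (simp add: ln_mult ln_realpow)
    then have "real (card ?S) * ln (1 / \<epsilon>) \<le> real m * ln K" using \<epsilon> by (simp add: ln_div)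
    moreover have "0 < ln (1 / \<epsilon>)" using \<epsilon> by simp
    ultimately show ?thesis by (simp add: field_simps)
  qed
  ultimately show ?thesis by (simp add: ring_distribs)
qed

section \<open>The trace estimate for a finite complex\<close>

lemma rowact_Ints:
  assumes "\<And>y. k x y \<in> \<int>" "\<And>y. w y \<in> \<int>"
  shows "rowact k w x \<in> \<int>"
  unfolding rowact_def by (intro Ints_sum Ints_mult assms)

lemma lcoef_Ints: "lcoef p y \<in> \<int>"
  by (induction p) (auto simp: lcoef_def intro!: Ints_add)

text \<open>Incidence numbers extended by 0 to all indices, so that \<open>kop\<close> applies on
  the whole types.\<close>

definition edgek :: "('v, 'e, 'f) complex2 \<Rightarrow> 'e \<Rightarrow> 'v \<Rightarrow> real" where
  "edgek X e v = (if e \<in> edges X then inc1 X e v else 0)"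

definition facek :: "('v, 'e, 'f) complex2 \<Rightarrow> 'f \<Rightarrow> 'e \<Rightarrow> real" where
  "facek X f e = (if f \<in> faces X then lcoef (attach X f) e else 0)"

text \<open>The Hodge Laplacian in degree 1 divided by \<open>K\<close>, where \<open>a\<close> is
  the boundary matrix of the edges and \<open>b\<close> that of the 2-cells.\<close>

definition lapl :: "('x \<Rightarrow> 'v \<Rightarrow> real) \<Rightarrow> ('f \<Rightarrow> 'x \<Rightarrow> real) \<Rightarrow> real \<Rightarrow> 'x ell2 \<Rightarrow> 'x ell2" where
  "lapl a b K f = (1 / K) *\<^sub>R (kop (ktransp a) (kop a f) + kop b (kop (ktransp b) f))"

lemma psd_contraction_lapl:
  assumes a: "bker a R1 S1" and b: "bker b R2 S2" and K: "R1 * S1 + R2 * S2 \<le> K" "0 < K"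
  shows "psd_contraction (lapl a b K)"
    and "lapl a b K f = 0 \<longleftrightarrow> kop a f = 0 \<and> kop (ktransp b) f = 0"
proof -
  have n1: "norm (kop (ktransp a) h) \<le> sqrt (R1 * S1) * norm h" for h
    using norm_kop_le[OF bker_transp[OF a], of h] by (simp add: mult.commute)
  have n2: "norm (kop b h) \<le> sqrt (R2 * S2) * norm h" for h using norm_kop_le[OF b, of h] .
  note l = bounded_linear.linear[OF bounded_linear_kop]
  note c = mult_nonneg_nonneg[OF bker_nonneg[OF a]] mult_nonneg_nonneg[OF bker_nonneg[OF b]]
  note L = psd_contraction_laplacian[OF l[OF a] l[OF bker_transp[OF a]] kop_adjoint[OF a]
      l[OF b] l[OF bker_transp[OF b]] kop_adjoint[OF b] n1 n2 c K]
  show "psd_contraction (lapl a b K)" unfolding lapl_def[abs_def] by (rule L(1))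
  show "lapl a b K f = 0 \<longleftrightarrow> kop a f = 0 \<and> kop (ktransp b) f = 0" unfolding lapl_def by (rule L(2))
qed

lemma coord_lapl:
  assumes a: "bker a R1 S1" and b: "bker b R2 S2"
  shows "coord (lapl a b K f) x
    = (1 / K) * (rowact a (rowact (ktransp a) (coord f)) x + rowact (ktransp b) (rowact b (coord f)) x)"
  by (simp add: lapl_def coord_kop[OF a] coord_kop[OF b] coord_kop[OF bker_transp[OF a]] coord_kop[OF bker_transp[OF b]])

text \<open>\<open>tr\<close> is the trace of the \<open>k\<close>-th power of 1 minus the scaled
  Laplacian. It decreases in \<open>k\<close> to the trace of the harmonic projection, whence the
  lower bound; the upper one holds because the unscaled Laplacian is an integer matrix in any
  enumeration of the edges.\<close>

lemma finite_complex_estimate: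
  fixes X :: "('v, 'e, 'f) complex2"
  assumes E: "finite (edges X)" and F: "finite (faces X)"
    and att: "\<And>f. f \<in> faces X \<Longrightarrow> fst ` set (attach X f) \<subseteq> edges X"
    and closed: "\<And>f v. f \<in> faces X \<Longrightarrow> (\<Sum>e\<in>edges X. lcoef (attach X f) e * inc1 X e v) = 0"
    and a: "bker (edgek X) R1 S1" and b: "bker (facek X) R2 S2"
    and K: "R1 * S1 + R2 * S2 \<le> K" "1 \<le> K" and \<epsilon>: "0 < \<epsilon>" "\<epsilon> < 1"
    and tr: "tr = (\<Sum>e\<in>edges X. coord (((\<lambda>f. f - lapl (edgek X) (facek X) K f) ^^ k) (delta e)) e)"
  shows "real (betti1 X) \<le> tr"
    and "tr \<le> real (betti1 X) + real (card (edges X)) * (ln K / ln (1 / \<epsilon>) + (1 - \<epsilon> / K) ^ k)"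
proof -
  let ?E = "edges X"
  define S where "S = lapl (edgek X) (facek X) K"
  have K0: "0 < K" using K by simp
  interpret psd_contraction S unfolding S_def by (rule psd_contraction_lapl(1)[OF a b K(1) K0])
  have Tdef: "(\<lambda>f. f - lapl (edgek X) (facek X) K f) = T"
    unfolding S_def[symmetric] by (rule ext) (simp only: T_def)
  have facek_edge: "facek X f e = 0" if "e \<notin> ?E" for f e
    using att[of f] lcoef_nonzero[of "attach X f" e] that by (auto simp: facek_def)
  have kopa: "kop (edgek X) u = 0 \<longleftrightarrow> (\<forall>v. (\<Sum>e\<in>?E. coord u e * inc1 X e v) = 0)" for u
  proof -
    have "coord (kop (edgek X) u) v = (\<Sum>e\<in>?E. coord u e * inc1 X e v)" for v
    proof -
      have "coord (kop (edgek X) u) v = (\<Sum>e\<in>?E. ktransp (edgek X) v e * coord u e)"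
        unfolding coord_kop[OF a] by (rule rowact_eq_sum[OF E]) (auto simp: ktransp_def edgek_def split: if_splits)
      then show ?thesis by (simp add: ktransp_def edgek_def mult.commute)
    qed
    then show ?thesis by (metis coord_zero ell2_eqI)
  qed
  have kopb: "kop (ktransp (facek X)) u = 0 \<longleftrightarrow> (\<forall>f\<in>faces X. (\<Sum>e\<in>?E. coord u e * lcoef (attach X f) e) = 0)" for u
  proof -
    have c: "coord (kop (ktransp (facek X)) u) f = (if f \<in> faces X then \<Sum>e\<in>?E. coord u e * lcoef (attach X f) e else 0)" for f
    proof -
      have "coord (kop (ktransp (facek X)) u) f = (\<Sum>e\<in>?E. facek X f e * coord u e)"
        unfolding coord_kop[OF bker_transp[OF b]] ktransp_ktransp
        by (rule rowact_eq_sum[OF E]) (use facek_edge in blast)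
      then show ?thesis by (simp add: facek_def mult.commute)
    qed
    show ?thesis
    proof
      assume *: "kop (ktransp (facek X)) u = 0"
      show "\<forall>f\<in>faces X. (\<Sum>e\<in>?E. coord u e * lcoef (attach X f) e) = 0"
      proof
        fix f assume "f \<in> faces X"
        then show "(\<Sum>e\<in>?E. coord u e * lcoef (attach X f) e) = 0" using c[of f] * by simp
      qed
    next
      assume "\<forall>f\<in>faces X. (\<Sum>e\<in>?E. coord u e * lcoef (attach X f) e) = 0"
      then show "kop (ktransp (facek X)) u = 0" by (intro ell2_eqI) (simp add: c)
    qed
  qed
  have S0: "S u = 0 \<longleftrightarrow> kop (edgek X) u = 0 \<and> kop (ktransp (facek X)) u = 0" for u
    unfolding S_def by (rule psd_contraction_lapl(2)[OF a b K(1) K0])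
  have fix_P: "P u = u \<longleftrightarrow> (\<forall>v. (\<Sum>e\<in>?E. coord u e * inc1 X e v) = 0) \<and>
      (\<forall>f\<in>faces X. (\<Sum>e\<in>?E. coord u e * lcoef (attach X f) e) = 0)" for u
    by (simp only: P_eq_iff S0 kopa kopb)
  have betti: "real (betti1 X) = (\<Sum>e\<in>?E. coord (P (delta e)) e)"
    by (rule betti1_eq_trace[OF E F att closed bounded_linear.linear[OF bounded_linear_P] P_idem fix_P])
  have tr': "tr = (\<Sum>e\<in>?E. inner ((T ^^ k) (delta e)) (delta e))" unfolding tr Tdef by simp
  have cP: "coord (P u) e = inner (P u) (delta e)" for u e by simp
  show "real (betti1 X) \<le> tr"
    unfolding betti tr'
  proof (rule sum_mono)
    fix e
    have "coord (P (delta e)) e = (norm (P (delta e)))\<^sup>2"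
      using sym_P[of "P (delta e)" "delta e"] by (simp add: power2_norm_eq_inner)
    also have "\<dots> \<le> inner ((T ^^ k) (delta e)) (delta e)"
      by (rule decseq_ge[OF inner_T_pow_decseq inner_T_pow_tendsto])
    finally show "coord (P (delta e)) e \<le> inner ((T ^^ k) (delta e)) (delta e)" .
  qed
  define m where "m = card ?E"
  obtain en where en: "bij_betw en {..<m} ?E"
    using ex_bij_betw_nat_finite[OF E] by (auto simp: m_def atLeast0LessThan)
  have enE: "en i \<in> ?E" if "i < m" for i using bij_betw_apply[OF en] that by simp
  have en_inj: "en i = en j \<longleftrightarrow> i = j" if "i < m" "j < m" for i j
    using bij_betw_imp_inj_on[OF en] that by (auto simp: inj_on_def)
  \<comment> \<open>The factor \<open>K\<close> undoes the scaling of \<open>S\<close>, so these are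
    the integral entries of the Laplacian.\<close>
  define M where "M x y = K * coord (S (delta x)) y" for x y
  have M: "M x y = rowact (edgek X) (rowact (ktransp (edgek X)) (coord (delta x))) y
      + rowact (ktransp (facek X)) (rowact (facek X) (coord (delta x))) y" for x y
    using K0 by (simp add: M_def S_def coord_lapl[OF a b])
  have Mint: "M x y \<in> \<int>" for x y
    unfolding M
    by (intro Ints_add rowact_Ints) (auto simp: ktransp_def edgek_def facek_def inc1_def coord_delta lcoef_Ints)
  have M0: "M x y = 0" if "y \<notin> ?E" for x y
    using that facek_edge by (simp add: M rowact_def ktransp_def edgek_def)
  have Msym: "M x y = M y x" for x y
    using sym[of "delta x" "delta y"] by (simp add: M_def)
  define D where "D i j = \<lfloor>M (en i) (en j)\<rfloor>" for i j
  have D: "real_of_int (D i j) = M (en i) (en j)" for i j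
    using Mint[of "en i" "en j"] by (auto simp: D_def elim: Ints_cases)
  define el where "el u = (\<Sum>i<m. u i *\<^sub>R delta (en i))" for u :: "nat \<Rightarrow> real"
  have form: "(\<Sum>i<m. \<Sum>j<m. real_of_int (D i j) * u i * u j) = K * inner (S (el u)) (el u)" for u
    unfolding el_def D M_def
    by (subst sum.swap) (simp add: linear_sum[OF lin] linear_cmul[OF lin] inner_sum_left inner_sum_right sum_distrib_left mult_ac)
  have el_norm: "(norm (el u))\<^sup>2 = (\<Sum>i<m. (u i)\<^sup>2)" for u
  proof -
    have "inner (el u) (el u) = (\<Sum>i<m. \<Sum>j<m. if i = j then u i * u j else 0)"
      unfolding el_def inner_sum_left inner_sum_right
      by (rule sum.cong[OF HOL.refl], rule sum.cong[OF HOL.refl]) (auto simp: coord_delta en_inj)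
    then show ?thesis unfolding power2_norm_eq_inner by (simp add: power2_eq_square)
  qed
  obtain \<mu> :: "nat \<Rightarrow> real" where \<mu>: "\<And>i. i < m \<Longrightarrow> 0 \<le> \<mu> i" "\<And>i. i < m \<Longrightarrow> \<mu> i \<le> K"
    "\<And>k. (\<Sum>i<m. coord ((T ^^ k) (delta (en i))) (en i)) = (\<Sum>i<m. (1 - \<mu> i / K) ^ k)"
    "1 \<le> (\<Prod>i | i < m \<and> \<mu> i \<noteq> 0. \<mu> i)"
  proof (rule integer_matrix_spectrum[of D m K "\<lambda>k i j. coord ((T ^^ k) (delta (en i))) (en j)"])
    show "D i j = D j i" for i j by (simp add: D_def Msym)
    show "0 \<le> (\<Sum>i<m. \<Sum>j<m. real_of_int (D i j) * u i * u j)" for u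
      unfolding form using order_trans[OF zero_le_power2 sq_le] K0 by simp
    show "(\<Sum>i<m. \<Sum>j<m. real_of_int (D i j) * u i * u j) \<le> K * (\<Sum>i<m. (u i)\<^sup>2)" for u
      unfolding form el_norm[symmetric]
      using inner_T_pow_nonneg[of 1 "el u"] K0
      by (intro mult_left_mono) (auto simp: T_def inner_diff_left power2_norm_eq_inner)
    show "coord ((T ^^ 0) (delta (en i))) (en j) = (if i = j then 1 else 0)" if "i < m" "j < m" for i j
      using en_inj[OF that] by (auto simp: coord_delta)
    fix k i j assume ij: "i < m" "j < m"
    have cT: "coord (T (delta (en j))) x = (if x = en j then 1 else 0) - M (en j) x / K" for x
      using K0 by (simp add: T_def coord_delta M_def)
    have "coord ((T ^^ Suc k) (delta (en i))) (en j) = inner ((T ^^ k) (delta (en i))) (T (delta (en j)))"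
      using sym_T[of "(T ^^ k) (delta (en i))" "delta (en j)"] by simp
    also have "T (delta (en j)) = (\<Sum>x\<in>?E. coord (T (delta (en j))) x *\<^sub>R delta x)"
      by (rule finite_support_eq_sum_delta[OF E]) (use enE[OF ij(2)] in \<open>auto simp: cT M0\<close>)
    also have "inner ((T ^^ k) (delta (en i))) \<dots>
      = (\<Sum>x\<in>?E. coord ((T ^^ k) (delta (en i))) x * coord (T (delta (en j))) x)"
      by (simp add: inner_sum_right mult.commute)
    also have "\<dots> = (\<Sum>l<m. coord ((T ^^ k) (delta (en i))) (en l) * coord (T (delta (en j))) (en l))"
      by (rule sum.reindex_bij_betw[OF en, symmetric])
    also have "\<dots> = (\<Sum>l<m. coord ((T ^^ k) (delta (en i))) (en l) * ((if l = j then 1 else 0) - real_of_int (D l j) / K))"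
      by (rule sum.cong) (use en_inj ij in \<open>auto simp: cT D Msym[of "en j"]\<close>)
    finally show "coord ((T ^^ Suc k) (delta (en i))) (en j)
      = (\<Sum>l<m. coord ((T ^^ k) (delta (en i))) (en l) * ((if l = j then 1 else 0) - real_of_int (D l j) / K))" .
  next
    fix \<mu> :: "nat \<Rightarrow> real"
    assume "\<And>i. i < m \<Longrightarrow> 0 \<le> \<mu> i" "\<And>i. i < m \<Longrightarrow> \<mu> i \<le> K"
      "\<And>k. (\<Sum>i<m. coord ((T ^^ k) (delta (en i))) (en i)) = (\<Sum>i<m. (1 - \<mu> i / K) ^ k)"
      "1 \<le> (\<Prod>i | i < m \<and> \<mu> i \<noteq> 0. \<mu> i)"
    then show thesis by (rule that)
  qed
  have trk: "(\<Sum>e\<in>?E. coord ((T ^^ k) (delta e)) e) = (\<Sum>i<m. (1 - \<mu> i / K) ^ k)" for k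
    unfolding \<mu>(3)[symmetric] by (rule sum.reindex_bij_betw[OF en, symmetric])
  have lim: "(\<lambda>k. \<Sum>i<m. (1 - \<mu> i / K) ^ k) \<longlonglongrightarrow> real (betti1 X)"
  proof -
    have "(\<lambda>k. \<Sum>e\<in>?E. inner ((T ^^ k) (delta e)) (delta e)) \<longlonglongrightarrow> (\<Sum>e\<in>?E. inner (P (delta e)) (delta e))"
      by (intro tendsto_intros T_pow_tendsto)
    then show ?thesis unfolding betti trk[symmetric] by simp
  qed
  show "tr \<le> real (betti1 X) + real (card ?E) * (ln K / ln (1 / \<epsilon>) + (1 - \<epsilon> / K) ^ k)"
    using power_trace_estimate[OF \<mu>(1,2,4) K(2) \<epsilon> lim, of k] trk[of k]
    unfolding tr Tdef m_def by simp
qed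

section \<open>Quotient kernels\<close>

lemma rowact_cong: "(\<And>y. k x y \<noteq> 0 \<Longrightarrow> w y = w' y) \<Longrightarrow> rowact k w x = rowact k w' x"
  unfolding rowact_def by (rule sum.cong) auto

lemma sum_lcoef_fibre:
  assumes "finite Y" "fst ` set p \<subseteq> Y"
  shows "(\<Sum>y\<in>{y \<in> Y. q y = F}. lcoef p y) = lcoef (map (\<lambda>(y, b). (q y, b)) p) F"
  using assms(2)
proof (induction p)
  case (Cons a p)
  obtain e b where a: "a = (e, b)" by fastforce
  have "(\<Sum>y\<in>{y \<in> Y. q y = F}. if e = y then (if b then 1 else - 1) else 0) = (if q e = F then (if b then 1 else - 1) else (0::real))"
    using assms(1) Cons.prems a by (simp add: sum.delta')
  moreover have "lcoef (a # p) y = (if e = y then (if b then 1 else - 1) else 0) + lcoef p y" for y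
    by (simp add: lcoef_def a)
  ultimately show ?case using Cons by (simp add: sum.distrib a) (simp add: lcoef_def)
qed (simp add: lcoef_def)

context group
begin

text \<open>The acting group is written as in \<open>cayley_quotient\<close>, so that cells of the
  quotient are literally such classes.\<close>

definition hcls :: "'a set \<Rightarrow> ('a, 'x) gspace \<Rightarrow> 'x \<Rightarrow> 'x set" where
  "hcls H \<alpha> x = orbit (G\<lparr>carrier := H\<rparr>) (fst \<alpha>) x"

lemma
  assumes H: "subgroup H G" and f: "free_gspace \<alpha>"
  shows free_gspace_subgroup: "group.free_gspace (G\<lparr>carrier := H\<rparr>) \<alpha>"
    and hcls_eq_iff: "x \<in> snd \<alpha> \<Longrightarrow> y \<in> snd \<alpha> \<Longrightarrow> hcls H \<alpha> x = hcls H \<alpha> y \<longleftrightarrow> (\<exists>h\<in>H. y = fst \<alpha> h x)"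
    and some_in_hcls: "x \<in> snd \<alpha> \<Longrightarrow> (SOME y. y \<in> hcls H \<alpha> x) \<in> snd \<alpha>"
      "x \<in> snd \<alpha> \<Longrightarrow> hcls H \<alpha> (SOME y. y \<in> hcls H \<alpha> x) = hcls H \<alpha> x"
proof -
  interpret Hg: group "G\<lparr>carrier := H\<rparr>" by (rule subgroup.subgroup_is_group[OF H]) (rule group_axioms)
  show fH: "Hg.free_gspace \<alpha>"
    using f subgroup.subset[OF H] unfolding Hg.free_gspace_def free_gspace_def by (simp add: subset_iff)
  show "x \<in> snd \<alpha> \<Longrightarrow> y \<in> snd \<alpha> \<Longrightarrow> hcls H \<alpha> x = hcls H \<alpha> y \<longleftrightarrow> (\<exists>h\<in>H. y = fst \<alpha> h x)"
    unfolding hcls_def using Hg.orbit_eq_iff[OF fH] by simp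
  have Q: "x \<in> snd \<alpha> \<Longrightarrow> hcls H \<alpha> x \<in> orbits (G\<lparr>carrier := H\<rparr>) (snd \<alpha>) (fst \<alpha>)"
    unfolding orbits_def hcls_def by blast
  show "x \<in> snd \<alpha> \<Longrightarrow> (SOME y. y \<in> hcls H \<alpha> x) \<in> snd \<alpha>"
    "x \<in> snd \<alpha> \<Longrightarrow> hcls H \<alpha> (SOME y. y \<in> hcls H \<alpha> x) = hcls H \<alpha> x"
    using Hg.some_in_orbit(2,3)[OF fH Q] by (simp_all add: hcls_def)
qed

lemma hcls_act:
  assumes H: "subgroup H G" and f: "free_gspace \<alpha>" and x: "x \<in> snd \<alpha>" and h: "h \<in> H"
  shows "hcls H \<alpha> (fst \<alpha> h x) = hcls H \<alpha> x"
proof -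
  have "fst \<alpha> h x \<in> snd \<alpha>" using free_gspaceD(1)[OF f x] h subgroup.subset[OF H] by blast
  then show ?thesis using hcls_eq_iff[OF H f x, of "fst \<alpha> h x"] h by metis
qed

text \<open>The kernel induced by an equivariant kernel on \<open>H\<close>-orbits. Its row action is that of \<open>k\<close> on
  \<open>H\<close>-invariant functions, which need not be square summable.\<close>

definition pushker ::
  "'a set \<Rightarrow> ('a, 'x) gspace \<Rightarrow> ('a, 'y) gspace \<Rightarrow> ('x \<Rightarrow> 'y \<Rightarrow> real) \<Rightarrow> 'x set \<Rightarrow> 'y set \<Rightarrow> real" where
  "pushker H \<alpha> \<beta> k E F = (if E \<in> hcls H \<alpha> ` snd \<alpha>
     then \<Sum>y | k (SOME x. x \<in> E) y \<noteq> 0 \<and> hcls H \<beta> y = F. k (SOME x. x \<in> E) y else 0)"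

text \<open>Independence of the representative: equivariance moves \<open>h\<close> to the second
  argument, where it permutes the points of the class \<open>F\<close>.\<close>

lemma fibre_sum_act:
  assumes H: "subgroup H G" and f: "free_gspace \<alpha>" "free_gspace \<beta>" and k: "eqker \<alpha> \<beta> k"
    and x: "x \<in> snd \<alpha>" and h: "h \<in> H"
  shows "(\<Sum>y | k (fst \<alpha> h x) y \<noteq> 0 \<and> hcls H \<beta> y = F. k (fst \<alpha> h x) y)
    = (\<Sum>y | k x y \<noteq> 0 \<and> hcls H \<beta> y = F. k x y)"
proof -
  have hG: "h \<in> carrier G" "inv h \<in> H" using h subgroup.subset[OF H] subgroup.m_inv_closed[OF H] by auto
  show ?thesis
  proof (rule sum.reindex_bij_witness[where i = "fst \<beta> h" and j = "fst \<beta> (inv h)"])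
    fix y assume "y \<in> {y. k (fst \<alpha> h x) y \<noteq> 0 \<and> hcls H \<beta> y = F}"
    then have y: "y \<in> snd \<beta>" "k (fst \<alpha> h x) y \<noteq> 0" "hcls H \<beta> y = F" using eqkerD(2)[OF k] by auto
    then show "fst \<beta> h (fst \<beta> (inv h) y) = y" "fst \<beta> (inv h) y \<in> {y. k x y \<noteq> 0 \<and> hcls H \<beta> y = F}"
      "k x (fst \<beta> (inv h) y) = k (fst \<alpha> h x) y"
      using eqker_shift[OF k f hG(1) x y(1)] hcls_act[OF H f(2) y(1) hG(2)] f hG by auto
  next
    fix y assume "y \<in> {y. k x y \<noteq> 0 \<and> hcls H \<beta> y = F}"
    then have y: "y \<in> snd \<beta>" "k x y \<noteq> 0" "hcls H \<beta> y = F" using eqkerD(2)[OF k] by auto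
    then show "fst \<beta> (inv h) (fst \<beta> h y) = y" "fst \<beta> h y \<in> {y. k (fst \<alpha> h x) y \<noteq> 0 \<and> hcls H \<beta> y = F}"
      using eqkerD(4)[OF k hG(1) x y(1)] hcls_act[OF H f(2) y(1) h] f hG by auto
  qed
qed

lemma pushker_hcls:
  assumes H: "subgroup H G" and f: "free_gspace \<alpha>" "free_gspace \<beta>" and k: "eqker \<alpha> \<beta> k" and x: "x \<in> snd \<alpha>"
  shows "pushker H \<alpha> \<beta> k (hcls H \<alpha> x) F = (\<Sum>y | k x y \<noteq> 0 \<and> hcls H \<beta> y = F. k x y)"
proof -
  let ?s = "SOME y. y \<in> hcls H \<alpha> x"
  note s = some_in_hcls[OF H f(1) x]
  obtain h where h: "h \<in> H" "?s = fst \<alpha> h x" using hcls_eq_iff[OF H f(1) x s(1)] s(2) by metis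
  show ?thesis
    unfolding pushker_def h(2) using fibre_sum_act[OF H f k x h(1)] x by simp
qed

text \<open>By freeness \<open>H\<close> parametrises the class of \<open>y\<close>.\<close>

lemma fibre_sum_subgroup:
  assumes H: "subgroup H G" and f: "free_gspace \<beta>"
    and z: "\<And>y. c y \<noteq> (0::real) \<Longrightarrow> y \<in> snd \<beta>" and y: "y \<in> snd \<beta>"
  shows "(\<Sum>y' | c y' \<noteq> 0 \<and> hcls H \<beta> y' = hcls H \<beta> y. c y') = (\<Sum>h | h \<in> H \<and> c (fst \<beta> h y) \<noteq> 0. c (fst \<beta> h y))"
proof -
  have HG: "h \<in> H \<Longrightarrow> h \<in> carrier G" for h using subgroup.subset[OF H] by blast
  have "bij_betw (\<lambda>h. fst \<beta> h y) {h. h \<in> H \<and> c (fst \<beta> h y) \<noteq> 0} {y'. c y' \<noteq> 0 \<and> hcls H \<beta> y' = hcls H \<beta> y}"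
    unfolding bij_betw_def
  proof
    show "inj_on (\<lambda>h. fst \<beta> h y) {h. h \<in> H \<and> c (fst \<beta> h y) \<noteq> 0}"
      by (rule inj_onI) (use gspace_inj[OF f y] HG in blast)
    show "(\<lambda>h. fst \<beta> h y) ` {h. h \<in> H \<and> c (fst \<beta> h y) \<noteq> 0} = {y'. c y' \<noteq> 0 \<and> hcls H \<beta> y' = hcls H \<beta> y}"
    proof (intro equalityI subsetI)
      fix y' assume "y' \<in> {y'. c y' \<noteq> 0 \<and> hcls H \<beta> y' = hcls H \<beta> y}"
      then have *: "c y' \<noteq> 0" "hcls H \<beta> y = hcls H \<beta> y'" by auto
      then obtain h where "h \<in> H" "y' = fst \<beta> h y" using hcls_eq_iff[OF H f y z[OF *(1)]] by blast
      then show "y' \<in> (\<lambda>h. fst \<beta> h y) ` {h. h \<in> H \<and> c (fst \<beta> h y) \<noteq> 0}" using * by blast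
    qed (use hcls_act[OF H f y] in auto)
  qed
  from sum.reindex_bij_betw[OF this, of c] show ?thesis by (rule HOL.sym)
qed

text \<open>Both entries are sums over \<open>h\<close> in \<open>H\<close>, of \<open>k\<close> at
  \<open>x\<close> and the translate of \<open>y\<close>, or at the translate of \<open>x\<close>
  and \<open>y\<close>; equivariance identifies them after inversion of \<open>h\<close>. Hence
  adjoints in the quotient are pushed forward from upstairs as well.\<close>

lemma pushker_transp:
  assumes H: "subgroup H G" and f: "free_gspace \<alpha>" "free_gspace \<beta>"
    and k: "eqker \<alpha> \<beta> k" and kt: "eqker \<beta> \<alpha> (ktransp k)"
  shows "ktransp (pushker H \<alpha> \<beta> k) = pushker H \<beta> \<alpha> (ktransp k)"
proof (rule ext, rule ext)
  fix F E
  have HG: "h \<in> H \<Longrightarrow> h \<in> carrier G" "h \<in> H \<Longrightarrow> inv h \<in> H" for h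
    using subgroup.subset[OF H] subgroup.m_inv_closed[OF H] by blast+
  have out: "pushker H \<alpha>' \<beta>' k' E' F' = 0" if "E' \<notin> hcls H \<alpha>' ` snd \<alpha>' \<or> F' \<notin> hcls H \<beta>' ` snd \<beta>'" "eqker \<alpha>' \<beta>' k'"
    for \<alpha>' :: "('a, 'u) gspace" and \<beta>' :: "('a, 'w) gspace" and k' E' F'
  proof (cases "E' \<in> hcls H \<alpha>' ` snd \<alpha>'")
    case True
    then have "{y. k' (SOME x. x \<in> E') y \<noteq> 0 \<and> hcls H \<beta>' y = F'} = {}"
      using that eqkerD(2)[OF that(2)] by blast
    then show ?thesis unfolding pushker_def by (simp only: sum.empty) simp
  qed (simp add: pushker_def)
  show "ktransp (pushker H \<alpha> \<beta> k) F E = pushker H \<beta> \<alpha> (ktransp k) F E"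
  proof (cases "E \<in> hcls H \<alpha> ` snd \<alpha> \<and> F \<in> hcls H \<beta> ` snd \<beta>")
    case True
    then obtain x y where xy: "x \<in> snd \<alpha>" "E = hcls H \<alpha> x" "y \<in> snd \<beta>" "F = hcls H \<beta> y" by blast
    have "ktransp (pushker H \<alpha> \<beta> k) F E = (\<Sum>h | h \<in> H \<and> k x (fst \<beta> h y) \<noteq> 0. k x (fst \<beta> h y))"
      unfolding ktransp_def xy pushker_hcls[OF H f k xy(1)]
      by (rule fibre_sum_subgroup[OF H f(2) _ xy(3)]) (rule eqkerD(2)[OF k])
    also have "\<dots> = (\<Sum>h | h \<in> H \<and> k (fst \<alpha> h x) y \<noteq> 0. k (fst \<alpha> h x) y)"
    proof (rule sum.reindex_bij_witness[where i = "\<lambda>h. inv h" and j = "\<lambda>h. inv h"])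
      fix h assume "h \<in> {h. h \<in> H \<and> k x (fst \<beta> h y) \<noteq> 0}"
      then show "inv (inv h) = h" "inv h \<in> {h. h \<in> H \<and> k (fst \<alpha> h x) y \<noteq> 0}"
        "k (fst \<alpha> (inv h) x) y = k x (fst \<beta> h y)"
        using HG eqker_shift[OF k f, of "inv h" x y] xy by auto
    next
      fix h assume "h \<in> {h. h \<in> H \<and> k (fst \<alpha> h x) y \<noteq> 0}"
      then show "inv (inv h) = h" "inv h \<in> {h. h \<in> H \<and> k x (fst \<beta> h y) \<noteq> 0}"
        using HG eqker_shift[OF k f, of h x y] xy by auto
    qed
    also have "\<dots> = (\<Sum>h | h \<in> H \<and> ktransp k y (fst \<alpha> h x) \<noteq> 0. ktransp k y (fst \<alpha> h x))"
      by (simp add: ktransp_def)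
    also have "\<dots> = pushker H \<beta> \<alpha> (ktransp k) F E"
      unfolding xy pushker_hcls[OF H f(2,1) kt xy(3)]
      by (rule fibre_sum_subgroup[OF H f(1) _ xy(1), symmetric]) (rule eqkerD(2)[OF kt])
    finally show ?thesis .
  next
    case False
    then show ?thesis
      using out[OF _ k, of E F] out[OF _ kt, of F E] by (auto simp: ktransp_def)
  qed
qed

lemma pushker_row:
  assumes H: "subgroup H G" and f: "free_gspace \<alpha>" "free_gspace \<beta>" and k: "eqker \<alpha> \<beta> k" and x: "x \<in> snd \<alpha>"
  shows "{F. pushker H \<alpha> \<beta> k (hcls H \<alpha> x) F \<noteq> 0} \<subseteq> hcls H \<beta> ` {y. k x y \<noteq> 0}"
proof
  fix F assume "F \<in> {F. pushker H \<alpha> \<beta> k (hcls H \<alpha> x) F \<noteq> 0}"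
  then have "{y. k x y \<noteq> 0 \<and> hcls H \<beta> y = F} \<noteq> {}"
    unfolding pushker_hcls[OF H f k x] by (metis (mono_tags, lifting) mem_Collect_eq sum.empty)
  then show "F \<in> hcls H \<beta> ` {y. k x y \<noteq> 0}" by blast
qed

lemma rowact_pullback:
  assumes H: "subgroup H G" and f: "free_gspace \<alpha>" "free_gspace \<beta>" and k: "eqker \<alpha> \<beta> k" and x: "x \<in> snd \<alpha>"
  shows "rowact k (\<lambda>y. w (hcls H \<beta> y)) x = rowact (pushker H \<alpha> \<beta> k) w (hcls H \<alpha> x)"
proof -
  let ?R = "{y. k x y \<noteq> 0}"
  have R: "finite ?R" by (rule eqkerD(3)[OF k])
  have "rowact (pushker H \<alpha> \<beta> k) w (hcls H \<alpha> x) = (\<Sum>F\<in>hcls H \<beta> ` ?R. pushker H \<alpha> \<beta> k (hcls H \<alpha> x) F * w F)"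
    by (rule rowact_eq_sum) (use R pushker_row[OF H f k x] in auto)
  also have "\<dots> = (\<Sum>F\<in>hcls H \<beta> ` ?R. \<Sum>y\<in>{y \<in> ?R. hcls H \<beta> y = F}. k x y * w (hcls H \<beta> y))"
    by (rule sum.cong) (auto simp: pushker_hcls[OF H f k x] sum_distrib_right intro!: sum.cong)
  also have "\<dots> = (\<Sum>y\<in>?R. k x y * w (hcls H \<beta> y))"
    by (rule sum.image_gen[OF R, symmetric])
  finally show ?thesis by (simp add: rowact_def)
qed

text \<open>Grouping a row into fibres can only decrease the sum of absolute values.\<close>

lemma pushker_row_sum:
  assumes H: "subgroup H G" and f: "free_gspace \<alpha>" "free_gspace \<beta>" and k: "eqker \<alpha> \<beta> k" and b: "bker k R S"
  shows "finite {F. pushker H \<alpha> \<beta> k E F \<noteq> 0} \<and> (\<Sum>F | pushker H \<alpha> \<beta> k E F \<noteq> 0. \<bar>pushker H \<alpha> \<beta> k E F\<bar>) \<le> R"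
proof (cases "E \<in> hcls H \<alpha> ` snd \<alpha>")
  case True
  then obtain x where x: "x \<in> snd \<alpha>" "E = hcls H \<alpha> x" by blast
  let ?R = "{y. k x y \<noteq> 0}"
  have R: "finite ?R" by (rule eqkerD(3)[OF k])
  note sub = pushker_row[OF H f k x(1), folded x(2)]
  have "(\<Sum>F | pushker H \<alpha> \<beta> k E F \<noteq> 0. \<bar>pushker H \<alpha> \<beta> k E F\<bar>) \<le> (\<Sum>F\<in>hcls H \<beta> ` ?R. \<bar>pushker H \<alpha> \<beta> k E F\<bar>)"
    by (rule sum_mono2) (use R sub in auto)
  also have "\<dots> \<le> (\<Sum>F\<in>hcls H \<beta> ` ?R. \<Sum>y\<in>{y \<in> ?R. hcls H \<beta> y = F}. \<bar>k x y\<bar>)"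
  proof (rule sum_mono)
    fix F
    have "pushker H \<alpha> \<beta> k E F = (\<Sum>y\<in>{y \<in> ?R. hcls H \<beta> y = F}. k x y)"
      unfolding x(2) pushker_hcls[OF H f k x(1)] by simp
    then show "\<bar>pushker H \<alpha> \<beta> k E F\<bar> \<le> (\<Sum>y\<in>{y \<in> ?R. hcls H \<beta> y = F}. \<bar>k x y\<bar>)" by (simp only: sum_abs)
  qed
  also have "\<dots> = (\<Sum>y\<in>?R. \<bar>k x y\<bar>)" by (rule sum.image_gen[OF R, symmetric])
  also have "\<dots> \<le> R" by (rule bker_row_sum[OF b R])
  finally show ?thesis using finite_subset[OF sub] R by simp
next
  case False
  then show ?thesis using bker_nonneg(1)[OF b] by (simp add: pushker_def)
qed

text \<open>The constants are those of \<open>k\<close>, whatever \<open>H\<close> is. This allows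
  one \<open>K\<close> for all quotients, hence estimates that are uniform in
  \<open>n\<close>.\<close>

lemma bker_pushker:
  assumes H: "subgroup H G" and f: "free_gspace \<alpha>" "free_gspace \<beta>"
    and k: "eqker \<alpha> \<beta> k" and kt: "eqker \<beta> \<alpha> (ktransp k)" and b: "bker k R S"
  shows "bker (pushker H \<alpha> \<beta> k) R S"
proof -
  have t: "pushker H \<alpha> \<beta> k E F = pushker H \<beta> \<alpha> (ktransp k) F E" for E F
    using fun_cong[OF fun_cong[OF pushker_transp[OF H f k kt], of F], of E] by (simp add: ktransp_def)
  show ?thesis unfolding bker_def
  proof (intro conjI allI)
    show "finite {F. pushker H \<alpha> \<beta> k E F \<noteq> 0}" "(\<Sum>F | pushker H \<alpha> \<beta> k E F \<noteq> 0. \<bar>pushker H \<alpha> \<beta> k E F\<bar>) \<le> R" for E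
      using pushker_row_sum[OF H f k b, of E] by auto
    show "finite {E. pushker H \<alpha> \<beta> k E F \<noteq> 0}" "(\<Sum>E | pushker H \<alpha> \<beta> k E F \<noteq> 0. \<bar>pushker H \<alpha> \<beta> k E F\<bar>) \<le> S" for F
      using pushker_row_sum[OF H f(2,1) kt bker_transp[OF b], of F] by (auto simp: t)
  qed
qed

lemma pushker_path:
  assumes H: "subgroup H G" and f: "free_gspace \<alpha>" "free_gspace \<beta>" and k: "eqker \<alpha> \<beta> k" and x: "x \<in> snd \<alpha>"
    and p: "\<And>y. k x y = lcoef p y"
  shows "pushker H \<alpha> \<beta> k (hcls H \<alpha> x) F = lcoef (map (\<lambda>(y, b). (hcls H \<beta> y, b)) p) F"
proof -
  have "(\<Sum>y | k x y \<noteq> 0 \<and> hcls H \<beta> y = F. k x y) = (\<Sum>y\<in>{y \<in> fst ` set p. hcls H \<beta> y = F}. lcoef p y)"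
    unfolding p by (rule sum.mono_neutral_left) (auto dest: lcoef_nonzero simp: image_iff)
  then show ?thesis unfolding pushker_hcls[OF H f k x] by (simp add: sum_lcoef_fibre)
qed

lemma rowact_equivariant:
  assumes k: "eqker \<alpha> \<beta> k" and f: "free_gspace \<alpha>" "free_gspace \<beta>" and g: "g \<in> carrier G" and x: "x \<in> snd \<alpha>"
  shows "rowact k w (fst \<alpha> g x) = rowact k (\<lambda>y. w (fst \<beta> g y)) x"
  unfolding rowact_def
proof (rule sum.reindex_bij_witness[where i = "fst \<beta> g" and j = "fst \<beta> (inv g)"])
  fix y assume "y \<in> {y. k (fst \<alpha> g x) y \<noteq> 0}"
  then have y: "y \<in> snd \<beta>" "k (fst \<alpha> g x) y \<noteq> 0" using eqkerD(2)[OF k] by auto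
  then show "fst \<beta> g (fst \<beta> (inv g) y) = y" "fst \<beta> (inv g) y \<in> {y. k x y \<noteq> 0}"
    "k x (fst \<beta> (inv g) y) * w (fst \<beta> g (fst \<beta> (inv g) y)) = k (fst \<alpha> g x) y * w y"
    using eqker_shift[OF k f g x y(1)] f g by auto
next
  fix y assume "y \<in> {y. k x y \<noteq> 0}"
  then have y: "y \<in> snd \<beta>" "k x y \<noteq> 0" using eqkerD(2)[OF k] by auto
  then show "fst \<beta> (inv g) (fst \<beta> g y) = y" "fst \<beta> g y \<in> {y. k (fst \<alpha> g x) y \<noteq> 0}"
    using eqkerD(4)[OF k g x y(1)] f g by auto
qed

end

section \<open>Approximation by finite quotients\<close>

text \<open>1 minus the scaled Laplacian, on arbitrary functions: a function pulled back from a
  quotient is periodic and in general not square summable.\<close>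

definition lapf :: "('x \<Rightarrow> 'v \<Rightarrow> real) \<Rightarrow> ('f \<Rightarrow> 'x \<Rightarrow> real) \<Rightarrow> real \<Rightarrow> ('x \<Rightarrow> real) \<Rightarrow> 'x \<Rightarrow> real" where
  "lapf a b K w x = w x - (1 / K) * (rowact a (rowact (ktransp a) w) x + rowact (ktransp b) (rowact b w) x)"

lemma coord_lapl_funpow:
  assumes a: "bker a R1 S1" and b: "bker b R2 S2"
  shows "coord (((\<lambda>f. f - lapl a b K f) ^^ k) u) = (lapf a b K ^^ k) (coord u)"
proof (induction k)
  case (Suc k)
  then show ?case by (auto simp: coord_lapl[OF a b] lapf_def)
qed simp

lemma sum_lcoef_mult:
  assumes "finite E" "fst ` set p \<subseteq> E"
  shows "(\<Sum>e\<in>E. lcoef p e * h e) = (\<Sum>(e, b)\<leftarrow>p. if b then h e else - h e)"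
  using assms(2)
proof (induction p)
  case (Cons a p)
  obtain e b where a: "a = (e, b)" by fastforce
  have "lcoef (a # p) y * h y = (if e = y then (if b then h y else - h y) else 0) + lcoef p y * h y" for y
    by (simp add: lcoef_def a ring_distribs)
  then have "(\<Sum>y\<in>E. lcoef (a # p) y * h y) = (if b then h e else - h e) + (\<Sum>y\<in>E. lcoef p y * h y)"
    using assms(1) Cons.prems a by (simp add: sum.distrib)
  then show ?case using Cons a by simp
qed (simp add: lcoef_def)

context group
begin

lemma lapf_cong:
  assumes a: "eqker \<alpha> \<beta> a" and b: "eqker \<phi> \<alpha> b" and x: "x \<in> snd \<alpha>"
    and w: "\<And>y. y \<in> snd \<alpha> \<Longrightarrow> w y = w' y"
  shows "lapf a b K w x = lapf a b K w' x"
proof -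
  have "rowact (ktransp a) w v = rowact (ktransp a) w' v" "rowact b w f = rowact b w' f" for v f
    by (rule rowact_cong; use w eqkerD(1)[OF a] eqkerD(2)[OF b] in \<open>auto simp: ktransp_def\<close>)+
  then show ?thesis using w[OF x] by (simp add: lapf_def rowact_def)
qed

lemma lapf_equivariant:
  assumes a: "eqker \<alpha> \<beta> a" "eqker \<beta> \<alpha> (ktransp a)" and b: "eqker \<phi> \<alpha> b" "eqker \<alpha> \<phi> (ktransp b)"
    and f: "free_gspace \<alpha>" "free_gspace \<beta>" "free_gspace \<phi>" and g: "g \<in> carrier G"
  shows "x \<in> snd \<alpha> \<Longrightarrow> (lapf a b K ^^ k) w (fst \<alpha> g x) = (lapf a b K ^^ k) (\<lambda>y. w (fst \<alpha> g y)) x"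
proof (induction k arbitrary: x)
  case (Suc k)
  let ?w = "(lapf a b K ^^ k) w"
  have 1: "rowact a (rowact (ktransp a) ?w) (fst \<alpha> g x) = rowact a (rowact (ktransp a) (\<lambda>y. ?w (fst \<alpha> g y))) x"
    unfolding rowact_equivariant[OF a(1) f(1,2) g Suc.prems]
    by (rule rowact_cong) (simp add: rowact_equivariant[OF a(2) f(2,1) g] eqkerD(2)[OF a(1)])
  have 2: "rowact (ktransp b) (rowact b ?w) (fst \<alpha> g x) = rowact (ktransp b) (rowact b (\<lambda>y. ?w (fst \<alpha> g y))) x"
    unfolding rowact_equivariant[OF b(2) f(1,3) g Suc.prems]
    by (rule rowact_cong) (simp add: rowact_equivariant[OF b(1) f(3,1) g] eqkerD(2)[OF b(2)])
  have "(lapf a b K ^^ Suc k) w (fst \<alpha> g x) = lapf a b K (\<lambda>y. ?w (fst \<alpha> g y)) x"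
    unfolding funpow.simps o_apply using 1 2 by (simp add: lapf_def[of a b K])
  also have "\<dots> = (lapf a b K ^^ Suc k) (\<lambda>y. w (fst \<alpha> g y)) x"
    unfolding funpow.simps o_apply by (rule lapf_cong[OF a(1) b(1) Suc.prems]) (rule Suc.IH)
  finally show ?case .
qed simp

text \<open>Pulling back intertwines the operator of the quotient with the one upstairs, so entries
  in the quotient can be computed upstairs.\<close>

lemma lapf_pullback:
  assumes H: "subgroup H G"
    and a: "eqker \<alpha> \<beta> a" "eqker \<beta> \<alpha> (ktransp a)" and b: "eqker \<phi> \<alpha> b" "eqker \<alpha> \<phi> (ktransp b)"
    and f: "free_gspace \<alpha>" "free_gspace \<beta>" "free_gspace \<phi>"
  shows "x \<in> snd \<alpha> \<Longrightarrow> (lapf (pushker H \<alpha> \<beta> a) (pushker H \<phi> \<alpha> b) K ^^ k) w (hcls H \<alpha> x)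
    = (lapf a b K ^^ k) (\<lambda>y. w (hcls H \<alpha> y)) x"
proof (induction k arbitrary: x)
  case (Suc k)
  let ?a = "pushker H \<alpha> \<beta> a" and ?b = "pushker H \<phi> \<alpha> b"
  let ?w = "(lapf ?a ?b K ^^ k) w"
  have 1: "rowact ?a (rowact (ktransp ?a) ?w) (hcls H \<alpha> x) = rowact a (rowact (ktransp a) (\<lambda>y. ?w (hcls H \<alpha> y))) x"
    unfolding rowact_pullback[OF H f(1,2) a(1) Suc.prems, symmetric] pushker_transp[OF H f(1,2) a]
    by (rule rowact_cong) (simp add: rowact_pullback[OF H f(2,1) a(2)] eqkerD(2)[OF a(1)])
  have 2: "rowact (ktransp ?b) (rowact ?b ?w) (hcls H \<alpha> x) = rowact (ktransp b) (rowact b (\<lambda>y. ?w (hcls H \<alpha> y))) x"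
    unfolding pushker_transp[OF H f(3,1) b] rowact_pullback[OF H f(1,3) b(2) Suc.prems, symmetric]
    by (rule rowact_cong) (simp add: rowact_pullback[OF H f(3,1) b(1)] eqkerD(2)[OF b(2)])
  have "(lapf ?a ?b K ^^ Suc k) w (hcls H \<alpha> x) = lapf a b K (\<lambda>y. ?w (hcls H \<alpha> y)) x"
    unfolding funpow.simps o_apply using 1 2 by (simp add: lapf_def[of _ _ K])
  also have "\<dots> = (lapf a b K ^^ Suc k) (\<lambda>y. w (hcls H \<alpha> y)) x"
    unfolding funpow.simps o_apply by (rule lapf_cong[OF a(1) b(1) Suc.prems]) (rule Suc.IH)
  finally show ?case .
qed simp

text \<open>Finite propagation: each application of the operator only looks at the finite set
  \<open>nb\<close> of neighbours, and \<open>B\<close> collects what is reached in \<open>k\<close>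
  steps.\<close>

lemma lapf_local:
  assumes a: "eqker \<alpha> \<beta> a" "eqker \<beta> \<alpha> (ktransp a)" and b: "eqker \<phi> \<alpha> b" "eqker \<alpha> \<phi> (ktransp b)"
  shows "x \<in> snd \<alpha> \<Longrightarrow> \<exists>B. finite B \<and> B \<subseteq> snd \<alpha> \<and>
    (\<forall>w w'. (\<forall>y\<in>B. w y = w' y) \<longrightarrow> (lapf a b K ^^ k) w x = (lapf a b K ^^ k) w' x)"
proof (induction k arbitrary: x)
  case 0
  then show ?case by (intro exI[of _ "{x}"]) auto
next
  case (Suc k)
  define nb where "nb = insert x ((\<Union>v\<in>{v. a x v \<noteq> 0}. {y. ktransp a v y \<noteq> 0}) \<union>
    (\<Union>f\<in>{f. ktransp b x f \<noteq> 0}. {y. b f y \<noteq> 0}))"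
  have nb: "finite nb" "nb \<subseteq> snd \<alpha>"
    using eqkerD(3)[OF a(1)] eqkerD(3)[OF a(2)] eqkerD(3)[OF b(1)] eqkerD(3)[OF b(2)] Suc.prems
      eqkerD(1)[OF a(1)] eqkerD(2)[OF b(1)]
    by (auto simp: nb_def ktransp_def)
  have loc: "lapf a b K w x = lapf a b K w' x" if "\<forall>y\<in>nb. w y = w' y" for w w'
  proof -
    have "rowact a (rowact (ktransp a) w) x = rowact a (rowact (ktransp a) w') x"
      by (rule rowact_cong, rule rowact_cong) (use that in \<open>auto simp: nb_def\<close>)
    moreover have "rowact (ktransp b) (rowact b w) x = rowact (ktransp b) (rowact b w') x"
      by (rule rowact_cong, rule rowact_cong) (use that in \<open>auto simp: nb_def\<close>)
    moreover have "w x = w' x" using that by (simp add: nb_def)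
    ultimately show ?thesis by (simp add: lapf_def)
  qed
  have "\<forall>y\<in>nb. \<exists>B. finite B \<and> B \<subseteq> snd \<alpha> \<and>
      (\<forall>w w'. (\<forall>y\<in>B. w y = w' y) \<longrightarrow> (lapf a b K ^^ k) w y = (lapf a b K ^^ k) w' y)"
    using Suc.IH nb(2) by blast
  from bchoice[OF this] obtain B where B: "\<forall>y\<in>nb. finite (B y) \<and> B y \<subseteq> snd \<alpha> \<and>
      (\<forall>w w'. (\<forall>z\<in>B y. w z = w' z) \<longrightarrow> (lapf a b K ^^ k) w y = (lapf a b K ^^ k) w' y)" ..
  show ?case
  proof (intro exI[of _ "\<Union>y\<in>nb. B y"] conjI allI impI)
    show "finite (\<Union>y\<in>nb. B y)" using nb(1) B by blast
    show "(\<Union>y\<in>nb. B y) \<subseteq> snd \<alpha>" using B by blast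
    fix w w' :: "_ \<Rightarrow> real" assume *: "\<forall>y\<in>(\<Union>y\<in>nb. B y). w y = w' y"
    have "(lapf a b K ^^ k) w y = (lapf a b K ^^ k) w' y" if "y \<in> nb" for y
      using B that * by blast
    then show "(lapf a b K ^^ Suc k) w x = (lapf a b K ^^ Suc k) w' x"
      unfolding funpow.simps o_apply by (intro loc) simp
  qed
qed

end

context cayley
begin

lemma hcls_psp: "(g, i) \<in> carrier G \<times> I \<Longrightarrow> hcls H (psp I) (g, i) = (H #> g) \<times> {i}"
  by (auto simp: hcls_def orbit_def r_coset_def)

lemma hcls_psp_image: "hcls H (psp I) ` (carrier G \<times> I) = (\<lambda>(C, i). C \<times> {i}) ` ((rcosets H) \<times> I)"
proof -
  have "hcls H (psp I) ` (carrier G \<times> I) = (\<lambda>(g, i). (H #> g) \<times> {i}) ` (carrier G \<times> I)"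
    by (rule image_cong) (auto simp: hcls_psp)
  also have "\<dots> = (\<lambda>(C, i). C \<times> {i}) ` ((rcosets H) \<times> I)"
    by (auto simp: RCOSETS_def image_iff)
  finally show ?thesis .
qed

lemma inj_coset_cells:
  assumes H: "subgroup H G"
  shows "inj_on (\<lambda>(C, i). C \<times> {i}) ((rcosets H) \<times> I)"
proof -
  have "C \<noteq> {}" if "C \<in> rcosets H" for C
    using that rcos_self[OF _ H] unfolding RCOSETS_def by blast
  then show ?thesis by (auto simp: inj_on_def times_eq_iff)
qed

lemma eqkers:
  "eqker (psp {..<d}) vsp d1ker" "eqker vsp (psp {..<d}) (ktransp d1ker)"
  "eqker (psp (rels j)) (psp {..<d}) (pathker (rels j))" "eqker (psp {..<d}) (psp (rels j)) (ktransp (pathker (rels j)))"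
  using eqker_transp[OF eqker_d1 free_psp free_vsp transversal_psp]
    eqker_transp[OF eqker_pathker[OF relsD] free_psp free_psp transversal_psp] eqker_d1 eqker_pathker[OF relsD]
  by auto

section \<open>The quotient of a Cayley subcomplex by a subgroup of finite index\<close>

context
  fixes H :: "'a set" and j :: nat
  assumes H: "subgroup H G" and fin: "finite (rcosets H)"
begin

abbreviation X where "X \<equiv> cayley_quotient G H (cayley_sub G d \<gamma> N r j)"
abbreviation dk where "dk \<equiv> pathker (rels j)"

lemma X_simps:
  "edges X = hcls H (psp {..<d}) ` (carrier G \<times> {..<d})"
  "faces X = hcls H (psp (rels j)) ` (carrier G \<times> rels j)"
  "src X E = hcls H vsp (fst (SOME e. e \<in> E))"
  "tgt X E = hcls H vsp (fst (SOME e. e \<in> E) \<otimes> \<gamma> (snd (SOME e. e \<in> E)))"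
  "attach X F = map (\<lambda>(e, b). (hcls H (psp {..<d}) e, b)) (wpath (fst (SOME f. f \<in> F)) (r (snd (SOME f. f \<in> F))))"
  by (auto simp: cayley_quotient_def quotient_complex_def cayley_sub_def cayley_complex_def rels_def
      hcls_def psp_def vsp_def orbits_def case_prod_unfold)

lemma finite_edges: "finite (edges X)" and finite_faces: "finite (faces X)"
  unfolding X_simps hcls_psp_image using fin by auto

lemma edge_rep:
  assumes "E \<in> edges X"
  obtains g i where "(SOME e. e \<in> E) = (g, i)" "g \<in> carrier G" "i < d" "E = hcls H (psp {..<d}) (g, i)"
proof -
  obtain e where e: "e \<in> snd (psp {..<d})" "E = hcls H (psp {..<d}) e" using assms unfolding X_simps by auto
  note s = some_in_hcls[OF H free_psp e(1), folded e(2)]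
  obtain g i where "(SOME e. e \<in> E) = (g, i)" by fastforce
  then show thesis using s by (intro that[of g i]) auto
qed

lemma face_rep:
  assumes "F \<in> faces X"
  obtains g k where "(SOME e. e \<in> F) = (g, k)" "g \<in> carrier G" "k \<in> rels j" "F = hcls H (psp (rels j)) (g, k)"
proof -
  obtain e where e: "e \<in> snd (psp (rels j))" "F = hcls H (psp (rels j)) e" using assms unfolding X_simps by auto
  note s = some_in_hcls[OF H free_psp e(1), folded e(2)]
  obtain g k where "(SOME e. e \<in> F) = (g, k)" by fastforce
  then show thesis using s by (intro that[of g k]) auto
qed

lemma pushker_edge:
  assumes "g \<in> carrier G" "i < d"
  shows "pushker H (psp {..<d}) vsp d1ker (hcls H (psp {..<d}) (g, i)) V
    = (if V = hcls H vsp (g \<otimes> \<gamma> i) then 1 else 0) - (if V = hcls H vsp g then 1 else 0)"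
proof -
  \<comment> \<open>Written as the signed count of a list of two vertices, so that
    \<open>pushker_path\<close> applies; it also covers edges that become loops in the
    quotient.\<close>
  have "d1ker (g, i) v = lcoef [(g \<otimes> \<gamma> i, True), (g, False)] v" for v
    using assms by (auto simp: d1ker_def lcoef_def gen_closed)
  from pushker_path[OF H free_psp free_vsp eqkers(1) _ this, of V] show ?thesis
    using assms by (auto simp: lcoef_def)
qed

lemma edgek_X: "edgek X = pushker H (psp {..<d}) vsp d1ker"
proof (rule ext, rule ext)
  fix E V
  show "edgek X E V = pushker H (psp {..<d}) vsp d1ker E V"
  proof (cases "E \<in> edges X")
    case True
    then obtain g i where e: "(SOME e. e \<in> E) = (g, i)" "g \<in> carrier G" "i < d" "E = hcls H (psp {..<d}) (g, i)"
      by (rule edge_rep)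
    have "edgek X E V = (if V = hcls H vsp (g \<otimes> \<gamma> i) then 1 else 0) - (if V = hcls H vsp g then 1 else 0)"
      using True e(1) by (simp add: edgek_def inc1_def X_simps(3,4))
    then show ?thesis using pushker_edge[OF e(2,3), of V] e(4) by simp
  qed (simp add: edgek_def pushker_def X_simps)
qed

lemma inc1_X:
  assumes "g \<in> carrier G" "i < d"
  shows "inc1 X (hcls H (psp {..<d}) (g, i)) V
    = (if V = hcls H vsp (g \<otimes> \<gamma> i) then 1 else 0) - (if V = hcls H vsp g then 1 else 0)"
proof -
  have "hcls H (psp {..<d}) (g, i) \<in> edges X" unfolding X_simps using assms by blast
  then have "inc1 X (hcls H (psp {..<d}) (g, i)) V = edgek X (hcls H (psp {..<d}) (g, i)) V"
    by (simp add: edgek_def)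
  then show ?thesis by (simp only: edgek_X pushker_edge[OF assms])
qed

lemma facek_X: "facek X = pushker H (psp (rels j)) (psp {..<d}) dk"
proof (rule ext, rule ext)
  fix F E
  show "facek X F E = pushker H (psp (rels j)) (psp {..<d}) dk F E"
  proof (cases "F \<in> faces X")
    case True
    then obtain g k where e: "(SOME e. e \<in> F) = (g, k)" "g \<in> carrier G" "k \<in> rels j" "F = hcls H (psp (rels j)) (g, k)"
      by (rule face_rep)
    have "dk (g, k) y = lcoef (wpath g (r k)) y" for y using e by (simp add: pathker_def)
    from pushker_path[OF H free_psp free_psp eqkers(3) _ this, of E] show ?thesis
      using True e by (simp add: facek_def X_simps(5))
  qed (simp add: facek_def pushker_def X_simps)
qed

lemma attach_edges:
  assumes "F \<in> faces X"
  shows "fst ` set (attach X F) \<subseteq> edges X"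
proof -
  obtain g k where e: "(SOME e. e \<in> F) = (g, k)" "g \<in> carrier G" "k \<in> rels j"
    using assms by (rule face_rep)
  have "fst ` set (wpath g (r k)) \<subseteq> carrier G \<times> {..<d}"
    by (rule wpath_edges[OF rel_words[OF relsD[OF e(3)]] e(2)])
  moreover have "fst ` set (attach X F) = hcls H (psp {..<d}) ` (fst ` set (wpath g (r k)))"
    by (force simp: X_simps(5) e(1) image_iff)
  ultimately show ?thesis unfolding X_simps(1) by (simp only: image_mono)
qed

text \<open>Induction on the word, with an inverse letter read as the edge from the next vertex
  back. Together with \<open>rel_val\<close> it shows that attaching paths remain closed in the
  quotient.\<close>

lemma telescoping_path:
  "w \<in> words d \<Longrightarrow> g \<in> carrier G \<Longrightarrow>
    (\<Sum>(E, b)\<leftarrow>map (\<lambda>(e, b). (hcls H (psp {..<d}) e, b)) (wpath g w). if b then inc1 X E V else - inc1 X E V)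
    = (if V = hcls H vsp (g \<otimes> val w) then 1 else 0) - (if V = hcls H vsp g then 1 else 0)"
proof (induction w arbitrary: g)
  case (Cons x w)
  obtain i b where x: "x = (i, b)" by fastforce
  have i: "i < d" using Cons.prems x by simp
  let ?h = "g \<otimes> letter_value G \<gamma> x"
  have h: "?h \<in> carrier G" using Cons.prems by simp
  have m1: "(if b then inc1 X (hcls H (psp {..<d}) (g, i)) V else - inc1 X (hcls H (psp {..<d}) (?h, i)) V)
    = (if V = hcls H vsp ?h then 1 else 0) - (if V = hcls H vsp g then 1 else 0)"
  proof (cases b)
    case True
    then have "?h = g \<otimes> \<gamma> i" using x by (simp add: letter_value_def)
    then show ?thesis using True by (simp only: inc1_X[OF Cons.prems(2) i] if_True)
  next
    case False
    have hg: "?h \<otimes> \<gamma> i = g"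
      using x False i Cons.prems by (simp add: letter_value_def m_assoc gen_closed)
    show ?thesis using False inc1_X[OF h i, of V] unfolding hg by simp
  qed
  have m2: "g \<otimes> val (x # w) = ?h \<otimes> val w" using Cons.prems by (simp add: m_assoc)
  have m3: "(\<Sum>(E, b)\<leftarrow>map (\<lambda>(e, b). (hcls H (psp {..<d}) e, b)) (wpath g (x # w)). if b then inc1 X E V else - inc1 X E V)
    = (if b then inc1 X (hcls H (psp {..<d}) (g, i)) V else - inc1 X (hcls H (psp {..<d}) (?h, i)) V)
      + (\<Sum>(E, b)\<leftarrow>map (\<lambda>(e, b). (hcls H (psp {..<d}) e, b)) (wpath ?h w). if b then inc1 X E V else - inc1 X E V)"
    by (cases b) (simp_all add: Let_def x)
  have m4: "w \<in> words d" using Cons.prems(1) by simp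
  show ?case unfolding m3 m1 m2 Cons.IH[OF m4 h] by simp
qed simp

lemma attach_closed:
  assumes "F \<in> faces X"
  shows "(\<Sum>e\<in>edges X. lcoef (attach X F) e * inc1 X e V) = 0"
proof -
  obtain g k where e: "(SOME e. e \<in> F) = (g, k)" "g \<in> carrier G" "k \<in> rels j"
    using assms by (rule face_rep)
  have "attach X F = map (\<lambda>(e, b). (hcls H (psp {..<d}) e, b)) (wpath g (r k))"
    by (simp add: X_simps(5) e(1))
  then show ?thesis
    unfolding sum_lcoef_mult[OF finite_edges attach_edges[OF assms]]
    using telescoping_path[OF rel_words[OF relsD[OF e(3)]] e(2), of V] rel_val[OF relsD[OF e(3)]] e(2) by simp
qed

lemma card_edges: "card (edges X) = card (rcosets H) * d"
  unfolding X_simps hcls_psp_image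
  by (subst card_image[OF inj_coset_cells[OF H]]) (simp add: card_cartesian_product)

lemma quotient_estimate:
  assumes a: "bker d1ker R1 S1" and b: "bker dk R2 S2"
    and K: "R1 * S1 + R2 * S2 \<le> K" "1 \<le> K" and \<epsilon>: "0 < \<epsilon>" "\<epsilon> < 1"
    and tr: "tr = (\<Sum>e\<in>edges X. (lapf (edgek X) (facek X) K ^^ k) (coord (delta e)) e)"
  shows "real (betti1 X) \<le> tr"
    "tr \<le> real (betti1 X) + real (card (rcosets H) * d) * (ln K / ln (1 / \<epsilon>) + (1 - \<epsilon> / K) ^ k)"
proof -
  have a': "bker (edgek X) R1 S1"
    unfolding edgek_X by (rule bker_pushker[OF H free_psp free_vsp eqkers(1,2) a])
  have b': "bker (facek X) R2 S2"
    unfolding facek_X by (rule bker_pushker[OF H free_psp free_psp eqkers(3,4) b])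
  note est = finite_complex_estimate[OF finite_edges finite_faces attach_edges attach_closed a' b' K \<epsilon>, of tr k]
  have tr': "tr = (\<Sum>e\<in>edges X. coord (((\<lambda>f. f - lapl (edgek X) (facek X) K f) ^^ k) (delta e)) e)"
    unfolding tr coord_lapl_funpow[OF a' b'] ..
  show "real (betti1 X) \<le> tr" by (rule est(1)[OF _ _ tr'])
  show "tr \<le> real (betti1 X) + real (card (rcosets H) * d) * (ln K / ln (1 / \<epsilon>) + (1 - \<epsilon> / K) ^ k)"
    using est(2)[OF _ _ tr'] unfolding card_edges .
qed

text \<open>A diagonal entry of the quotient is computed upstairs from the indicator of an
  \<open>H\<close>-orbit of edges. Translated by \<open>inv g\<close>, this indicator agrees on
  \<open>B i\<close> with that of the single edge \<open>(\<one>, i)\<close>: by normality any other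
  coincidence would put a nontrivial element into \<open>H\<close>, against \<open>good\<close>. So
  all classes of type \<open>i\<close> contribute equally.\<close>

lemma quotient_trace:
  assumes nor: "H \<lhd> G"
    and B: "\<And>i. i < d \<Longrightarrow> B i \<subseteq> carrier G \<times> {..<d}"
      "\<And>i w w'. i < d \<Longrightarrow> \<forall>y\<in>B i. w y = w' y \<Longrightarrow> (lapf d1ker dk K ^^ k) w (\<one>, i) = (lapf d1ker dk K ^^ k) w' (\<one>, i)"
    and good: "\<And>i y. i < d \<Longrightarrow> y \<in> B i \<Longrightarrow> fst y \<in> H \<Longrightarrow> fst y = \<one>"
  shows "(\<Sum>e\<in>edges X. (lapf (edgek X) (facek X) K ^^ k) (coord (delta e)) e)
    = real (card (rcosets H)) * (\<Sum>i<d. (lapf d1ker dk K ^^ k) (coord (delta (\<one>, i))) (\<one>, i))"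
proof -
  let ?p = "psp {..<d}"
  let ?t = "\<lambda>i. (lapf d1ker dk K ^^ k) (coord (delta (\<one>, i))) (\<one>, i)"
  let ?f = "\<lambda>e. (lapf (edgek X) (facek X) K ^^ k) (coord (delta e)) e"
  have val: "?f (hcls H ?p (g, i)) = ?t i" if g: "g \<in> carrier G" and i: "i < d" for g i
  proof -
    let ?E = "hcls H ?p (g, i)"
    have gi: "(g, i) \<in> snd ?p" "(\<one>, i) \<in> snd ?p" "(g, i) = fst ?p g (\<one>, i)" using g i by auto
    have "?f ?E = (lapf d1ker dk K ^^ k) (\<lambda>e. coord (delta ?E) (hcls H ?p e)) (fst ?p g (\<one>, i))"
      unfolding edgek_X facek_X lapf_pullback[OF H eqkers free_psp free_vsp free_psp gi(1)] using gi(3) by simp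
    also have "\<dots> = (lapf d1ker dk K ^^ k) (\<lambda>e. coord (delta ?E) (hcls H ?p (fst ?p g e))) (\<one>, i)"
      by (rule lapf_equivariant[OF eqkers free_psp free_vsp free_psp g gi(2)])
    also have "\<dots> = ?t i"
    proof (rule B(2)[OF i], rule ballI)
      fix y assume y: "y \<in> B i"
      then obtain x i' where xi: "y = (x, i')" "x \<in> carrier G" "i' < d" using B(1)[OF i] by auto
      have "hcls H ?p (g \<otimes> x, i') = ?E \<longleftrightarrow> y = (\<one>, i)"
      proof
        assume "hcls H ?p (g \<otimes> x, i') = ?E"
        then obtain h where h: "h \<in> H" "(g \<otimes> x, i') = (h \<otimes> g, i)"
          using hcls_eq_iff[OF H free_psp, of "(g, i)" "{..<d}" "(g \<otimes> x, i')"] g i xi by auto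
        have hG: "h \<in> carrier G" using h(1) subgroup.subset[OF H] by blast
        have "x = inv g \<otimes> (g \<otimes> x)" using g xi by (simp flip: m_assoc)
        also have "\<dots> = inv g \<otimes> h \<otimes> g" using h g hG by (simp add: m_assoc)
        also have "\<dots> \<in> H" using normal.inv_op_closed1[OF nor g h(1)] .
        finally have "x = \<one>" using good[OF i y] xi(1) by simp
        then show "y = (\<one>, i)" using h xi by simp
      qed (use g xi in simp)
      then show "coord (delta ?E) (hcls H ?p (fst ?p g y)) = coord (delta (\<one>, i)) y"
        by (simp add: coord_delta xi)
    qed
    finally show ?thesis .
  qed
  have "(\<Sum>e\<in>edges X. ?f e) = (\<Sum>(C, i)\<in>(rcosets H) \<times> {..<d}. ?f (C \<times> {i}))"
    unfolding X_simps(1) hcls_psp_image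
    by (subst sum.reindex[OF inj_coset_cells[OF H]]) (simp add: o_def case_prod_unfold)
  also have "\<dots> = (\<Sum>(C, i)\<in>(rcosets H) \<times> {..<d}. ?t i)"
  proof (rule sum.cong, simp, clarify)
    fix C i assume *: "C \<in> rcosets H" "i < d"
    then obtain g where g: "g \<in> carrier G" "C = H #> g" unfolding RCOSETS_def by blast
    then have "C \<times> {i} = hcls H ?p (g, i)" using * by (simp add: hcls_psp)
    then show "?f (C \<times> {i}) = ?t i" using val[OF g(1) *(2)] by simp
  qed
  also have "\<dots> = real (card (rcosets H)) * (\<Sum>i<d. ?t i)"
    by (simp add: sum.cartesian_product[symmetric])
  finally show ?thesis .
qed

end
end

section \<open>The limit over the tower of subgroups\<close>

context cayley
begin

text \<open>For each \<open>k\<close> and all large \<open>n\<close>, the normalised Betti number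
  lies below \<open>\<tau> k\<close> by at most an error depending on \<open>\<epsilon>\<close> and
  \<open>k\<close> only, and \<open>\<tau> k\<close> tends to the trace of the harmonic projection.
  So \<open>k\<close> can be fixed before \<open>n\<close>.\<close>

lemma approximation:
  fixes \<Gamma> :: "nat \<Rightarrow> 'a set"
  assumes nor: "\<And>n. \<Gamma> n \<lhd> G" and fin: "\<And>n. finite (rcosets (\<Gamma> n))"
    and dec: "decseq \<Gamma>" and int: "(\<Inter>n. \<Gamma> n) = {\<one>}"
  shows "\<exists>P. harm j P \<and>
    (\<lambda>n. real (betti1 (cayley_quotient G (\<Gamma> n) (cayley_sub G d \<gamma> N r j))) / real (card (rcosets (\<Gamma> n))))
      \<longlonglongrightarrow> (\<Sum>x\<in>{\<one>} \<times> {..<d}. coord (P (delta x)) x)"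
proof -
  let ?dk = "pathker (rels j)"
  have sub: "subgroup (\<Gamma> n) G" for n using nor normal_imp_subgroup by blast
  obtain R1 S1 where a: "bker d1ker R1 S1"
    using eqker_bker[OF eqker_d1 free_psp free_vsp transversal_psp transversal_vsp] by auto
  obtain R2 S2 where b: "bker ?dk R2 S2"
    using eqker_bker[OF eqkers(3)[of j] free_psp free_psp transversal_psp[OF finite_rels] transversal_psp] by auto
  \<comment> \<open>The maximum with 1 makes \<open>ln K\<close> nonnegative in the eigenvalue
    estimate.\<close>
  define K where "K = max 1 (R1 * S1 + R2 * S2)"
  have K: "R1 * S1 + R2 * S2 \<le> K" "1 \<le> K" "0 < K" by (auto simp: K_def)
  define S where "S = lapl d1ker ?dk K"
  interpret psd_contraction S unfolding S_def by (rule psd_contraction_lapl(1)[OF a b K(1,3)])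
  note D2 = eqop_d2(1)[OF finite_rels[of j] relsD]
  have "eqop (psp {..<d}) (psp {..<d}) S S"
  proof -
    have "S = (\<lambda>f. (1 / K) *\<^sub>R (d1t (d1 f) + d2 (rels j) (d2t (rels j) f)))"
      by (rule ext) (simp add: S_def lapl_def d1_def d1t_def d2_def d2t_def)
    moreover have "eqop (psp {..<d}) (psp {..<d}) (\<lambda>f. (1 / K) *\<^sub>R (d1t (d1 f) + d2 (rels j) (d2t (rels j) f)))
        (\<lambda>f. (1 / K) *\<^sub>R (d1t (d1 f) + d2 (rels j) (d2t (rels j) f)))"
      by (intro eqop_scaleR eqop_add eqop_comp[OF eqop_d1 eqop_adjoint[OF eqop_d1] free_psp free_vsp]
          eqop_comp[OF eqop_adjoint[OF D2] D2 free_psp free_psp])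
    ultimately show ?thesis by simp
  qed
  then have eP: "eqop (psp {..<d}) (psp {..<d}) P P"
    unfolding P_def by (rule eqop_kernel_proj[OF psd_contraction_axioms _ free_psp])
  have S0: "S u = 0 \<longleftrightarrow> d1 u = 0 \<and> d2t (rels j) u = 0" for u
    unfolding S_def d1_def d2t_def by (rule psd_contraction_lapl(2)[OF a b K(1,3)])
  have harmP: "harm j P" unfolding harm_def by (intro conjI allI eP P_idem) (simp only: P_eq_iff S0)
  define L where "L = (\<Sum>x\<in>{\<one>} \<times> {..<d}. coord (P (delta x)) x)"
  define \<tau> where "\<tau> k = (\<Sum>i<d. (lapf d1ker ?dk K ^^ k) (coord (delta (\<one>, i))) (\<one>, i))" for k
  define \<beta> where "\<beta> n = real (betti1 (cayley_quotient G (\<Gamma> n) (cayley_sub G d \<gamma> N r j))) / real (card (rcosets (\<Gamma> n)))" for n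
  have T: "(\<lambda>f. f - lapl d1ker ?dk K f) = T"
    unfolding S_def[symmetric] by (rule ext) (simp only: T_def)
  have \<tau>: "\<tau> k = (\<Sum>i<d. inner ((T ^^ k) (delta (\<one>, i))) (delta (\<one>, i)))" for k
    unfolding \<tau>_def coord_lapl_funpow[OF a b, symmetric] T by simp
  have "{\<one>} \<times> {..<d} = Pair \<one> ` {..<d}" by auto
  then have L: "L = (\<Sum>i<d. (norm (P (delta (\<one>, i))))\<^sup>2)"
  proof -
    have "coord (P (delta x)) x = (norm (P (delta x)))\<^sup>2" for x
      using sym_P[of "P (delta x)" "delta x"] by (simp add: power2_norm_eq_inner)
    then show ?thesis unfolding L_def \<open>{\<one>} \<times> {..<d} = Pair \<one> ` {..<d}\<close>
      by (subst sum.reindex) (auto simp: inj_on_def)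
  qed
  have \<tau>_lim: "\<tau> \<longlonglongrightarrow> L"
    unfolding \<tau> L by (intro tendsto_sum inner_T_pow_tendsto)
  have L_le: "L \<le> \<tau> k" for k
    unfolding \<tau> L by (intro sum_mono decseq_ge[OF inner_T_pow_decseq inner_T_pow_tendsto])
  \<comment> \<open>The threshold for \<open>n\<close> depends on \<open>k\<close> alone: it only
    has to keep the nontrivial group elements seen in \<open>k\<close> steps out of
    \<open>\<Gamma> n\<close>.\<close>
  have bounds: "\<forall>\<^sub>F n in sequentially. \<forall>\<epsilon>. 0 < \<epsilon> \<and> \<epsilon> < 1 \<longrightarrow>
      \<beta> n \<le> \<tau> k \<and> \<tau> k \<le> \<beta> n + real d * (ln K / ln (1 / \<epsilon>) + (1 - \<epsilon> / K) ^ k)" for k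
  proof -
    have "\<forall>i\<in>{..<d}. \<exists>B. finite B \<and> B \<subseteq> carrier G \<times> {..<d} \<and>
      (\<forall>w w'. (\<forall>y\<in>B. w y = w' y) \<longrightarrow> (lapf d1ker ?dk K ^^ k) w (\<one>, i) = (lapf d1ker ?dk K ^^ k) w' (\<one>, i))"
    proof
      fix i assume "i \<in> {..<d}"
      then have "(\<one>, i) \<in> snd (psp {..<d})" by simp
      from lapf_local[OF eqkers(1,2) eqkers(3,4)[of j] this, where K = K and k = k]
      show "\<exists>B. finite B \<and> B \<subseteq> carrier G \<times> {..<d} \<and>
        (\<forall>w w'. (\<forall>y\<in>B. w y = w' y) \<longrightarrow> (lapf d1ker ?dk K ^^ k) w (\<one>, i) = (lapf d1ker ?dk K ^^ k) w' (\<one>, i))"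
        by simp
    qed
    from bchoice[OF this] obtain B where B: "\<forall>i\<in>{..<d}. finite (B i) \<and> B i \<subseteq> carrier G \<times> {..<d} \<and>
      (\<forall>w w'. (\<forall>y\<in>B i. w y = w' y) \<longrightarrow> (lapf d1ker ?dk K ^^ k) w (\<one>, i) = (lapf d1ker ?dk K ^^ k) w' (\<one>, i))" ..
    \<comment> \<open>Since the \<open>\<Gamma> n\<close> decrease, an element that has left them
      stays out, and finitely many elements have a common threshold.\<close>
    have "\<forall>\<^sub>F n in sequentially. \<forall>x\<in>(\<Union>i<d. fst ` B i). x \<in> \<Gamma> n \<longrightarrow> x = \<one>"
    proof (rule eventually_ball_finite)
      show "finite (\<Union>i<d. fst ` B i)" using B by auto
      show "\<forall>x\<in>(\<Union>i<d. fst ` B i). \<forall>\<^sub>F n in sequentially. x \<in> \<Gamma> n \<longrightarrow> x = \<one>"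
      proof
        fix x
        show "\<forall>\<^sub>F n in sequentially. x \<in> \<Gamma> n \<longrightarrow> x = \<one>"
        proof (cases "x = \<one>")
          case False
          then obtain n0 where "x \<notin> \<Gamma> n0" using int by blast
          then have "x \<notin> \<Gamma> n" if "n \<ge> n0" for n using decseqD[OF dec that] by blast
          then show ?thesis unfolding eventually_sequentially by blast
        qed simp
      qed
    qed
    then show ?thesis
    proof eventually_elim
      case (elim n)
      let ?c = "real (card (rcosets (\<Gamma> n)))"
      have "rcosets (\<Gamma> n) \<noteq> {}" unfolding RCOSETS_def by auto
      then have c: "0 < ?c" using fin[of n] by (simp add: card_gt_0_iff)
      have tr: "?c * \<tau> k = (\<Sum>e\<in>edges (cayley_quotient G (\<Gamma> n) (cayley_sub G d \<gamma> N r j)).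
        (lapf (edgek (cayley_quotient G (\<Gamma> n) (cayley_sub G d \<gamma> N r j)))
          (facek (cayley_quotient G (\<Gamma> n) (cayley_sub G d \<gamma> N r j))) K ^^ k) (coord (delta e)) e)"
        unfolding \<tau>_def
      proof (rule quotient_trace[OF sub fin nor, symmetric, where B = B])
        show "B i \<subseteq> carrier G \<times> {..<d}" if "i < d" for i using B that by blast
        show "(lapf d1ker ?dk K ^^ k) w (\<one>, i) = (lapf d1ker ?dk K ^^ k) w' (\<one>, i)"
          if "i < d" "\<forall>y\<in>B i. w y = w' y" for i w w' using B that by blast
        show "fst y = \<one>" if "i < d" "y \<in> B i" "fst y \<in> \<Gamma> n" for i y using elim that by blast
      qed
      show ?case
      proof (intro allI impI)
        fix \<epsilon> :: real assume "0 < \<epsilon> \<and> \<epsilon> < 1"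
        then have \<epsilon>: "0 < \<epsilon>" "\<epsilon> < 1" by auto
        let ?s = "ln K / ln (1 / \<epsilon>) + (1 - \<epsilon> / K) ^ k"
        note est = quotient_estimate[OF sub fin a b K(1,2) \<epsilon> tr]
        have "\<beta> n \<le> \<tau> k" using est(1) c by (simp add: \<beta>_def divide_le_eq mult.commute)
        moreover have "\<tau> k \<le> \<beta> n + real d * ?s"
        proof -
          have "?c * \<tau> k \<le> ?c * (\<beta> n + real d * ?s)"
            using est(2) c by (simp add: \<beta>_def ring_distribs mult.assoc)
          then show ?thesis using c by simp
        qed
        ultimately show "\<beta> n \<le> \<tau> k \<and> \<tau> k \<le> \<beta> n + real d * ?s" ..
      qed
    qed
  qed
  have "\<beta> \<longlonglongrightarrow> L"
  proof (rule tendstoI)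
    fix e :: real assume e: "0 < e"
    \<comment> \<open>\<open>M\<close> will be \<open>ln (1 / \<epsilon>)\<close>. It makes the term
      with \<open>ln K\<close> less than a third of \<open>e\<close>; the other two thirds are for
      the power term and for \<open>\<tau> k - L\<close>. The summand 1 keeps \<open>M\<close>
      positive even if \<open>ln K\<close> is 0.\<close>
    define M where "M = 3 * (real d * ln K) / e + 1"
    have lnK: "0 \<le> real d * ln K" using K(2) by simp
    have M: "0 < M" "real d * ln K / M < e / 3"
    proof -
      show "0 < M" unfolding M_def using lnK e by (intro add_nonneg_pos divide_nonneg_pos) auto
      then show "real d * ln K / M < e / 3"
        unfolding M_def using e by (simp add: field_simps)
    qed
    define \<epsilon> where "\<epsilon> = exp (- M)"
    have \<epsilon>: "0 < \<epsilon>" "\<epsilon> < 1" "ln (1 / \<epsilon>) = M" using M(1) by (auto simp: \<epsilon>_def ln_div)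
    have q: "0 \<le> 1 - \<epsilon> / K" "1 - \<epsilon> / K < 1" using \<epsilon>(1,2) K by (auto simp: divide_le_eq)
    have "(\<lambda>k. real d * (1 - \<epsilon> / K) ^ k) \<longlonglongrightarrow> real d * 0"
      by (intro tendsto_intros LIMSEQ_realpow_zero q)
    then have "\<forall>\<^sub>F k in sequentially. real d * (1 - \<epsilon> / K) ^ k < e / 3"
      using e by (intro order_tendstoD(2)[where y = "real d * 0"]) auto
    moreover have "\<forall>\<^sub>F k in sequentially. \<tau> k < L + e / 3"
      using e by (intro order_tendstoD(2)[OF \<tau>_lim]) auto
    ultimately have "\<forall>\<^sub>F k in sequentially. real d * (1 - \<epsilon> / K) ^ k < e / 3 \<and> \<tau> k < L + e / 3"
      by (rule eventually_conj)
    then obtain k where k: "real d * (1 - \<epsilon> / K) ^ k < e / 3" "\<tau> k < L + e / 3"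
      unfolding eventually_sequentially by blast
    from bounds[of k] show "\<forall>\<^sub>F n in sequentially. dist (\<beta> n) L < e"
    proof eventually_elim
      case (elim n)
      then have b: "\<beta> n \<le> \<tau> k" "\<tau> k \<le> \<beta> n + real d * (ln K / ln (1 / \<epsilon>) + (1 - \<epsilon> / K) ^ k)"
        using \<epsilon>(1,2) by auto
      have "real d * (ln K / ln (1 / \<epsilon>) + (1 - \<epsilon> / K) ^ k) = real d * ln K / M + real d * (1 - \<epsilon> / K) ^ k"
        by (simp add: \<epsilon>(3) ring_distribs)
      then show ?case using b k M(2) L_le[of k] unfolding dist_real_def by linarith
    qed
  qed
  then show ?thesis using harmP unfolding \<beta>_def L_def by blast
qed

end

theorem proposition1p12:
  fixes G :: "('a, 'b) monoid_scheme"
    and \<Gamma> :: "nat \<Rightarrow> 'a set"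
    and d :: nat
    and \<gamma> :: "nat \<Rightarrow> 'a"
    and N :: enat
    and r :: "nat \<Rightarrow> letter list"
  assumes "group G"
    and "residually_finite G"
    and "\<And>n. \<Gamma> n \<lhd> G"
    and "\<And>n. finite (rcosets\<^bsub>G\<^esub> (\<Gamma> n))"
    and "decseq \<Gamma>"
    and "(\<Inter>n. \<Gamma> n) = {\<one>\<^bsub>G\<^esub>}"
    and "is_presentation G d \<gamma> N r"
  shows "\<exists>l :: nat \<Rightarrow> real.
    (\<forall>j. (\<lambda>n. real (betti1 (cayley_quotient G (\<Gamma> n) (cayley_sub G d \<gamma> N r j)))
              / real (card (rcosets\<^bsub>G\<^esub> (\<Gamma> n)))) \<longlonglongrightarrow> l j) \<and>
    (\<lambda>j. ereal (l j)) \<longlonglongrightarrow> l2_betti G 1"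
proof -
  interpret group G by fact
  interpret cayley G d \<gamma> N r by (intro cayley.intro cayley_axioms.intro) fact+
  have "\<forall>j. \<exists>P. harm j P \<and>
    (\<lambda>n. real (betti1 (cayley_quotient G (\<Gamma> n) (cayley_sub G d \<gamma> N r j))) / real (card (rcosets\<^bsub>G\<^esub> (\<Gamma> n))))
      \<longlonglongrightarrow> (\<Sum>x\<in>{\<one>\<^bsub>G\<^esub>} \<times> {..<d}. coord (P (delta x)) x)"
    using approximation[OF assms(3,4,5,6)] by blast
  from choice[OF this] obtain P where P: "\<forall>j. harm j (P j) \<and>
    (\<lambda>n. real (betti1 (cayley_quotient G (\<Gamma> n) (cayley_sub G d \<gamma> N r j))) / real (card (rcosets\<^bsub>G\<^esub> (\<Gamma> n))))
      \<longlonglongrightarrow> (\<Sum>x\<in>{\<one>\<^bsub>G\<^esub>} \<times> {..<d}. coord (P j (delta x)) x)" ..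
  show ?thesis
  proof (intro exI[of _ "\<lambda>j. \<Sum>x\<in>{\<one>\<^bsub>G\<^esub>} \<times> {..<d}. coord (P j (delta x)) x"] conjI allI)
    show "(\<lambda>n. real (betti1 (cayley_quotient G (\<Gamma> n) (cayley_sub G d \<gamma> N r j))) / real (card (rcosets\<^bsub>G\<^esub> (\<Gamma> n))))
      \<longlonglongrightarrow> (\<Sum>x\<in>{\<one>\<^bsub>G\<^esub>} \<times> {..<d}. coord (P j (delta x)) x)" for j
      using P by blast
    show "(\<lambda>j. ereal (\<Sum>x\<in>{\<one>\<^bsub>G\<^esub>} \<times> {..<d}. coord (P j (delta x)) x)) \<longlonglongrightarrow> l2_betti G 1"
      by (rule harmonic_traces_tendsto_l2_betti) (use P in blast)
  qed
qed

end
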